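(* Let $\Sigma=\Sigma_{g,p}$ with $p\geqslant1$, and with $p\geqslant 3$ if $g=0$. Let $\mathcal R(\Sigma)$ be the space of type-preserving representations of $\pi_1(\Sigma)$ into $\mathrm{PSL}(2,\mathbb R)$. (1) If $g\geqslant1$, then $\mathcal R(\Sigma)$ has in total $$\sum_{n=\chi(\Sigma)}^{-\chi(\Sigma)}\ \sum_{k=\max\{n+p+\chi(\Sigma),0\}}^{\min\{n-\chi(\Sigma),p\}}\binom pk$$ connected components, one for each pair $(n,s)\in\mathbb Z\times\{\pm1\}^p$ satisfying $\chi(\Sigma)+p_+(s)\leqslant n\leqslant-\chi(\Sigma)-p_-(s)$. (2) If $g=0$, then $\mathcal R(\Sigma)$ has in total $$\sum_{n=\chi(\Sigma)}^{-\chi(\Sigma)}\ \sum_{k=\max\{n+p+\chi(\Sigma),0\}}^{\min\{n-\chi(\Sigma),p\}}\binom pk+2p+2$$ connected components, one for each pair $(n,s)\in\mathbb Z\times\{\pm1\}^p$ satisfying one of the following: (i) $\chi(\Sigma)+p_+(s)\leqslant n\leqslant-\chi(\Sigma)-p_-(s)$; (ii) $n=0$ and either $p_-(s)=1$ or $p_+(s)=1$; (iii) $n=1$ and $p_-(s)=0$, or $n=-1$ and $p_+(s)=0$. Here the component corresponding to $(n,s)$ is the set of type-preserving representations with relative Euler class $n$ and sign $s$, and a sum whose lower limit exceeds its upper limit is $0$.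
   Context: $\Sigma_{g,p}$ is the surface obtained from a closed connected oriented surface of genus $g$ by removing $p$ points; $\chi(\Sigma_{g,p})=2-2g-p$. Fix a presentation $\pi_1(\Sigma)=\langle a_1,b_1,\dots,a_g,b_g,c_1,\dots,c_p\mid [a_1,b_1]\cdots[a_g,b_g]c_1\cdots c_p\rangle$, where $c_1,\dots,c_p$ are the preferred peripheral elements, $c_i$ being represented by a loop freely homotopic to a circle around the $i$-th puncture. A non-trivial element $\pm A\in\mathrm{PSL}(2,\mathbb R)$ is hyperbolic, parabolic, or elliptic if $|\mathrm{tr}(A)|>2$, $=2$, or $<2$ respectively. A parabolic element is positive if it is $\mathrm{PSL}(2,\mathbb R)$-conjugate to $\pm\begin{bmatrix}1&1\\0&1\end{bmatrix}$ and negative if it is conjugate to $\pm\begin{bmatrix}1&-1\\0&1\end{bmatrix}$. A representation $\phi:\pi_1(\Sigma)\to\mathrm{PSL}(2,\mathbb R)$ is type-preserving if every $\phi(c_i)$ is parabolic. Its sign $s(\phi)\in\{\pm1\}^p$ has $i$-th component $+1$ if $\phi(c_i)$ is positive and $-1$ if $\phi(c_i)$ is negative. For $s\in\{\pm1\}^p$, $p_+(s)$ and $p_-(s)$ are the numbers of components equal to $+1$ and $-1$. Relative Euler class: let $\widetilde{\mathrm{SL}}(2,\mathbb R)$ be the universal covering group of $\mathrm{PSL}(2,\mathbb R)$, with exponential map $\widetilde{\exp}$, and let $z=\widetilde{\exp}\begin{bmatrix}0&\pi\\-\pi&0\end{bmatrix}$, a generator of the center. A parabolic element of $\mathrm{PSL}(2,\mathbb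 R)$ has a unique lift lying in the image of $\widetilde{\exp}$. Let $\widetilde{\phi(c_i)}$ be this lift of $\phi(c_i)$, and $\widetilde{\phi(a_j)},\widetilde{\phi(b_j)}$ arbitrary lifts. Then $e(\phi)=n$ is the integer with $[\widetilde{\phi(a_1)},\widetilde{\phi(b_1)}]\cdots[\widetilde{\phi(a_g)},\widetilde{\phi(b_g)}]\,\widetilde{\phi(c_1)}\cdots\widetilde{\phi(c_p)}=z^n$. $\mathcal R(\Sigma)$ carries the subspace topology from $\mathrm{Hom}(\pi_1(\Sigma),\mathrm{PSL}(2,\mathbb R))$ with the compact-open topology. *)

theory Defs
  imports "HOL-Analysis.Analysis" "HOL-Algebra.Coset"
begin

section \<open>Group presentations and surface groups\<close>

text \<open>The letter \<open>(x, True)\<close> stands for the generator \<open>x\<close> and \<open>(x, False)\<close> for its inverse.\<close>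

type_synonym 'a word = "('a \<times> bool) list"

definition words :: "'a set \<Rightarrow> 'a word set" where
  "words S = lists (S \<times> UNIV)"

inductive_set presentation_rel :: "'a set \<Rightarrow> 'a word set \<Rightarrow> ('a word \<times> 'a word) set"
  for S :: "'a set" and R :: "'a word set" where
  refl: "w \<in> words S \<Longrightarrow> (w, w) \<in> presentation_rel S R"
| sym: "(v, w) \<in> presentation_rel S R \<Longrightarrow> (w, v) \<in> presentation_rel S R"
| trans: "(u, v) \<in> presentation_rel S R \<Longrightarrow> (v, w) \<in> presentation_rel S R
    \<Longrightarrow> (u, w) \<in> presentation_rel S R"
| cancel: "u \<in> words S \<Longrightarrow> v \<in> words S \<Longrightarrow> x \<in> S
    \<Longrightarrow> (u @ [(x, b), (x, \<not> b)] @ v, u @ v) \<in> presentation_rel S R"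
| relator: "u \<in> words S \<Longrightarrow> v \<in> words S \<Longrightarrow> r \<in> R \<Longrightarrow> r \<in> words S
    \<Longrightarrow> (u @ r @ v, u @ v) \<in> presentation_rel S R"

definition presented_group :: "'a set \<Rightarrow> 'a word set \<Rightarrow> 'a word set monoid" where
  "presented_group S R =
    \<lparr>carrier = words S // presentation_rel S R,
     mult = (\<lambda>X Y. \<Union>u\<in>X. \<Union>v\<in>Y. presentation_rel S R `` {u @ v}),
     one = presentation_rel S R `` {[]}\<rparr>"

definition presented_gen :: "'a set \<Rightarrow> 'a word set \<Rightarrow> 'a \<Rightarrow> 'a word set" where
  "presented_gen S R x = presentation_rel S R `` {[(x, True)]}"

text \<open>All indices start at 0: the handles are \<open>j < g\<close> and the punctures are \<open>i < p\<close>.\<close>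

datatype surface_gen = Gen_a nat | Gen_b nat | Gen_c nat

definition surface_gens :: "nat \<Rightarrow> nat \<Rightarrow> surface_gen set" where
  "surface_gens g p = Gen_a ` {..<g} \<union> Gen_b ` {..<g} \<union> Gen_c ` {..<p}"

definition surface_relator :: "nat \<Rightarrow> nat \<Rightarrow> surface_gen word" where
  "surface_relator g p =
    concat (map (\<lambda>j. [(Gen_a j, True), (Gen_b j, True), (Gen_a j, False), (Gen_b j, False)]) [0..<g])
    @ map (\<lambda>i. (Gen_c i, True)) [0..<p]"

definition surface_group :: "nat \<Rightarrow> nat \<Rightarrow> surface_gen word set monoid" where
  "surface_group g p = presented_group (surface_gens g p) {surface_relator g p}"

definition surface_elt :: "nat \<Rightarrow> nat \<Rightarrow> surface_gen \<Rightarrow> surface_gen word set" where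
  "surface_elt g p x = presented_gen (surface_gens g p) {surface_relator g p} x"

definition euler_char :: "nat \<Rightarrow> nat \<Rightarrow> int" where
  "euler_char g p = 2 - 2 * int g - int p"


section \<open>The group \<open>PSL(2, \<real>)\<close>\<close>

definition mat2 :: "real \<Rightarrow> real \<Rightarrow> real \<Rightarrow> real \<Rightarrow> real^2^2" where
  "mat2 a b c d = vector [vector [a, b], vector [c, d]]"

definition SL2R :: "(real^2^2) monoid" where
  "SL2R = \<lparr>carrier = {A. det A = 1}, mult = (**), one = mat 1\<rparr>"

text \<open>Elements of \<open>PSL(2, \<real>)\<close> are the cosets \<open>{A, - A}\<close>.\<close>

definition PSL2R :: "(real^2^2) set monoid" where
  "PSL2R = SL2R Mod {mat 1, - mat 1}"

definition psl :: "real^2^2 \<Rightarrow> (real^2^2) set" where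
  "psl A = {mat 1, - mat 1} #>\<^bsub>SL2R\<^esub> A"

text \<open>The quotient topology of the subspace topology on \<open>SL(2, \<real>)\<close>.\<close>

definition PSL2R_top :: "(real^2^2) set topology" where
  "PSL2R_top = topology (\<lambda>U. U \<subseteq> carrier PSL2R \<and>
     openin (top_of_set (carrier SL2R)) {A \<in> carrier SL2R. psl A \<in> U})"

definition parabolic :: "(real^2^2) set \<Rightarrow> bool" where
  "parabolic X \<longleftrightarrow> X \<in> carrier PSL2R \<and> X \<noteq> \<one>\<^bsub>PSL2R\<^esub> \<and> (\<forall>A\<in>X. \<bar>trace A\<bar> = 2)"

definition conjugate_in :: "('a, 'b) monoid_scheme \<Rightarrow> 'a \<Rightarrow> 'a \<Rightarrow> bool" where
  "conjugate_in G x y \<longleftrightarrow> (\<exists>h\<in>carrier G. x = h \<otimes>\<^bsub>G\<^esub> y \<otimes>\<^bsub>G\<^esub> inv\<^bsub>G\<^esub> h)"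

definition positive_parabolic :: "(real^2^2) set \<Rightarrow> bool" where
  "positive_parabolic X \<longleftrightarrow> parabolic X \<and> conjugate_in PSL2R X (psl (mat2 1 1 0 1))"

definition negative_parabolic :: "(real^2^2) set \<Rightarrow> bool" where
  "negative_parabolic X \<longleftrightarrow> parabolic X \<and> conjugate_in PSL2R X (psl (mat2 1 (-1) 0 1))"


section \<open>The universal covering group of \<open>PSL(2, \<real>)\<close>\<close>

text \<open>The universal cover consists of the classes of paths that start at the identity, modulo
  homotopy relative to the endpoints, with pointwise multiplication of paths. A path is a function
  on all of \<open>\<real>\<close> of which only the restriction to \<open>[0, 1]\<close> matters; functions that agree on \<open>[0, 1]\<close>
  lie in the same class.\<close>

definition psl_paths :: "(real \<Rightarrow> (real^2^2) set) set" where
  "psl_paths = {\<gamma>. pathin PSL2R_top \<gamma> \<and> \<gamma> 0 = \<one>\<^bsub>PSL2R\<^esub>}"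

definition psl_path_rel :: "((real \<Rightarrow> (real^2^2) set) \<times> (real \<Rightarrow> (real^2^2) set)) set" where
  "psl_path_rel = {(\<gamma>, \<delta>). \<gamma> \<in> psl_paths \<and> \<delta> \<in> psl_paths \<and>
     homotopic_with (\<lambda>\<eta>. \<eta> 0 = \<gamma> 0 \<and> \<eta> 1 = \<gamma> 1) (top_of_set {0..1}) PSL2R_top \<gamma> \<delta>}"

definition SL2R_univ :: "(real \<Rightarrow> (real^2^2) set) set monoid" where
  "SL2R_univ =
    \<lparr>carrier = psl_paths // psl_path_rel,
     mult = (\<lambda>X Y. \<Union>\<gamma>\<in>X. \<Union>\<delta>\<in>Y. psl_path_rel `` {\<lambda>t. \<gamma> t \<otimes>\<^bsub>PSL2R\<^esub> \<delta> t}),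
     one = psl_path_rel `` {\<lambda>t. \<one>\<^bsub>PSL2R\<^esub>}\<rparr>"

definition univ_proj :: "(real \<Rightarrow> (real^2^2) set) set \<Rightarrow> (real^2^2) set" where
  "univ_proj L = the_elem ((\<lambda>\<gamma>. \<gamma> 1) ` L)"

definition lifts :: "(real^2^2) set \<Rightarrow> (real \<Rightarrow> (real^2^2) set) set set" where
  "lifts X = {L \<in> carrier SL2R_univ. univ_proj L = X}"

text \<open>Neither \<open>exp\<close> nor \<open>^\<close> can be used here, as \<open>*\<close> on \<open>real^2^2\<close> is the componentwise product.\<close>

definition mat_exp :: "real^2^2 \<Rightarrow> real^2^2" where
  "mat_exp X = (\<Sum>n. (1 / fact n) *\<^sub>R (((**) X ^^ n) (mat 1)))"

definition sl2R :: "(real^2^2) set" where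
  "sl2R = {X. trace X = 0}"

text \<open>The exponential map of the covering group sends \<open>X\<close> to the endpoint of the lift of the
  one-parameter subgroup of \<open>X\<close>, that is, to the class of this one-parameter subgroup on \<open>[0, 1]\<close>.\<close>

definition univ_exp :: "real^2^2 \<Rightarrow> (real \<Rightarrow> (real^2^2) set) set" where
  "univ_exp X = psl_path_rel `` {\<lambda>t. psl (mat_exp (t *\<^sub>R X))}"

definition univ_z :: "(real \<Rightarrow> (real^2^2) set) set" where
  "univ_z = univ_exp (mat2 0 pi (- pi) 0)"

definition parabolic_lift :: "(real^2^2) set \<Rightarrow> (real \<Rightarrow> (real^2^2) set) set" where
  "parabolic_lift X = (THE L. L \<in> lifts X \<and> L \<in> univ_exp ` sl2R)"


section \<open>Type-preserving representations\<close>

text \<open>Functions are taken to be \<open>undefined\<close> outside \<open>topspace X\<close>, so that equality of elements is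
  equality of maps on \<open>X\<close>.\<close>

definition compact_open_topology :: "'a topology \<Rightarrow> 'b topology \<Rightarrow> ('a \<Rightarrow> 'b) topology" where
  "compact_open_topology X Y = topology_generated_by
     {{f. continuous_map X Y f \<and> f \<in> extensional (topspace X) \<and> f ` K \<subseteq> U} | K U.
        compactin X K \<and> openin Y U}"

definition representations :: "nat \<Rightarrow> nat \<Rightarrow> (surface_gen word set \<Rightarrow> (real^2^2) set) set" where
  "representations g p =
     hom (surface_group g p) PSL2R \<inter> extensional (carrier (surface_group g p))"

definition representation_space ::
    "nat \<Rightarrow> nat \<Rightarrow> (surface_gen word set \<Rightarrow> (real^2^2) set) topology" where
  "representation_space g p = subtopology
     (compact_open_topology (discrete_topology (carrier (surface_group g p))) PSL2R_top)
     (representations g p)"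

definition type_preserving :: "nat \<Rightarrow> nat \<Rightarrow> (surface_gen word set \<Rightarrow> (real^2^2) set) set" where
  "type_preserving g p =
     {\<phi> \<in> representations g p. \<forall>i<p. parabolic (\<phi> (surface_elt g p (Gen_c i)))}"

definition type_preserving_space ::
    "nat \<Rightarrow> nat \<Rightarrow> (surface_gen word set \<Rightarrow> (real^2^2) set) topology" where
  "type_preserving_space g p = subtopology (representation_space g p) (type_preserving g p)"

definition sign_vectors :: "nat \<Rightarrow> (nat \<Rightarrow> int) set" where
  "sign_vectors p = {..<p} \<rightarrow>\<^sub>E {1, -1}"

definition p_plus :: "nat \<Rightarrow> (nat \<Rightarrow> int) \<Rightarrow> nat" where
  "p_plus p s = card {i. i < p \<and> s i = 1}"

definition p_minus :: "nat \<Rightarrow> (nat \<Rightarrow> int) \<Rightarrow> nat" where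
  "p_minus p s = card {i. i < p \<and> s i = -1}"

text \<open>The value 0 below does not occur for type-preserving \<open>\<phi>\<close>.\<close>

definition rep_sign :: "nat \<Rightarrow> nat \<Rightarrow> (surface_gen word set \<Rightarrow> (real^2^2) set) \<Rightarrow> nat \<Rightarrow> int" where
  "rep_sign g p \<phi> = (\<lambda>i\<in>{..<p}.
     if positive_parabolic (\<phi> (surface_elt g p (Gen_c i))) then 1
     else if negative_parabolic (\<phi> (surface_elt g p (Gen_c i))) then -1 else 0)"

definition group_commutator :: "('a, 'b) monoid_scheme \<Rightarrow> 'a \<Rightarrow> 'a \<Rightarrow> 'a" where
  "group_commutator G x y = x \<otimes>\<^bsub>G\<^esub> y \<otimes>\<^bsub>G\<^esub> inv\<^bsub>G\<^esub> x \<otimes>\<^bsub>G\<^esub> inv\<^bsub>G\<^esub> y"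

text \<open>Ordered product of a list.\<close>

definition list_product :: "('a, 'b) monoid_scheme \<Rightarrow> 'a list \<Rightarrow> 'a" where
  "list_product G xs = foldr (\<lambda>x y. x \<otimes>\<^bsub>G\<^esub> y) xs \<one>\<^bsub>G\<^esub>"

definition rel_euler :: "nat \<Rightarrow> nat \<Rightarrow> (surface_gen word set \<Rightarrow> (real^2^2) set) \<Rightarrow> int" where
  "rel_euler g p \<phi> = (THE n. \<forall>\<alpha> \<beta>.
     (\<forall>j<g. \<alpha> j \<in> lifts (\<phi> (surface_elt g p (Gen_a j)))) \<longrightarrow>
     (\<forall>j<g. \<beta> j \<in> lifts (\<phi> (surface_elt g p (Gen_b j)))) \<longrightarrow>
     list_product SL2R_univ
       (map (\<lambda>j. group_commutator SL2R_univ (\<alpha> j) (\<beta> j)) [0..<g]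
        @ map (\<lambda>i. parabolic_lift (\<phi> (surface_elt g p (Gen_c i)))) [0..<p])
     = univ_z [^]\<^bsub>SL2R_univ\<^esub> n)"

definition rep_stratum ::
    "nat \<Rightarrow> nat \<Rightarrow> int \<times> (nat \<Rightarrow> int) \<Rightarrow> (surface_gen word set \<Rightarrow> (real^2^2) set) set" where
  "rep_stratum g p = (\<lambda>(n, s). {\<phi> \<in> type_preserving g p. rel_euler g p \<phi> = n \<and> rep_sign g p \<phi> = s})"

end

theory Submission
 imports Defs
begin

text \<open>The universal cover is modelled as \<open>\<real> \<times> \<complex>\<close>, acting on the line of arguments; the order of the line
  separates its conjugacy classes. A continuous map with connected fibers that is open stays so after
  multiplying it by one more commutator or parabolic factor \<open>k\<close>, provided that for every \<open>T\<close> the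
  values \<open>k\<close> with \<open>T * inverse k\<close> in its image form a connected set. Starting from one handle, or
  from two parabolic elements with different fixed points, this shows by induction that the relator
  product has connected fibers over an explicit set, which yields the list of pairs \<open>(n, s)\<close>. The
  degenerate tuples (a first handle that commutes, or parabolic elements with a common fixed point)
  are joined to the others by explicit paths, unless \<open>g = 0\<close>, \<open>n = 0\<close> and exactly one sign differs
  from the others, where parallel tuples form a component of their own.
  Sign and relative Euler class are locally constant, so these fibers are the components.\<close>

notation (input) iff (infixr "<->" 25) and tendsto (infixr "--->" 55)

section \<open>Real matrices as real-linear maps of the complex plane\<close>

text \<open>The pair \<open>(\<alpha>, \<beta>)\<close> stands for the real-linear map \<open>u \<mapsto> \<alpha> * u + \<beta> * cnj u\<close>.\<close>

type_synonym cmat = "complex \<times> complex"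

definition cm_mult :: "cmat => cmat => cmat" (infixl "#*" 70) where
 "A #* B = (fst A * fst B + snd A * cnj (snd B), fst A * snd B + snd A * cnj (fst B))"

definition cm_det :: "cmat => real" where
 "cm_det A = (cmod (fst A))\<^sup>2 - (cmod (snd A))\<^sup>2"

definition cm_adj :: "cmat => cmat" where
 "cm_adj A = (cnj (fst A), - snd A)"

definition cm_app :: "cmat => complex => complex" where
 "cm_app A u = fst A * u + snd A * cnj u"

lemma cm_mult_assoc: "(A #* B) #* C = A #* (B #* C)"
 by (simp add: cm_mult_def algebra_simps)

lemma cm_mult_one [simp]: "(1, 0) #* A = A" "A #* (1, 0) = A"
 by (simp_all add: cm_mult_def)

lemma cm_mult_scaleR [simp]: "(r *\<^sub>R A) #* B = r *\<^sub>R (A #* B)" "A #* (r *\<^sub>R B) = r *\<^sub>R (A #* B)"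
 by (simp_all add: cm_mult_def scaleR_conv_of_real algebra_simps)

lemma cm_mult_minus [simp]: "(- A) #* B = - (A #* B)" "A #* (- B) = - (A #* B)"
 by (simp_all add: cm_mult_def)

lemma cm_mult_add: "(A + B) #* C = A #* C + B #* C" "A #* (B + C) = A #* B + A #* C"
 by (simp_all add: cm_mult_def algebra_simps)

lemma cm_mult_diff: "(A - B) #* C = A #* C - B #* C" "A #* (B - C) = A #* B - A #* C"
 by (simp_all add: cm_mult_def algebra_simps)

lemma cm_det_eq: "complex_of_real (cm_det A) = fst A * cnj (fst A) - snd A * cnj (snd A)"
 by (simp only: cm_det_def of_real_diff complex_norm_square)

lemma cm_det_mult [simp]: "cm_det (A #* B) = cm_det A * cm_det B"
proof -
 have "complex_of_real (cm_det (A #* B)) = complex_of_real (cm_det A * cm_det B)"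
  unfolding of_real_mult cm_det_eq by (simp add: cm_mult_def algebra_simps)
 then show ?thesis using of_real_eq_iff by blast
qed

lemma cm_det_scaleR [simp]: "cm_det (r *\<^sub>R A) = r\<^sup>2 * cm_det A"
 by (simp add: cm_det_def power_mult_distrib algebra_simps)

lemma cm_det_minus [simp]: "cm_det (- A) = cm_det A"
 by (simp add: cm_det_def)

lemma cm_det_adj [simp]: "cm_det (cm_adj A) = cm_det A"
 by (simp add: cm_det_def cm_adj_def)

lemma cm_adj_mult: "cm_adj A #* A = (of_real (cm_det A), 0)" "A #* cm_adj A = (of_real (cm_det A), 0)"
 unfolding cm_det_eq by (simp_all add: cm_mult_def cm_adj_def algebra_simps)

lemma cm_scalar: "(of_real r, 0) #* A = r *\<^sub>R A" "A #* (of_real r, 0) = r *\<^sub>R A"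
 by (simp_all add: cm_mult_def scaleR_conv_of_real prod_eq_iff algebra_simps)

lemma cm_adj_cancel:
 assumes "cm_det A = 1"
 shows "cm_adj A #* A = (1, 0)" "A #* cm_adj A = (1, 0)"
  "cm_adj A #* (A #* B) = B" "A #* (cm_adj A #* B) = B"
 by (simp_all add: cm_adj_mult assms cm_mult_assoc[symmetric])

lemma cm_app_mult: "cm_app (A #* B) u = cm_app A (cm_app B u)"
 by (simp add: cm_app_def cm_mult_def algebra_simps)

lemma cm_app_scaleR: "cm_app A (of_real r * u) = of_real r * cm_app A u"
 by (simp add: cm_app_def algebra_simps)

section \<open>The universal covering group and its action on the line\<close>

text \<open>The pair \<open>(t, b)\<close> stands for the matrix with \<open>\<alpha> = sqrt (1 + \<bar>b\<bar>\<^sup>2) * cis t\<close> and \<open>\<beta> = b * cis t\<close>,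
 together with the choice of the argument \<open>t\<close> of \<open>\<alpha>\<close>. It acts on arguments of vectors.\<close>

type_synonym ucov = "real \<times> complex"

definition radius :: "complex => real" where
 "radius b = sqrt (1 + (cmod b)\<^sup>2)"

definition umat :: "ucov => cmat" where
 "umat k = (of_real (radius (snd k)) * cis (fst k), snd k * cis (fst k))"

definition uact :: "ucov => real => real" where
 "uact k x = x + fst k + Arg (of_real (radius (snd k)) + snd k * cis (- (2 * x)))"

definition umult_aux :: "ucov => ucov => complex" where
 "umult_aux k l = of_real (radius (snd k) * radius (snd l)) + snd k * cnj (snd l) * cis (- (2 * fst l))"

definition umult :: "ucov => ucov => ucov" (infixl "&*" 70) where
 "k &* l = (fst k + fst l + Arg (umult_aux k l),
   (of_real (radius (snd k)) * snd l + snd k * of_real (radius (snd l)) * cis (- (2 * fst l)))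
    * cis (- Arg (umult_aux k l)))"

definition uinv :: "ucov => ucov" where
 "uinv k = (- fst k, - snd k * cis (2 * fst k))"

abbreviation uone :: ucov where
 "uone \<equiv> (0, 0)"

lemma radius_gt: "cmod b < radius b" "0 < radius b" "1 <= radius b"
proof -
 show "cmod b < radius b" unfolding radius_def by (rule real_less_rsqrt) simp
 show "1 <= radius b" unfolding radius_def by simp
 then show "0 < radius b" by linarith
qed

lemma radius_nonneg [simp]: "0 <= radius b" "\<not> radius b < 0" "radius b ~= 0"
 using radius_gt(2)[of b] by simp_all

lemma radius_power2: "(radius b)\<^sup>2 = 1 + (cmod b)\<^sup>2"
 by (simp add: radius_def)

lemma radius_0 [simp]: "radius 0 = 1"
 by (simp add: radius_def)

lemma radius_norm: "cmod b = cmod c ==> radius b = radius c"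
 by (simp add: radius_def)

lemma cm_det_umat [simp]: "cm_det (umat k) = 1"
 using radius_gt(2)[of "snd k"] by (simp add: cm_det_def umat_def norm_mult power_mult_distrib radius_power2)

lemma Re_pos_of_radius: "cmod c <= cmod b ==> 0 < Re (of_real (radius b) + c)"
 using radius_gt(1)[of b] abs_Re_le_cmod[of c] by simp

lemma Arg_bound: "0 < Re z ==> \<bar>Arg z\<bar> < pi / 2"
 using Arg_Re_pos[of z] by blast

lemma cis_Arg_norm: "z ~= 0 ==> of_real (cmod z) * cis (Arg z) = z"
 using rcis_cmod_Arg[of z] by (simp add: rcis_def)

lemma uact_dir_pos: "0 < Re (of_real (radius b) + b * cis x)"
 by (rule Re_pos_of_radius) (simp add: norm_mult)

lemma umult_aux_pos: "0 < Re (umult_aux k l)"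
proof -
 have "cmod (snd k * cnj (snd l) * cis (- (2 * fst l))) < radius (snd k) * radius (snd l)"
  using radius_gt[of "snd k"] radius_gt[of "snd l"]
  by (simp add: norm_mult) (metis mult_strict_mono' norm_ge_zero)
 then show ?thesis
  using abs_Re_le_cmod[of "snd k * cnj (snd l) * cis (- (2 * fst l))"]
  by (simp add: umult_aux_def)
qed

lemma uact_bounds: "\<bar>uact k x - x - fst k\<bar> < pi / 2"
 using Arg_bound[OF uact_dir_pos] by (simp add: uact_def)

lemma cm_app_umat_cis:
 obtains r where "0 < r" "cm_app (umat k) (cis x) = of_real r * cis (uact k x)"
proof
 define w where "w = of_real (radius (snd k)) + snd k * cis (- (2 * x))"
 have w: "0 < Re w" unfolding w_def by (rule uact_dir_pos)
 then have "w ~= 0" by auto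
 then show "0 < cmod w" by simp
 have e: "cis (fst k) * cnj (cis x) = cis (x + fst k) * cis (- (2 * x))"
  by (simp add: cis_cnj cis_mult)
 have "cm_app (umat k) (cis x) = cis (x + fst k) * w"
  unfolding cm_app_def umat_def w_def
  by (simp add: algebra_simps cis_mult cis_cnj)
 also have "\<dots> = of_real (cmod w) * cis (uact k x)"
  by (subst cis_Arg_norm[OF \<open>w ~= 0\<close>, symmetric]) (simp add: uact_def w_def cis_mult algebra_simps)
 finally show "cm_app (umat k) (cis x) = of_real (cmod w) * cis (uact k x)" .
qed

lemma umat_mult: "umat (k &* l) = umat k #* umat l"
proof -
 obtain t b where k: "k = (t, b)" by (cases k)
 obtain s c where l: "l = (s, c)" by (cases l)
 define A where "A = umult_aux k l"
 define B where "B = of_real (radius b) * c + b * of_real (radius c) * cis (- (2 * s))"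
 have A: "A = of_real (radius b * radius c) + b * cnj c * cis (- (2 * s))"
  by (simp add: A_def umult_aux_def k l)
 have "A ~= 0" using umult_aux_pos[of k l] unfolding A_def by auto
 have kl: "k &* l = (t + s + Arg A, B * cis (- Arg A))"
  by (simp add: umult_def A_def B_def k l)
 have e1: "umat k #* umat l = (cis (t + s) * A, cis (t + s) * B)"
 proof -
  have "cnj (cis s) = cis s * cis (- (2 * s))" "cis (t + s) = cis t * cis s"
   by (simp_all add: cis_cnj cis_mult)
  then show ?thesis
   unfolding cm_mult_def umat_def A B_def k l by (simp add: algebra_simps)
 qed
 have "cm_det (cis (t + s) * A, cis (t + s) * B) = 1"
  unfolding e1[symmetric] by simp
 then have n: "(cmod A)\<^sup>2 = 1 + (cmod B)\<^sup>2" by (simp add: cm_det_def norm_mult)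
 have r: "radius (snd (k &* l)) = cmod A"
  unfolding kl radius_def by (simp add: norm_mult n[symmetric])
 have "of_real (cmod A) * cis (t + s + Arg A) = cis (t + s) * A"
  using cis_Arg_norm[OF \<open>A ~= 0\<close>] by (simp add: cis_mult[symmetric] algebra_simps)
 moreover have "B * cis (- Arg A) * cis (t + s + Arg A) = cis (t + s) * B"
  by (simp add: cis_mult algebra_simps)
 ultimately show ?thesis
  unfolding e1 by (simp add: umat_def r, simp add: kl)
qed

lemma pi_multiple_small:
 fixes d :: real
 assumes "d = 2 * pi * of_int n" "\<bar>d\<bar> < 2 * pi"
 shows "d = 0"
using assms by (simp add: abs_mult)

lemma cis_eq_small:
 assumes "cis x = cis y" "\<bar>x - y\<bar> < 2 * pi"
 shows "x = y"
proof -
 have "cis (x - y) = 1" using assms(1) by (simp add: cis_divide[symmetric])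
 then have "cos (x - y) = 1" by (metis cis.sel(1) one_complex.sel(1))
 then obtain n :: int where "x - y = of_int n * 2 * pi" using cos_one_2pi_int by blast
 then show ?thesis using pi_multiple_small[of "x - y" n] assms(2) by (simp add: mult_ac)
qed

lemma uact_mult: "uact (k &* l) x = uact k (uact l x)"
proof -
 let ?A = "uact (k &* l) x"
 obtain r1 where r1: "0 < r1" "cm_app (umat (k &* l)) (cis x) = of_real r1 * cis ?A"
  by (rule cm_app_umat_cis)
 obtain r2 where r2: "0 < r2" "cm_app (umat l) (cis x) = of_real r2 * cis (uact l x)"
  by (rule cm_app_umat_cis)
 let ?B = "uact k (uact l x)"
 obtain r3 where r3: "0 < r3"
   "cm_app (umat k) (cis (uact l x)) = of_real r3 * cis ?B"
  by (rule cm_app_umat_cis)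
 have e: "of_real r1 * cis ?A = of_real (r2 * r3) * cis ?B"
  unfolding r1(2)[symmetric] umat_mult cm_app_mult r2(2) cm_app_scaleR r3(2) by simp
 have "cmod (of_real r1 * cis ?A) = cmod (of_real (r2 * r3) * cis ?B)"
  by (simp only: e)
 then have "r1 = r2 * r3" using r1 r2 r3 by (simp add: norm_mult)
 then have c: "cis ?A = cis ?B" using e r1(1) by auto
 have "fst (k &* l) = fst k + fst l + Arg (umult_aux k l)" by (simp add: umult_def)
 then have "\<bar>uact (k &* l) x - uact k (uact l x)\<bar> < 2 * pi"
  using uact_bounds[of "k &* l" x] uact_bounds[of k "uact l x"] uact_bounds[of l x]
   Arg_bound[OF umult_aux_pos[of k l]] by linarith
 then show ?thesis by (rule cis_eq_small[OF c])
qed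

lemma norm_umat: "cmod (fst (umat k)) = radius (snd k)"
 using radius_gt(2)[of "snd k"] by (simp add: umat_def norm_mult)

lemma ucov_eqI:
 assumes m: "umat k = umat l" and x: "uact k x = uact l x"
 shows "k = l"
proof -
 have "radius (snd k) = radius (snd l)" using norm_umat m by metis
 then have c: "cis (fst k) = cis (fst l)"
  using m radius_gt(2)[of "snd l"] by (simp add: umat_def)
 have "\<bar>fst k - fst l\<bar> < 2 * pi"
  using uact_bounds[of k x] uact_bounds[of l x] x by linarith
 then have t: "fst k = fst l" by (rule cis_eq_small[OF c])
 then have "snd k = snd l" using m by (simp add: umat_def)
 with t show ?thesis by (simp add: prod_eq_iff)
qed

lemma umat_one [simp]: "umat uone = (1, 0)"
 by (simp add: umat_def)

lemma uact_one [simp]: "uact uone x = x"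
 by (simp add: uact_def)

lemma umat_inv: "umat (uinv k) = cm_adj (umat k)"
proof -
 have "radius (snd (uinv k)) = radius (snd k)"
  by (rule radius_norm) (simp add: uinv_def norm_mult)
 then show ?thesis by (simp add: umat_def cm_adj_def uinv_def cis_cnj cis_mult)
qed

lemma umult_assoc: "(k &* l) &* m = k &* (l &* m)"
 by (rule ucov_eqI[of _ _ 0]) (simp_all add: umat_mult cm_mult_assoc uact_mult)

lemma umult_one [simp]: "uone &* k = k" "k &* uone = k"
 by (rule ucov_eqI[of _ _ 0]; simp add: umat_mult uact_mult)+

lemma uinv_left [simp]: "uinv k &* k = uone"
proof (rule ucov_eqI[of _ _ 0])
 let ?A = "uinv k &* k"
 show "umat ?A = umat uone"
  by (simp add: umat_mult umat_inv cm_adj_mult)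
 have r: "radius (snd (uinv k)) = radius (snd k)"
  by (rule radius_norm) (simp add: uinv_def norm_mult)
 have "snd (uinv k) * cnj (snd k) * cis (- (2 * fst k))
   = - (snd k * cnj (snd k)) * (cis (2 * fst k) * cis (- (2 * fst k)))"
  by (simp add: uinv_def)
 also have "\<dots> = of_real (1 - (radius (snd k))\<^sup>2)"
  by (simp add: cis_mult radius_power2 complex_norm_square del: of_real_power)
 finally have a: "umult_aux (uinv k) k = of_real 1"
  by (simp add: umult_aux_def r power2_eq_square)
 have t: "fst ?A = 0"
  using a by (simp add: umult_def) (simp add: uinv_def)
 have "snd ?A = 0"
  unfolding umult_def a by (simp add: r) (simp add: uinv_def cis_mult)
 with t have "uinv k &* k = uone" by (simp add: prod_eq_iff)
 then show "uact ?A 0 = uact uone 0" by simp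
qed

lemma uinv_right [simp]: "k &* uinv k = uone"
 by (metis uinv_left umult_assoc umult_one)

lemma uinv_cancel [simp]: "uinv k &* (k &* l) = l" "k &* (uinv k &* l) = l"
 by (simp_all add: umult_assoc[symmetric])

lemma uinv_uinv [simp]: "uinv (uinv k) = k"
 by (metis uinv_cancel(1) uinv_left umult_one(2))

lemma uinv_mult: "uinv (k &* l) = uinv l &* uinv k"
 by (metis uinv_cancel(2) uinv_right umult_assoc uinv_cancel(1) umult_one(2))

lemma uinv_one [simp]: "uinv uone = uone"
 by (metis uinv_left umult_one(2))

lemma umult_right_cancel [simp]: "l &* k = m &* k <-> l = m"
 by (metis umult_assoc uinv_right umult_one(2))

lemma umult_eq_iff: "k &* l = m <-> k = m &* uinv l" "k &* l = m <-> l = uinv k &* m"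
 by (metis umult_assoc uinv_right uinv_left umult_one(2)) (metis uinv_cancel)

lemma continuous_on_radius [continuous_intros]:
 "continuous_on S f ==> continuous_on S (%x. radius (f x))"
 unfolding radius_def by (intro continuous_intros)

lemma continuous_on_cis' [continuous_intros]:
 "continuous_on S f ==> continuous_on S (%x. cis (f x))"
 unfolding cis_conv_exp by (intro continuous_intros)

lemma Re_pos_not_nonpos: "0 < Re z ==> z \<notin> \<real>\<^sub>\<le>\<^sub>0"
 by (auto simp: complex_nonpos_Reals_iff)

lemma continuous_on_umult_aux:
 assumes "continuous_on S f" "continuous_on S g"
 shows "continuous_on S (%x. umult_aux (f x) (g x))"
 unfolding umult_aux_def by (intro continuous_intros assms)

lemma continuous_on_umult [continuous_intros]:
 assumes "continuous_on S f" "continuous_on S g"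
 shows "continuous_on S (%x. f x &* g x)"
 unfolding umult_def
 by (intro continuous_intros assms continuous_on_umult_aux ballI Re_pos_not_nonpos umult_aux_pos)

lemma continuous_on_uinv [continuous_intros]:
 "continuous_on S f ==> continuous_on S (%x. uinv (f x))"
 unfolding uinv_def by (intro continuous_intros)

lemma continuous_on_umat [continuous_intros]:
 "continuous_on S f ==> continuous_on S (%x. umat (f x))"
 unfolding umat_def by (intro continuous_intros)

lemma continuous_on_uact [continuous_intros]:
 assumes "continuous_on S f" "continuous_on S g"
 shows "continuous_on S (%x. uact (f x) (g x))"
 unfolding uact_def
 by (intro continuous_intros assms ballI Re_pos_not_nonpos uact_dir_pos)

lemma uact_cancel [simp]: "uact (uinv k) (uact k x) = x" "uact k (uact (uinv k) x) = x"
 by (simp_all add: uact_mult[symmetric])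

definition urot :: "real => ucov" where
 "urot h = (h, 0)"

definition uz :: "int => ucov" where
 "uz n = urot (pi * of_int n)"

lemma urot_mult_left: "urot h &* k = (h + fst k, snd k)"
 by (simp add: umult_def umult_aux_def urot_def radius_gt(2))

lemma uact_urot [simp]: "uact (urot h) x = x + h"
 by (simp add: uact_def urot_def)

lemma umat_urot: "umat (urot h) = (cis h, 0)"
 by (simp add: umat_def urot_def)

lemma cis_2pi_int: "cis (2 * (pi * of_int n)) = 1"
 using cis_multiple_2pi[of "of_int n"] by (simp add: mult_ac)

lemma uz_mult_left: "uz n &* k = (fst k + pi * of_int n, snd k)"
 by (simp add: uz_def urot_mult_left)

lemma uz_central: "k &* uz n = uz n &* k"
proof -
 have "cis (- (2 * (pi * real_of_int n))) = 1" using cis_2pi_int[of "- n"] by simp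
 then show ?thesis
  unfolding uz_mult_left by (simp add: umult_def umult_aux_def uz_def urot_def radius_gt(2))
qed

lemma uz_0 [simp]: "uz 0 = uone"
 by (simp add: uz_def urot_def)

lemma uz_add: "uz m &* uz n = uz (m + n)"
 by (simp add: uz_mult_left) (simp add: uz_def urot_def algebra_simps)

lemma uinv_uz [simp]: "uinv (uz n) = uz (- n)"
 by (metis umult_eq_iff(1) umult_one(1) uz_0 uz_add right_minus add.commute)

lemma uact_uz [simp]: "uact (uz n) x = x + pi * of_int n"
 by (simp add: uz_def)

lemma uz_inj [simp]: "uz m = uz n <-> m = n"
 by (simp add: uz_def urot_def)

lemma uact_plus_pi: "uact k (x + pi * of_int n) = uact k x + pi * of_int n"
 by (metis uact_mult uact_uz uz_central)

lemma uact_less_aux: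
 assumes "x < y" "y < x + pi"
 shows "uact k x < uact k y" "uact k y < uact k x + pi"
proof -
 obtain r where r: "0 < r" "cm_app (umat k) (cis x) = of_real r * cis (uact k x)"
  by (rule cm_app_umat_cis)
 obtain s where s: "0 < s" "cm_app (umat k) (cis y) = of_real s * cis (uact k y)"
  by (rule cm_app_umat_cis)
 let ?A = "uact k y - uact k x"
 have "Im (cm_app A u * cnj (cm_app A v)) = cm_det A * Im (u * cnj v)" for A u v
  unfolding cm_det_def cm_app_def cmod_power2 by (simp add: algebra_simps power2_eq_square)
 from this[of "umat k" "cis y" "cis x"]
 have "Im (of_real s * cis (uact k y) * cnj (of_real r * cis (uact k x))) = Im (cis y * cnj (cis x))"
  by (simp only: r s cm_det_umat mult_1)
 also have "of_real s * cis (uact k y) * cnj (of_real r * cis (uact k x)) = of_real (s * r) * cis ?A"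
  by (simp add: cis_cnj cis_mult algebra_simps)
 also have "Im \<dots> = s * r * sin ?A" by simp
 also have "cis y * cnj (cis x) = cis (y - x)" by (simp add: cis_cnj cis_mult)
 finally have "s * r * sin ?A = sin (y - x)" by simp
 moreover have "0 < sin (y - x)" using assms by (intro sin_gt_zero) auto
 ultimately have p: "0 < sin ?A"
  using r(1) s(1) by (metis mult_pos_pos zero_less_mult_pos)
 define d where "d = uact k y - uact k x"
 have d: "- pi < d" "d < 2 * pi"
  using uact_bounds[of k x] uact_bounds[of k y] assms unfolding d_def by linarith+
 have p: "0 < sin d" using p by (simp add: d_def)
 have "0 < d"
 proof (rule ccontr)
  assume "\<not> 0 < d"
  then have "0 <= sin (- d)" using d by (intro sin_ge_zero) auto
  then show False using p by simp
 qed
 moreover have "d < pi"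
 by (smt (verit) d sin_le_zero p)
 ultimately show "uact k x < uact k y" "uact k y < uact k x + pi" by (simp_all add: d_def)
qed

lemma uact_less: assumes "x < y" shows "uact k x < uact k y"
proof -
 define n where "n = \<lfloor>(y - x) / pi\<rfloor>"
 define s where "s = y - pi * of_int n"
 have "of_int n <= (y - x) / pi" "(y - x) / pi < of_int n + 1" by (simp_all add: n_def)
 then have s: "x <= s" "s < x + pi" by (simp_all add: s_def field_simps)
 have n0: "0 <= n" using assms by (simp add: n_def)
 have y: "uact k y = uact k s + pi * of_int n"
  unfolding uact_plus_pi[symmetric] by (simp add: s_def)
 show ?thesis
 by (smt (verit) s_def assms y s uact_less_aux)
qed

lemma uact_less_iff [simp]: "uact k x < uact k y <-> x < y"
 by (metis uact_less linorder_neqE not_less_iff_gr_or_eq)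

lemma uact_le_iff [simp]: "uact k x <= uact k y <-> x <= y"
 by (metis uact_less_iff not_less)

subsection \<open>Displacement\<close>

definition ulo :: "ucov => real" where
 "ulo k = fst k - arctan (cmod (snd k))"

definition uhi :: "ucov => real" where
 "uhi k = fst k + arctan (cmod (snd k))"

lemma continuous_on_ulo [continuous_intros]:
 "continuous_on S f ==> continuous_on S (%x. ulo (f x))"
 unfolding ulo_def by (intro continuous_intros)

lemma continuous_on_uhi [continuous_intros]:
 "continuous_on S f ==> continuous_on S (%x. uhi (f x))"
 unfolding uhi_def by (intro continuous_intros)

lemma ulo_le_uhi: "ulo k <= uhi k" "uhi k < ulo k + pi"
 using arctan_ubound[of "cmod (snd k)"] zero_le_arctan_iff[of "cmod (snd k)"]
 by (auto simp: ulo_def uhi_def simp del: zero_le_arctan_iff)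

lemma sin_arctan_radius: "radius b * sin (arctan (cmod b)) = cmod b"
 "radius b * cos (arctan (cmod b)) = 1"
 using radius_gt(2)[of b] by (simp_all add: sin_arctan cos_arctan radius_def)

lemma Arg_le_arctan:
 assumes "cmod c = cmod b"
 shows "\<bar>Arg (of_real (radius b) + c)\<bar> <= arctan (cmod b)"
proof -
 define w where "w = of_real (radius b) + c"
 define h where "h = arctan (cmod b)"
 have w: "0 < Re w" unfolding w_def by (rule Re_pos_of_radius) (simp add: assms)
 then have w0: "w ~= 0" by auto
 have h: "0 <= h" "h < pi / 2" using arctan_ubound[of "cmod b"] unfolding h_def by auto
 have B: "\<bar>Arg w\<bar> < pi / 2" by (rule Arg_bound[OF w])
 have W: "w = of_real (cmod w) * cis (Arg w)" by (simp add: cis_Arg_norm[OF w0])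
 have "cmod w * sin (Arg w - h) = Im (w * cis (- h))"
  by (subst (2) W) (simp add: sin_diff algebra_simps)
 also have "\<dots> = - (radius b * sin h) + Im (c * cis (- h))"
  by (simp add: w_def algebra_simps)
 also have "\<dots> <= - cmod b + cmod (c * cis (- h))"
  using abs_Im_le_cmod[of "c * cis (- h)"] sin_arctan_radius(1)[of b] unfolding h_def by linarith
 also have "\<dots> = 0" by (simp add: norm_mult assms)
 finally have 1: "sin (Arg w - h) <= 0" using w0 by (simp add: mult_le_0_iff)
 have "cmod w * sin (Arg w + h) = Im (w * cis h)"
  by (subst (2) W) (simp add: sin_add algebra_simps)
 also have "\<dots> = radius b * sin h + Im (c * cis h)"
  by (simp add: w_def algebra_simps)
 also have "\<dots> \<ge> cmod b - cmod (c * cis h)"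
  using abs_Im_le_cmod[of "c * cis h"] sin_arctan_radius(1)[of b] unfolding h_def by linarith
 finally have 2: "0 <= sin (Arg w + h)" using w0 by (simp add: norm_mult assms zero_le_mult_iff)
 have "Arg w <= h"
 proof (rule ccontr)
  assume "\<not> Arg w <= h"
  then have "0 < sin (Arg w - h)" using B h by (intro sin_gt_zero) auto
  then show False using 1 by simp
 qed
 moreover have "- h <= Arg w"
 proof (rule ccontr)
  assume "\<not> - h <= Arg w"
  then have "0 < sin (- (Arg w + h))" using B h by (intro sin_gt_zero) auto
  then show False using 2 by (simp only: sin_minus)
 qed
 ultimately show ?thesis by (simp add: w_def h_def)
qed

lemma Arg_eq_arctan:
 "Arg (of_real (radius b) + of_real (cmod b) * \<i> * cis (arctan (cmod b))) = arctan (cmod b)" (is ?Q)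
 "Arg (of_real (radius b) - of_real (cmod b) * \<i> * cis (- arctan (cmod b))) = - arctan (cmod b)" (is ?P)
proof -
 define h where "h = arctan (cmod b)"
 have h: "0 <= h" "h < pi / 2" using arctan_ubound[of "cmod b"] unfolding h_def by auto
 have r: "radius b * sin h = cmod b" "radius b * cos h = 1"
  unfolding h_def by (rule sin_arctan_radius)+
 have "radius b = radius b * ((sin h)\<^sup>2 + (cos h)\<^sup>2)"
  by (simp only: sin_cos_squared_add mult_1_right)
 also have "\<dots> = (radius b * sin h) * sin h + (radius b * cos h) * cos h"
  by (simp only: algebra_simps power2_eq_square)
 finally have "radius b - cmod b * sin h = cos h" unfolding r by simp
 then have e: "radius b - cmod b * sin h = cos h" .
 have "cmod b * cos h = sin h" using r by (metis mult.commute mult.left_commute mult_1)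
 then have "of_real (radius b) + of_real (cmod b) * \<i> * cis h = cis h"
  "of_real (radius b) - of_real (cmod b) * \<i> * cis (- h) = cis (- h)"
  using e by (simp_all add: complex_eq_iff)
 then show ?Q
  ?P
  using h unfolding h_def[symmetric] by (simp_all add: Arg_cis)
qed

lemma uact_lo_hi: "x + ulo k <= uact k x" "uact k x <= x + uhi k"
proof -
 have "\<bar>Arg (of_real (radius (snd k)) + snd k * cis (- (2 * x)))\<bar> <= arctan (cmod (snd k))"
  by (rule Arg_le_arctan) (simp add: norm_mult)
 then show "x + ulo k <= uact k x" "uact k x <= x + uhi k"
  unfolding uact_def ulo_def uhi_def by linarith+
qed

lemma cis_half_solution:
 assumes "cmod a = 1" obtains x where "cis (- (2 * x)) = a"
proof
 show "cis (- (2 * (- Arg a / 2))) = a" using cis_Arg[of a] assms by (cases "a = 0") (auto simp: sgn_eq)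
qed

lemma obtain_rotation:
 assumes "cmod a = 1" obtains x where "b * cis (- (2 * x)) = of_real (cmod b) * a"
proof (cases "b = 0")
 case True then show ?thesis using that by auto
next
 case False
 then have "cmod (of_real (cmod b) * a / b) = 1" by (simp add: norm_mult norm_divide assms)
 then obtain x where "cis (- (2 * x)) = of_real (cmod b) * a / b" by (rule cis_half_solution)
 then show ?thesis using that[of x] False by simp
qed

lemma uact_hi_attained: obtains x where "uact k x = x + uhi k"
proof -
 have "cmod (\<i> * cis (arctan (cmod (snd k)))) = 1" by (simp add: norm_mult)
 then obtain x where "snd k * cis (- (2 * x)) = of_real (cmod (snd k)) * (\<i> * cis (arctan (cmod (snd k))))"
  by (rule obtain_rotation)
 then show ?thesis by (smt (verit) uact_def uhi_def mult.assoc Arg_eq_arctan that)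
qed

lemma uact_lo_attained: obtains x where "uact k x = x + ulo k"
proof -
 have "cmod (- \<i> * cis (- arctan (cmod (snd k)))) = 1" by (simp add: norm_mult)
 then obtain x where "snd k * cis (- (2 * x)) = of_real (cmod (snd k)) * (- \<i> * cis (- arctan (cmod (snd k))))"
  by (rule obtain_rotation)
 then have "uact k x = x + ulo k" using Arg_eq_arctan(2)[of "snd k"] by (simp add: uact_def ulo_def mult.assoc)
 then show ?thesis by (rule that)
qed

lemma uhi_le_iff: "uhi k <= c <-> (\<forall>x. uact k x <= x + c)"
 by (metis uact_lo_hi(2) uact_hi_attained add_le_cancel_left order_trans)

lemma le_ulo_iff: "c <= ulo k <-> (\<forall>x. x + c <= uact k x)"
 by (metis uact_lo_hi(1) uact_lo_attained add_le_cancel_left order_trans)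

lemma less_ulo_iff: "c < ulo k <-> (\<forall>x. x + c < uact k x)"
 by (metis uact_lo_hi(1) uact_lo_attained add_less_cancel_left less_le_trans)

lemma ulo_uinv [simp]: "ulo (uinv k) = - uhi k" and uhi_uinv [simp]: "uhi (uinv k) = - ulo k"
 by (simp_all add: ulo_def uhi_def uinv_def norm_mult)

definition ule :: "ucov => ucov => bool" (infix "<~" 50) where
 "k <~ l <-> (\<forall>x. uact k x <= uact l x)"

lemma ule_refl [simp]: "k <~ k" and ule_trans [trans]: "k <~ l ==> l <~ m ==> k <~ m"
 by (auto simp: ule_def intro: order_trans)

lemma ule_mult_left [simp]: "m &* k <~ m &* l <-> k <~ l"
 by (simp add: ule_def uact_mult)

lemma ule_mult_right [simp]: "k &* m <~ l &* m <-> k <~ l"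
 unfolding ule_def uact_mult by (metis uact_cancel(2))

lemma ule_move: "k <~ l &* m <-> k &* uinv m <~ l" (is ?P) "k <~ l &* m <-> uinv l &* k <~ m" (is ?Q)
 "k &* m <~ l <-> k <~ l &* uinv m" (is ?R) "l &* m <~ k <-> m <~ uinv l &* k" (is ?S)
proof -
 show ?P using ule_mult_right[of k "uinv m" "l &* m"] by (simp add: umult_assoc)
 show ?Q using ule_mult_left[of "uinv l" k "l &* m"] by simp
 show ?R using ule_mult_right[of "k &* m" "uinv m" l] by (simp add: umult_assoc)
 show ?S using ule_mult_left[of "uinv l" "l &* m" k] by simp
qed

lemma uinv_ule [simp]: "uinv k <~ uinv l <-> l <~ k"
 by (metis ule_move(1,2) umult_one(1) umult_one(2) uinv_uinv)

lemma ule_uz: "k <~ uz n <-> uhi k <= pi * of_int n" "uz n <~ k <-> pi * of_int n <= ulo k"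
 by (simp_all add: ule_def uhi_le_iff le_ulo_iff)

lemma ule_one: "k <~ uone <-> uhi k <= 0" "uone <~ k <-> 0 <= ulo k"
 using ule_uz[where k = k and n = 0] by (simp_all add: uz_0[symmetric] del: uz_0)

lemma ule_uz_uz [simp]: "uz m <~ uz n <-> m <= n"
 by (simp add: ule_def)

lemma ule_antisym: "k <~ l ==> l <~ k ==> k = l"
proof -
 assume "k <~ l" "l <~ k"
 then have e: "uact (uinv l &* k) x = x" for x
  by (metis ule_def antisym uact_mult uact_cancel(1))
 have "uhi (uinv l &* k) <= 0" "0 <= ulo (uinv l &* k)"
  by (simp_all add: uhi_le_iff le_ulo_iff e)
 then have "arctan (cmod (snd (uinv l &* k))) <= 0" "uhi (uinv l &* k) = 0" "ulo (uinv l &* k) = 0"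
  using ulo_le_uhi(1)[of "uinv l &* k"] unfolding uhi_def ulo_def by linarith+
 then have "uinv l &* k = uone" by (auto simp: prod_eq_iff uhi_def)
 then show "k = l" by (metis umult_eq_iff(2) umult_one(2) uinv_uinv)
qed

lemma closed_ule: "closed {k. k <~ l}" "closed {k. l <~ k}"
proof -
 have "{k. k <~ l} = {k. uhi (uinv l &* k) <= 0}"
  using ule_move(2)[of _ l uone] ule_one by auto
 then show "closed {k. k <~ l}" by (simp only:) (intro closed_Collect_le continuous_intros)
 have "{k. l <~ k} = {k. 0 <= ulo (uinv l &* k)}"
  using ule_move(4)[of l uone] ule_one by auto
 then show "closed {k. l <~ k}" by (simp only:) (intro closed_Collect_le continuous_intros)
qed

lemma uz_ule_conj: "uz n <~ k &* l &* uinv k <-> uz n <~ l" (is ?P) "k &* l &* uinv k <~ uz n <-> l <~ uz n" (is ?Q)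
proof -
 have "k &* uz n &* uinv k = uz n" by (metis uz_central umult_assoc uinv_right umult_one(2))
 then show ?P ?Q
  by (metis ule_mult_left ule_mult_right)+
qed

lemma conj_eq_uz_mult:
 assumes "k &* l &* uinv k = uz n &* l" shows "n = 0"
proof -
 define m where "m = \<lfloor>ulo l / pi\<rfloor>"
 have m: "pi * of_int m <= ulo l" "ulo l < pi * (of_int m + 1)"
  using floor_correct[of "ulo l / pi"] unfolding m_def
  by (simp_all only: pos_le_divide_eq pos_divide_less_eq pi_gt_zero mult.commute of_int_add of_int_1)
 have shift: "uz j <~ uz n &* l <-> uz (j - n) <~ l" for j
  by (simp add: ule_move(2) uz_add)
 have "uz j <~ l <-> j <= m" for j :: int
 proof
  assume "uz j <~ l"
  then have "pi * of_int j < pi * (of_int m + 1)" by (metis ule_uz m le_less_trans)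
  then show "j <= m" by simp
 next
  assume "j <= m"
  then have "pi * of_int j <= pi * real_of_int m" by simp
  then show "uz j <~ l" using m(1) unfolding ule_uz by (rule order_trans)
 qed
 then have "j - n <= m <-> j <= m" for j using shift[of j] uz_ule_conj(1)[of j k l] assms by simp
 from this[of m] this[of "m + n"] show "n = 0" by simp
qed

subsection \<open>Parabolic one-parameter subgroups\<close>

text \<open>The direction \<open>cis h\<close> fixed by \<open>upar v r\<close> satisfies \<open>cis (2 * h) = \<i> * v\<close>.\<close>

definition upar :: "complex => real => ucov" where
 "upar v r = (arctan r, of_real r * v * cis (- arctan r))"

lemma cis_arctan: "of_real (sqrt (1 + r\<^sup>2)) * cis (arctan r) = Complex 1 r"
proof -
 have "sqrt (1 + r\<^sup>2) ~= 0" by (metis add_nonneg_eq_0_iff real_sqrt_eq_zero_cancel_iff zero_le_one zero_le_power2 zero_neq_one)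
 then show ?thesis by (simp add: complex_eq_iff cos_arctan sin_arctan)
qed

lemma radius_upar:
 assumes "cmod v = 1"
 shows "radius (snd (upar v r)) = sqrt (1 + r\<^sup>2)" "cmod (snd (upar v r)) = \<bar>r\<bar>"
 by (simp_all add: radius_def upar_def norm_mult assms)

lemma umat_upar:
 assumes "cmod v = 1"
 shows "umat (upar v r) = (Complex 1 r, of_real r * v)"
proof -
 have "fst (umat (upar v r)) = Complex 1 r"
  using cis_arctan[of r] by (simp add: umat_def radius_upar assms) (simp add: upar_def)
 moreover have "snd (umat (upar v r)) = of_real r * v"
  by (simp add: umat_def upar_def cis_mult)
 ultimately show ?thesis by (simp add: prod_eq_iff)
qed

lemma upar_0 [simp]: "upar v 0 = uone"
 by (simp add: upar_def)

lemma axis_exists: assumes "cmod v = 1" obtains h where "cis (2 * h) = \<i> * v"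
proof -
 have "cmod (\<i> * v) = 1" using assms by (simp add: norm_mult)
 then obtain x where "cis (- (2 * x)) = \<i> * v" by (rule cis_half_solution)
 then show ?thesis using that[of "- x"] by simp
qed

lemma axis_cnj:
 assumes "cis (2 * h) = \<i> * v" shows "cis (- (2 * h)) = - \<i> * cnj v"
 using arg_cong[OF assms, of cnj] by (simp add: cis_cnj)

lemma upar_fix:
 assumes z: "cmod v = 1" and h: "cis (2 * h) = \<i> * v"
 shows "uact (upar v r) h = h"
proof -
 have zz: "v * cnj v = 1" using z complex_norm_square[of v] by simp
 have "of_real (sqrt (1 + r\<^sup>2)) = cis (- arctan r) * Complex 1 r"
  unfolding cis_arctan[symmetric] by (simp add: cis_mult)
 moreover have "of_real r * v * cis (- arctan r) * (- \<i> * cnj v) = - \<i> * of_real r * cis (- arctan r)"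
  using zz by (metis (no_types, lifting) mult.assoc mult.commute mult.right_neutral)
 ultimately have "of_real (sqrt (1 + r\<^sup>2)) + of_real r * v * cis (- arctan r) * (- \<i> * cnj v)
   = cis (- arctan r) * (Complex 1 r - \<i> * of_real r)" by (simp add: algebra_simps)
 also have "Complex 1 r - \<i> * of_real r = 1" by (simp add: complex_eq_iff)
 finally have "of_real (radius (snd (upar v r))) + snd (upar v r) * cis (- (2 * h)) = cis (- arctan r)"
  unfolding axis_cnj[OF h] radius_upar(1)[OF z] by (simp add: upar_def)
 moreover have "Arg (cis (- arctan r)) = - arctan r"
  using arctan_lbound[of r] arctan_ubound[of r] by (intro Arg_cis) auto
 ultimately show ?thesis by (simp add: uact_def) (simp add: upar_def)
qed

lemma upar_add:
 assumes z: "cmod v = 1" shows "upar v r &* upar v s = upar v (r + s)"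
proof -
 obtain h where h: "cis (2 * h) = \<i> * v" using axis_exists[OF z] .
 have zz: "v * cnj v = 1" using z complex_norm_square[of v] by simp
 show ?thesis
 proof (rule ucov_eqI)
  have "Complex 1 r * Complex 1 s + of_real r * v * (of_real s * cnj v)
    = Complex 1 r * Complex 1 s + of_real (r * s) * (v * cnj v)" by simp
  also have "\<dots> = Complex 1 (r + s)" unfolding zz by (simp add: complex_eq_iff)
  finally have 1: "Complex 1 r * Complex 1 s + of_real r * v * (of_real s * cnj v) = Complex 1 (r + s)" .
  have "Complex 1 r * of_real s + of_real r * cnj (Complex 1 s) = of_real (r + s)"
   by (simp add: complex_eq_iff)
  then have 2: "Complex 1 r * (of_real s * v) + of_real r * v * cnj (Complex 1 s) = of_real (r + s) * v"
   by (metis (no_types, opaque_lifting) distrib_right mult.assoc mult.commute)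
  show "umat (upar v r &* upar v s) = umat (upar v (r + s))"
   using 1 2 by (simp add: umat_mult umat_upar z cm_mult_def)
  show "uact (upar v r &* upar v s) h = uact (upar v (r + s)) h"
   by (simp add: uact_mult upar_fix[OF z h])
 qed
qed

lemma uinv_upar: "cmod v = 1 ==> uinv (upar v r) = upar v (- r)"
 by (metis upar_add upar_0 add.right_inverse umult_eq_iff(2) umult_one(2))

lemma ulo_upar: "cmod v = 1 ==> ulo (upar v r) = arctan r - arctan \<bar>r\<bar>"
 and uhi_upar: "cmod v = 1 ==> uhi (upar v r) = arctan r + arctan \<bar>r\<bar>"
 by (simp_all add: ulo_def uhi_def radius_upar) (simp_all add: upar_def)

lemma upar_mono:
 assumes z: "cmod v = 1" and rs: "r <= s" shows "upar v r <~ upar v s"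
proof -
 have "uone &* upar v r <~ upar v (s - r) &* upar v r" by (smt (verit) ulo_upar ule_mult_right assms ule_one)
 then show ?thesis by (simp add: upar_add z)
qed

lemma upar_reach:
 assumes z: "cmod v = 1" and h: "cis (2 * h) = \<i> * v"
  and x: "h < x" "x < y" "y < h + pi"
 obtains r where "0 < r" "uact (upar v r) x = y"
proof -
 define a where "a = x - h"
 define c where "c = y - h"
 have ac: "0 < a" "a < c" "c < pi" using x by (simp_all add: a_def c_def)
 have s: "0 < sin a" "0 < sin c" "0 < sin (c - a)" using ac by (intro sin_gt_zero; simp)+
 define r where "r = sin (c - a) / (2 * sin a * sin c)"
 have r: "0 < r" using s by (simp add: r_def)
 have zz: "v * cnj v = 1" using z complex_norm_square[of v] by simp
 have x': "cis x = cis h * cis a" and y': "cis y = cis h * cis c"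
  by (simp_all add: a_def c_def cis_mult)
 have zc: "v * cnj (cis h) = - \<i> * cis h"
 proof -
  have "\<i> * v * cis (- h) = cis h" unfolding h[symmetric] by (simp add: cis_mult)
  moreover have "v * cis (- h) = - \<i> * (\<i> * v * cis (- h))"
   by (simp add: mult.assoc[symmetric])
  ultimately show ?thesis by (simp only: cis_cnj)
 qed
 have "cm_app (umat (upar v r)) (cis x) = cis h * (Complex 1 r * cis a) + of_real r * (v * cnj (cis h)) * cnj (cis a)"
  unfolding umat_upar[OF z] cm_app_def x' by (simp add: algebra_simps)
 also have "\<dots> = cis h * (Complex 1 r * cis a - \<i> * of_real r * cnj (cis a))"
  unfolding zc by (simp add: algebra_simps)
 also have "Complex 1 r * cis a - \<i> * of_real r * cnj (cis a) = Complex (cos a - 2 * r * sin a) (sin a)"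
  by (simp add: complex_eq_iff)
 also have "\<dots> = of_real (sin a / sin c) * cis c"
 proof -
  show ?thesis using s by (simp add: r_def field_simps sin_diff complex_eq_iff)
 qed
 also have "cis h * (of_real (sin a / sin c) * cis c) = of_real (sin a / sin c) * cis y"
  unfolding y' by (simp add: algebra_simps)
 finally have 1: "cm_app (umat (upar v r)) (cis x) = of_real (sin a / sin c) * cis y" .
 let ?A = "uact (upar v r) x"
 obtain q where q: "0 < q" "cm_app (umat (upar v r)) (cis x) = of_real q * cis ?A"
  by (rule cm_app_umat_cis)
 have e: "of_real (sin a / sin c) * cis y = of_real q * cis ?A"
  using 1 q(2) by metis
 then have "cmod (of_real (sin a / sin c) * cis y) = cmod (of_real q * cis ?A)"
  by (rule arg_cong)
 then have "sin a / sin c = q" using s q(1) by (simp add: norm_mult del: of_real_divide)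
 then have "cis ?A = cis y" using e q(1) by auto
 moreover have "\<bar>uact (upar v r) x - x - arctan r\<bar> < pi / 2" "0 < arctan r" "arctan r < pi / 2"
  using uact_bounds[of "upar v r" x] r arctan_ubound[of r] by (simp_all only: upar_def fst_conv zero_less_arctan_iff)
 then have "\<bar>uact (upar v r) x - y\<bar> < 2 * pi" using x by linarith
 ultimately show ?thesis using cis_eq_small that r by simp
qed

lemma upar_of_trace:
 assumes tr: "Re (fst (umat k)) = 1" and t: "\<bar>fst k\<bar> < pi / 2"
  and y: "y = Im (fst (umat k))" "y ~= 0"
 shows "k = upar (snd (umat k) / of_real y) y" "cmod (snd (umat k) / of_real y) = 1"
proof -
 have a: "fst (umat k) = Complex 1 y" using tr y by (simp add: complex_eq_iff)
 let ?A = "snd (umat k) / of_real y"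
 have "(cmod (fst (umat k)))\<^sup>2 - (cmod (snd (umat k)))\<^sup>2 = 1"
  using cm_det_umat[of k] by (simp only: cm_det_def)
 then have "(cmod (snd (umat k)))\<^sup>2 = y\<^sup>2" unfolding a cmod_power2 by simp
 then have n: "cmod (snd (umat k)) = \<bar>y\<bar>" by (metis abs_norm_cancel power2_eq_iff abs_abs power2_abs abs_of_nonneg norm_ge_zero real_sqrt_abs)
 then show z: "cmod ?A = 1" using y by (simp add: norm_divide)
 have "radius (snd k) * cos (fst k) = 1" "radius (snd k) * sin (fst k) = y"
  using tr y by (simp_all add: umat_def)
 then have t': "arctan y = fst k" by (smt (verit) tan_def div_by_1 mult_divide_mult_cancel_left radius_nonneg t arctan_unique)
 have "umat (upar ?A y) = umat k"
  using a y z by (simp add: umat_upar prod_eq_iff)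
 then have "snd (umat k) = snd (upar ?A y) * cis (fst k)"
  by (simp add: umat_def t' upar_def cis_mult)
 then show "k = upar ?A y" using t' by (simp add: umat_def prod_eq_iff upar_def)
qed

text \<open>The displacement at the fixed direction of \<open>upar v r\<close>.\<close>

definition udisp :: "ucov => complex => real" where
 "udisp k v = fst k + Arg (of_real (radius (snd k)) - \<i> * snd k * cnj v)"

lemma uact_axis:
 assumes "cis (2 * h) = \<i> * v" shows "uact k h = h + udisp k v"
 unfolding uact_def udisp_def axis_cnj[OF assms] by (simp add: mult_ac)

lemma udisp_dir_pos:
 assumes "cmod v = 1" shows "0 < Re (of_real (radius b) - \<i> * b * cnj v)"
 using Re_pos_of_radius[of "- (\<i> * b * cnj v)" b] assms by (simp add: norm_mult)

lemma parabolic_of_trace: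
 assumes tr: "Re (fst (umat k)) = 1" and x: "x < uact k x" "uact k x < x + pi"
 shows "\<exists>v r. cmod v = 1 \<and> 0 < r \<and> k = upar v r \<and> r = Im (fst (umat k)) \<and> of_real r * v = snd (umat k)"
proof -
 define j where "j = round (fst k / (2 * pi))"
 define t where "t = fst k - 2 * pi * of_int j"
 have "\<bar>of_int j - fst k / (2 * pi)\<bar> <= 1 / 2" unfolding j_def by (rule of_int_round_abs_le)
 then have tb: "\<bar>t\<bar> <= pi" by (simp add: t_def field_simps)
 have "cis (fst k) = cis t"
  using cis_multiple_2pi[of "of_int j"] by (simp add: t_def cis_divide[symmetric] mult_ac)
 then have cs: "cos (fst k) = cos t" "sin (fst k) = sin t" by (simp_all add: complex_eq_iff)
 have rc: "radius (snd k) * cos t = 1" using tr cs by (simp add: umat_def)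
 then have ct: "0 < cos t" using radius_gt(2)[of "snd k"] by (metis zero_less_mult_pos zero_less_one)
 have t2: "\<bar>t\<bar> < pi / 2"
 proof (rule ccontr)
  assume "\<not> \<bar>t\<bar> < pi / 2"
  then have "cos \<bar>t\<bar> <= cos (pi / 2)" using tb by (intro cos_monotone_0_pi_le) auto
  then show False using ct by simp
 qed
 have "(cmod (snd k))\<^sup>2 = (tan t)\<^sup>2"
 by (smt (verit) field_simps rc ct power_one radius_power2 tan_sec)
 then have "cmod (snd k) = \<bar>tan t\<bar>" by (metis abs_norm_cancel power2_abs power2_eq_iff_nonneg abs_ge_zero)
 also have "\<dots> = tan \<bar>t\<bar>" using t2 tan_gt_zero[of t] tan_gt_zero[of "- t"]
  by (cases "t = 0"; cases "0 < t") (auto simp: abs_if)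
 finally have ab: "arctan (cmod (snd k)) = \<bar>t\<bar>" using t2 by (simp add: arctan_tan)
 have b: "ulo k = 2 * pi * of_int j + t - \<bar>t\<bar>" "uhi k = 2 * pi * of_int j + t + \<bar>t\<bar>"
  by (simp_all add: ulo_def uhi_def ab) (simp_all add: t_def)
 have 1: "2 * pi * of_int j + t - \<bar>t\<bar> < pi" "0 < 2 * pi * of_int j + t + \<bar>t\<bar>"
  using uact_lo_hi[where k = k and x = x] x unfolding b by linarith+
 have "j = 0"
 proof -
  have "pi * (2 * of_int j) < pi * 2" "pi * (-1) < pi * (2 * of_int j)" using 1 t2 by linarith+
  then have "2 * real_of_int j < 2" "-1 < 2 * real_of_int j" by (simp_all only: mult_less_cancel_left_pos pi_gt_zero)
  then show ?thesis by linarith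
 qed
 then have t: "t = fst k" "0 < t" using 1 by (auto simp: t_def)
 define y where "y = Im (fst (umat k))"
 have y: "0 < y" using t t2 sin_gt_zero radius_gt by (simp add: y_def umat_def)
 then show ?thesis using upar_of_trace[OF tr _ y_def] t2 t
  by (intro exI[of _ "snd (umat k) / of_real y"] exI[of _ y]) (auto simp: y_def)
qed

subsection \<open>Arcs of the circle\<close>

lemma connected_arc_Re: "connected {v :: complex. cmod v = 1 \<and> c < Re v}"
proof (cases "c < -1 \<or> 1 <= c")
 case True
 have "\<bar>Re v\<bar> <= 1" if "cmod v = 1" for v using abs_Re_le_cmod[of v] that by simp
 then have "{v. cmod v = 1 \<and> c < Re v} = (if c < -1 then sphere 0 1 else {})"
  using True by (fastforce simp: sphere_def dist_norm)
 then show ?thesis using connected_sphere[of "0 :: complex" 1] by simp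
next
 case False
 then have c: "-1 <= c" "c < 1" by auto
 let ?A = "{- arccos c <..< arccos c}"
 have "{v. cmod v = 1 \<and> c < Re v} = cis ` ?A"
 proof (intro equalityI subsetI)
  fix v :: complex assume "v \<in> {v. cmod v = 1 \<and> c < Re v}"
  then have z: "v = cis (Arg v)" "c < Re v" using cis_Arg[of v] by (cases "v = 0"; auto simp: sgn_eq)+
  have "c < cos \<bar>Arg v\<bar>" using z by (metis cis.sel(1) cos_abs_real)
  moreover have "\<bar>Arg v\<bar> <= pi" using Arg_le_pi[of v] mpi_less_Arg[of v] by auto
  ultimately have "\<bar>Arg v\<bar> < arccos c"
   using c arccos_less_arccos[of c "cos \<bar>Arg v\<bar>"] by (simp add: arccos_cos del: cos_abs_real)
  then show "v \<in> cis ` ?A" using z(1) by (intro image_eqI[of _ _ "Arg v"]) auto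
 next
  fix v :: complex assume "v \<in> cis ` ?A"
  then obtain x where x: "v = cis x" "\<bar>x\<bar> < arccos c" by auto
  have "cos (arccos c) < cos \<bar>x\<bar>"
   using x arccos_ubound[of c] c by (intro cos_monotone_0_pi) auto
  then show "v \<in> {v. cmod v = 1 \<and> c < Re v}" using x c by simp
 qed
 then show ?thesis by (simp only:) (intro connected_continuous_image continuous_intros connected_Ioo)
qed

lemma connected_arc_halfplane: "connected {v :: complex. cmod v = 1 \<and> c < Re (v * h)}"
proof (cases "h = 0")
 case True
 then have "{v. cmod v = 1 \<and> c < Re (v * h)} = (if c < 0 then sphere 0 1 else {})"
  by (auto simp: sphere_def dist_norm)
 then show ?thesis using connected_sphere[of "0 :: complex" 1] by simp
next
 case False
 define n where "n = h / of_real (cmod h)"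
 have n: "cmod n = 1" using False by (simp add: n_def norm_divide)
 then have nn: "n * cnj n = 1" using complex_norm_square[of n] by simp
 have m: "h = of_real (cmod h) * n" using False by (simp add: n_def)
 let ?A = "{v. cmod v = 1 \<and> c / cmod h < Re v}"
 let ?B = "%w. w * cnj n"
 have "{v. cmod v = 1 \<and> c < Re (v * h)} = ?B ` ?A"
 proof (intro equalityI subsetI)
  fix v assume z: "v \<in> {v. cmod v = 1 \<and> c < Re (v * h)}"
  have "Re (v * h) = cmod h * Re (v * n)" by (subst m) (simp add: algebra_simps)
  then have "c / cmod h < Re (v * n)" using z False by (simp add: field_simps)
  then show "v \<in> ?B ` ?A"
   using z n nn by (intro image_eqI[of _ _ "v * n"]) (auto simp: norm_mult mult.assoc)
 next
  fix v assume "v \<in> ?B ` ?A"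
  then obtain w where w: "v = w * cnj n" "cmod w = 1" "c / cmod h < Re w" by auto
  have "v * h = of_real (cmod h) * w * (n * cnj n)" unfolding w(1) by (subst m) simp
  then have "Re (v * h) = cmod h * Re w" unfolding nn by simp
  then show "v \<in> {v. cmod v = 1 \<and> c < Re (v * h)}"
   using w False n by (simp add: norm_mult field_simps)
 qed
 then show ?thesis
  by (simp only:) (intro connected_continuous_image continuous_intros connected_arc_Re)
qed

lemma Arg_less_iff_Im:
 assumes "0 < Re w" "\<bar>s\<bar> < pi / 2"
 shows "Arg w < s <-> Im (w * cis (- s)) < 0" (is ?P) "s < Arg w <-> 0 < Im (w * cis (- s))" (is ?Q)
proof -
 have w0: "w ~= 0" using assms by auto
 have B: "\<bar>Arg w\<bar> < pi / 2" by (rule Arg_bound[OF assms(1)])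
 have "Im (w * cis (- s)) = cmod w * sin (Arg w - s)"
  by (subst cis_Arg_norm[OF w0, symmetric]) (simp add: sin_diff algebra_simps)
 moreover have "0 < sin (Arg w - s)" if "s < Arg w" using that B assms by (intro sin_gt_zero) auto
 moreover have "sin (Arg w - s) < 0" if "Arg w < s"
 proof -
  have "0 < sin (s - Arg w)" using that B assms by (intro sin_gt_zero) auto
  then show ?thesis by (metis minus_diff_eq neg_less_0_iff_less sin_minus)
 qed
 ultimately show ?P ?Q
  using w0 by (auto simp: mult_less_0_iff zero_less_mult_iff) (metis less_irrefl linorder_neqE_linordered_idom mult_zero_right sin_zero order.asym diff_self)+
qed

lemma connected_udisp_less: "connected {v. cmod v = 1 \<and> udisp k v < s}"
proof -
 define u where "u = s - fst k"
 let ?w = "%v. of_real (radius (snd k)) - \<i> * snd k * cnj v"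
 let ?A = "{v. cmod v = 1 \<and> Arg (?w v) < u}"
 have e: "{v. cmod v = 1 \<and> udisp k v < s} = ?A"
  by (auto simp: udisp_def u_def)
 have B: "\<bar>Arg (?w v)\<bar> < pi / 2" if "cmod v = 1" for v by (rule Arg_bound[OF udisp_dir_pos[OF that]])
 consider "pi / 2 <= u" | "u <= - (pi / 2)" | "\<bar>u\<bar> < pi / 2" by linarith
 then show ?thesis
 proof cases
  case 1
  then have "?A = sphere 0 1" using B by (fastforce simp: sphere_def dist_norm)
  then show ?thesis unfolding e using connected_sphere[of "0 :: complex" 1] by (simp del: sphere_def)
 next
  case 2
  then have "?A = {}" using B by fastforce
  then show ?thesis unfolding e by (simp only: connected_empty)
 next
  case 3
  let ?B = "radius (snd k) * sin u"
  have im: "Im (?w v * cis (- u)) = - ?B - Re (v * (cnj (snd k) * cis u))" for v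
   by (simp add: algebra_simps)
  have "Arg (?w v) < u <-> - ?B < Re (v * (cnj (snd k) * cis u))"
   if "cmod v = 1" for v
   unfolding Arg_less_iff_Im(1)[OF udisp_dir_pos[OF that] 3] im by linarith
  then have "?A
    = {v. cmod v = 1 \<and> - ?B < Re (v * (cnj (snd k) * cis u))}"
   by blast
  then show ?thesis unfolding e by (simp only: connected_arc_halfplane)
 qed
qed

subsection \<open>Orientation reversal\<close>

definition umir :: "ucov => ucov" where
 "umir k = (- fst k, cnj (snd k))"

lemma continuous_on_umir [continuous_intros]:
 "continuous_on S f ==> continuous_on S (%x. umir (f x))"
 unfolding umir_def by (intro continuous_intros)

lemma umir_umir [simp]: "umir (umir k) = k"
 by (simp add: umir_def)

lemma Arg_cnj_pos: "0 < Re w ==> Arg (cnj w) = - Arg w"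
 by (auto simp: Arg_cnj Arg_real)

lemma radius_cnj [simp]: "radius (cnj b) = radius b"
 by (rule radius_norm) simp

lemma uact_umir: "uact (umir k) x = - uact k (- x)"
by (smt (verit, best) Arg_cnj_pos cis_cnj complex_cnj_add complex_cnj_complex_of_real complex_cnj_mult prod.sel(1,2) radius_cnj uact_def uact_dir_pos umir_def)

lemma umat_umir: "umat (umir k) = (cnj (fst (umat k)), cnj (snd (umat k)))"
 by (simp add: umat_def umir_def cis_cnj)

lemma udisp_umir: "cmod v = 1 ==> udisp (umir k) (- cnj v) = - udisp k v"
 using Arg_cnj_pos[OF udisp_dir_pos[of v "snd k"]] by (simp add: udisp_def umir_def)

lemma connected_udisp_greater: "connected {v. cmod v = 1 \<and> s < udisp k v}"
proof -
 have "{v. cmod v = 1 \<and> s < udisp k v} = (%v. - cnj v) ` {v. cmod v = 1 \<and> udisp (umir k) v < - s}" (is "?A = ?f ` ?B")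
 proof (intro equalityI subsetI)
  fix v assume "v \<in> ?A"
  then show "v \<in> ?f ` ?B" using udisp_umir[of v k] by (intro image_eqI[of _ _ "- cnj v"]) auto
 next
  fix v assume "v \<in> ?f ` ?B"
  then show "v \<in> ?A" using udisp_umir[of v k] by auto
 qed
 then show ?thesis by (simp only:) (intro connected_continuous_image connected_udisp_less continuous_intros)
qed

lemma umir_mult: "umir (k &* l) = umir k &* umir l"
 by (rule ucov_eqI[of _ _ 0]) (simp_all add: umat_umir umat_mult cm_mult_def uact_umir uact_mult)

lemma umir_uz [simp]: "umir (uz n) = uz (- n)"
 by (simp add: umir_def uz_def urot_def)

lemma umir_one [simp]: "umir uone = uone"
 by (simp add: umir_def)

lemma umir_uinv: "umir (uinv k) = uinv (umir k)"
 by (metis umir_mult umir_one uinv_left umult_eq_iff(1) umult_one(1))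

lemma umir_ule [simp]: "umir k <~ umir l <-> l <~ k"
 unfolding ule_def uact_umir by (metis neg_le_iff_le minus_minus)

lemma ulo_umir [simp]: "ulo (umir k) = - uhi k" and uhi_umir [simp]: "uhi (umir k) = - ulo k"
 by (simp_all add: ulo_def uhi_def umir_def)

lemma umir_upar: "umir (upar v r) = upar (- cnj v) (- r)"
 by (simp add: umir_def upar_def cis_cnj arctan_minus)

subsection \<open>The quotient by the center\<close>

text \<open>The image in \<open>PSL(2, \<real>)\<close> of \<open>(t, b)\<close> is recorded as \<open>(cis (2 * t), b)\<close>.\<close>

type_synonym ppt = "complex \<times> complex"

definition ppts :: "ppt set" where
 "ppts = {p. cmod (fst p) = 1}"

definition pproj :: "ucov => ppt" where
 "pproj k = (cis (2 * fst k), snd k)"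

definition plift :: "ppt => ucov" where
 "plift p = (Arg (fst p) / 2, snd p)"

lemma pproj_in [simp]: "pproj k \<in> ppts"
 by (simp add: pproj_def ppts_def)

lemma pproj_plift [simp]: "p \<in> ppts ==> pproj (plift p) = p"
 using cis_Arg[of "fst p"] by (cases "fst p = 0") (auto simp: pproj_def plift_def ppts_def sgn_eq prod_eq_iff)

lemma continuous_on_pproj [continuous_intros]:
 "continuous_on S f ==> continuous_on S (%x. pproj (f x))"
 unfolding pproj_def by (intro continuous_intros)

lemma pproj_eq_iff: "pproj k = pproj l <-> (\<exists>n. k = uz n &* l)"
proof
 assume "pproj k = pproj l"
 then have c: "cis (2 * fst k) = cis (2 * fst l)" and s: "snd k = snd l" by (auto simp: pproj_def)
 from c have "cis (2 * fst k - 2 * fst l) = 1" by (simp add: cis_divide[symmetric])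
 then have "cos (2 * fst k - 2 * fst l) = 1" by (metis cis.sel(1) one_complex.sel(1))
 then obtain n :: int where "2 * fst k - 2 * fst l = of_int n * 2 * pi" using cos_one_2pi_int by blast
 then have "2 * fst k - 2 * fst l = 2 * (pi * of_int n)" by simp
 then have "fst k = fst l + pi * of_int n" by linarith
 then show "\<exists>n. k = uz n &* l" using s by (intro exI[of _ n]) (simp add: uz_mult_left prod_eq_iff)
next
 assume "\<exists>n. k = uz n &* l"
 then obtain n where "k = uz n &* l" by blast
 then show "pproj k = pproj l"
  by (simp add: pproj_def uz_mult_left distrib_left flip: cis_mult) (simp add: cis_2pi_int)
qed

lemma pproj_surj: assumes "p \<in> ppts" obtains k where "p = pproj k"
 using pproj_plift[OF assms] by metis

definition ucomm :: "ucov => ucov => ucov" where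
 "ucomm k l = k &* l &* uinv k &* uinv l"

lemma ucomm_uz [simp]: "ucomm (uz n &* k) l = ucomm k l" (is ?P) "ucomm k (uz n &* l) = ucomm k l" (is ?Q)
proof -
 have 1: "uz n &* x &* y &* (uinv x &* uz (- n)) = x &* y &* uinv x" for x y
  by (metis umult_assoc uz_central uz_add add.left_inverse uz_0 umult_one(2) uinv_cancel)
 show ?P
  unfolding ucomm_def uinv_mult uinv_uz by (simp only: 1)
 have "k &* (uz n &* l) &* uinv k &* (uinv l &* uz (- n)) = uz n &* (k &* l &* uinv k &* uinv l) &* uz (- n)"
  by (metis umult_assoc uz_central)
 also have "\<dots> = k &* l &* uinv k &* uinv l"
  by (metis umult_assoc uz_central uz_add add.right_inverse uz_0 umult_one(2))
 finally show ?Q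
  by (simp add: ucomm_def uinv_mult)
qed

definition pcomm :: "ppt => ppt => ucov" where
 "pcomm p q = ucomm (plift p) (plift q)"

lemma pcomm_pproj [simp]: "pcomm (pproj k) (pproj l) = ucomm k l"
by (metis pcomm_def ucomm_uz(2) pproj_in pproj_plift ucomm_uz(1) pproj_eq_iff)

text \<open>Near \<open>p\<close> the projection has the continuous section that replaces the principal argument
 by the branch close to \<open>Arg (fst p)\<close>.\<close>

lemma pproj_local_section:
 assumes p: "p \<in> ppts"
 obtains h where "\<And>q. q \<in> ppts ==> pproj (h q) = q" "h p = plift p" "continuous (at p) h"
proof
 define h where "h = (%q :: ppt. ((Arg (fst p) + Arg (fst q / fst p)) / 2, snd q))"
 have p1: "cmod (fst p) = 1" using p by (simp add: ppts_def)
 then have p0: "fst p ~= 0" by auto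
 show "pproj (h q) = q" if q: "q \<in> ppts" for q
 proof -
  have "cmod (fst q / fst p) = 1" using q p1 by (simp add: ppts_def norm_divide)
  then have "cis (Arg (fst q / fst p)) = fst q / fst p" "cis (Arg (fst p)) = fst p"
   using cis_Arg[of "fst q / fst p"] cis_Arg[of "fst p"] p0 p1 by (cases "fst q = 0"; auto simp: sgn_eq)+
  moreover have "2 * fst (h q) = Arg (fst p) + Arg (fst q / fst p)" by (simp add: h_def)
  ultimately have "cis (2 * fst (h q)) = fst q" using p0 by (simp only: cis_mult[symmetric]) simp
  then show ?thesis by (simp add: pproj_def prod_eq_iff) (simp add: h_def)
 qed
 show "h p = plift p" using p0 by (simp add: h_def plift_def)
 have "continuous (at p) (%q. Arg (fst q / fst p))"
  using p0 by (intro continuous_at_compose[of _ "%q. fst q / fst p" Arg, unfolded o_def] continuous_at_Arg continuous_intros) auto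
 then show "continuous (at p) h" unfolding h_def by (intro continuous_intros) auto
qed

lemma continuous_on_pcomm_aux: "continuous_on (ppts \<times> ppts) (%x. pcomm (fst x) (snd x))"
 unfolding continuous_on_eq_continuous_within
proof
 fix x assume "x \<in> ppts \<times> ppts"
 then obtain p q where x: "x = (p, q)" "p \<in> ppts" "q \<in> ppts" by auto
 obtain h where s: "\<And>q. q \<in> ppts ==> pproj (h q) = q" "continuous (at p) h"
  using pproj_local_section[OF x(2)] by metis
 obtain u where t: "\<And>q. q \<in> ppts ==> pproj (u q) = q" "continuous (at q) u"
  using pproj_local_section[OF x(3)] by metis
 have "continuous_on UNIV (%y. ucomm (fst y) (snd y))"
  unfolding ucomm_def by (intro continuous_intros)
 then have c: "continuous (at y) (%y. ucomm (fst y) (snd y))" for y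
  by (metis continuous_on_eq_continuous_at open_UNIV UNIV_I)
 let ?A = "%y. ucomm (h (fst y)) (u (snd y))"
 have "continuous (at (p, q)) (%y. (h (fst y), u (snd y)))"
  using s(2) t(2) by (intro continuous_Pair continuous_at_compose[of _ fst h, unfolded o_def]
   continuous_at_compose[of _ snd u, unfolded o_def] continuous_intros) auto
 then have "continuous (at x) ?A"
  unfolding x(1) using continuous_at_compose[OF _ c, of "(p, q)" "%y. (h (fst y), u (snd y))"] by (simp add: o_def)
 then have "continuous (at x within ppts \<times> ppts) ?A"
  by (rule continuous_at_imp_continuous_within)
 then show "continuous (at x within ppts \<times> ppts) (%x. pcomm (fst x) (snd x))"
 proof (rule continuous_transform_within[OF _ zero_less_one \<open>x \<in> ppts \<times> ppts\<close>])
  fix y assume "y \<in> ppts \<times> ppts"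
  then show "ucomm (h (fst y)) (u (snd y)) = pcomm (fst y) (snd y)" by (metis mem_Times_iff s t pcomm_pproj)
 qed
qed

lemma continuous_on_pcomm [continuous_intros]:
 assumes "continuous_on S f" "continuous_on S g" "\<And>x. x \<in> S ==> f x \<in> ppts" "\<And>x. x \<in> S ==> g x \<in> ppts"
 shows "continuous_on S (%x. pcomm (f x) (g x))"
 using continuous_on_compose2[OF continuous_on_pcomm_aux, of S "%x. (f x, g x)"] assms
 by (auto intro!: continuous_intros)

lemma ucomm_bounds: "- pi < uhi (ucomm k l)" "ulo (ucomm k l) < pi"
proof -
 have "\<not> uz 1 <~ ucomm k l" for k l
 proof
  assume "uz 1 <~ ucomm k l"
  then have 1: "uz 1 &* l <~ k &* l &* uinv k"
   unfolding ucomm_def by (metis ule_move(3) uinv_uinv umult_assoc)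
  define m where "m = \<lfloor>ulo l / pi\<rfloor>"
  have m: "pi * of_int m <= ulo l" "ulo l < pi * (of_int m + 1)"
   using floor_correct[of "ulo l / pi"] unfolding m_def
   by (simp_all only: pos_le_divide_eq pos_divide_less_eq pi_gt_zero mult.commute of_int_add of_int_1)
  have "uz 1 &* uz m <~ uz 1 &* l" using m by (simp add: ule_uz)
  then have "uz (1 + m) <~ l" by (metis uz_ule_conj 1 uz_add ule_trans)
  then show False using m unfolding ule_uz by (simp add: add.commute)
 qed
 then have 1: "ulo (ucomm k l) < pi" for k l unfolding ule_uz by (simp add: not_le)
 then show "ulo (ucomm k l) < pi" .
 have "ucomm k l = uinv (ucomm l k)" by (simp add: ucomm_def uinv_mult umult_assoc)
 then show "- pi < uhi (ucomm k l)" using 1[of l k] by (metis uhi_uinv neg_less_iff_less)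
qed

lemma pcomm_bounds:
 assumes "p \<in> ppts" "q \<in> ppts" shows "- pi < uhi (pcomm p q)" "ulo (pcomm p q) < pi"
 unfolding pcomm_def by (rule ucomm_bounds)+

section \<open>Splitting off a parabolic factor\<close>

definition upp :: "real => complex => ucov" where
 "upp s w = upar (sgn w) (s * cmod w)"

lemma continuous_on_upar [continuous_intros]:
 "continuous_on S f ==> continuous_on S g ==> continuous_on S (%x. upar (f x) (g x))"
 unfolding upar_def by (intro continuous_intros)

lemma continuous_on_upp [continuous_intros]:
 "continuous_on S f ==> (\<And>x. x \<in> S ==> f x ~= 0) ==> continuous_on S (%x. upp s (f x))"
 unfolding upp_def sgn_div_norm by (intro continuous_intros) auto

lemma cmod_sgn: "w ~= 0 ==> cmod (sgn w) = 1"
 by (simp add: norm_sgn)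

lemma sgn_polar:
 fixes v :: complex
 assumes "cmod v = 1" "0 < r" shows "sgn (of_real r * v) = v" "cmod (of_real r * v) = r"
 using assms by (simp_all add: sgn_mult sgn_of_real norm_mult) (simp add: sgn_eq)

lemma upp_polar: "cmod v = 1 ==> 0 < r ==> upp s (of_real r * v) = upar v (s * r)"
 by (simp add: upp_def sgn_polar)

lemma polar: "w ~= 0 ==> w = of_real (cmod w) * sgn w"
 by (simp add: sgn_eq)

lemma connected_polar_region:
 fixes K :: "complex set"
 assumes K: "open K" "0 \<notin> K"
  and F: "\<And>v. cmod v = 1 ==> connected {r. 0 < r \<and> of_real r * v \<in> K}"
  and B: "connected {v. cmod v = 1 \<and> (\<exists>r>0. of_real r * v \<in> K)}"
 shows "connected K"
proof -
 let ?B = "{v. cmod v = 1 \<and> (\<exists>r>0. of_real r * v \<in> K)}"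
 have nz: "w ~= 0" if "w \<in> K" for w using that K(2) by auto
 have im: "sgn ` K = ?B"
 proof (intro equalityI subsetI)
  fix v assume "v \<in> sgn ` K"
  then obtain w where w: "w \<in> K" "v = sgn w" by auto
  then have "of_real (cmod w) * v \<in> K" "0 < cmod w" using nz polar by (metis, auto)
  then show "v \<in> ?B" using w nz cmod_sgn by blast
 next
  fix v assume "v \<in> ?B"
  then show "v \<in> sgn ` K" using sgn_polar(1) by (auto simp: image_iff) metis
 qed
 have op: "openin (top_of_set ?B) (sgn ` C)" if "openin (top_of_set K) C" for C
 proof -
  have C: "open C" "C \<subseteq> K" using that K(1) openin_open_eq by blast+
  let ?A = "\<Union>r\<in>{0<..}. (%w. of_real r * w) -` C"
  have "sgn ` C = ?B \<inter> ?A"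
  proof (intro equalityI subsetI)
   fix v assume "v \<in> sgn ` C"
   then obtain w where w: "w \<in> C" "v = sgn w" by auto
   then have "of_real (cmod w) * v \<in> C" "0 < cmod w" using nz polar C by (metis subsetD, auto)
   moreover have "v \<in> ?B" using w C im by blast
   ultimately show "v \<in> ?B \<inter> ?A" by auto
  next
   fix v assume "v \<in> ?B \<inter> ?A"
   then obtain r where r: "cmod v = 1" "0 < r" "of_real r * v \<in> C" by auto
   then show "v \<in> sgn ` C" using sgn_polar(1)[OF r(1,2)] by (metis image_eqI)
  qed
  moreover have "open ?A"
   using C by (intro open_UN ballI open_vimage continuous_intros)
  ultimately show ?thesis by (simp only: openin_open_Int)
 qed
 have "connected (K \<inter> sgn -` ?B)"
 proof (rule connected_open_monotone_preimage[OF _ im op])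
  show "continuous_on K sgn" using nz by (intro continuous_intros) auto
  fix v assume "v \<in> ?B"
  then have z: "cmod v = 1" by simp
  have "K \<inter> sgn -` {v} = (%r. of_real r * v) ` {r. 0 < r \<and> of_real r * v \<in> K}"
  proof (intro equalityI subsetI)
   fix w assume "w \<in> K \<inter> sgn -` {v}"
   then have w: "w \<in> K" "sgn w = v" by auto
   have "w = of_real (cmod w) * v" using w nz polar by metis
   moreover have "0 < cmod w" using w nz by auto
   ultimately show "w \<in> (%r. of_real r * v) ` {r. 0 < r \<and> of_real r * v \<in> K}"
    using w(1) by (metis (mono_tags, lifting) image_eqI mem_Collect_eq)
  qed (auto simp: sgn_polar z)
  then show "connected (K \<inter> sgn -` {v})"
   using F[OF z] by (simp only:) (intro connected_continuous_image continuous_intros)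
 qed (use B in auto)
 then show ?thesis using im by (metis Int_absorb2 image_subset_iff_subset_vimage order_refl)
qed

locale parabolic_slice =
 fixes P Q :: "ucov => bool"
 assumes closed_P: "closed {k. P k}" and closed_Q: "closed {k. Q k}"
  and P_mono: "P k ==> l <~ k ==> P l" and Q_mono: "Q k ==> k <~ l ==> Q l"
begin

definition region :: "complex set" where
 "region = {w. w ~= 0 \<and> \<not> P (upp 1 w) \<and> \<not> Q (upp 1 w)}"

definition base :: "complex set" where
 "base = {v. cmod v = 1 \<and> (\<exists>r>0. \<not> P (upar v r) \<and> \<not> Q (upar v r))}"

lemma polar_region: "cmod v = 1 ==> 0 < r ==> of_real r * v \<in> region <-> \<not> P (upar v r) \<and> \<not> Q (upar v r)"
 by (auto simp: region_def upp_polar)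

lemma base_eq: "base = {v. cmod v = 1 \<and> (\<exists>r>0. of_real r * v \<in> region)}"
 by (auto simp: base_def polar_region)

lemma open_region: "open region"
proof -
 have "open (- {0} \<inter> (%w. upp 1 w) -` (- {k. P k} \<inter> - {k. Q k}))"
  using closed_P closed_Q by (intro continuous_open_preimage continuous_intros) auto
 moreover have "- {0} \<inter> (%w. upp 1 w) -` (- {k. P k} \<inter> - {k. Q k}) = region"
  by (auto simp: region_def)
 ultimately show ?thesis by simp
qed

lemma connected_region: assumes "connected base" shows "connected region"
proof (rule connected_polar_region)
 show "open region" by (rule open_region)
 show "0 \<notin> region" by (simp add: region_def)
 show "connected {v. cmod v = 1 \<and> (\<exists>r>0. of_real r * v \<in> region)}"
  using assms by (simp only: base_eq)
 fix v :: complex assume z: "cmod v = 1"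
 let ?A = "{r. 0 < r \<and> \<not> P (upar v r) \<and> \<not> Q (upar v r)}"
 let ?B = "{r. 0 < r \<and> of_real r * v \<in> region}"
 have "r <= s ==> upar v r <~ upar v s" for r s by (rule upar_mono[OF z])
 then have "is_interval ?A"
  unfolding is_interval_1 using P_mono Q_mono by (smt (verit, best) mem_Collect_eq)
 moreover have "?B = ?A"
  using polar_region[OF z] by blast
 ultimately show "connected ?B"
  using is_interval_connected by simp
qed

lemma region_empty_iff: "region = {} <-> base = {}"
proof
 assume "region = {}" then show "base = {}" unfolding base_eq by simp
next
 assume b: "base = {}"
 show "region = {}"
 proof (rule ccontr)
  assume "region ~= {}"
  then obtain w where w: "w \<in> region" by auto
  then have "w ~= 0" by (simp add: region_def)
  moreover from this have "of_real (cmod w) * sgn w \<in> region" using w polar by metis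
  ultimately show False using base_eq cmod_sgn b by simp
 qed
qed

lemma exists_not_Q_iff:
 assumes z: "cmod v = 1"
 shows "(\<exists>r>0. \<not> Q (upar v r)) <-> \<not> Q uone"
proof
 assume "\<exists>r>0. \<not> Q (upar v r)"
 then obtain r where r: "0 < r" "\<not> Q (upar v r)" by auto
 then have "uone <~ upar v r" using upar_mono[OF z, of 0 r] by simp
 then show "\<not> Q uone" using r Q_mono by blast
next
 assume q: "\<not> Q uone"
 show "\<exists>r>0. \<not> Q (upar v r)"
 proof (rule ccontr)
  assume n: "\<not> (\<exists>r>0. \<not> Q (upar v r))"
  let ?A = "%r. upar v r"
  have c: "closed (?A -` {k. Q k})"
   by (intro closed_vimage closed_Q) (intro continuous_intros)
  have "{0<..} \<subseteq> ?A -` {k. Q k}" using n by auto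
  then have "closure {0<..} \<subseteq> ?A -` {k. Q k}" using c by (rule closure_minimal)
  then show False using q by (auto simp: closure_greaterThan)
 qed
qed

lemma base_iff:
 assumes z: "cmod v = 1" and D: "\<And>r. 0 < r ==> \<not> (P (upar v r) \<and> Q (upar v r))"
 shows "v \<in> base <-> (\<exists>r>0. \<not> P (upar v r)) \<and> \<not> Q uone"
proof
 assume "v \<in> base" then show "(\<exists>r>0. \<not> P (upar v r)) \<and> \<not> Q uone"
  unfolding exists_not_Q_iff[OF z, symmetric] by (auto simp: base_def)
next
 assume a: "(\<exists>r>0. \<not> P (upar v r)) \<and> \<not> Q uone"
 then obtain r s where rs: "0 < r" "\<not> P (upar v r)" "0 < s" "\<not> Q (upar v s)"
  using exists_not_Q_iff[OF z] by auto
 let ?P = "(%r. upar v r) -` {k. P k}" and ?Q = "(%r. upar v r) -` {k. Q k}"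
 have c: "closed ?P" "closed ?Q"
  by (intro closed_vimage closed_P closed_Q continuous_intros)+
 have "\<not> {0<..} \<subseteq> ?P \<union> ?Q"
 proof
  assume "{0<..} \<subseteq> ?P \<union> ?Q"
  moreover have "?P \<inter> ?Q \<inter> {0<..} = {}" using D by auto
  ultimately have "?P \<inter> {0<..} = {} \<or> ?Q \<inter> {0<..} = {}"
   using connected_Ioi[of "0::real"] c unfolding connected_closed by blast
  then show False
  proof
   assume "?P \<inter> {0<..} = {}" then have "\<not> P (upar v s)" using rs by auto
   with rs \<open>{0<..} \<subseteq> ?P \<union> ?Q\<close> show False by auto
  next
   assume "?Q \<inter> {0<..} = {}" then have "\<not> Q (upar v r)" using rs by auto
   with rs \<open>{0<..} \<subseteq> ?P \<union> ?Q\<close> show False by auto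
  qed
 qed
 then show "v \<in> base" using z by (auto simp: base_def)
qed

end

lemma eventually_uact_less:
 assumes "uact k x < c" shows "eventually (%y. uact k y < c) (at_right x)"
proof -
 have "isCont (uact k) x"
  using continuous_on_uact[of UNIV "%_. k" "%x. x"]
  by (simp add: continuous_on_eq_continuous_at)
 then have "(uact k ---> uact k x) (at_right x)"
  using tendsto_within_subset[of "uact k" _ x UNIV "{x<..}"] by (simp add: isCont_def)
 then show ?thesis using assms by (rule order_tendstoD(2))
qed

lemma exists_upar_not_le:
 assumes z: "cmod v = 1"
 shows "(\<exists>r>0. \<not> upar v r <~ L) <-> udisp L v < pi"
proof -
 obtain h where h: "cis (2 * h) = \<i> * v" using axis_exists[OF z] .
 have d: "uact L h = h + udisp L v" by (rule uact_axis[OF h])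
 show ?thesis
 proof
  assume "\<exists>r>0. \<not> upar v r <~ L"
  then obtain r x where r: "0 < r" "uact L x < uact (upar v r) x" by (auto simp: ule_def not_le)
  show "udisp L v < pi"
  proof (rule ccontr)
   assume "\<not> udisp L v < pi"
   then have l: "h + pi <= uact L h" using d by simp
   define n where "n = \<lfloor>(x - h) / pi\<rfloor>"
   define y where "y = x - pi * of_int n"
   have "of_int n <= (x - h) / pi" "(x - h) / pi < of_int n + 1" by (simp_all add: n_def)
   then have y: "h <= y" "y < h + pi" by (simp_all add: y_def field_simps)
   have x: "x = y + pi * of_int n" by (simp add: y_def)
   have "uact (upar v r) y < uact (upar v r) (h + pi * of_int 1)" using y by simp
   then have "uact (upar v r) y < h + pi" unfolding uact_plus_pi by (simp add: upar_fix[OF z h])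
   also have "\<dots> <= uact L y" using l y uact_le_iff[of L h y] by linarith
   finally show False using r(2) unfolding x uact_plus_pi by simp
  qed
 next
  assume "udisp L v < pi"
  then have l: "uact L h < h + pi" using d by simp
  then have "eventually (%x. uact L x < h + pi) (at_right h)" by (rule eventually_uact_less)
  moreover have "eventually (%x. x < h + pi) (at_right h)"
   by (rule order_tendstoD(2)[OF tendsto_ident_at]) simp
  moreover have "eventually (%x. h < x) (at_right h)" by (simp add: eventually_at_filter)
  ultimately have "eventually (%x. uact L x < h + pi \<and> x < h + pi \<and> h < x) (at_right h)"
   by eventually_elim simp
  then obtain x where x: "uact L x < h + pi" "x < h + pi" "h < x"
   by (metis (mono_tags, lifting) eventually_happens' trivial_limit_at_right_real)
  define y where "y = (max x (uact L x) + h + pi) / 2"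
  have y: "x < y" "uact L x < y" "y < h + pi" using x by (auto simp: y_def max_def)
  obtain r where r: "0 < r" "uact (upar v r) x = y"
   using upar_reach[OF z h x(3) y(1,3)] .
  then show "\<exists>r>0. \<not> upar v r <~ L" using y by (auto simp: ule_def not_le)
 qed
qed

lemma exists_upar_mult_pos:
 assumes z: "cmod v = 1"
 shows "(\<exists>r>0. 0 < ulo (k &* upar v r)) <-> 0 < udisp k v"
proof -
 obtain h where h: "cis (2 * h) = \<i> * v" using axis_exists[OF z] .
 have d: "uact k h = h + udisp k v" by (rule uact_axis[OF h])
 show ?thesis
 proof
  assume "\<exists>r>0. 0 < ulo (k &* upar v r)"
  then obtain r where "0 < ulo (k &* upar v r)" by auto
  then have "h < uact (k &* upar v r) h" using uact_lo_hi(1)[where k = "k &* upar v r" and x = h] by linarith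
  then show "0 < udisp k v" using d by (simp add: uact_mult upar_fix[OF z h])
 next
  assume "0 < udisp k v"
  then have "uact (uinv k) h < uact (uinv k) (uact k h)" unfolding uact_less_iff using d by linarith
  then have l: "uact (uinv k) h < h" by simp
  then have "eventually (%x. uact (uinv k) x < h) (at_right h)" by (rule eventually_uact_less)
  moreover have "eventually (%x. x < h + pi) (at_right h)"
   by (rule order_tendstoD(2)[OF tendsto_ident_at]) simp
  moreover have "eventually (%x. h < x) (at_right h)" by (simp add: eventually_at_filter)
  ultimately have "eventually (%x. uact (uinv k) x < h \<and> x < h + pi \<and> h < x) (at_right h)"
   by eventually_elim simp
  then obtain x1 where x1: "uact (uinv k) x1 < h" "x1 < h + pi" "h < x1"
   by (metis (mono_tags, lifting) eventually_happens' trivial_limit_at_right_real)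
  have l1: "uact (uinv k) (h + pi) < h + pi" using l uact_plus_pi[of "uinv k" h 1] by simp
  define y where "y = (max x1 (uact (uinv k) (h + pi)) + h + pi) / 2"
  have y: "x1 < y" "uact (uinv k) (h + pi) < y" "y < h + pi" using x1 l1 by (auto simp: y_def max_def)
  obtain r where r: "0 < r" "uact (upar v r) x1 = y"
   using upar_reach[OF z h x1(3) y(1,3)] .
  have key: "uact (uinv k) x < uact (upar v r) x" if x: "h <= x" "x < h + pi" for x
  by (smt (verit, ccfv_SIG) r(1,2) uact_le_iff uact_lo_hi(1) ulo_upar x(1,2) x1(1) y(2) z)
  have "x + 0 < uact (k &* upar v r) x" for x
  proof -
   define n where "n = \<lfloor>(x - h) / pi\<rfloor>"
   define u where "u = x - pi * of_int n"
   have "of_int n <= (x - h) / pi" "(x - h) / pi < of_int n + 1" by (simp_all add: n_def)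
   then have u: "h <= u" "u < h + pi" by (simp_all add: u_def field_simps)
   have x: "x = u + pi * of_int n" by (simp add: u_def)
   have "uact k (uact (uinv k) u) < uact k (uact (upar v r) u)" using key[OF u] by (simp only: uact_less_iff)
   then show ?thesis unfolding x uact_plus_pi by (simp add: uact_mult)
  qed
  then show "\<exists>r>0. 0 < ulo (k &* upar v r)" using less_ulo_iff r by auto
 qed
qed

lemma exists_udisp_iff: "(\<exists>v. cmod v = 1 \<and> P (udisp k v)) <-> (\<exists>x. P (uact k x - x))"
proof
 assume "\<exists>v. cmod v = 1 \<and> P (udisp k v)"
 then obtain v where z: "cmod v = 1" "P (udisp k v)" by auto
 obtain h where "cis (2 * h) = \<i> * v" using axis_exists[OF z(1)] .
 then show "\<exists>x. P (uact k x - x)" using z(2) uact_axis[of h v k] by (intro exI[of _ h]) simp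
next
 assume "\<exists>x. P (uact k x - x)"
 then obtain x where x: "P (uact k x - x)" by auto
 have "cis (2 * x) = \<i> * (- \<i> * cis (2 * x))" by simp
 from uact_axis[OF this, of k] show "\<exists>v. cmod v = 1 \<and> P (udisp k v)"
  using x by (intro exI[of _ "- \<i> * cis (2 * x)"]) (simp add: norm_mult)
qed

lemma exists_udisp_less_iff: "(\<exists>v. cmod v = 1 \<and> udisp k v < pi * of_int n) <-> \<not> uz n <~ k"
 and exists_udisp_greater_iff: "(\<exists>v. cmod v = 1 \<and> 0 < udisp k v) <-> \<not> k <~ uone"
 unfolding exists_udisp_iff[of "%u. u < pi * of_int n"] exists_udisp_iff[of "%u. 0 < u"] by (auto simp: ule_def not_le algebra_simps)

text \<open>\<open>uband a b\<close> is the union of the conjugacy classes between \<open>uz a\<close> and \<open>uz b\<close>, including the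
 hyperbolic classes on both levels \<open>a\<close> and \<open>b\<close>.\<close>

definition uband :: "int => int => ucov set" where
 "uband a b = {k. \<not> k <~ uz a \<and> \<not> uz b <~ k}"

definition upos :: "int => ucov set" where
 "upos n = {k. 0 < ulo k \<and> \<not> uz n <~ k}"

definition uneg :: "int => ucov set" where
 "uneg n = {k. uhi k < 0 \<and> \<not> k <~ uz (- n)}"

lemma open_uband: "open (uband a b)"
proof -
 have "uband a b = - {k. k <~ uz a} \<inter> - {k. uz b <~ k}" by (auto simp: uband_def)
 then show ?thesis using closed_ule by (simp only:) (intro open_Int open_Compl; simp)
qed

lemma umir_uband: "umir k \<in> uband a b <-> k \<in> uband (- b) (- a)"
by (smt (verit, ccfv_SIG) mem_Collect_eq uband_def umir_ule umir_uz)

lemma umir_upos: "umir k \<in> upos n <-> k \<in> uneg n"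
proof -
 have "uz n <~ umir k <-> k <~ uz (- n)"
  using umir_ule[of "uz (- n)" k] by simp
 then show ?thesis by (auto simp: upos_def uneg_def)
qed

lemma uz_in_uband: "uz n \<in> uband a b <-> a < n \<and> n < b"
 by (auto simp: uband_def)

lemma uz_in_upos: "uz n \<in> upos m <-> 0 < n \<and> n < m"
 by (auto simp: upos_def) (auto simp: ulo_def uz_def urot_def zero_less_mult_iff)

lemma uz_in_uneg: "uz n \<in> uneg m <-> - m < n \<and> n < 0"
 using umir_upos[of "uz n" m] by (auto simp: uz_in_upos)

definition usplit :: "ucov => real => ucov set => complex set" where
 "usplit T s I = {w. w ~= 0 \<and> T &* uinv (upp s w) \<in> I}"

lemma umir_upp: "w ~= 0 ==> umir (upp s w) = upp (- s) (- cnj w)"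
 by (simp add: upp_def umir_upar) (simp add: sgn_eq)

lemma usplit_mirror:
 assumes "\<And>k. umir k \<in> J <-> k \<in> I"
 shows "usplit T s I = (%w. - cnj w) ` usplit (umir T) (- s) J"
proof -
 have *: "w \<in> usplit T s I <-> - cnj w \<in> usplit (umir T) (- s) J" for w
  using assms[of "T &* uinv (upp s w)"] by (auto simp: usplit_def umir_mult umir_uinv umir_upp)
 show ?thesis
 proof (intro equalityI subsetI)
  fix w assume "w \<in> usplit T s I"
  then have "- cnj w \<in> usplit (umir T) (- s) J" using * by blast
  then show "w \<in> (%w. - cnj w) ` usplit (umir T) (- s) J" by (rule rev_image_eqI) simp
 next
  fix w assume "w \<in> (%w. - cnj w) ` usplit (umir T) (- s) J"
  then obtain v where "w = - cnj v" "v \<in> usplit (umir T) (- s) J" by blast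
  then show "w \<in> usplit T s I" using *[of w] by simp
 qed
qed

lemma connected_usplit_mirror:
 assumes "\<And>k. umir k \<in> J <-> k \<in> I" "connected (usplit (umir T) (- s) J)"
 shows "connected (usplit T s I)"
 unfolding usplit_mirror[OF assms(1)] by (intro connected_continuous_image assms(2) continuous_intros)

lemma usplit_mirror_empty:
 assumes "\<And>k. umir k \<in> J <-> k \<in> I"
 shows "usplit T s I = {} <-> usplit (umir T) (- s) J = {}"
 unfolding usplit_mirror[OF assms(1)] by simp

lemma open_usplit:
 assumes "open I" shows "open (usplit T s I)"
proof -
 have "open (- {0} \<inter> (%w. T &* uinv (upp s w)) -` I)"
  using assms by (intro continuous_open_preimage continuous_intros) auto
 moreover have "- {0} \<inter> (%w. T &* uinv (upp s w)) -` I = usplit T s I"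
  by (auto simp: usplit_def)
 ultimately show ?thesis by simp
qed

lemma uband_split_pos:
 assumes "a <= b"
 shows "connected (usplit T 1 (uband a b))" (is ?Q) "usplit T 1 (uband a b) ~= {} <-> T \<in> uband a (b + 1)" (is ?P)
proof -
 define L where "L = uz (- b) &* T"
 define U where "U = uz (- a) &* T"
 interpret parabolic_slice "%k. k <~ L" "%k. U <~ k"
  by unfold_locales (auto simp: closed_ule intro: ule_trans)
 have "T &* uinv c <~ uz a <-> U <~ c" "uz b <~ T &* uinv c <-> c <~ L" for c
  unfolding U_def L_def
  using ule_move(3)[of T "uinv c" "uz a"] ule_move(2)[of T "uz a" c]
   ule_move(1)[of "uz b" T "uinv c"] ule_move(4)[of "uz b" c T] by simp_all
 then have K: "usplit T 1 (uband a b) = region"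
  by (auto simp: usplit_def uband_def region_def)
 have U1: "U <~ uone <-> T <~ uz a"
  unfolding U_def using ule_move(4)[of "uz (- a)" T uone] by simp
 have L1: "uz 1 <~ L <-> uz (b + 1) <~ T"
  unfolding L_def using ule_move(2)[of "uz 1" "uz (- b)" T] by (simp add: uz_add)
 have nP: "(\<exists>r>0. \<not> upar v r <~ L) <-> udisp L v < pi * of_int 1" if "cmod v = 1" for v
  using exists_upar_not_le[OF that] by simp
 have UL: "U <~ L <-> b <= a" unfolding U_def L_def by simp
 have "connected base \<and> (base ~= {} <-> T \<in> uband a (b + 1))"
 proof (cases "T <~ uz a")
  case True
  then have "uband a (b + 1) \<inter> {T} = {}" by (simp add: uband_def)
  moreover have "base = {}"
  using True U1 base_def exists_not_Q_iff by auto
  ultimately show ?thesis using True by (auto simp: uband_def)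
 next
  case False
  then have QU: "\<not> U <~ uone" using U1 by simp
  have ne: "T \<in> uband a (b + 1) <-> \<not> uz 1 <~ L" using False L1 by (simp add: uband_def)
  show ?thesis
  proof (cases "\<exists>v r. cmod v = 1 \<and> 0 < r \<and> upar v r <~ L \<and> U <~ upar v r")
   case False
   then have "v \<in> base <-> udisp L v < pi * of_int 1" if "cmod v = 1" for v
    using base_iff[OF that] nP[OF that] QU that by blast
   then have "base = {v. cmod v = 1 \<and> udisp L v < pi * of_int 1}" by (auto simp: base_def)
   then show ?thesis
    using connected_udisp_less[of L "pi * of_int 1"] exists_udisp_less_iff[of L 1] ne by auto
  next
   case True
   then obtain v0 r0 where z0: "cmod v0 = 1" "0 < r0" "upar v0 r0 <~ L" "U <~ upar v0 r0" by blast
   then have "U <~ L" by (metis ule_trans)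
   then have "U = L" using assms by (simp add: U_def L_def)
   then have L0: "L = upar v0 r0" using z0 ule_antisym by blast
   have "uhi L < pi * of_int 1"
    unfolding L0 uhi_upar[OF z0(1)] using z0(2) arctan_ubound[of r0] by simp
   then have n1: "\<not> uz 1 <~ L" using ulo_le_uhi(1)[of L] unfolding ule_uz by linarith
   have d: "udisp L v < pi * of_int 1" if z: "cmod v = 1" for v
   proof -
    obtain h where h: "cis (2 * h) = \<i> * v" using axis_exists[OF z] .
    show ?thesis using uact_axis[OF h, of L] uact_lo_hi(2)[where k = L and x = h] \<open>uhi L < pi * of_int 1\<close> by linarith
   qed
   have mem: "v \<in> base <-> v ~= v0" if z: "cmod v = 1" for v
   proof (cases "v = v0")
    case True
    have "upar v0 r <~ L \<or> L <~ upar v0 r" for r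
     unfolding L0 using upar_mono[OF z0(1)] by (metis linear)
    then have "upar v r <~ L \<or> U <~ upar v r" for r using True \<open>U = L\<close> by simp
    then show ?thesis using True unfolding base_def by blast
   next
    case False
    have "\<not> (upar v r <~ L \<and> U <~ upar v r)" if "0 < r" for r
    proof
     assume "upar v r <~ L \<and> U <~ upar v r"
     then have "upar v r = upar v0 r0" using \<open>U = L\<close> ule_antisym L0 by metis
     then have "umat (upar v r) = umat (upar v0 r0)" by simp
     then show False using that z0 False unfolding umat_upar[OF z] umat_upar[OF z0(1)] by auto
    qed
    then show ?thesis using base_iff[OF z] nP[OF z] QU d[OF z] False by blast
   qed
   have zz: "v0 * cnj v0 = 1" using z0(1) complex_norm_square[of v0] by simp
   have "base = {v. cmod v = 1 \<and> -1 < Re (v * (- cnj v0))}"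
   proof -
    have "v ~= v0 <-> -1 < Re (v * (- cnj v0))" if z: "cmod v = 1" for v
    proof -
     let ?A = "cmod (v - v0)"
     let ?B = "v * cnj v0"
     have "?A\<^sup>2 = (cmod v)\<^sup>2 + (cmod v0)\<^sup>2 - 2 * Re ?B"
      unfolding cmod_power2 by (simp add: power2_eq_square algebra_simps)
     then have "?A\<^sup>2 = 2 - 2 * Re ?B" using z z0(1) by simp
     moreover have "v ~= v0 <-> 0 < ?A\<^sup>2" by simp
     moreover have "Re (v * (- cnj v0)) = - Re ?B" by simp
     ultimately show ?thesis by linarith
    qed
    then show ?thesis using mem by (auto simp: base_def)
   qed
   moreover have "- v0 \<in> base" using mem[of "- v0"] z0(1) by (auto simp: equal_neg_zero)
   moreover have "T \<in> uband a (b + 1)" using ne n1 by blast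
   ultimately show ?thesis using connected_arc_halfplane[of "-1" "- cnj v0"] by (metis empty_iff)
  qed
 qed
 then show ?Q ?P
  unfolding K using connected_region region_empty_iff by auto
qed

lemma uband_split_neg:
 assumes "a <= b"
 shows "connected (usplit T (-1) (uband a b))" (is ?Q) "usplit T (-1) (uband a b) ~= {} <-> T \<in> uband (a - 1) b" (is ?P)
proof -
 have m: "umir k \<in> uband (- b) (- a) <-> k \<in> uband a b" for k by (simp add: umir_uband)
 have 1: "- b <= - a" using assms by simp
 show ?Q
  using connected_usplit_mirror[OF m, of T "-1"] uband_split_pos(1)[OF 1] by simp
 show ?P
  using usplit_mirror_empty[OF m, of T "-1"] uband_split_pos(2)[OF 1, of "umir T"] by (simp add: umir_uband)
qed

lemma closed_ulo_mult:
 "closed {k. ulo (T &* uinv k) <= 0}" "closed {k. ulo (T &* k) <= 0}"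
 by (intro closed_Collect_le continuous_intros)+

lemma not_ulo_pos_mono: "k <~ l ==> ulo l <= 0 ==> ulo k <= 0"
 using less_ulo_iff[of 0 k] less_ulo_iff[of 0 l] unfolding ule_def by (metis less_le_trans not_le)

lemma not_ulo_pos_mult:
 "k <~ l ==> ulo (T &* l) <= 0 ==> ulo (T &* k) <= 0"
 "k <~ l ==> ulo (T &* uinv k) <= 0 ==> ulo (T &* uinv l) <= 0"
 by (erule not_ulo_pos_mono[rotated], simp)+

lemma ulo_uz_le: "1 <= n ==> uz n <~ k ==> 0 < ulo k"
 unfolding ule_uz by (smt (verit, best) mult_pos_pos of_int_pos pi_gt_zero)

lemma upos_split_pos:
 assumes "1 <= n"
 shows "connected (usplit T 1 (upos n))" (is ?Q) "usplit T 1 (upos n) ~= {} <-> T \<in> upos (n + 1)" (is ?P)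
proof -
 define L where "L = uz (- n) &* T"
 interpret parabolic_slice "%k. k <~ L" "%k. ulo (T &* uinv k) <= 0"
  by unfold_locales (auto simp: closed_ule closed_ulo_mult intro: ule_trans not_ulo_pos_mult)
 have eq: "uz n <~ T &* uinv c <-> c <~ L" for c
  unfolding L_def using ule_move(1)[of "uz n" T "uinv c"] ule_move(4)[of "uz n" c T] by simp
 have K: "usplit T 1 (upos n) = region"
  by (auto simp: usplit_def upos_def region_def eq)
 have L1: "uz 1 <~ L <-> uz (n + 1) <~ T"
  unfolding L_def using ule_move(2)[of "uz 1" "uz (- n)" T] by (simp add: uz_add)
 have "\<not> (upar v r <~ L \<and> ulo (T &* uinv (upar v r)) <= 0)" for v r
  using eq[of "upar v r"] ulo_uz_le[OF assms, of "T &* uinv (upar v r)"] by auto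
 then have "v \<in> base <-> udisp L v < pi * of_int 1 \<and> 0 < ulo T" if "cmod v = 1" for v
  using base_iff[OF that] exists_upar_not_le[OF that, of L] by (simp add: not_le)
 then have "base = (if 0 < ulo T then {v. cmod v = 1 \<and> udisp L v < pi * of_int 1} else {})"
  by (auto simp: base_def)
 then have "connected base \<and> (base ~= {} <-> T \<in> upos (n + 1))"
  using connected_udisp_less[of L "pi * of_int 1"] exists_udisp_less_iff[of L 1] L1 by (auto simp: upos_def)
 then show ?Q ?P
  unfolding K using connected_region region_empty_iff by auto
qed

lemma uinv_upp: "w ~= 0 ==> uinv (upp s w) = upp (- s) w"
 by (simp add: upp_def uinv_upar cmod_sgn)

lemma upos_split_neg:
 assumes "1 <= n"
 shows "connected (usplit T (-1) (upos n))" (is ?Q) "usplit T (-1) (upos n) ~= {} <-> T \<in> uband 0 n" (is ?P)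
proof -
 define U where "U = uinv T &* uz n"
 interpret parabolic_slice "%k. ulo (T &* k) <= 0" "%k. U <~ k"
  by unfold_locales (auto simp: closed_ule closed_ulo_mult intro: ule_trans not_ulo_pos_mult)
 have eq: "uz n <~ T &* c <-> U <~ c" for c
  unfolding U_def by (simp add: ule_move(2))
 have K: "usplit T (-1) (upos n) = region"
  by (auto simp: usplit_def upos_def region_def eq uinv_upp)
 have U1: "U <~ uone <-> uz n <~ T"
  using eq[of uone] by simp
 have "\<not> (ulo (T &* upar v r) <= 0 \<and> U <~ upar v r)" for v r
  using eq[of "upar v r"] ulo_uz_le[OF assms, of "T &* upar v r"] by auto
 then have "v \<in> base <-> 0 < udisp T v \<and> \<not> uz n <~ T" if "cmod v = 1" for v
  using base_iff[OF that] exists_upar_mult_pos[OF that, of T] U1 by (simp add: not_le)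
 then have "base = (if uz n <~ T then {} else {v. cmod v = 1 \<and> 0 < udisp T v})"
  by (auto simp: base_def)
 then have "connected base \<and> (base ~= {} <-> T \<in> uband 0 n)"
  using connected_udisp_greater[of 0 T] exists_udisp_greater_iff[of T] by (auto simp: uband_def)
 then show ?Q ?P
  unfolding K using connected_region region_empty_iff by auto
qed

lemma uneg_split_neg:
 assumes "1 <= n"
 shows "connected (usplit T (-1) (uneg n))" "usplit T (-1) (uneg n) ~= {} <-> T \<in> uneg (n + 1)"
 using connected_usplit_mirror[OF umir_upos, of T "-1"] usplit_mirror_empty[OF umir_upos, of T "-1"]
  upos_split_pos[OF assms, of "umir T"] by (simp_all add: umir_upos)

lemma uneg_split_pos:
 assumes "1 <= n"
 shows "connected (usplit T 1 (uneg n))" "usplit T 1 (uneg n) ~= {} <-> T \<in> uband (- n) 0"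
 using connected_usplit_mirror[OF umir_upos, of T 1] usplit_mirror_empty[OF umir_upos, of T 1]
  upos_split_neg[OF assms, of "umir T"] by (simp_all add: umir_uband)

section \<open>Splitting off a commutator\<close>

lemma ule_shift: "(h, b) <~ (h', b) <-> h <= h'"
 by (simp add: ule_def uact_def)

locale strip =
 fixes P Q :: "ucov => bool"
 assumes closed_P: "closed {k. P k}" and closed_Q: "closed {k. Q k}"
  and P_mono: "P k ==> l <~ k ==> P l" and Q_mono: "Q k ==> k <~ l ==> Q l"
begin

definition region :: "ucov set" where
 "region = {k. \<not> P k \<and> \<not> Q k}"

lemma open_region: "open region"
proof -
 have "region = - {k. P k} \<inter> - {k. Q k}" by (auto simp: region_def)
 then show ?thesis using closed_P closed_Q by (simp only:) (intro open_Int open_Compl)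
qed

lemma connected_region:
 assumes "connected (snd ` region)" shows "connected region"
proof -
 have o: "open (snd ` C)" if "open C" for C :: "ucov set" using that by (rule open_image_snd)
 have "connected (region \<inter> snd -` (snd ` region))"
 proof (rule connected_open_monotone_preimage[OF _ HOL.refl])
  show "continuous_on region snd" by (intro continuous_intros)
  show "openin (top_of_set (snd ` region)) (snd ` C)" if "openin (top_of_set region) C" for C
   using that o open_region by (auto simp: openin_open_eq)
  fix b assume "b \<in> snd ` region"
  have "is_interval {h. (h, b) \<in> region}"
   unfolding is_interval_1 region_def
   by clarify (metis P_mono Q_mono ule_shift)
  moreover have "region \<inter> snd -` {b} = (%h. (h, b)) ` {h. (h, b) \<in> region}" by auto
  ultimately show "connected (region \<inter> snd -` {b})"
   by (simp only:) (intro connected_continuous_image continuous_intros is_interval_connected)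
 qed (use assms in auto)
 moreover have "region \<inter> snd -` (snd ` region) = region" by auto
 ultimately show ?thesis by simp
qed

lemma region_fiber:
 assumes D: "\<And>h. \<not> (P (h, b) \<and> Q (h, b))" and "\<not> P (r, b)" "\<not> Q (s, b)"
 shows "b \<in> snd ` region"
proof -
 let ?P = "(%h. (h, b)) -` {k. P k}" and ?Q = "(%h. (h, b)) -` {k. Q k}"
 have c: "closed ?P" "closed ?Q"
  by (intro closed_vimage closed_P closed_Q continuous_intros)+
 have "\<not> UNIV \<subseteq> ?P \<union> ?Q"
 proof
  assume u: "UNIV \<subseteq> ?P \<union> ?Q"
  moreover have "?P \<inter> ?Q \<inter> UNIV = {}" using D by auto
  ultimately have "?P \<inter> UNIV = {} \<or> ?Q \<inter> UNIV = {}"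
   using connected_closedD[OF connected_UNIV _ _ c] by simp
  then show False using u assms(2,3) by auto
 qed
 then obtain h where "(h, b) \<in> region" by (auto simp: region_def)
 then show ?thesis by force
qed

end

definition ubands :: "ucov => int => int => ucov set" where
 "ubands T a b = {k. k \<in> uband (-1) 1 \<and> T &* uinv k \<in> uband a b}"

lemma ubands_iff:
 "k \<in> ubands T a b <-> \<not> (k <~ uz (-1) \<or> k <~ uz (- b) &* T) \<and> \<not> (uz 1 <~ k \<or> uz (- a) &* T <~ k)"
 using ule_move(3)[of T "uinv k" "uz a"] ule_move(2)[of T "uz a" k]
   ule_move(1)[of "uz b" T "uinv k"] ule_move(4)[of "uz b" k T]
 by (auto simp: ubands_def uband_def)

lemma open_ubands: "open (ubands T a b)"
proof -
 have "open (uband (-1) 1 \<inter> (%k. T &* uinv k) -` uband a b)"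
  by (intro open_Int open_uband open_vimage continuous_intros)
 moreover have "uband (-1) 1 \<inter> (%k. T &* uinv k) -` uband a b = ubands T a b"
  by (auto simp: ubands_def)
 ultimately show ?thesis by simp
qed

lemma ubands_mirror: "ubands T a b = umir ` ubands (umir T) (- b) (- a)"
proof -
 have *: "k \<in> ubands T a b <-> umir k \<in> ubands (umir T) (- b) (- a)" for k
  unfolding ubands_def mem_Collect_eq umir_uinv[symmetric] umir_mult[symmetric] umir_uband by simp
 show ?thesis
 proof (intro equalityI subsetI)
  fix k assume "k \<in> ubands T a b"
  then show "k \<in> umir ` ubands (umir T) (- b) (- a)"
   by (intro image_eqI[of _ _ "umir k"]) (simp_all only: * umir_umir)
 next
  fix k assume "k \<in> umir ` ubands (umir T) (- b) (- a)"
  then show "k \<in> ubands T a b" using * by (metis imageE umir_umir)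
 qed
qed

lemma parabolic_of_snd:
 assumes "b ~= 0"
 shows "(arctan (cmod b), b) = upp 1 (b * cis (arctan (cmod b)))"
 by (simp add: upp_def upar_def norm_mult sgn_mult assms)
   (simp add: sgn_eq assms cis_mult mult.assoc)

lemma connected_not_le_region:
 assumes L: "uone <~ L"
 shows "connected {k. \<not> k <~ L \<and> \<not> uone <~ k}" (is ?Q)
  "{k. \<not> k <~ L \<and> \<not> uone <~ k} ~= {} <-> \<not> uz 1 <~ L" (is ?P)
proof -
 interpret strip "%k. k <~ L" "%k. uone <~ k"
  by unfold_locales (auto simp: closed_ule intro: ule_trans)
 have r: "region = {k. \<not> k <~ L \<and> \<not> uone <~ k}" by (simp add: region_def)
 let ?p = "%b. (arctan (cmod b), b)"
 have lo: "ulo (?p b) = 0" for b by (simp add: ulo_def)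
 let ?A = "{b. \<not> ?p b <~ L}"
 have b: "snd ` region = ?A"
 proof (intro equalityI subsetI)
  fix b assume "b \<in> snd ` region"
  then obtain h where t: "\<not> (h, b) <~ L" "\<not> uone <~ (h, b)" by (auto simp: region_def)
  then have "(h, b) <~ ?p b" using ule_one by (simp add: ulo_def ule_shift)
  then show "b \<in> ?A" using t ule_trans by blast
 next
  fix b assume "b \<in> ?A"
  then have "arctan (cmod b) \<in> (%h. (h, b)) -` (- {k. k <~ L})" by simp
  moreover have "open ((%h. (h, b)) -` (- {k. k <~ L}))"
   by (intro open_vimage open_Compl closed_ule continuous_intros)
  ultimately obtain e where e: "0 < e" "ball (arctan (cmod b)) e \<subseteq> (%h. (h, b)) -` (- {k. k <~ L})"
   by (meson openE)
  moreover have "arctan (cmod b) - e / 2 \<in> ball (arctan (cmod b)) e" using e(1) by (simp add: dist_real_def)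
  ultimately have "arctan (cmod b) - e / 2 \<in> (%h. (h, b)) -` (- {k. k <~ L})" by blast
  moreover have "\<not> uone <~ (arctan (cmod b) - e / 2, b)"
   using e(1) by (simp add: ule_one ulo_def)
  ultimately show "b \<in> snd ` region" by (force simp: region_def)
 qed
 define S where "S = usplit L 1 (uband (-1) 0)"
 have S: "S = {w. w ~= 0 \<and> \<not> upp 1 w <~ L}"
 proof -
  have 1: "uone <~ L &* uinv c <-> c <~ L" for c
   using ule_move(1)[of uone L "uinv c"] by simp
  have "\<not> L &* uinv (upp 1 w) <~ uz (-1)" if "w ~= 0" for w
  proof
   assume "L &* uinv (upp 1 w) <~ uz (-1)"
   then have "uone <~ uz (-1) &* upp 1 w"
    using ule_move(3)[of L "uinv (upp 1 w)" "uz (-1)"] L ule_trans by simp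
   then have "uz 1 <~ upp 1 w" using ule_move(2)[of uone "uz (-1)" "upp 1 w"] by simp
   then show False using ule_uz that pi_gt_zero by (simp add: upp_def ulo_upar cmod_sgn)
  qed
  then show ?thesis unfolding S_def usplit_def uband_def using 1 by auto
 qed
 let ?B = "%w. w * cis (- arctan (cmod w))"
 have im: "?A = ?B ` S"
 proof (intro equalityI subsetI)
  fix b assume b: "b \<in> ?A"
  then have "b ~= 0" using L by auto
  then have "b * cis (arctan (cmod b)) \<in> S"
   using b parabolic_of_snd[of b] by (simp add: S)
  then show "b \<in> ?B ` S"
   by (rule rev_image_eqI) (simp add: norm_mult cis_mult mult.assoc)
 next
  fix b assume "b \<in> ?B ` S"
  then obtain w where w: "b = w * cis (- arctan (cmod w))" "w \<in> S" by auto
  then have "b ~= 0" "b * cis (arctan (cmod b)) = w" by (auto simp: S norm_mult cis_mult mult.assoc)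
  then show "b \<in> ?A" using w(2) parabolic_of_snd[of b] by (simp add: S)
 qed
 have "connected S" unfolding S_def by (rule uband_split_pos) simp
 then have "connected (snd ` region)"
  unfolding b im by (rule connected_continuous_image[rotated]) (intro continuous_intros)
 then show ?Q using connected_region r by simp
 have "region ~= {} <-> snd ` region ~= {}" by simp
 also have "\<dots> <-> S ~= {}" unfolding b im by blast
 also have "\<dots> <-> L \<in> uband (-1) 1" unfolding S_def using uband_split_pos(2)[of "-1" 0 L] by simp
 also have "\<dots> <-> \<not> uz 1 <~ L"
 proof -
  have "\<not> L <~ uz (-1)" using ule_trans[OF L, of "uz (-1)"] ule_uz_uz[of 0 "-1"] by auto
  then show ?thesis by (simp add: uband_def)
 qed
 finally show ?P unfolding r .
qed

lemma ubands_large: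
 assumes ab: "a < b" and T: "uz (b + 1) <~ T"
 shows "connected (ubands T a b)" "ubands T a b ~= {} <-> T \<in> uband (a - 2) (b + 2)" (is ?P)
proof -
 define L where "L = uz (- (b + 1)) &* T"
 have L: "uone <~ L" unfolding L_def using ule_move(4)[of "uz (b + 1)" uone T] T by simp
 have zL: "uz (- b) &* T = uz 1 &* L" by (simp add: L_def umult_assoc[symmetric] uz_add)
 have 1: "uz 1 <~ uz (- b) &* T" unfolding zL using ule_mult_left[of "uz 1" uone L] L by simp
 have 2: "uz (- b) &* T <~ uz (- a) &* T" using ab by simp
 have "uz (-1) <~ uz 1" by simp
 then have 3: "k <~ uz (-1) ==> k <~ uz (- b) &* T" for k using 1 ule_trans by blast
 have 4: "uz (- a) &* T <~ k ==> uz 1 <~ k" for k using 1 2 ule_trans by blast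
 let ?A = "{k. \<not> k <~ L \<and> \<not> uone <~ k}"
 have *: "k \<in> ubands T a b <-> uz (-1) &* k \<in> ?A" for k
 proof -
  have "k <~ uz 1 &* L <-> uz (-1) &* k <~ L" "uz 1 <~ k <-> uone <~ uz (-1) &* k"
   using ule_move(2)[of k "uz 1" L] ule_move(4)[of "uz 1" uone k] by simp_all
  then show ?thesis using 3[of k] 4[of k] unfolding ubands_iff zL mem_Collect_eq by blast
 qed
 have u: "uz 1 &* (uz (-1) &* k) = k" "uz (-1) &* (uz 1 &* k) = k" for k
  by (simp_all add: umult_assoc[symmetric] uz_add)
 let ?B = "%k. uz 1 &* k"
 have e: "ubands T a b = ?B ` ?A"
 proof (intro equalityI subsetI)
  fix k assume "k \<in> ubands T a b"
  then show "k \<in> ?B ` ?A"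
   unfolding * by (rule rev_image_eqI) (simp only: u)
 next
  fix k assume "k \<in> ?B ` ?A"
  then obtain l where "k = uz 1 &* l" "l \<in> ?A" by blast
  then show "k \<in> ubands T a b" unfolding * by (simp only: u)
 qed
 show "connected (ubands T a b)"
  unfolding e by (intro connected_continuous_image continuous_intros connected_not_le_region(1) L)
 have "\<not> T <~ uz (a - 2)" using ule_trans[OF T, of "uz (a - 2)"] ab by auto
 moreover have "uz 1 <~ L <-> uz (b + 2) <~ T"
  unfolding L_def using ule_move(2)[of "uz 1" "uz (- (b + 1))" T] by (simp add: uz_add add.commute)
 ultimately show ?P
  unfolding e using connected_not_le_region(2)[OF L] by (simp add: uband_def)
qed

lemma ubands_connected:
 assumes ab: "a < b"
 shows "connected (ubands T a b) \<and> (ubands T a b ~= {} <-> T \<in> uband (a - 2) (b + 2))"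
proof -
 consider "uz (b + 1) <~ T" | "T <~ uz (a - 1)" | "\<not> uz (b + 1) <~ T" "\<not> T <~ uz (a - 1)" by blast
 then show ?thesis
 proof cases
  case 1 then show ?thesis using ubands_large[OF ab] by blast
 next
  case 2
  have T: "uz (- a + 1) <~ umir T" using 2 umir_ule[of "uz (a - 1)" T] by simp
  have "- b < - a" using ab by simp
  note * = ubands_large[OF this T]
  have "connected (ubands T a b)"
   unfolding ubands_mirror[of T] by (intro connected_continuous_image continuous_intros *(1))
  moreover have "umir T \<in> uband (- b - 2) (- a + 2) <-> T \<in> uband (a - 2) (b + 2)"
   by (simp add: umir_uband add.commute)
  ultimately show ?thesis using *(2) ubands_mirror[of T a b] by simp
 next
  case 3
  define P where "P = (%k. k <~ uz (-1) \<or> k <~ uz (- b) &* T)"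
  define Q where "Q = (%k. uz 1 <~ k \<or> uz (- a) &* T <~ k)"
  interpret strip P Q
   unfolding P_def Q_def
   by unfold_locales (auto simp: Collect_disj_eq closed_ule intro: closed_Un ule_trans)
  have "k \<in> ubands T a b <-> k \<in> region" for k
   unfolding ubands_iff region_def mem_Collect_eq unfolding P_def Q_def by (rule HOL.refl)
  then have e: "ubands T a b = region" by blast
  have 1: "\<not> uz (- a) &* T <~ uz (-1)"
   using 3(2) ule_move(4)[of "uz (- a)" T "uz (-1)"] by (simp add: uz_add)
  have 2: "\<not> uz 1 <~ uz (- b) &* T"
   using 3(1) ule_move(2)[of "uz 1" "uz (- b)" T] by (simp add: uz_add)
  have 4: "\<not> uz (- a) &* T <~ uz (- b) &* T" using ab by simp
  have D: "\<not> (P k \<and> Q k)" for k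
  by (metis "1" "2" "4" P_def P_mono Q_def neg_le_0_iff_le neg_less_eq_nonneg not_one_le_zero ule_antisym ule_uz_uz zero_le_one)
  have "b' \<in> snd ` region" for b'
  proof -
   define r where "r = Max {pi * of_int (-1), uhi (uz (- b) &* T)} + arctan (cmod b') + 1"
   have "\<not> P (r, b')"
   proof
    have n: "\<not> (r, b') <~ k" if "uhi k <= r - arctan (cmod b') - 1" for k
    proof
     assume "(r, b') <~ k"
     then have "uact (r, b') 0 <= uact k 0" by (simp add: ule_def)
     moreover have "0 + ulo (r, b') <= uact (r, b') 0" "uact k 0 <= 0 + uhi k" by (rule uact_lo_hi)+
     ultimately show False using that by (simp add: ulo_def)
    qed
    assume "P (r, b')"
    moreover have "uhi (uz (-1)) <= r - arctan (cmod b') - 1" "uhi (uz (- b) &* T) <= r - arctan (cmod b') - 1"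
     by (simp_all add: r_def) (simp add: uhi_def uz_def urot_def)
    ultimately show False unfolding P_def using n by blast
   qed
   moreover define s where "s = Min {pi * of_int 1, ulo (uz (- a) &* T)} - arctan (cmod b') - 1"
   have "\<not> Q (s, b')"
   proof
    have n: "\<not> k <~ (s, b')" if "s + arctan (cmod b') + 1 <= ulo k" for k
    proof
     assume "k <~ (s, b')"
     then have "uact k 0 <= uact (s, b') 0" by (simp add: ule_def)
     moreover have "0 + ulo k <= uact k 0" "uact (s, b') 0 <= 0 + uhi (s, b')" by (rule uact_lo_hi)+
     ultimately show False using that by (simp add: uhi_def)
    qed
    assume "Q (s, b')"
    moreover have "s + arctan (cmod b') + 1 <= ulo (uz 1)" "s + arctan (cmod b') + 1 <= ulo (uz (- a) &* T)"
     by (simp_all add: s_def) (simp add: ulo_def uz_def urot_def)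
    ultimately show False unfolding Q_def using n by blast
   qed
   ultimately show ?thesis using D by (intro region_fiber)
  qed
  then have s: "snd ` region = UNIV" by blast
  then have "connected region" using connected_region connected_UNIV[where 'a = complex] by metis
  moreover have "region ~= {}" using s by auto
  moreover have "T \<in> uband (a - 2) (b + 2)"
  proof -
   have "uz (b + 1) <~ uz (b + 2)" "uz (a - 2) <~ uz (a - 1)" by simp_all
   then show ?thesis using 3 ule_trans unfolding uband_def by blast
  qed
  ultimately show ?thesis using e by simp
 qed
qed

lemma ubands_delete:
 assumes ab: "a < b" and F: "finite F"
 shows "connected (ubands T a b - F)" (is ?Q) "ubands T a b - F ~= {} <-> T \<in> uband (a - 2) (b + 2)" (is ?P)
proof -
 have "connected (S - F)" if "open S" "connected S" for S :: "ucov set"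
  using F
 proof (induction F)
  case (insert x F)
  have "open (S - F)" using that insert.hyps by (intro open_Diff finite_imp_closed)
  then have "connected (S - F - {x})" using insert.IH by (intro connected_open_delete) auto
  moreover have "S - F - {x} = S - insert x F" by auto
  ultimately show ?case by simp
 qed (use that in auto)
 then show ?Q using open_ubands ubands_connected[OF ab] by blast
 have "ubands T a b = {} \<or> infinite (ubands T a b)"
 using finite_imp_not_open open_ubands by blast
 then show ?P by (metis F Diff_eq_empty_iff empty_Diff finite_subset ubands_connected ab)
qed

section \<open>Commutators\<close>

lemma connected_hub:
 assumes "\<And>x. x \<in> S ==> \<exists>C. connected C \<and> C \<subseteq> S \<and> p \<in> C \<and> x \<in> C"
 shows "connected S"
 unfolding connected_iff_connected_component
by (smt (verit) connected_component_def assms connected_component_trans)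

subsection \<open>From matrices to the quotient group\<close>

definition pmat :: "cmat => ppt" where
 "pmat A = ((fst A / of_real (cmod (fst A)))\<^sup>2,
   snd A * cnj (fst A) / of_real (cmod (fst A) * sqrt (cm_det A)))"

lemma pmat_umat [simp]: "pmat (umat k) = pproj k"
proof -
 have 1: "fst (umat k) / of_real (cmod (fst (umat k))) = cis (fst k)"
  unfolding norm_umat by (simp add: umat_def)
 have "snd (umat k) * cnj (fst (umat k)) = snd k * of_real (radius (snd k)) * (cis (fst k) * cis (- fst k))"
  by (simp add: umat_def cis_cnj)
 then show ?thesis using 1 by (simp add: cis_mult pmat_def norm_umat pproj_def Complex.DeMoivre)
qed

lemma pmat_scaleR [simp]:
 assumes "c ~= 0" shows "pmat (c *\<^sub>R A) = pmat A"
proof -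
 have 1: "(fst (c *\<^sub>R A) / of_real (cmod (fst (c *\<^sub>R A))))\<^sup>2 = (fst A / of_real (cmod (fst A)))\<^sup>2"
  using assms
  by (simp add: scaleR_conv_of_real norm_mult power_divide power_mult_distrib flip: of_real_power)
 have 2: "cmod (fst (c *\<^sub>R A)) * sqrt (cm_det (c *\<^sub>R A)) = c\<^sup>2 * (cmod (fst A) * sqrt (cm_det A))"
  by (simp add: real_sqrt_mult power2_eq_square)
 have 3: "snd (c *\<^sub>R A) * cnj (fst (c *\<^sub>R A)) = of_real (c\<^sup>2) * (snd A * cnj (fst A))"
  by (simp add: scaleR_conv_of_real power2_eq_square)
 show ?thesis unfolding pmat_def 1 2 3 using assms by (simp del: of_real_power)
qed

lemma fst_nz_of_det: "0 < cm_det A ==> fst A ~= 0"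
 unfolding cm_det_def by (metis diff_gt_0_iff_gt norm_zero not_less power_zero_numeral zero_le_power2)

lemma continuous_on_pmat: "continuous_on {A. 0 < cm_det A} pmat"
 unfolding pmat_def
 by (intro continuous_intros) (auto dest: fst_nz_of_det simp: cm_det_def intro!: continuous_intros)

lemma continuous_on_cm_mult [continuous_intros]:
 "continuous_on S f ==> continuous_on S g ==> continuous_on S (%x. f x #* g x)"
 unfolding cm_mult_def by (intro continuous_intros)

lemma continuous_on_cm_det [continuous_intros]:
 "continuous_on S f ==> continuous_on S (%x. cm_det (f x))"
 unfolding cm_det_def by (intro continuous_intros)

lemma continuous_on_cm_adj [continuous_intros]:
 "continuous_on S f ==> continuous_on S (%x. cm_adj (f x))"
 unfolding cm_adj_def by (intro continuous_intros)

lemma isCont_pmat: "0 < cm_det A ==> isCont pmat A"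
proof -
 assume "0 < cm_det A"
 moreover have "open {A. 0 < cm_det A}" by (intro open_Collect_less continuous_intros)
 ultimately show ?thesis using continuous_on_pmat continuous_on_eq_continuous_at by blast
qed

lemma umat_surj:
 assumes "cm_det A = 1"
 shows "umat (Arg (fst A), snd A * cis (- Arg (fst A))) = A"
proof -
 have n0: "fst A ~= 0" using fst_nz_of_det assms by simp
 have "(cmod (fst A))\<^sup>2 = 1 + (cmod (snd A))\<^sup>2" using assms by (simp add: cm_det_def)
 then have r: "radius (snd A * cis (- Arg (fst A))) = cmod (fst A)"
  by (simp add: radius_def norm_mult) (metis abs_norm_cancel real_sqrt_abs)
 show ?thesis unfolding umat_def by (simp add: r prod_eq_iff cis_Arg_norm n0 cis_mult mult.assoc)
qed

lemma det_pos_scale: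
 assumes "0 < cm_det A" obtains k where "A = sqrt (cm_det A) *\<^sub>R umat k" "pmat A = pproj k"
proof -
 define B where "B = (1 / sqrt (cm_det A)) *\<^sub>R A"
 have "cm_det B = 1" using assms by (simp add: B_def power_divide)
 then obtain k where k: "umat k = B" using umat_surj by blast
 have A: "A = sqrt (cm_det A) *\<^sub>R umat k" unfolding k B_def using assms by simp
 moreover have "pmat A = pproj k" using assms by (subst A) simp
 ultimately show ?thesis by (rule that)
qed

lemma pmat_in_ppts: "0 < cm_det A ==> pmat A \<in> ppts"
 by (metis det_pos_scale pproj_in)

lemma umat_eq_iff: "umat k = umat l <-> (\<exists>n. k = uz (2 * n) &* l)"
proof
 assume e: "umat k = umat l"
 then have "radius (snd k) = radius (snd l)" using norm_umat by metis
 then have c: "cis (fst k) = cis (fst l)" using e by (simp add: umat_def)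
 then have s: "snd k = snd l" using e by (simp add: umat_def)
 have "cis (fst k - fst l) = 1" using c by (simp add: cis_divide[symmetric])
 then have "cos (fst k - fst l) = 1" by (metis cis.sel(1) one_complex.sel(1))
 then obtain n :: int where "fst k - fst l = of_int n * 2 * pi" using cos_one_2pi_int by blast
 then show "\<exists>n. k = uz (2 * n) &* l" using s
  by (intro exI[of _ n]) (simp add: uz_mult_left prod_eq_iff algebra_simps)
next
 assume "\<exists>n. k = uz (2 * n) &* l"
 then obtain n where k: "k = uz (2 * n) &* l" by blast
 show "umat k = umat l" using cis_2pi_int umat_urot k umat_mult by (simp add: mult_ac uz_def)
qed

lemma near_uz_mult:
 assumes "k = uz n &* l" "\<bar>fst k - fst l\<bar> < pi" shows "n = 0"
using assms by (simp add: uz_mult_left abs_mult)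

subsection \<open>The matrix equation for a commutator\<close>

lemma ucomm_eq_iff: "ucomm (uinv k) l = T <-> l &* k &* uinv l = k &* T"
by (auto simp: ucomm_def umult_assoc)

lemma ucomm_eq_matrix:
 assumes "umat l #* umat k = umat k #* umat T #* umat l"
 shows "\<exists>n. ucomm (uinv k) l = uz (2 * n) &* T"
proof -
 have "umat (l &* k) = umat (k &* T &* l)" by (simp only: umat_mult assms)
 then obtain n where "l &* k = uz (2 * n) &* (k &* T &* l)" unfolding umat_eq_iff by blast
 then have "l &* k &* uinv l = uz (2 * n) &* (k &* T)" by (metis umult_assoc uinv_right umult_one(2))
 also have "\<dots> = k &* (uz (2 * n) &* T)" by (metis umult_assoc uz_central)
 finally show ?thesis using ucomm_eq_iff by blast
qed

lemma matrix_of_ucomm_eq: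
 assumes "ucomm (uinv k) l = T"
 shows "umat l #* umat k = umat k #* umat T #* umat l" (is ?P)
  "Re (fst (umat k #* umat T)) = Re (fst (umat k))" (is ?Q)
proof -
 have e: "l &* k = k &* T &* l" using assms unfolding ucomm_eq_iff by (metis umult_assoc uinv_left umult_one(2))
 then show m: ?P by (metis umat_mult)
 have tr: "Re (fst (A #* B)) = Re (fst (B #* A))" for A B
  by (simp add: cm_mult_def algebra_simps)
 have "umat k #* umat T = umat l #* (umat k #* cm_adj (umat l))"
  by (simp only: cm_mult_assoc[symmetric] m) (simp add: cm_mult_assoc cm_adj_cancel)
 then show ?Q
  by (simp add: tr[of "umat l"] cm_mult_assoc cm_adj_cancel)
qed

lemma intertwiner:
 assumes b: "cm_det b = 1" and b': "cm_det b' = 1" and tr: "Re (fst b') = Re (fst b)"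
 shows "(b' #* X - X #* cm_adj b) #* b = b' #* (b' #* X - X #* cm_adj b)"
proof -
 define u where "u = 2 * Re (fst b)"
 have a: "cm_adj b = (of_real u, 0) - b" "cm_adj b' = (of_real u, 0) - b'"
  unfolding u_def by (simp_all add: cm_adj_def prod_eq_iff complex_eq_iff tr)
 have "b' #* ((of_real u, 0) - b') = (1, 0)" unfolding a(2)[symmetric] by (simp add: cm_adj_mult b')
 then have sq: "b' #* b' = u *\<^sub>R b' - (1, 0)" by (metis cm_mult_diff cm_scalar add_diff_cancel_left' diff_add_cancel)
 have "(b' #* X - X #* cm_adj b) #* b = b' #* X #* b - X"
  by (simp add: cm_mult_diff cm_mult_assoc cm_adj_mult b)
 moreover have "b' #* (b' #* X - X #* cm_adj b) = (b' #* b') #* X - b' #* X #* ((of_real u, 0) - b)"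
  unfolding a by (simp only: cm_mult_diff cm_mult_assoc)
 moreover have "\<dots> = b' #* X #* b - X"
  unfolding sq by (simp only: cm_mult_diff cm_scalar cm_mult_scaleR cm_mult_one) simp
 ultimately show ?thesis by simp
qed

lemma intertwiner_surj:
 assumes B: "B #* b = b' #* B" and N: "Im (fst b) ~= 0 \<or> snd b ~= 0"
 obtains X where "B = b' #* X - X #* cm_adj b"
proof -
 define q where "q = (Im (fst b))\<^sup>2 + (cmod (snd b))\<^sup>2"
 have q: "q ~= 0" using N by (auto simp: q_def add_nonneg_eq_0_iff)
 define Y where "Y = (1 / (2 * q)) *\<^sub>R (Complex 0 (- Im (fst b)), snd b)"
 have "b #* (Complex 0 (- Im (fst b)), snd b) - (Complex 0 (- Im (fst b)), snd b) #* cm_adj b = (of_real (2 * q), 0)"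
  unfolding q_def cmod_power2 cm_mult_def cm_adj_def by (simp add: complex_eq_iff power2_eq_square algebra_simps)
 then have "b #* Y - Y #* cm_adj b = (1 / (2 * q)) *\<^sub>R (of_real (2 * q), 0)"
  unfolding Y_def by (simp only: cm_mult_scaleR scaleR_diff_right[symmetric])
 also have "\<dots> = (1, 0)" using q by (simp add: scaleR_conv_of_real)
 finally have "B = B #* (b #* Y - Y #* cm_adj b)" by simp
 also have "\<dots> = b' #* (B #* Y) - (B #* Y) #* cm_adj b"
  by (simp add: cm_mult_diff cm_mult_assoc[symmetric] B)
 finally show ?thesis by (rule that)
qed

lemma connected_intertwiners:
 "connected (pmat ` {B. 0 < cm_det B \<and> B #* b = b' #* B})"
proof (cases "{B. 0 < cm_det B \<and> B #* b = b' #* B} = {}")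
 case False
 then obtain B_0 where B0: "0 < cm_det B_0" "B_0 #* b = b' #* B_0" by blast
 show ?thesis
 proof (rule connected_hub)
  fix p assume "p \<in> pmat ` {B. 0 < cm_det B \<and> B #* b = b' #* B}"
  then obtain B where B: "0 < cm_det B" "B #* b = b' #* B" "p = pmat B" by blast
  define C1 where "C1 = cm_adj B_0 #* B"
  define C where "C = (if 0 <= Re (fst C1) then C1 else - C1)"
  define f where "f = (%s. B_0 #* ((of_real (1 - s), 0) + s *\<^sub>R C))"
  have "cm_det B_0 *\<^sub>R (cm_adj B_0 #* b') = cm_det B_0 *\<^sub>R (b #* cm_adj B_0)" by (metis cm_mult_assoc B0 cm_adj_mult cm_scalar)
  then have "cm_adj B_0 #* b' = b #* cm_adj B_0" using B0(1) by simp
  then have c1: "C1 #* b = b #* C1" unfolding C1_def by (metis cm_mult_assoc B(2))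
  then have Cb: "C #* b = b #* C" by (simp add: C_def)
  have dC: "0 < cm_det C" "0 <= Re (fst C)" using B0(1) B(1) by (simp_all add: C_def C1_def)
  have d: "0 < cm_det (f s)" if "0 <= s" "s <= 1" for s
  proof -
   have "cm_det ((of_real (1 - s), 0) + s *\<^sub>R C) = (1 - s)\<^sup>2 + 2 * s * (1 - s) * Re (fst C) + s\<^sup>2 * cm_det C"
    unfolding cm_det_def cmod_power2 by (simp add: power2_eq_square algebra_simps)
   moreover have "0 <= 2 * s * (1 - s) * Re (fst C)" using that dC by simp
   moreover have "0 < (1 - s)\<^sup>2 + s\<^sup>2 * cm_det C"
    using that dC(1) by (cases "s = 0") (simp_all add: add_nonneg_pos)
   ultimately show ?thesis by (smt (verit) f_def B0 cm_det_mult mult_pos_pos)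
  qed
  have i: "f s #* b = b' #* f s" for s
  proof -
   have "f s = (1 - s) *\<^sub>R B_0 + s *\<^sub>R (B_0 #* C)" unfolding f_def cm_mult_add cm_scalar by simp
   moreover have "B_0 #* C #* b = b' #* (B_0 #* C)" by (metis Cb B0(2) cm_mult_assoc)
   ultimately show ?thesis by (simp add: cm_mult_add B0(2))
  qed
  have cf: "continuous_on {0..1} f" unfolding f_def by (intro continuous_intros)
  have "connected (pmat ` f ` {0..1})"
   by (intro connected_continuous_image cf connected_Icc continuous_on_subset[OF continuous_on_pmat]) (auto simp: d)
  moreover have "pmat ` f ` {0..1} \<subseteq> pmat ` {B. 0 < cm_det B \<and> B #* b = b' #* B}"
   using d i by auto
  moreover have "pmat B_0 \<in> pmat ` f ` {0..1}"
  proof -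
   show ?thesis by (force simp: f_def)
  qed
  moreover have "p \<in> pmat ` f ` {0..1}"
  proof -
   have "f 1 = B_0 #* C" by (simp add: f_def zero_prod_def[symmetric])
   also have "\<dots> = (if 0 <= Re (fst C1) then cm_det B_0 else - cm_det B_0) *\<^sub>R B"
    by (simp add: C_def C1_def cm_mult_assoc[symmetric] cm_adj_mult cm_scalar)
   finally have "pmat (f 1) = p" using B0(1) B(3) by simp
   then show ?thesis by (metis atLeastAtMost_iff image_eqI order_refl zero_le_one)
  qed
  ultimately show "\<exists>C. connected C \<and> C \<subseteq> pmat ` {B. 0 < cm_det B \<and> B #* b = b' #* B} \<and> pmat B_0 \<in> C \<and> p \<in> C"
   by blast
 qed
qed (simp only: image_empty connected_empty)

subsection \<open>Deforming a commuting-free pair\<close>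

lemma tendsto_cm_mult [tendsto_intros]:
 "(f ---> a) F ==> (g ---> b) F ==> ((%x. f x #* g x) ---> a #* b) F"
 unfolding cm_mult_def by (intro tendsto_intros)

lemma tendsto_cm_adj [tendsto_intros]:
 "(f ---> a) F ==> ((%x. cm_adj (f x)) ---> cm_adj a) F"
 unfolding cm_adj_def by (intro tendsto_intros)

lemma tendsto_cm_det [tendsto_intros]:
 "(f ---> a) F ==> ((%x. cm_det (f x)) ---> cm_det a) F"
 unfolding cm_det_def by (intro tendsto_intros)

lemma tendsto_umat [tendsto_intros]: "(f ---> a) F ==> ((%x. umat (f x)) ---> umat a) F"
 by (rule continuous_on_tendsto_compose[of UNIV umat]) (auto intro!: continuous_intros)

lemma tendsto_pmat: "(f ---> a) F ==> 0 < cm_det a ==> ((%x. pmat (f x)) ---> pmat a) F"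
 by (rule isCont_tendsto_compose[OF isCont_pmat])

lemma tendsto_pcomm:
 assumes "(f ---> a) F" "(g ---> b) F" "a \<in> ppts" "b \<in> ppts"
  "eventually (%x. f x \<in> ppts \<and> g x \<in> ppts) F"
 shows "((%x. pcomm (f x) (g x)) ---> pcomm a b) F"
 using continuous_on_tendsto_compose[OF continuous_on_pcomm_aux tendsto_Pair[OF assms(1,2)]] assms(3-5)
 by (auto elim: eventually_mono)

lemma nonscalar_of_ucomm:
 assumes e: "ucomm (uinv k) l = T" and T: "T ~= uone"
 shows "Im (fst (umat k)) ~= 0 \<or> snd (umat k) ~= 0"
proof (rule ccontr)
 assume "\<not> (Im (fst (umat k)) ~= 0 \<or> snd (umat k) ~= 0)"
 then obtain c where c: "umat k = (of_real c, 0)"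
  by (metis complex_of_real_def complex_surj prod.collapse)
 have "c ~= 0"
  using cm_det_umat[of k] by (auto simp: c cm_det_def)
 have "umat l #* umat k = umat k #* umat T #* umat l" by (rule matrix_of_ucomm_eq(1)[OF e])
 then have "c *\<^sub>R umat l = c *\<^sub>R (umat T #* umat l)" unfolding c cm_scalar cm_mult_scaleR .
 then have "umat l = umat T #* umat l" using \<open>c ~= 0\<close> by simp
 then have "umat (uone &* l) = umat (T &* l)" by (simp add: umat_mult)
 then obtain n where "uone &* l = uz (2 * n) &* (T &* l)" unfolding umat_eq_iff by blast
 then have T': "T = uz (- (2 * n))" by (metis umult_eq_iff uinv_uz umult_one)
 have "- pi < uhi T" "ulo T < pi" using ucomm_bounds[of "uinv k" l] e by auto
 then have "- 1 < real_of_int (- (2 * n))" "real_of_int (- (2 * n)) < 1"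
  unfolding T' by (simp_all add: uhi_def ulo_def uz_def urot_def) (metis mult.right_neutral mult_less_cancel_left_pos mult_minus_right pi_gt_zero minus_less_iff minus_mult_right)+
 then have "n = 0" by simp
 then show False using T T' by simp
qed

lemma comm_deform:
 assumes T: "(T ---> T_0) F" and b: "(b ---> umat k) F"
  and ev: "eventually (%x. cm_det (b x) = 1 \<and> Re (fst (b x #* umat (T x))) = Re (fst (b x))) F"
  and e: "ucomm (uinv k) l = T_0" and T0: "T_0 ~= uone"
 obtains S where "(S ---> pproj l) F"
  "eventually (%x. pmat (cm_adj (b x)) \<in> ppts \<and> S x \<in> ppts \<and> pcomm (pmat (cm_adj (b x))) (S x) = T x) F"
proof -
 obtain X where X: "umat l = (umat k #* umat T_0) #* X - X #* cm_adj (umat k)"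
  using intertwiner_surj[OF matrix_of_ucomm_eq(1)[OF e] nonscalar_of_ucomm[OF e T0]] .
 define B where "B = (%x. (b x #* umat (T x)) #* X - X #* cm_adj (b x))"
 define S where "S = (%x. pmat (B x))"
 have B: "(B ---> umat l) F"
  unfolding X B_def by (intro tendsto_intros b T)
 then have S: "(S ---> pproj l) F"
  unfolding S_def using tendsto_pmat[OF B] by simp
 have ba: "((%x. pmat (cm_adj (b x))) ---> pproj (uinv k)) F"
  using tendsto_pmat[OF tendsto_cm_adj[OF b]] by (simp add: umat_inv[symmetric])
 have "((%x. cm_det (B x)) ---> cm_det (umat l)) F" by (intro tendsto_intros B)
 then have dB: "eventually (%x. 0 < cm_det (B x)) F" by (rule order_tendstoD) simp
 have ev2: "eventually (%x. pmat (cm_adj (b x)) \<in> ppts \<and> S x \<in> ppts \<and>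
   (\<exists>n. pcomm (pmat (cm_adj (b x))) (S x) = uz (2 * n) &* T x)) F"
  using ev dB
 proof eventually_elim
  case (elim x)
  then obtain k' where k': "umat k' = b x" using umat_surj by blast
  obtain l' where l': "B x = sqrt (cm_det (B x)) *\<^sub>R umat l'" "pmat (B x) = pproj l'"
   using det_pos_scale[OF elim(2)] .
  have "B x #* b x = (b x #* umat (T x)) #* B x"
   unfolding B_def using elim(1) by (intro intertwiner) simp_all
  then have "sqrt (cm_det (B x)) *\<^sub>R (umat l' #* umat k') = sqrt (cm_det (B x)) *\<^sub>R (umat k' #* umat (T x) #* umat l')"
   by (subst (asm) (1 2) l'(1)) (simp add: k')
  then have "umat l' #* umat k' = umat k' #* umat (T x) #* umat l'" using elim(2) by simp
  then obtain n where "ucomm (uinv k') l' = uz (2 * n) &* T x" using ucomm_eq_matrix by blast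
  moreover have "pmat (cm_adj (b x)) = pproj (uinv k')" unfolding k'[symmetric] by (simp add: umat_inv[symmetric])
  ultimately show ?case unfolding S_def l'(2) by auto
 qed
 have "((%x. pcomm (pmat (cm_adj (b x))) (S x)) ---> pcomm (pproj (uinv k)) (pproj l)) F"
  using ev2 by (intro tendsto_pcomm S ba) (auto elim: eventually_mono)
 then have "((%x. fst (pcomm (pmat (cm_adj (b x))) (S x)) - fst (T x)) ---> fst T_0 - fst T_0) F"
  using e by (intro tendsto_intros T) simp
 then have "eventually (%x. dist (fst (pcomm (pmat (cm_adj (b x))) (S x)) - fst (T x)) (fst T_0 - fst T_0) < pi) F"
  by (rule tendstoD) simp
 then have "eventually (%x. pmat (cm_adj (b x)) \<in> ppts \<and> S x \<in> ppts \<and> pcomm (pmat (cm_adj (b x))) (S x) = T x) F"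
  using ev2
 proof eventually_elim
  case (elim x)
  then obtain n where n: "pcomm (pmat (cm_adj (b x))) (S x) = uz (2 * n) &* T x" by blast
  have "2 * n = 0" using elim(1) by (intro near_uz_mult[OF n]) (simp add: dist_real_def)
  then show ?case using n elim(2) by simp
 qed
 then show ?thesis using that S by blast
qed

definition npairs :: "(ppt \<times> ppt) set" where
 "npairs = {x. fst x \<in> ppts \<and> snd x \<in> ppts \<and> pcomm (fst x) (snd x) ~= uone}"

lemma lift_pair:
 assumes "p \<in> ppts" "q \<in> ppts"
 obtains k l where "p = pproj (uinv k)" "q = pproj l" "pcomm p q = ucomm (uinv k) l"
by (metis assms(1,2) pcomm_def pproj_plift uinv_uinv)

lemma pcomm_section:
 assumes p: "x \<in> npairs"
 obtains S where "(S ---> x) (nhds (pcomm (fst x) (snd x)))"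
  "eventually (%T. S T \<in> npairs \<and> pcomm (fst (S T)) (snd (S T)) = T) (nhds (pcomm (fst x) (snd x)))"
proof -
 obtain k l where kl: "fst x = pproj (uinv k)" "snd x = pproj l" "pcomm (fst x) (snd x) = ucomm (uinv k) l"
  using p lift_pair[of "fst x" "snd x"] unfolding npairs_def by blast
 define T0 where "T0 = pcomm (fst x) (snd x)"
 have T0: "T0 ~= uone" using p by (simp add: T0_def npairs_def)
 have e: "ucomm (uinv k) l = T0" by (simp add: T0_def kl(3))
 define b0 where "b0 = umat k"
 define A where "A = (umat T0 - (1, 0)) #* b0"
 define Y where "Y = (cnj (fst A), snd A)"
 define g0 where "g0 = (%T. Re (fst (b0 #* (umat T - (1, 0)))))"
 define g1 where "g1 = (%T. Re (fst (b0 #* Y #* (umat T - (1, 0)))))"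
 define h where "h = (%T. - g0 T / g1 T)"
 define b where "b = (%T. b0 #* ((1, 0) + h T *\<^sub>R Y))"
 define c where "c = (%T. (1 / sqrt (cm_det (b T))) *\<^sub>R b T)"
 have tr: "Re (fst (A #* B)) = Re (fst (B #* A))" for A B
  by (simp add: cm_mult_def algebra_simps)
 have "A ~= 0"
 proof
  assume "A = 0"
  then have "A #* cm_adj b0 = 0" by (simp add: cm_mult_def zero_prod_def)
  then have "umat T0 = umat uone" by (simp add: A_def cm_mult_assoc cm_adj_mult b0_def)
  then obtain n where "T0 = uz (2 * n) &* uone" unfolding umat_eq_iff by blast
  then have n: "T0 = uz (2 * n)" by simp
  have "T0 \<in> uband (-1) 1" using ucomm_bounds[of "uinv k" l] unfolding e by (simp add: uband_def ule_uz not_le)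
  then have "n = 0" unfolding n uz_in_uband by auto
  then show False using T0 n by simp
 qed
 have "Re (fst (Y #* A)) = (cmod (fst A))\<^sup>2 + (cmod (snd A))\<^sup>2"
  unfolding Y_def cm_mult_def cmod_power2 by (simp add: power2_eq_square)
 moreover have "g1 T0 = Re (fst (Y #* A))"
  unfolding g1_def A_def by (simp add: tr[of b0] cm_mult_assoc)
 moreover have "fst A ~= 0 \<or> snd A ~= 0" using \<open>A ~= 0\<close> by (metis prod_eqI fst_zero snd_zero)
 ultimately have g1: "0 < g1 T0"
  by (metis add_pos_nonneg add_nonneg_pos zero_less_norm_iff zero_less_power zero_le_power2)
 have g0: "g0 T0 = 0" using matrix_of_ucomm_eq(2)[OF e] by (simp add: g0_def b0_def cm_mult_diff)
 have lim: "((%T. T) ---> T0) (nhds T0)" by (rule filterlim_ident)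
 have lg1: "(g1 ---> g1 T0) (nhds T0)" unfolding g1_def by (intro tendsto_intros lim)
 have lg0: "(g0 ---> g0 T0) (nhds T0)" unfolding g0_def by (intro tendsto_intros lim)
 have "(h ---> 0) (nhds T0)" unfolding h_def using lg0 lg1 g1 g0
  by (auto intro!: tendsto_eq_intros)
 then have "(b ---> b0 #* ((1, 0) + 0 *\<^sub>R Y)) (nhds T0)"
  unfolding b_def by (intro tendsto_intros)
 then have lb: "(b ---> b0) (nhds T0)" by (simp add: zero_prod_def[symmetric])
 then have ld: "((%T. cm_det (b T)) ---> 1) (nhds T0)" using tendsto_cm_det[OF lb] by (simp add: b0_def)
 then have "(c ---> (1 / sqrt 1) *\<^sub>R b0) (nhds T0)" unfolding c_def by (intro tendsto_intros lb ld) auto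
 then have lc: "(c ---> umat k) (nhds T0)" by (simp add: b0_def)
 have "eventually (%T. 0 < cm_det (b T)) (nhds T0)" using ld by (rule order_tendstoD) simp
 moreover have "eventually (%T. 0 < g1 T) (nhds T0)" using lg1 g1 by (rule order_tendstoD)
 ultimately have ev: "eventually (%T. cm_det (c T) = 1 \<and> Re (fst (c T #* umat T)) = Re (fst (c T))) (nhds T0)"
 proof eventually_elim
  case (elim T)
  have "Re (fst (b T #* (umat T - (1, 0)))) = g0 T + h T * g1 T" by (simp add: b_def cm_mult_add g0_def g1_def)
  then have "Re (fst (b T #* (umat T - (1, 0)))) = 0" using elim(2) by (simp add: h_def)
  then have "Re (fst (c T #* umat T)) = Re (fst (c T))" by (simp add: c_def cm_mult_diff)
  then show ?case using elim(1) by (simp add: c_def power_divide)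
 qed
 obtain S where S: "(S ---> pproj l) (nhds T0)"
  "eventually (%T. pmat (cm_adj (c T)) \<in> ppts \<and> S T \<in> ppts \<and> pcomm (pmat (cm_adj (c T))) (S T) = T) (nhds T0)"
  using comm_deform[OF lim lc ev e T0] .
 have "((%T. pmat (cm_adj (c T))) ---> pproj (uinv k)) (nhds T0)"
  using tendsto_pmat[OF tendsto_cm_adj[OF lc]] by (simp add: umat_inv[symmetric])
 then have "((%T. (pmat (cm_adj (c T)), S T)) ---> (pproj (uinv k), pproj l)) (nhds T0)"
  using S(1) by (intro tendsto_intros)
 moreover have "(pproj (uinv k), pproj l) = x" using kl by (simp add: prod_eq_iff)
 moreover have "eventually (%T. T ~= uone) (nhds T0)"
  using T0 by (intro eventually_nhds_in_open[of "- {uone}", simplified]) auto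
 then have "eventually (%T. (pmat (cm_adj (c T)), S T) \<in> npairs \<and> pcomm (fst (pmat (cm_adj (c T)), S T)) (snd (pmat (cm_adj (c T)), S T)) = T) (nhds T0)"
  using S(2) by eventually_elim (simp add: npairs_def)
 ultimately show ?thesis using that[of "%T. (pmat (cm_adj (c T)), S T)"] by (simp add: T0_def)
qed

lemma open_pcomm_image:
 assumes "openin (top_of_set npairs) C"
 shows "open ((%x. pcomm (fst x) (snd x)) ` C)"
 unfolding open_subopen[of "(%x. pcomm (fst x) (snd x)) ` C"]
proof
 fix T assume "T \<in> (%x. pcomm (fst x) (snd x)) ` C"
 then obtain x where x: "x \<in> C" "T = pcomm (fst x) (snd x)" by blast
 obtain U where U: "open U" "C = npairs \<inter> U" using assms by (auto simp: openin_open)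
 obtain S where S: "(S ---> x) (nhds T)"
  "eventually (%T. S T \<in> npairs \<and> pcomm (fst (S T)) (snd (S T)) = T) (nhds T)"
  using pcomm_section[of x] x U by blast
 have "eventually (%T. S T \<in> U) (nhds T)" using S(1) U x by (intro topological_tendstoD) auto
 then have "eventually (%T. T \<in> (%x. pcomm (fst x) (snd x)) ` C) (nhds T)"
  using S(2) by eventually_elim (use U in force)
 then show "\<exists>V. open V \<and> T \<in> V \<and> V \<subseteq> (%x. pcomm (fst x) (snd x)) ` C"
  unfolding eventually_nhds by blast
qed

definition pfiber :: "ucov => (ppt \<times> ppt) set" where
 "pfiber T = {x. fst x \<in> ppts \<and> snd x \<in> ppts \<and> pcomm (fst x) (snd x) = T}"

lemma connected_pfiber:
 assumes T: "T ~= uone" and K: "connected (fst ` pfiber T)"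
 shows "connected (pfiber T)"
proof -
 have "connected (pfiber T \<inter> fst -` (fst ` pfiber T))"
 proof (rule connected_open_monotone_preimage[OF _ HOL.refl])
  show "continuous_on (pfiber T) fst" by (intro continuous_intros)
  show "openin (top_of_set (fst ` pfiber T)) (fst ` C)" if C: "openin (top_of_set (pfiber T)) C" for C
  proof (subst openin_subopen, intro ballI)
   fix p assume "p \<in> fst ` C"
   then obtain q where pq: "(p, q) \<in> C" by auto
   obtain U where U: "open U" "C = pfiber T \<inter> U" using C by (auto simp: openin_open)
   have pq': "p \<in> ppts" "q \<in> ppts" "pcomm p q = T" using pq U by (auto simp: pfiber_def)
   obtain k l where kl: "p = pproj (uinv k)" "q = pproj l" "pcomm p q = ucomm (uinv k) l"
    using lift_pair[OF pq'(1,2)] .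
   define F where "F = at p within fst ` pfiber T"
   obtain h where s: "\<And>q. q \<in> ppts ==> pproj (h q) = q" "h p = plift p" "continuous (at p) h"
    using pproj_local_section[OF pq'(1)] by blast
   obtain n where n: "uinv k = uz n &* h p" using s(1)[OF pq'(1)] kl(1) pproj_eq_iff by metis
   define b where "b = (%a. umat (uinv (uz n &* h a)))"
   have "(h ---> h p) F" unfolding F_def using s(3)[unfolded continuous_within]
    by (rule tendsto_within_subset) simp
   moreover have "isCont (%a. umat (uinv (uz n &* a))) (h p)"
    by (intro continuous_on_interior[of UNIV] continuous_intros) simp
   ultimately have "(b ---> umat (uinv (uz n &* h p))) F"
    unfolding b_def by (rule isCont_tendsto_compose[rotated])
   then have lb: "(b ---> umat k) F" by (simp add: n[symmetric])
   have pb: "pmat (cm_adj (b a)) = a" if "a \<in> ppts" for a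
    unfolding b_def umat_inv[symmetric] using s(1)[OF that] pproj_eq_iff[of "uz n &* h a" "h a"] by auto
   have in_K: "cm_det (b a) = 1 \<and> Re (fst (b a #* umat T)) = Re (fst (b a))" if aK: "a \<in> fst ` pfiber T" for a
   proof -
    obtain d where d: "a \<in> ppts" "d \<in> ppts" "pcomm a d = T" using aK by (auto simp: pfiber_def)
    obtain l' where l': "d = pproj l'" using pproj_surj[OF d(2)] .
    have "ucomm (uinv (uinv (uz n &* h a))) l' = T" by (metis s d pproj_eq_iff l' pcomm_pproj uinv_uinv)
    from matrix_of_ucomm_eq(2)[OF this] show ?thesis by (simp add: b_def)
   qed
   have ev: "eventually (%a. cm_det (b a) = 1 \<and> Re (fst (b a #* umat T)) = Re (fst (b a))) F"
    unfolding F_def eventually_at_filter by (intro always_eventually) (use in_K in blast)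
   obtain S where S: "(S ---> pproj l) F"
    "eventually (%x. pmat (cm_adj (b x)) \<in> ppts \<and> S x \<in> ppts \<and> pcomm (pmat (cm_adj (b x))) (S x) = T) F"
    using comm_deform[OF tendsto_const lb ev kl(3)[symmetric, unfolded pq'(3)] T] by blast
   have "((%a. (a, S a)) ---> (p, q)) F" using S(1) unfolding F_def kl(2) by (intro tendsto_intros)
   then have "eventually (%a. (a, S a) \<in> U) F" using U pq by (intro topological_tendstoD) auto
   moreover have "eventually (%a. a \<in> fst ` pfiber T) F" by (simp add: F_def eventually_at_filter)
   ultimately have "eventually (%a. a \<in> fst ` C) F"
    using S(2)
   proof eventually_elim
    case (elim a)
    then have "(a, S a) \<in> C" using pb by (auto simp: pfiber_def U)
    then show ?case by force
   qed
   then obtain V where V: "open V" "p \<in> V" "\<And>a. a \<in> V ==> a ~= p ==> a \<in> fst ` pfiber T ==> a \<in> fst ` C"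
    unfolding F_def eventually_at_topological by blast
   have "fst ` pfiber T \<inter> V \<subseteq> fst ` C" using pq V by force
   moreover have "p \<in> fst ` pfiber T" using \<open>p \<in> fst ` C\<close> U by blast
   ultimately show "\<exists>V. openin (top_of_set (fst ` pfiber T)) V \<and> p \<in> V \<and> V \<subseteq> fst ` C"
    using V(1,2) openin_open_Int by blast
  qed
  fix p assume "p \<in> fst ` pfiber T"
  then obtain q where pq: "p \<in> ppts" "q \<in> ppts" "pcomm p q = T" by (auto simp: pfiber_def)
  obtain k l where kl: "p = pproj (uinv k)" "q = pproj l" "pcomm p q = ucomm (uinv k) l"
   using lift_pair[OF pq(1,2)] .
  let ?B = "umat l #* umat k #* cm_adj (umat l)"
  let ?A = "{B. 0 < cm_det B \<and> B #* umat k = ?B #* B}"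
  have *: "(p, q') \<in> pfiber T <-> q' \<in> pmat ` ?A" for q'
  proof
   assume "(p, q') \<in> pfiber T"
   then have q': "q' \<in> ppts" "pcomm p q' = T" by (auto simp: pfiber_def)
   obtain l' where l': "q' = pproj l'" using pproj_surj[OF q'(1)] .
   have "umat l' #* umat k = ?B #* umat l'" by (metis q' pq kl l' ucomm_eq_iff pcomm_pproj umult_assoc uinv_left umult_one umat_mult umat_inv)
   then show "q' \<in> pmat ` ?A"
    unfolding l' by (intro image_eqI[of _ _ "umat l'"]) auto
  next
   assume "q' \<in> pmat ` ?A"
   then obtain B where B: "0 < cm_det B" "B #* umat k = ?B #* B" "q' = pmat B"
    by blast
   obtain l' where l': "B = sqrt (cm_det B) *\<^sub>R umat l'" "pmat B = pproj l'" using det_pos_scale[OF B(1)] .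
   have "sqrt (cm_det B) *\<^sub>R (umat l' #* umat k) = sqrt (cm_det B) *\<^sub>R (?B #* umat l')"
    using B(2) by (subst (asm) (1 2) l'(1)) simp
   then have "umat (l' &* k) = umat (l &* k &* uinv l &* l')" using B(1) by (simp add: umat_mult umat_inv)
   then obtain n where "l' &* k = uz (2 * n) &* (l &* k &* uinv l &* l')" unfolding umat_eq_iff by blast
   then have e: "l' &* k &* uinv l' = uz (2 * n) &* (l &* k &* uinv l)" by (metis umult_assoc uinv_right umult_one(2))
   then have "2 * n = 0" by (smt (verit) uinv_mult umult_assoc uinv_cancel conj_eq_uz_mult)
   then show "(p, q') \<in> pfiber T" using e kl pq ucomm_eq_iff B l' by (simp add: pfiber_def)
  qed
  have "pfiber T \<inter> fst -` {p} = (%q'. (p, q')) ` (pmat ` ?A)"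
   using * by auto
  then show "connected (pfiber T \<inter> fst -` {p})"
   by (simp only:) (intro connected_continuous_image[OF _ connected_intertwiners] continuous_intros)
 qed (use K in auto)
 moreover have "pfiber T \<inter> fst -` (fst ` pfiber T) = pfiber T" by auto
 ultimately show ?thesis by simp
qed

subsection \<open>Commutators of a given positive displacement\<close>

lemma connected_cone_region_real:
 assumes y: "0 < y" and a: "0 <= a"
 shows "connected {w. c < y * radius w - a * Re w}"
proof -
 define S where "S = {w. c < y * radius w - a * Re w}"
 have rad: "\<bar>Re w\<bar> <= radius w" "\<bar>Im w\<bar> <= radius w" for w
  using radius_gt(1)[of w] abs_Re_le_cmod[of w] abs_Im_le_cmod[of w] by linarith+
 have mono: "\<bar>t\<bar> <= \<bar>u\<bar> ==> radius (Complex x t) <= radius (Complex x u)" for x t u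
  by (simp add: radius_def cmod_def abs_le_square_iff)
 define X where "X = \<bar>c\<bar> / y + 1"
 have "y * X = \<bar>c\<bar> + y" using y by (simp add: X_def field_simps)
 moreover have "0 <= \<bar>c\<bar> / y" using y by simp
 ultimately have X: "c < y * X" "0 < X" using y unfolding X_def by linarith+
 have line: "Complex (- X) t \<in> S" for t
 proof -
  have "y * X <= y * radius (Complex (- X) t)" using rad(1)[of "Complex (- X) t"] y X by simp
  moreover have "0 <= a * X" using a X by simp
  ultimately show ?thesis using X by (simp add: S_def)
 qed
 have up: "\<exists>C. connected C \<and> C \<subseteq> S \<and> of_real (- X) \<in> C \<and> p \<in> C" if p: "p \<in> S" "0 <= Im p" for p
 proof -
  define x where "x = Re p"
  let ?A = "X + \<bar>x\<bar>"
  let ?B = "(\<bar>c\<bar> + a * ?A) / y + 1"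
  define H where "H = max (Im p) ?B"
  have H: "Im p <= H" "c + a * ?A < y * H" "0 <= H"
  proof -
   have "y * ?B <= y * H" using y by (simp add: H_def)
   moreover have "y * ?B = \<bar>c\<bar> + a * ?A + y" using y by (simp add: field_simps)
   ultimately show "c + a * ?A < y * H" using y by linarith
   show "Im p <= H" by (simp add: H_def)
   then show "0 <= H" using p by linarith
  qed
  define C1 where "C1 = (%t. Complex x t) ` {Im p..H}"
  define C2 where "C2 = (%t. Complex t H) ` {min (- X) x..max (- X) x}"
  define C3 where "C3 = (%t. Complex (- X) t) ` {0..H}"
  have Complex_cont: "continuous_on A (%t. Complex t h)" "continuous_on A (%t. Complex h t)" for A h
   by (simp_all add: Complex_eq) (intro continuous_intros)+
  have con: "connected C1" "connected C2" "connected C3"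
   unfolding C1_def C2_def C3_def by (intro connected_continuous_image Complex_cont connected_Icc)+
  have m1: "Complex x H \<in> C1" "Complex x H \<in> C2" "Complex (- X) H \<in> C2" "Complex (- X) H \<in> C3"
   "p \<in> C1" "of_real (- X) \<in> C3"
   using H p unfolding C1_def C2_def C3_def
   by (auto simp: image_iff complex_eq_iff x_def intro: bexI[of _ H])
  have "connected (C1 \<union> C2)" using con m1 by (intro connected_Un) auto
  then have "connected (C1 \<union> C2 \<union> C3)" using con m1 by (intro connected_Un) auto
  moreover have "C1 \<subseteq> S"
  proof
   fix w assume "w \<in> C1"
   then obtain t where t: "w = Complex x t" "Im p <= t" "t <= H" by (auto simp: C1_def)
   have "radius (Complex x (Im p)) <= radius (Complex x t)" using t p by (intro mono) auto
   then have "y * radius p <= y * radius w" using y t by (simp add: x_def)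
   then show "w \<in> S" using p t by (simp add: S_def x_def)
  qed
  moreover have "C2 \<subseteq> S"
  proof
   fix w assume "w \<in> C2"
   then obtain t where t: "w = Complex t H" "min (- X) x <= t" "t <= max (- X) x" by (auto simp: C2_def)
   then have "a * t <= a * ?A" by (smt (verit) X a mult_left_mono)
   moreover have "y * H <= y * radius w" using rad(2)[of w] t H y by simp
   ultimately show "w \<in> S" using H t by (simp add: S_def)
  qed
  moreover have "C3 \<subseteq> S" using line by (auto simp: C3_def)
  ultimately show ?thesis using m1 by (intro exI[of _ "C1 \<union> C2 \<union> C3"]) auto
 qed
 have cnjS: "cnj w \<in> S <-> w \<in> S" for w by (simp add: S_def)
 have "connected S"
 proof (rule connected_hub)
  fix p assume p: "p \<in> S"
  show "\<exists>C. connected C \<and> C \<subseteq> S \<and> of_real (- X) \<in> C \<and> p \<in> C"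
  proof (cases "0 <= Im p")
   case False
   then obtain C where C: "connected C" "C \<subseteq> S" "of_real (- X) \<in> C" "cnj p \<in> C"
    using up[of "cnj p"] p cnjS by auto
   have "connected (cnj ` C)" by (intro connected_continuous_image C continuous_intros)
   moreover have "of_real (- X) \<in> cnj ` C" using C(3) by (intro image_eqI[of _ _ "of_real (- X)"]) auto
   moreover have "p \<in> cnj ` C" using C(4) by (intro image_eqI[of _ _ "cnj p"]) auto
   moreover have "cnj ` C \<subseteq> S" using C(2) cnjS by auto
   ultimately show ?thesis by blast
  qed (use up p in blast)
 qed
 then show ?thesis by (simp add: S_def)
qed

lemma polar_unit: obtains n :: complex where "cmod n = 1" "v = of_real (cmod v) * n"
by (smt (verit, del_insts) abs_norm_cancel divide_self_if norm_divide norm_eq_zero norm_of_real of_real_def polar scaleR_conv_of_real sgn_eq)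

lemma connected_cone_region:
 "connected {w. c < y * radius w - Re (w * cnj v)}"
proof (cases "0 < y")
 case True
 obtain h where n: "cmod h = 1" "v = of_real (cmod v) * h" by (rule polar_unit)
 have nn: "h * cnj h = 1" using n complex_norm_square[of h] by simp
 have r: "radius (w * h) = radius w" for w by (rule radius_norm) (simp add: norm_mult n)
 have e: "Re (w * h * cnj v) = cmod v * Re w" for w
 proof -
  have "w * h * cnj v = of_real (cmod v) * w * (h * cnj h)" by (subst n(2)) simp
  then show ?thesis by (metis nn mult_1_right Re_complex_of_real times_complex.sel Im_complex_of_real mult_zero_left diff_zero)
 qed
 let ?A = "{w. c < y * radius w - cmod v * Re w}"
 have "{w. c < y * radius w - Re (w * cnj v)} = (%w. w * h) ` ?A"
 proof (intro equalityI subsetI)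
  fix w assume w: "w \<in> {w. c < y * radius w - Re (w * cnj v)}"
  have "w = w * cnj h * h" using nn by (simp add: mult.assoc mult.commute)
  moreover from this have "w * cnj h \<in> ?A"
   using w r[of "w * cnj h"] e[of "w * cnj h"] by (metis (no_types, lifting) mem_Collect_eq)
  ultimately show "w \<in> (%w. w * h) ` ?A" by (rule image_eqI)
 next
  fix w assume "w \<in> (%w. w * h) ` ?A"
  then obtain u where u: "w = u * h" "c < y * radius u - cmod v * Re u" by blast
  show "w \<in> {w. c < y * radius w - Re (w * cnj v)}" unfolding u(1) mem_Collect_eq r e by (rule u(2))
 qed
 then show ?thesis
  using True by (simp only:) (intro connected_continuous_image connected_cone_region_real continuous_intros norm_ge_zero)
next
 case False
 have rn: "radius w = norm (1 :: real, w)" for w by (simp add: radius_def norm_Pair)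
 have "convex {w. c < y * radius w - Re (w * cnj v)}"
 proof (rule convexI)
  fix p q and s t :: real
  assume p: "p \<in> {w. c < y * radius w - Re (w * cnj v)}" and q: "q \<in> {w. c < y * radius w - Re (w * cnj v)}"
   and st: "0 <= s" "0 <= t" "s + t = 1"
  let ?B = "s *\<^sub>R p + t *\<^sub>R q"
  have "(1 :: real, s *\<^sub>R p + t *\<^sub>R q) = s *\<^sub>R (1, p) + t *\<^sub>R (1, q)" using st by simp
  then have "radius ?B <= s * radius p + t * radius q"
   unfolding rn using norm_triangle_ineq[of "s *\<^sub>R (1 :: real, p)" "t *\<^sub>R (1, q)"] st by (simp only: norm_scaleR abs_of_nonneg)
  then have "y * (s * radius p + t * radius q) <= y * radius ?B"
   using False by (simp add: mult_left_mono_neg)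
  moreover have "Re (?B * cnj v) = s * Re (p * cnj v) + t * Re (q * cnj v)"
   by (simp add: algebra_simps)
  moreover have "s * c + t * c < s * (y * radius p - Re (p * cnj v)) + t * (y * radius q - Re (q * cnj v))"
  by (smt (verit, ccfv_SIG) mem_Collect_eq mult_le_cancel_left p q st(1,2,3))
  moreover have "s * c + t * c = c" using st by (metis distrib_right mult_1)
  ultimately show "s *\<^sub>R p + t *\<^sub>R q \<in> {w. c < y * radius w - Re (w * cnj v)}"
   by (simp add: algebra_simps)
 qed
 then show ?thesis by (rule convex_connected)
qed

lemma cone_region_nonempty:
 assumes c: "0 <= c" and yv: "0 < y + cmod v"
 shows "\<exists>w. c < y * radius w - Re (w * cnj v)"
proof -
 obtain h where n: "cmod h = 1" "v = of_real (cmod v) * h" by (rule polar_unit)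
 have nn: "h * cnj h = 1" using n complex_norm_square[of h] by simp
 define x where "x = (c + \<bar>y\<bar>) / (y + cmod v) + 1"
 have "(y + cmod v) * x = c + \<bar>y\<bar> + (y + cmod v)" unfolding x_def distrib_left using yv by simp
 moreover have "0 <= x" unfolding x_def using c yv by (intro add_nonneg_nonneg divide_nonneg_pos) auto
 ultimately have x: "0 <= x" "c + \<bar>y\<bar> < (y + cmod v) * x" using yv by linarith+
 define w where "w = of_real (- x) * h"
 have "w * cnj v = of_real (- x * cmod v) * (h * cnj h)" unfolding w_def by (subst n(2)) simp
 then have 1: "Re (w * cnj v) = - x * cmod v" by (simp add: nn)
 have cw: "cmod w = x" using x n by (simp add: w_def norm_mult)
 have r: "x <= radius w" using radius_gt(1)[of w] cw by simp
 have "radius w <= 1 + x" unfolding radius_def cw using x(1) by (intro real_le_lsqrt) (auto simp: power2_eq_square algebra_simps)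
 then have "y * x - \<bar>y\<bar> <= y * radius w"
 proof (cases "0 <= y")
  case True then show ?thesis using mult_left_mono[OF r True] by simp
 next
  case False
  then have "y * (1 + x) <= y * radius w" using \<open>radius w <= 1 + x\<close> by (intro mult_left_mono_neg) auto
  then show ?thesis using False by (simp add: algebra_simps)
 qed
 then have "c < y * radius w - Re (w * cnj v)" using x(2) unfolding 1 by (simp add: algebra_simps)
 then show ?thesis by blast
qed

lemma cm_square_traceless:
 assumes "Re (fst N) = 0" shows "N #* N = (of_real (- cm_det N), 0)"
 using assms unfolding cm_det_def cmod_power2
 by (simp add: cm_mult_def prod_eq_iff complex_eq_iff power2_eq_square algebra_simps)

definition cm_ip :: "cmat => cmat => real" where
 "cm_ip A B = Re (fst A * cnj (fst B)) - Re (snd A * cnj (snd B))"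

lemma cm_det_add: "cm_det (A + r *\<^sub>R B) = cm_det A + 2 * r * cm_ip A B + r\<^sup>2 * cm_det B"
 unfolding cm_det_def cm_ip_def cmod_power2 by (simp add: power2_eq_square algebra_simps)

lemma hyperbolic_normal_form:
 assumes tr: "Re (fst N) = 0" and d: "cm_det N = - n\<^sup>2" and nu: "0 < n"
 obtains B where "0 < cm_det B" "B #* N = (0, of_real n) #* B"
proof -
 define N0 :: cmat where "N0 = (0, of_real n)"
 define J :: cmat where "J = (\<i>, 0)"
 have sq: "N #* N = (of_real (n\<^sup>2), 0)" using cm_square_traceless[OF tr] d by simp
 have sq0: "N0 #* N0 = (of_real (n\<^sup>2), 0)" by (simp add: N0_def cm_mult_def power2_eq_square)
 have d0: "cm_det N0 = - n\<^sup>2" by (simp add: N0_def cm_det_def)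
 have J: "J #* N0 = - (N0 #* J)" "cm_det J = 1" by (simp_all add: J_def N0_def cm_mult_def cm_det_def)
 have "cm_det (N + N0) + cm_det (N - N0) = - 4 * n\<^sup>2"
  using cm_det_add[of N 1 N0] cm_det_add[of N "-1" N0] d d0 by simp
 moreover have "0 < n\<^sup>2" using nu by simp
 ultimately consider "cm_det (N + N0) < 0" | "cm_det (N - N0) < 0" by linarith
 then show ?thesis
 proof cases
  case 1
  let ?B = "N0 #* (N + N0)"
  have "?B #* N = N0 #* ?B"
  by (smt (verit) cm_mult_assoc sq0 cm_mult_add sq add.commute)
  moreover have "0 < cm_det ?B" using 1 \<open>0 < n\<^sup>2\<close> by (simp add: d0 mult_pos_neg)
  ultimately show ?thesis using that unfolding N0_def by blast
 next
  case 2
  let ?A = "N0 #* (J #* (N - N0))"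
  have "?A #* N = - (N0 #* (J #* (N0 #* (N - N0))))" by (simp add: cm_mult_diff sq sq0 cm_mult_assoc)
  also have "J #* (N0 #* (N - N0)) = - ?A"
   by (simp only: cm_mult_assoc[symmetric] J cm_mult_minus)
  finally have "?A #* N = N0 #* ?A"
   by (simp only: cm_mult_minus minus_minus)
  moreover have "0 < cm_det ?A" using 2 \<open>0 < n\<^sup>2\<close> by (simp add: d0 J mult_pos_neg)
  ultimately show ?thesis using that unfolding N0_def by blast
 qed
qed

lemma traceless_part:
 assumes "cm_det b = 1"
 shows "Re (fst (b - (of_real (Re (fst b)), 0))) = 0" (is ?Q)
  "cm_det (b - (of_real (Re (fst b)), 0)) = 1 - (Re (fst b))\<^sup>2" (is ?P)
proof -
 show ?Q by simp
 show ?P using assms by (simp add: cm_det_def cmod_power2)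
qed

lemma hyperbolic_conjugate:
 assumes b: "cm_det b = 1" "cm_det b' = 1" and tr: "Re (fst b') = Re (fst b)" "1 < (Re (fst b))\<^sup>2"
 obtains B where "0 < cm_det B" "B #* b = b' #* B"
proof -
 define u where "u = Re (fst b)"
 define n where "n = sqrt (u\<^sup>2 - 1)"
 have nu: "0 < n" "1 - u\<^sup>2 = - n\<^sup>2" using tr by (simp_all add: n_def u_def)
 note p = traceless_part[OF b(1), folded u_def] traceless_part[OF b(2), unfolded tr(1), folded u_def]
 obtain B1 where B1: "0 < cm_det B1" "B1 #* (b - (of_real u, 0)) = (0, of_real n) #* B1"
  using hyperbolic_normal_form[OF p(1) p(2)[unfolded nu(2)] nu(1)] .
 obtain B2 where B2: "0 < cm_det B2" "B2 #* (b' - (of_real u, 0)) = (0, of_real n) #* B2"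
  using hyperbolic_normal_form[OF p(3) p(4)[unfolded nu(2)] nu(1)] .
 define N0 :: cmat where "N0 = (of_real u, of_real n)"
 have 1: "B1 #* b = N0 #* B1" "B2 #* b' = N0 #* B2"
 proof -
  have N0: "N0 = (of_real u, 0) + (0, of_real n)" by (simp add: N0_def)
  show "B1 #* b = N0 #* B1" using B1(2) unfolding N0 cm_mult_add cm_mult_diff cm_scalar by (simp add: algebra_simps)
  show "B2 #* b' = N0 #* B2" using B2(2) unfolding N0 cm_mult_add cm_mult_diff cm_scalar by (simp add: algebra_simps)
 qed
 have "cm_det B2 *\<^sub>R (b' #* cm_adj B2) = cm_det B2 *\<^sub>R (cm_adj B2 #* N0)" by (metis 1 cm_mult_assoc cm_adj_mult cm_scalar)
 then have "b' #* cm_adj B2 = cm_adj B2 #* N0" using B2(1) by simp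
 then have "(cm_adj B2 #* B1) #* b = b' #* (cm_adj B2 #* B1)" by (metis 1(1) cm_mult_assoc)
 moreover have "0 < cm_det (cm_adj B2 #* B1)" using B1 B2 by simp
 ultimately show ?thesis using that by blast
qed

lemma ucomm_of_intertwiner:
 assumes B: "0 < cm_det B" "B #* umat k = umat k #* umat T #* B"
 obtains l n where "ucomm (uinv k) l = uz (2 * n) &* T"
proof -
 obtain l where l: "B = sqrt (cm_det B) *\<^sub>R umat l" using det_pos_scale[OF B(1)] by blast
 have "sqrt (cm_det B) *\<^sub>R (umat l #* umat k) = sqrt (cm_det B) *\<^sub>R (umat k #* umat T #* umat l)"
  using B(2) by (subst (asm) (1 2) l) simp
 then have "umat l #* umat k = umat k #* umat T #* umat l" using B(1) by simp
 then show ?thesis using ucomm_eq_matrix that by blast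
qed

lemma det_minus_one: "cm_det (umat T - (1, 0)) = 2 - 2 * Re (fst (umat T))"
 using cm_det_umat[of T] unfolding cm_det_def cmod_power2[of "fst _"]
 by (simp add: power2_eq_square algebra_simps)

lemma hyperbolic_lift:
 assumes "1 < Re (fst (umat k))" "\<bar>fst k\<bar> < pi / 2"
 shows "ulo k < 0" "0 < uhi k"
proof -
 define h where "h = arctan (cmod (snd k))"
 have "radius (snd k) * cos (fst k) > radius (snd k) * cos h"
  using assms(1) sin_arctan_radius(2)[of "snd k"] by (simp add: umat_def h_def)
 then have "cos h < cos \<bar>fst k\<bar>" using radius_gt(2)[of "snd k"] by simp
 moreover have "0 <= h" "h < pi / 2" using arctan_ubound[of "cmod (snd k)"] by (auto simp: h_def)
 ultimately have "\<bar>fst k\<bar> < h" using assms(2) by (subst (asm) cos_mono_less_eq) auto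
 then show "ulo k < 0" "0 < uhi k" by (auto simp: ulo_def uhi_def h_def)
qed

lemma hyperbolic_trace:
 assumes "ulo k < 0" "0 < uhi k" shows "1 < Re (fst (umat k))"
proof -
 define h where "h = arctan (cmod (snd k))"
 have t: "\<bar>fst k\<bar> < h" using assms by (auto simp: ulo_def uhi_def h_def)
 have "h < pi / 2" using arctan_ubound[of "cmod (snd k)"] by (auto simp: h_def)
 then have "cos h < cos \<bar>fst k\<bar>" using t by (intro cos_monotone_0_pi) auto
 then have "radius (snd k) * cos h < radius (snd k) * cos (fst k)" using radius_gt(2)[of "snd k"] by simp
 then show ?thesis using sin_arctan_radius(2)[of "snd k"] by (simp add: umat_def h_def)
qed

lemma hyperbolic_fixpoint:
 assumes "ulo k < 0" "0 < uhi k" obtains x where "uact k x = x"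
proof -
 obtain x_1 where x1: "uact k x_1 = x_1 + ulo k" by (rule uact_lo_attained)
 obtain x_2 where x2: "uact k x_2 = x_2 + uhi k" by (rule uact_hi_attained)
 let ?A = "%x. uact k x - x"
 have "connected (?A ` UNIV)"
  by (intro connected_continuous_image continuous_intros connected_UNIV)
 moreover have "ulo k \<in> ?A ` UNIV" using x1 by (intro image_eqI[of _ _ x_1]) simp_all
 moreover have "uhi k \<in> ?A ` UNIV" using x2 by (intro image_eqI[of _ _ x_2]) simp_all
 ultimately have "0 \<in> ?A ` UNIV"
  using connectedD_interval less_imp_le[OF assms(1)] less_imp_le[OF assms(2)] by blast
 then obtain x where "0 = uact k x - x" by blast
 then show ?thesis using that[of x] by linarith
qed

lemma Im_cm_app:
 assumes "cm_app A (cis x) = of_real r * cis y"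
 shows "Im (fst A + snd A * cis (- (2 * x))) = r * sin (y - x)"
proof -
 have "cm_app A (cis x) * cis (- x) = fst A * (cis x * cis (- x)) + snd A * (cis (- x) * cis (- x))"
  by (simp add: cm_app_def cis_cnj algebra_simps)
 also have "\<dots> = fst A + snd A * cis (- (2 * x))" by (simp add: cis_mult)
 finally have e: "cm_app A (cis x) * cis (- x) = fst A + snd A * cis (- (2 * x))" .
 have "fst A + snd A * cis (- (2 * x)) = of_real r * (cis y * cis (- x))"
  unfolding e[symmetric] assms by (rule mult.assoc)
 then show ?thesis by (simp add: cis_mult)
qed

lemma Im_umat_uact:
 obtains r where "0 < r" "Im (fst (umat k) + snd (umat k) * cis (- (2 * x))) = r * sin (uact k x - x)"
 using cm_app_umat_cis[of k x] Im_cm_app by metis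

lemma pfiber_fst_iff:
 "p \<in> fst ` pfiber T <-> (\<exists>k l. p = pproj (uinv k) \<and> ucomm (uinv k) l = T)"
proof
 assume "p \<in> fst ` pfiber T"
 then obtain q where q: "p \<in> ppts" "q \<in> ppts" "pcomm p q = T" by (auto simp: pfiber_def)
 then show "\<exists>k l. p = pproj (uinv k) \<and> ucomm (uinv k) l = T" by (metis lift_pair)
next
 assume "\<exists>k l. p = pproj (uinv k) \<and> ucomm (uinv k) l = T"
 then obtain k l where "p = pproj (uinv k)" "ucomm (uinv k) l = T" by blast
 then have "(p, pproj l) \<in> pfiber T" by (simp add: pfiber_def)
 then show "p \<in> fst ` pfiber T" by force
qed

lemma ucomm_shift: "ucomm (uinv (uz n &* k)) l = ucomm (uinv k) l" (is ?P) "pproj (uinv (uz n &* k)) = pproj (uinv k)" (is ?Q)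
proof -
 have e: "uinv (uz n &* k) = uz (- n) &* uinv k" by (simp add: uinv_mult uz_central)
 show ?P unfolding e by simp
 show ?Q unfolding e pproj_eq_iff by blast
qed

lemma conj_order:
 assumes "ucomm (uinv k) l = T"
 shows "uz n <~ k &* T <-> uz n <~ k" "k &* T <~ uz n <-> k <~ uz n"
 using assms unfolding ucomm_eq_iff by (metis uz_ule_conj)+

lemma elliptic_cone:
 assumes "0 <= ulo k" "uhi k <= pi" shows "cmod (snd (umat k)) <= Im (fst (umat k))"
proof -
 define h where "h = arctan (cmod (snd k))"
 have h: "0 <= h" "h < pi / 2" using arctan_ubound[of "cmod (snd k)"] by (auto simp: h_def)
 have t: "h <= fst k" "fst k <= pi - h" using assms by (simp_all add: ulo_def uhi_def h_def)
 have "sin h <= sin (fst k)"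
 proof (cases "fst k <= pi / 2")
  case True then show ?thesis using t h by (intro sin_monotone_2pi_le) auto
 next
  case False
  then have "sin h <= sin (pi - fst k)" using t h by (intro sin_monotone_2pi_le) auto
  then show ?thesis by simp
 qed
 then have "radius (snd k) * sin h <= radius (snd k) * sin (fst k)" by (intro mult_left_mono) simp_all
 then show ?thesis using sin_arctan_radius(1)[of "snd k"] by (simp add: umat_def norm_mult h_def)
qed

definition halfturn :: "complex => cmat" where
 "halfturn w = (\<i> * of_real (radius w), w)"

lemma halfturn_det: "cm_det (halfturn w) = 1"
 by (simp add: cm_det_def halfturn_def norm_mult power_mult_distrib radius_power2)

lemma pfiber_positive:
 assumes T: "0 < ulo T" "ulo T < pi"
 defines "a \<equiv> fst (umat T)" and "be \<equiv> snd (umat T)"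
 defines "d \<equiv> 2 - 2 * Re a"
 defines "s \<equiv> (1 / sqrt d) *\<^sub>R cm_adj (umat T - (1, 0))"
 shows "fst ` pfiber T = (%w. pmat (cm_adj (halfturn w #* s))) ` {w. sqrt d < Im a * radius w - Re (w * cnj be)}" (is ?P)
  and "0 < Im a + cmod be" and "0 < d"
proof -
 define t where "t = fst T"
 define h where "h = arctan (cmod (snd T))"
 define R where "R = radius (snd T)"
 have R: "0 < R" by (simp add: R_def radius_gt)
 have h: "0 <= h" "h < pi / 2" using arctan_ubound[of "cmod (snd T)"] by (auto simp: h_def)
 have t: "h < t" "t < pi + h" using T by (simp_all add: ulo_def t_def h_def)
 have al: "Re a = R * cos t" "Im a = R * sin t" by (simp_all add: a_def umat_def R_def t_def)
 have be: "cmod be = R * sin h" "R * cos h = 1"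
  using sin_arctan_radius[of "snd T"] by (simp_all add: be_def umat_def norm_mult R_def h_def)
 have "cos t < cos h"
 proof (cases "t <= pi")
  case True then show ?thesis using t h by (intro cos_monotone_0_pi) auto
 next
  case False
  then have "cos (2 * pi - t) < cos h" using t h by (intro cos_monotone_0_pi) auto
  then show ?thesis by simp
 qed
 then show d: "0 < d" by (smt (verit) assms be R mult_less_cancel_left_pos al)
 have "0 < sin ((t + h) / 2)" using t h by (intro sin_gt_zero) auto
 moreover have "0 < cos ((t - h) / 2)" using t h by (intro cos_gt_zero_pi) auto
 ultimately have "0 < R * (sin t + sin h)" using R by (simp add: sin_plus_sin)
 then show "0 < Im a + cmod be" by (simp add: al be distrib_left)
 have dM: "cm_det (umat T - (1, 0)) = d" by (simp add: det_minus_one d_def a_def)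
 have sM: "s #* (umat T - (1, 0)) = (of_real (sqrt d), 0)"
  using d unfolding s_def cm_mult_scaleR cm_adj_mult dM
  by (simp add: scaleR_conv_of_real real_div_sqrt flip: of_real_divide of_real_mult)
 have Ms: "(umat T - (1, 0)) #* s = (of_real (sqrt d), 0)"
  using d unfolding s_def cm_mult_scaleR cm_adj_mult dM
  by (simp add: scaleR_conv_of_real real_div_sqrt flip: of_real_divide of_real_mult)
 have ds: "cm_det s = 1" using d by (simp add: s_def dM power_divide)
 have tr: "Re (fst (halfturn w #* s)) = (Im a * radius w - Re (w * cnj be)) / sqrt d" for w
  by (simp add: s_def halfturn_def cm_mult_def cm_adj_def a_def be_def scaleR_conv_of_real diff_divide_distrib algebra_simps)
 have sqd: "0 < sqrt d" using d by simp
 have Tx: "x < uact T x" "uact T x < x + 2 * pi" for x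
  using uact_lo_hi[where k = T and x = x] ulo_le_uhi(2)[of T] T by linarith+
 show ?P
 proof (intro equalityI subsetI)
  fix p assume "p \<in> fst ` pfiber T"
  then obtain k_0 l where kl0: "p = pproj (uinv k_0)" "ucomm (uinv k_0) l = T" unfolding pfiber_fst_iff by blast
  have "\<exists>n. \<not> k_0 <~ uz n \<and> \<not> uz n <~ k_0"
  proof (rule ccontr)
   assume n: "\<not> (\<exists>n. \<not> k_0 <~ uz n \<and> \<not> uz n <~ k_0)"
   define m where "m = \<lfloor>ulo k_0 / pi\<rfloor>"
   have m: "pi * of_int m <= ulo k_0" "ulo k_0 < pi * of_int (m + 1)"
    using floor_correct[of "ulo k_0 / pi"] unfolding m_def
    by (simp_all only: pos_le_divide_eq pos_divide_less_eq pi_gt_zero mult.commute of_int_add of_int_1)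
   have "uz m <~ k_0" using m(1) by (simp only: ule_uz)
   moreover have "k_0 <~ uz (m + 1)" by (smt (verit) m ule_uz n)
   moreover define k where "k = uz (- m) &* k_0"
   moreover have e: "ucomm (uinv k) l = T" unfolding k_def ucomm_shift using kl0 by simp
   ultimately have "uz 0 <~ k" "k <~ uz 1"
    using ule_move(4)[of "uz m" "uz 0" k_0] ule_move(2)[of k_0 "uz m" "uz 1"] by (simp_all add: uz_add)
   then have "0 <= ulo k" "uhi k <= pi" "0 <= ulo (k &* T)" "uhi (k &* T) <= pi"
    using conj_order[OF e, of 0] conj_order[OF e, of 1] unfolding ule_uz by simp_all
   then have c: "cmod (snd (umat k)) <= Im (fst (umat k))" "cmod (snd (umat (k &* T))) <= Im (fst (umat (k &* T)))"
    by (simp_all add: elliptic_cone)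
   define j where "j = (1 / sqrt d) *\<^sub>R (umat k #* (umat T - (1, 0)))"
   have kT: "umat (k &* T) = umat k + sqrt d *\<^sub>R j" using sqd by (simp add: j_def umat_mult cm_mult_diff)
   have dj: "cm_det j = 1" using d by (simp add: j_def dM power_divide)
   have rj: "Re (fst j) = 0" using matrix_of_ucomm_eq(2)[OF e] by (simp add: j_def cm_mult_diff)
   have "(cmod (snd j))\<^sup>2 < \<bar>Im (fst j)\<bar>\<^sup>2" using dj rj by (simp add: cm_det_def cmod_power2)
   then have cj: "cmod (snd j) < \<bar>Im (fst j)\<bar>" by (rule power2_less_imp_less) simp
   have "1 = 1 + 2 * sqrt d * cm_ip (umat k) j + d"
    using cm_det_add[of "umat k" "sqrt d" j] d unfolding kT[symmetric] by (simp add: dj)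
   then have i1: "cm_ip (umat k) j < 0" using d sqd by (smt (verit) mult_nonneg_nonneg)
   have "umat k = umat (k &* T) + (- sqrt d) *\<^sub>R j" by (simp add: kT)
   then have "1 = 1 + 2 * (- sqrt d) * cm_ip (umat (k &* T)) j + d"
    using cm_det_add[of "umat (k &* T)" "- sqrt d" j] d by (metis cm_det_umat dj mult.right_neutral power2_minus real_sqrt_pow2 less_imp_le)
   then have i2: "0 < cm_ip (umat (k &* T)) j" using d sqd by (smt (verit) mult_nonneg_nonneg mult_minus_left mult_minus_right mult_nonneg_nonpos)
   have ip: "cm_ip A j = Im (fst A) * Im (fst j) - Re (snd A * cnj (snd j))" for A
    by (simp add: cm_ip_def rj)
   have cs: "\<bar>Re (snd A * cnj (snd j))\<bar> <= Im (fst A) * \<bar>Im (fst j)\<bar>" if "cmod (snd A) <= Im (fst A)" for A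
   proof -
    have "\<bar>Re (snd A * cnj (snd j))\<bar> <= cmod (snd A) * cmod (snd j)"
     using abs_Re_le_cmod[of "snd A * cnj (snd j)"] by (simp add: norm_mult)
    also have "\<dots> <= Im (fst A) * \<bar>Im (fst j)\<bar>" using that cj by (intro mult_mono) (auto intro: order_trans[OF norm_ge_zero])
    finally show ?thesis .
   qed
   show False
   proof (cases "0 <= Im (fst j)")
    case True then show False using cs[OF c(1)] i1 unfolding ip by simp
   next
    case False then show False using cs[OF c(2)] i2 unfolding ip by simp
   qed
  qed
  then obtain n where n: "\<not> k_0 <~ uz n" "\<not> uz n <~ k_0" by blast
  define k where "k = uz (- n) &* k_0"
  have e: "ucomm (uinv k) l = T" "p = pproj (uinv k)" unfolding k_def ucomm_shift using kl0 by simp_all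
  have "\<not> k <~ uz 0" "\<not> uz 0 <~ k"
   using n ule_move(4)[of "uz n" "uz 0" k_0] ule_move(2)[of k_0 "uz n" "uz 0"] unfolding k_def by (simp_all add: uz_add)
  then have k: "ulo k < 0" "0 < uhi k" "ulo (k &* T) < 0"
   using conj_order(1)[OF e(1), of 0] unfolding ule_uz by simp_all
  define w where "w = (1 / sqrt d) *\<^sub>R snd (umat k #* (umat T - (1, 0)))"
  define j where "j = (1 / sqrt d) *\<^sub>R (umat k #* (umat T - (1, 0)))"
  have dj: "cm_det j = 1" using d by (simp add: j_def dM power_divide)
  have rj: "Re (fst j) = 0" using matrix_of_ucomm_eq(2)[OF e(1)] by (simp add: j_def cm_mult_diff)
  have kT: "umat (k &* T) = umat k + sqrt d *\<^sub>R j" using sqd by (simp add: j_def umat_mult cm_mult_diff)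
  obtain x where x: "uact k x = x" using hyperbolic_fixpoint[OF k(1,2)] .
  have "x < uact (k &* T) x" using uact_less[OF Tx(1)[of x], of k] x by (simp add: uact_mult)
  moreover have "uact (k &* T) x < x + pi"
   using uact_lo_hi(2)[where k = "k &* T" and x = x] ulo_le_uhi(2)[of "k &* T"] k(3) by linarith
  ultimately have sp: "0 < sin (uact (k &* T) x - x)" by (intro sin_gt_zero) auto
  obtain r where r: "0 < r" "Im (fst (umat (k &* T)) + snd (umat (k &* T)) * cis (- (2 * x))) = r * sin (uact (k &* T) x - x)"
   by (rule Im_umat_uact)
  obtain q where q: "Im (fst (umat k) + snd (umat k) * cis (- (2 * x))) = q * sin (uact k x - x)"
   using Im_umat_uact[of k x] by metis
  have "Im (fst (umat (k &* T)) + snd (umat (k &* T)) * cis (- (2 * x)))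
    = Im (fst (umat k) + snd (umat k) * cis (- (2 * x))) + sqrt d * Im (fst j + snd j * cis (- (2 * x)))"
   unfolding kT by (simp add: algebra_simps)
  then have "0 < sqrt d * Im (fst j + snd j * cis (- (2 * x)))" using r q x sp by simp
  then have "0 < Im (fst j) + Im (snd j * cis (- (2 * x)))" using sqd by (simp add: zero_less_mult_iff)
  moreover have "\<bar>Im (snd j * cis (- (2 * x)))\<bar> <= cmod (snd j)"
   using abs_Im_le_cmod[of "snd j * cis (- (2 * x))"] by (simp add: norm_mult)
  moreover have sqj: "(Im (fst j))\<^sup>2 = 1 + (cmod (snd j))\<^sup>2" using dj rj by (simp add: cm_det_def cmod_power2)
  then have "(cmod (snd j))\<^sup>2 < \<bar>Im (fst j)\<bar>\<^sup>2" by simp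
  then have "cmod (snd j) < \<bar>Im (fst j)\<bar>" by (rule power2_less_imp_less) simp
  ultimately have "Im (fst j) = radius (snd j)" using sqj by (simp add: radius_def real_sqrt_unique)
  then have jw: "j = halfturn w" using rj by (simp add: halfturn_def w_def j_def prod_eq_iff complex_eq_iff)
  have "j #* s = (1 / sqrt d) *\<^sub>R (umat k #* ((umat T - (1, 0)) #* s))"
   by (simp add: j_def cm_mult_assoc)
  then have kw: "umat k = halfturn w #* s" unfolding Ms cm_scalar jw using sqd by simp
  have "1 < Re (fst (umat k))" using hyperbolic_trace k by blast
  then have "sqrt d < Im a * radius w - Re (w * cnj be)" unfolding kw tr using sqd by (simp add: field_simps)
  moreover have "p = pmat (cm_adj (halfturn w #* s))" unfolding kw[symmetric] e(2) by (simp add: umat_inv[symmetric])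
  ultimately show "p \<in> (%w. pmat (cm_adj (halfturn w #* s))) ` {w. sqrt d < Im a * radius w - Re (w * cnj be)}" by blast
 next
  fix p assume "p \<in> (%w. pmat (cm_adj (halfturn w #* s))) ` {w. sqrt d < Im a * radius w - Re (w * cnj be)}"
  then obtain w where w: "p = pmat (cm_adj (halfturn w #* s))" "sqrt d < Im a * radius w - Re (w * cnj be)" by blast
  define b where "b = halfturn w #* s"
  define k :: ucov where "k = (Arg (fst b), snd b * cis (- Arg (fst b)))"
  have kb: "umat k = b" unfolding k_def by (rule umat_surj) (simp add: b_def halfturn_det ds)
  have bt: "1 < Re (fst b)" unfolding b_def tr using w(2) sqd by (simp add: field_simps)
  have "\<bar>fst k\<bar> < pi / 2" unfolding k_def fst_conv by (rule Arg_bound) (use bt in simp)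
  then have k: "ulo k < 0" "0 < uhi k" using hyperbolic_lift[of k] bt kb by simp_all
  have b': "b #* umat T = b + sqrt d *\<^sub>R halfturn w"
  proof -
   have "b #* (umat T - (1, 0)) = sqrt d *\<^sub>R halfturn w" by (simp add: b_def cm_mult_assoc sM cm_scalar)
   then show ?thesis by (simp add: cm_mult_diff algebra_simps)
  qed
  obtain B where B: "0 < cm_det B" "B #* b = (b #* umat T) #* B"
  proof (rule hyperbolic_conjugate[of b "b #* umat T"])
   show "cm_det b = 1" using kb by (metis cm_det_umat)
   then show "cm_det (b #* umat T) = 1" by simp
   show "Re (fst (b #* umat T)) = Re (fst b)" unfolding b' by (simp add: halfturn_def)
   show "1 < (Re (fst b))\<^sup>2" using bt by (simp add: one_less_power)
  qed
  obtain l n where ln: "ucomm (uinv k) l = uz (2 * n) &* T"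
   using ucomm_of_intertwiner[of B k T] B kb by metis
  obtain x where x: "uact k x = x" using hyperbolic_fixpoint[OF k] .
  have 1: "x < uact (k &* T) x" "uact (k &* T) x < x + 2 * pi"
  proof -
   show "x < uact (k &* T) x" using uact_less[OF Tx(1)[of x], of k] x by (simp add: uact_mult)
   have "uact k (uact T x) < uact k (x + pi * of_int 2)" using Tx(2)[of x] by (simp add: mult.commute)
   then show "uact (k &* T) x < x + 2 * pi" unfolding uact_plus_pi x by (simp add: uact_mult mult.commute)
  qed
  obtain r where r: "0 < r" "Im (fst (umat (k &* T)) + snd (umat (k &* T)) * cis (- (2 * x))) = r * sin (uact (k &* T) x - x)"
   by (rule Im_umat_uact)
  obtain q where q: "Im (fst (umat k) + snd (umat k) * cis (- (2 * x))) = q * sin (uact k x - x)"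
   using Im_umat_uact[of k x] by metis
  have "Im (fst (umat (k &* T)) + snd (umat (k &* T)) * cis (- (2 * x)))
    = Im (fst (umat k) + snd (umat k) * cis (- (2 * x))) + sqrt d * Im (fst (halfturn w) + snd (halfturn w) * cis (- (2 * x)))"
   unfolding umat_mult kb b' by (simp add: algebra_simps)
  moreover have "0 < Im (fst (halfturn w) + snd (halfturn w) * cis (- (2 * x)))"
   using abs_Im_le_cmod[of "w * cis (- (2 * x))"] radius_gt(1)[of w] by (simp add: halfturn_def norm_mult)
  moreover have "Im (fst (umat k) + snd (umat k) * cis (- (2 * x))) = 0" unfolding q x by simp
  ultimately have sp: "0 < sin (uact (k &* T) x - x)" by (smt (verit) zero_less_mult_iff r sqd)
  have lt: "uact (k &* T) x - x < pi"
  by (smt (verit) 1 sin_le_zero sp)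
  have c: "l &* k &* uinv l = uz (2 * n) &* (k &* T)"
   using ln unfolding ucomm_eq_iff by (metis umult_assoc uz_central)
  have "\<not> uz 0 <~ l &* k &* uinv l" "\<not> l &* k &* uinv l <~ uz 0"
   using k unfolding uz_ule_conj unfolding ule_uz by simp_all
  then have "ulo (uz (2 * n) &* (k &* T)) < 0" "0 < uhi (uz (2 * n) &* (k &* T))" unfolding c ule_uz by simp_all
  then have "uact (uz (2 * n) &* (k &* T)) x - x < pi" "- pi < uact (uz (2 * n) &* (k &* T)) x - x"
   using uact_lo_hi[where k = "uz (2 * n) &* (k &* T)" and x = x] ulo_le_uhi(2)[of "uz (2 * n) &* (k &* T)"] by linarith+
  then have "uact (k &* T) x + pi * of_int (2 * n) - x < pi" "- pi < uact (k &* T) x + pi * of_int (2 * n) - x"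
   by (simp_all add: uact_mult[of "uz (2 * n)"])
  then have "pi * of_int (2 * n) < pi * 1" "pi * (-2) < pi * of_int (2 * n)" using 1 lt by linarith+
  then have "real_of_int (2 * n) < 1" "-2 < real_of_int (2 * n)" by (simp_all only: mult_less_cancel_left_pos pi_gt_zero)
  then have "n = 0" by linarith
  then have "ucomm (uinv k) l = T" using ln by simp
  moreover have "p = pproj (uinv k)" unfolding w(1) b_def[symmetric] kb[symmetric] by (simp add: umat_inv[symmetric])
  ultimately show "p \<in> fst ` pfiber T" unfolding pfiber_fst_iff by blast
 qed
qed

lemma connected_pfiber_image:
 assumes T: "T ~= uone" and S: "fst ` pfiber T = (%w. pmat (cm_adj (F w))) ` S" "connected S" "continuous_on S F"
  "\<And>w. w \<in> S ==> cm_det (F w) = 1"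
 shows "connected (pfiber T)" "pfiber T ~= {} <-> S ~= {}" (is ?P)
proof -
 have "continuous_on S (%w. pmat (cm_adj (F w)))"
  by (rule continuous_on_compose2[OF continuous_on_pmat]) (use S in \<open>auto intro!: continuous_intros\<close>)
 then have "connected (fst ` pfiber T)" unfolding S(1) using S(2) by (rule connected_continuous_image)
 with T show "connected (pfiber T)" by (rule connected_pfiber)
 show ?P by (metis S(1) image_is_empty)
qed

lemma connected_pfiber_positive:
 assumes T: "0 < ulo T" "ulo T < pi"
 shows "connected (pfiber T)" "pfiber T ~= {}"
proof -
 let ?S = "{w. sqrt (2 - 2 * Re (fst (umat T))) < Im (fst (umat T)) * radius w - Re (w * cnj (snd (umat T)))}"
 define s where "s = (1 / sqrt (2 - 2 * Re (fst (umat T)))) *\<^sub>R cm_adj (umat T - (1, 0))"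
 note * = pfiber_positive[OF T, folded s_def]
 have "T ~= uone" "cm_det s = 1" "continuous_on ?S (%w. halfturn w #* s)"
  using T *(3) unfolding halfturn_def by (auto simp: ulo_def s_def det_minus_one power_divide intro!: continuous_intros)
 moreover have "\<exists>w. w \<in> ?S" unfolding mem_Collect_eq using *(2,3) by (intro cone_region_nonempty) auto
 ultimately show "connected (pfiber T)" "pfiber T ~= {}"
  using connected_pfiber_image[OF _ *(1) connected_cone_region] by (auto simp: halfturn_det)
qed

lemma pfiber_inverse: "pfiber (uinv T) = (%x. (snd x, fst x)) ` pfiber T"
proof -
 have e: "pcomm (snd x) (fst x) = uinv (pcomm (fst x) (snd x))" for x :: "ppt \<times> ppt"
  by (simp add: pcomm_def ucomm_def uinv_mult umult_assoc)
 have "pcomm (fst x) (snd x) = uinv T <-> pcomm (snd x) (fst x) = T" for x :: "ppt \<times> ppt"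
  unfolding e by (metis uinv_uinv)
 then have *: "x \<in> pfiber (uinv T) <-> (snd x, fst x) \<in> pfiber T" for x
  unfolding pfiber_def mem_Collect_eq fst_conv snd_conv by (simp only: conj_ac)
 show ?thesis
 proof (intro equalityI subsetI)
  fix x assume "x \<in> pfiber (uinv T)"
  then show "x \<in> (%x. (snd x, fst x)) ` pfiber T" unfolding * by (rule rev_image_eqI) simp
 next
  fix x assume "x \<in> (%x. (snd x, fst x)) ` pfiber T"
  then obtain y where "x = (snd y, fst y)" "y \<in> pfiber T" by blast
  then show "x \<in> pfiber (uinv T)" unfolding * by simp
 qed
qed

lemma connected_pfiber_negative:
 assumes T: "uhi T < 0" "- pi < uhi T"
 shows "connected (pfiber T)" "pfiber T ~= {}"
proof -
 have 1: "0 < ulo (uinv T)" "ulo (uinv T) < pi" using T by simp_all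
 have e: "pfiber T = (%x. (snd x, fst x)) ` pfiber (uinv T)"
  using pfiber_inverse[of "uinv T"] by simp
 show "connected (pfiber T)" unfolding e
  by (intro connected_continuous_image connected_pfiber_positive 1 continuous_intros)
 show "pfiber T ~= {}" unfolding e using connected_pfiber_positive(2)[OF 1] by blast
qed

lemma ucomm_level:
 assumes T: "ulo T <= 0" "0 <= uhi T" and e: "ucomm k l = uz (2 * n) &* T"
 shows "ucomm k l = T"
proof -
 have "ulo T + pi * of_int (2 * n) < pi" "- pi < uhi T + pi * of_int (2 * n)"
  using ucomm_bounds[of k l] unfolding e by (simp_all add: ulo_def uhi_def uz_mult_left)
 moreover have "- pi < ulo T" "uhi T < pi" using ulo_le_uhi(2)[of T] T by linarith+
 ultimately have "pi * of_int (2 * n) < pi * 2" "pi * (-2) < pi * of_int (2 * n)" by linarith+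
 then have "real_of_int (2 * n) < 2" "-2 < real_of_int (2 * n)" by (simp_all only: mult_less_cancel_left_pos pi_gt_zero)
 then have "n = 0" by linarith
 then show ?thesis using e by simp
qed

definition reflection :: "real \<times> real => cmat" where
 "reflection x = (\<i> * of_real (fst x), of_real (sqrt (1 + (fst x)\<^sup>2)) * cis (snd x))"

lemma reflection_det: "cm_det (reflection x) = -1"
 by (simp add: cm_det_def reflection_def norm_mult)

lemma pfiber_hyperbolic:
 assumes T: "ulo T < 0" "0 < uhi T"
 defines "d \<equiv> 2 * Re (fst (umat T)) - 2"
 defines "s \<equiv> (1 / sqrt d) *\<^sub>R cm_adj (umat T - (1, 0))"
 shows "fst ` pfiber T = range (%x. pmat (cm_adj (reflection x #* s)))" and "cm_det s = -1"
proof -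
 have d: "0 < d" using hyperbolic_trace[OF T] by (simp add: d_def)
 let ?B = "umat T - (1, 0)"
 have dM: "cm_det ?B = - d" by (simp add: det_minus_one d_def)
 have sqd: "0 < sqrt d" using d by simp
 have sM: "s #* ?B = (of_real (- sqrt d), 0)"
  using d unfolding s_def cm_mult_scaleR cm_adj_mult dM
  by (simp add: scaleR_conv_of_real real_div_sqrt flip: of_real_divide of_real_mult)
 have Ms: "?B #* s = (of_real (- sqrt d), 0)"
  using d unfolding s_def cm_mult_scaleR cm_adj_mult dM
  by (simp add: scaleR_conv_of_real real_div_sqrt flip: of_real_divide of_real_mult)
 show ds: "cm_det s = -1" using d by (simp add: s_def dM power_divide)
 let ?A = "%x. pmat (cm_adj (reflection x #* s))"
 show "fst ` pfiber T = range ?A"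
 proof (intro equalityI subsetI)
  fix p assume "p \<in> fst ` pfiber T"
  then obtain k l where e: "p = pproj (uinv k)" "ucomm (uinv k) l = T" unfolding pfiber_fst_iff by blast
  define r where "r = (- (1 / sqrt d)) *\<^sub>R (umat k #* ?B)"
  have dr: "cm_det r = -1" using d by (simp add: r_def dM power_divide)
  have rr: "Re (fst r) = 0" using matrix_of_ucomm_eq(2)[OF e(2)] by (simp add: r_def cm_mult_diff)
  have "(cmod (snd r))\<^sup>2 = 1 + (Im (fst r))\<^sup>2" using dr rr by (simp add: cm_det_def cmod_power2)
  then have "cmod (snd r) = sqrt (1 + (Im (fst r))\<^sup>2)" by (metis abs_norm_cancel real_sqrt_abs)
  then have "reflection (Im (fst r), Arg (snd r)) = r"
   using rr cis_Arg_norm[of "snd r"] by (cases "snd r = 0") (auto simp: reflection_def prod_eq_iff complex_eq_iff)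
  moreover have "r #* s = (- (1 / sqrt d)) *\<^sub>R (umat k #* (?B #* s))"
   by (simp only: r_def cm_mult_scaleR cm_mult_assoc)
  then have "r #* s = umat k" unfolding Ms cm_scalar using sqd by simp
  ultimately have "p = pmat (cm_adj (reflection (Im (fst r), Arg (snd r)) #* s))"
   using e(1) by (simp add: umat_inv[symmetric])
  then show "p \<in> range ?A" by (rule range_eqI)
 next
  fix p assume "p \<in> range ?A"
  then obtain x where p: "p = pmat (cm_adj (reflection x #* s))" by blast
  define b where "b = reflection x #* s"
  have db: "cm_det b = 1" by (simp add: b_def reflection_det ds)
  then obtain k where kb: "umat k = b" using umat_surj by blast
  have b': "b #* umat T = b + (- sqrt d) *\<^sub>R reflection x"
  proof -
   have "b #* ?B = (- sqrt d) *\<^sub>R reflection x" by (simp only: b_def cm_mult_assoc sM cm_scalar)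
   then show ?thesis by (simp add: cm_mult_diff algebra_simps)
  qed
  let ?C = "b #* umat T"
  have tr: "Re (fst ?C) = Re (fst b)" unfolding b' by (simp add: reflection_def)
  have db': "cm_det ?C = 1" by (simp add: db)
  obtain B where B: "0 < cm_det B" "B #* b = ?C #* B"
  proof (cases "1 < (Re (fst b))\<^sup>2")
   case True
   then show ?thesis using that hyperbolic_conjugate[OF db db' tr] by blast
  next
   case False
   define u where "u = Re (fst b)"
   define N where "N = b - (of_real u, 0)"
   define N' where "N' = b #* umat T - (of_real u, 0)"
   have N: "Re (fst N) = 0" "cm_det N = 1 - u\<^sup>2" "Re (fst N') = 0" "cm_det N' = 1 - u\<^sup>2"
    using traceless_part[OF db] traceless_part[OF db'] unfolding N_def N'_def tr u_def by blast+
   have "cm_det (N' - N) = - d" using d by (simp add: N'_def N_def b' reflection_det)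
   moreover have "cm_det (N' + N) + cm_det (N' - N) = 2 * cm_det N' + 2 * cm_det N"
    using cm_det_add[of N' 1 N] cm_det_add[of N' "-1" N] by simp
   ultimately have "0 < cm_det (N' + N)" using N False d by (simp add: u_def)
   moreover have "(N' + N) #* N = N' #* (N' + N)"
    unfolding cm_mult_add cm_square_traceless[OF N(1)] cm_square_traceless[OF N(3)] N(2,4) by simp
   then have "(N' + N) #* b = ?C #* (N' + N)"
   proof -
    have "b = N + (of_real u, 0)" "b #* umat T = N' + (of_real u, 0)" by (simp_all add: N_def N'_def)
    then show ?thesis using \<open>(N' + N) #* N = N' #* (N' + N)\<close>
     by (metis cm_mult_add(1) cm_mult_add(2) cm_scalar)
   qed
   ultimately show ?thesis using that by blast
  qed
  obtain l n where "ucomm (uinv k) l = uz (2 * n) &* T"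
   using ucomm_of_intertwiner[of B k T] B kb by metis
  then have "ucomm (uinv k) l = T" by (rule ucomm_level[rotated 2]) (use T in simp_all)
  moreover have "p = pproj (uinv k)" unfolding p b_def[symmetric] kb[symmetric] by (simp add: umat_inv[symmetric])
  ultimately show "p \<in> fst ` pfiber T" unfolding pfiber_fst_iff by blast
 qed
qed

lemma connected_pfiber_hyperbolic:
 assumes T: "ulo T < 0" "0 < uhi T"
 shows "connected (pfiber T)" "pfiber T ~= {}"
proof -
 define s where "s = (1 / sqrt (2 * Re (fst (umat T)) - 2)) *\<^sub>R cm_adj (umat T - (1, 0))"
 note * = pfiber_hyperbolic[OF T, folded s_def]
 have "T ~= uone" "continuous_on UNIV (%x. reflection x #* s)"
  using T unfolding reflection_def by (auto simp: ulo_def intro!: continuous_intros)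
 then show "connected (pfiber T)" "pfiber T ~= {}"
  using connected_pfiber_image[OF _ *(1) connected_UNIV] *(2) by (simp_all add: reflection_det)
qed

definition horo :: "complex => complex => cmat" where
 "horo v w = (Complex (sqrt (1 + (Im w)\<^sup>2)) (Re w), v * w)"

lemma horo_det: "cmod v = 1 ==> cm_det (horo v w) = 1"
 by (simp add: cm_det_def horo_def norm_mult cmod_power2)

lemma upar_conj_sign:
 assumes z: "cmod v = 1" and e: "l &* upar v p &* uinv l = upar v q"
 shows "0 <= p <-> 0 <= q" (is ?P) "p <= 0 <-> q <= 0" (is ?Q)
proof -
 have lo: "uz 0 <~ upar v r <-> 0 <= r" for r
  unfolding ule_uz ulo_upar[OF z] by (cases "0 <= r") (auto simp: arctan_minus abs_if)
 have hi: "upar v r <~ uz 0 <-> r <= 0" for r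
  unfolding ule_uz uhi_upar[OF z] by (cases "0 <= r") (auto simp: arctan_minus abs_if)
 show ?P using uz_ule_conj(1)[of 0 l "upar v p"] unfolding e lo by simp
 show ?Q using uz_ule_conj(2)[of l "upar v p" 0] unfolding e hi by simp
qed

lemma upar_scale_intertwiner:
 assumes z: "cmod v = 1" and r: "0 < h"
 defines "B \<equiv> (of_real (h + 1), \<i> * v * of_real (h - 1))"
 shows "0 < cm_det B" "B #* (Complex 1 p, of_real p * v) = (Complex 1 (h * p), of_real (h * p) * v) #* B" (is ?P)
proof -
 have zz: "v * cnj v = 1" using z complex_norm_square[of v] by simp
 have "cm_det B = (h + 1)\<^sup>2 - (h - 1)\<^sup>2"
  unfolding B_def cm_det_def fst_conv snd_conv norm_mult norm_of_real z by simp
 also have "\<dots> = 4 * h" by (simp add: power2_eq_square algebra_simps)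
 finally show "0 < cm_det B" using r by simp
 define n :: cmat where "n = (\<i>, v)"
 have c: "(Complex 1 q, of_real q * v) = (1, 0) + q *\<^sub>R n" for q
  by (simp add: n_def scaleR_conv_of_real complex_eq_iff)
 have e: "\<i> * v * of_real (h - 1) * cnj v = \<i> * of_real (h - 1)"
  "v * cnj (\<i> * v * of_real (h - 1)) = - \<i> * of_real (h - 1)"
  using zz by (simp_all add: mult.commute mult.left_commute)
 have "B #* n = h *\<^sub>R (n #* B)"
  unfolding B_def n_def cm_mult_def fst_conv snd_conv e by (simp add: scaleR_conv_of_real algebra_simps)
 then show ?P
  unfolding c by (simp add: cm_mult_add mult.commute)
qed

lemma pfiber_parabolic:
 assumes z: "cmod v = 1" and r: "r ~= 0"
 shows "fst ` pfiber (upar v r) = (%w. pmat (cm_adj (horo v w))) ` (- closed_segment 0 (of_real (- r)))"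
proof -
 define T where "T = upar v r"
 have zz: "v * cnj v = 1" using z complex_norm_square[of v] by simp
 have mT: "umat T = (Complex 1 r, of_real r * v)" unfolding T_def by (rule umat_upar[OF z])
 have Tb: "ulo T <= 0" "0 <= uhi T" unfolding T_def ulo_upar[OF z] uhi_upar[OF z]
  by (cases "0 <= r"; simp add: arctan_minus abs_if)+
 have seg: "w \<in> closed_segment 0 (of_real (- r)) <-> Im w = 0 \<and> Re w * (Re w + r) <= 0" for w
 proof
  assume "w \<in> closed_segment 0 (of_real (- r))"
  then obtain u where u: "0 <= u" "u <= 1" "w = of_real (- u * r)" by (auto simp: in_segment scaleR_conv_of_real)
  have "Re w * (Re w + r) = - (u * (1 - u) * r\<^sup>2)" unfolding u(3) by (simp add: power2_eq_square algebra_simps)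
  moreover have "0 <= u * (1 - u) * r\<^sup>2" using u by simp
  moreover have "Im w = 0" by (simp add: u(3))
  ultimately show "Im w = 0 \<and> Re w * (Re w + r) <= 0" by linarith
 next
  assume w: "Im w = 0 \<and> Re w * (Re w + r) <= 0"
  define u where "u = - Re w / r"
  have "Re w = - u * r" using r by (simp add: u_def)
  then have "(- u * r) * (- u * r + r) <= 0" using w by simp
  then have "u * (u - 1) * r\<^sup>2 <= 0" by (simp add: power2_eq_square algebra_simps)
  then have "u * (u - 1) <= 0" using r by (simp add: mult_le_0_iff)
  then have "0 <= u" "u <= 1" by (auto simp: mult_le_0_iff)
  moreover have "w = u *\<^sub>R of_real (- r)" using w \<open>Re w = - u * r\<close> by (simp add: complex_eq_iff)
  ultimately show "w \<in> closed_segment 0 (of_real (- r))" by (auto simp: in_segment)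
 qed
 have tr: "Re (fst (A #* umat T)) - Re (fst A) = r * (Re (snd A * cnj v) - Im (fst A))" for A
  by (simp add: mT cm_mult_def algebra_simps)
 have horo_mult: "horo v w #* umat T = horo v (w + of_real (r * (sqrt (1 + (Im w)\<^sup>2) + Im w)))" for w
 proof -
  let ?A = "horo v (w + of_real (r * (sqrt (1 + (Im w)\<^sup>2) + Im w)))"
  have "v * w * cnj (of_real r * v) = of_real r * w"
   using zz by (metis (no_types, lifting) complex_cnj_complex_of_real complex_cnj_mult mult.assoc mult.commute mult.right_neutral)
  then have "fst (horo v w #* umat T) = Complex (sqrt (1 + (Im w)\<^sup>2)) (Re w) * Complex 1 r + of_real r * w"
   by (simp add: mT horo_def cm_mult_def)
  also have "\<dots> = fst ?A"
   by (simp add: horo_def complex_eq_iff algebra_simps)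
  finally have 1: "fst (horo v w #* umat T) = fst ?A" .
  have "Complex (sqrt (1 + (Im w)\<^sup>2)) (Re w) * of_real r + w * cnj (Complex 1 r) = w + of_real (r * (sqrt (1 + (Im w)\<^sup>2) + Im w))"
   by (simp add: complex_eq_iff algebra_simps)
  moreover have "snd (horo v w #* umat T) = v * (Complex (sqrt (1 + (Im w)\<^sup>2)) (Re w) * of_real r + w * cnj (Complex 1 r))"
   by (simp add: mT horo_def cm_mult_def algebra_simps)
  ultimately have "snd (horo v w #* umat T) = snd ?A"
   by (simp add: horo_def)
  with 1 show ?thesis by (simp add: prod_eq_iff)
 qed
 have horo_real: "horo v w = (Complex 1 (Re w), of_real (Re w) * v)" if "Im w = 0" for w
  using that by (simp add: horo_def complex_eq_iff)
 have "fst ` pfiber T = (%w. pmat (cm_adj (horo v w))) ` (- closed_segment 0 (of_real (- r)))"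
 proof (intro equalityI subsetI)
  fix a assume "a \<in> fst ` pfiber T"
  then obtain k_0 l where kl0: "a = pproj (uinv k_0)" "ucomm (uinv k_0) l = T" unfolding pfiber_fst_iff by blast
  obtain k where k: "a = pproj (uinv k)" "ucomm (uinv k) l = T" "0 <= Re (fst (umat k))"
  proof (cases "0 <= Re (fst (umat k_0))")
   case True then show ?thesis using kl0 that by blast
  next
   case False
   have "umat (uz 1 &* k_0) = - umat k_0" by (simp add: umat_mult uz_def umat_urot cm_mult_def prod_eq_iff)
   then show ?thesis using kl0 that[of "uz 1 &* k_0"] False by (simp add: ucomm_shift)
  qed
  define w where "w = snd (umat k) * cnj v"
  have sw: "snd (umat k) = v * w" using zz by (simp add: w_def mult.left_commute)
  have "r * (Re (snd (umat k) * cnj v) - Im (fst (umat k))) = 0" using tr[of "umat k"] matrix_of_ucomm_eq(2)[OF k(2)] by simp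
  then have iw: "Im (fst (umat k)) = Re w" using r by (simp add: w_def)
  have "(Re (fst (umat k)))\<^sup>2 = 1 + (Im w)\<^sup>2"
  proof -
   have "1 = (cmod (fst (umat k)))\<^sup>2 - (cmod (snd (umat k)))\<^sup>2" using cm_det_umat[of k] unfolding cm_det_def by simp
   also have "\<dots> = (Re (fst (umat k)))\<^sup>2 + (Re w)\<^sup>2 - (cmod w)\<^sup>2" unfolding sw by (simp add: norm_mult z cmod_power2[of "fst _"] iw)
   finally show ?thesis by (simp add: cmod_power2)
  qed
  then have "Re (fst (umat k)) = sqrt (1 + (Im w)\<^sup>2)" using k(3) by (metis real_sqrt_unique)
  then have kw: "umat k = horo v w" using sw iw by (simp add: horo_def prod_eq_iff complex_eq_iff)
  have "w \<notin> closed_segment 0 (of_real (- r))"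
  proof
   assume "w \<in> closed_segment 0 (of_real (- r))"
   then have w: "Im w = 0" "Re w * (Re w + r) <= 0" unfolding seg by auto
   have "umat k = umat (upar v (Re w))" unfolding kw horo_real[OF w(1)] umat_upar[OF z] ..
   then obtain n where n: "k = uz (2 * n) &* upar v (Re w)" unfolding umat_eq_iff by blast
   then have "ucomm (uinv (upar v (Re w))) l = T" using k(2) by (simp only: ucomm_shift)
   then have "l &* upar v (Re w) &* uinv l = upar v (Re w + r)" unfolding ucomm_eq_iff T_def upar_add[OF z] .
   then show False using upar_conj_sign[OF z, of l "Re w" "Re w + r"] w(2) r by (auto simp: mult_le_0_iff)
  qed
  moreover have "a = pmat (cm_adj (horo v w))" unfolding k(1) kw[symmetric] by (simp add: umat_inv[symmetric])
  ultimately show "a \<in> (%w. pmat (cm_adj (horo v w))) ` (- closed_segment 0 (of_real (- r)))" by blast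
 next
  fix a assume "a \<in> (%w. pmat (cm_adj (horo v w))) ` (- closed_segment 0 (of_real (- r)))"
  then obtain w where w: "a = pmat (cm_adj (horo v w))" "w \<notin> closed_segment 0 (of_real (- r))" by blast
  obtain k where k: "umat k = horo v w" using umat_surj horo_det[OF z] by blast
  define w' where "w' = w + of_real (r * (sqrt (1 + (Im w)\<^sup>2) + Im w))"
  obtain B where B: "0 < cm_det B" "B #* horo v w = (horo v w #* umat T) #* B"
  proof (cases "Im w = 0")
   case True
   then have w': "w' = w + of_real r" by (simp add: w'_def)
   have "0 < Re w * (Re w + r)" using w(2) True unfolding seg by simp
   then have rho: "0 < (Re w + r) / Re w" "(Re w + r) / Re w * Re w = Re w + r"
    by (auto simp: zero_less_mult_iff divide_pos_pos divide_neg_neg)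
   show ?thesis
    using that upar_scale_intertwiner(1)[OF z rho(1)] upar_scale_intertwiner(2)[OF z rho(1), of "Re w"] True w'
    unfolding horo_mult w'_def[symmetric] rho(2) by (simp add: horo_real)
  next
   case False
   then have "1 < (Re (fst (horo v w)))\<^sup>2" by (simp add: horo_def)
   moreover have "Re (fst (horo v w #* umat T)) = Re (fst (horo v w))"
    unfolding horo_mult by (simp add: horo_def)
   ultimately show ?thesis
    using that hyperbolic_conjugate[of "horo v w" "horo v w #* umat T"] by (auto simp: horo_det[OF z])
  qed
  obtain l n where "ucomm (uinv k) l = uz (2 * n) &* T"
   using ucomm_of_intertwiner[of B k T] B k by metis
  then have "ucomm (uinv k) l = T" by (rule ucomm_level[OF Tb])
  moreover have "a = pproj (uinv k)" unfolding w(1) k[symmetric] by (simp add: umat_inv[symmetric])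
  ultimately show "a \<in> fst ` pfiber T" unfolding pfiber_fst_iff by blast
 qed
 then show ?thesis by (simp add: T_def)
qed

lemma connected_pfiber_parabolic:
 assumes z: "cmod v = 1" and r: "r ~= 0"
 shows "connected (pfiber (upar v r))" (is ?P) "pfiber (upar v r) ~= {}" (is ?Q)
proof -
 let ?S = "- closed_segment 0 (of_real (- r) :: complex)"
 have "connected ?S"
  by (intro connected_complement_bounded_convex bounded_closed_segment convex_closed_segment) simp
 moreover have "\<i> \<in> ?S" by (auto simp: in_segment complex_eq_iff)
 moreover have "upar v r ~= uone" "continuous_on ?S (horo v)"
  using r unfolding horo_def[abs_def] Complex_eq by (auto simp: upar_def intro!: continuous_intros)
 ultimately show ?P ?Q
  using connected_pfiber_image[OF _ pfiber_parabolic[OF assms]] horo_det[OF z] by auto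
qed

lemma parabolic_of_bounds:
 assumes T: "T ~= uone" "ulo T <= 0" "0 <= uhi T" "\<not> (ulo T < 0 \<and> 0 < uhi T)"
 obtains v r where "cmod v = 1" "r ~= 0" "T = upar v r"
proof -
 define h where "h = arctan (cmod (snd T))"
 have t: "\<bar>fst T\<bar> = h" using T by (auto simp: ulo_def uhi_def h_def)
 have h: "h < pi / 2" using arctan_ubound[of "cmod (snd T)"] by (simp add: h_def)
 have "cos (fst T) = cos h" using t by (metis cos_abs_real)
 then have tr: "Re (fst (umat T)) = 1" using sin_arctan_radius(2)[of "snd T"] by (simp add: umat_def h_def)
 have "snd T ~= 0"
 proof
  assume "snd T = 0"
  then have "h = 0" by (simp add: h_def)
  then show False using t T(1) \<open>snd T = 0\<close> by (simp add: prod_eq_iff)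
 qed
 then have "0 < h" by (simp add: h_def)
 then have "sin \<bar>fst T\<bar> ~= 0" using t h sin_gt_zero[of h] by simp
 then have "sin (fst T) ~= 0" by (auto simp: abs_if split: if_splits)
 then have "Im (fst (umat T)) ~= 0" by (simp add: umat_def)
 then show ?thesis using that upar_of_trace[OF tr _ HOL.refl] t h by metis
qed

proposition pfiber_connected:
 assumes "T ~= uone" shows "connected (pfiber T)" "pfiber T ~= {} <-> T \<in> uband (-1) 1"
proof -
 have "connected (pfiber T) \<and> (pfiber T ~= {} <-> T \<in> uband (-1) 1)"
 proof (cases "T \<in> uband (-1) 1")
  case False
  have "pfiber T = {}"
  proof (rule ccontr)
   assume "pfiber T ~= {}"
   then obtain p q where "p \<in> ppts" "q \<in> ppts" "pcomm p q = T" by (auto simp: pfiber_def)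
   then have "T \<in> uband (-1) 1" using pcomm_bounds[of p q] by (auto simp: uband_def ule_uz not_le)
   then show False using False by simp
  qed
  then show ?thesis using False by simp
 next
  case True
  then have b: "- pi < uhi T" "ulo T < pi" by (simp_all add: uband_def ule_uz not_le)
  consider "0 < ulo T" | "uhi T < 0" | "ulo T < 0" "0 < uhi T" | "ulo T <= 0" "0 <= uhi T" "\<not> (ulo T < 0 \<and> 0 < uhi T)"
   by linarith
  then show ?thesis
  proof cases
   case 1 then show ?thesis using connected_pfiber_positive b True by blast
  next
   case 2 then show ?thesis using connected_pfiber_negative b True by blast
  next
   case 3 then show ?thesis using connected_pfiber_hyperbolic b True by blast
  next
   case 4
   then obtain v r where "cmod v = 1" "r ~= 0" "T = upar v r" using parabolic_of_bounds assms by metis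
   then show ?thesis using connected_pfiber_parabolic True by blast
  qed
 qed
 then show "connected (pfiber T)" "pfiber T ~= {} <-> T \<in> uband (-1) 1" by blast+
qed

section \<open>Maps with connected fibers\<close>

definition fibered :: "'a::topological_space set => ('a => ucov) => ucov set => bool" where
 "fibered X f I <-> continuous_on X f \<and> (\<forall>C. openin (top_of_set X) C --> open (f ` C)) \<and>
   (\<forall>T. connected {x \<in> X. f x = T}) \<and> f ` X = I"

lemma fibered_vimage_connected:
 assumes f: "fibered X f I" and C: "connected C" "C \<subseteq> I" shows "connected {x \<in> X. f x \<in> C}"
proof -
 have "connected (X \<inter> f -` C)"
 proof (rule connected_open_monotone_preimage)
  show "continuous_on X f" "f ` X = I" using f by (auto simp: fibered_def)
  show "openin (top_of_set I) (f ` U)" if U: "openin (top_of_set X) U" for U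
  by (metis (no_types, lifting) f fibered_def image_mono open_subset openin_imp_subset that)
  show "connected (X \<inter> f -` {y})" for y
  proof -
   have "X \<inter> f -` {y} = {x \<in> X. f x = y}" by auto
   moreover have "connected {x \<in> X. f x = y}" using f unfolding fibered_def by blast
   ultimately show ?thesis by (simp only:)
  qed
 qed (use C in auto)
 moreover have "X \<inter> f -` C = {x \<in> X. f x \<in> C}" by auto
 ultimately show ?thesis by simp
qed

lemma fibered_fusion:
 assumes f: "fibered X f I" and h: "continuous_on Y h"
  and Y: "\<And>T. connected {y \<in> Y. T &* uinv (h y) \<in> I}"
  and J: "\<And>T. {y \<in> Y. T &* uinv (h y) \<in> I} ~= {} <-> T \<in> J"
 shows "fibered (X \<times> Y) (%x. f (fst x) &* h (snd x)) J"
proof -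
 have cf: "continuous_on X f" and op: "\<And>C. openin (top_of_set X) C ==> open (f ` C)"
  and fib: "\<And>T. connected {x \<in> X. f x = T}" and im: "f ` X = I"
  using f by (auto simp: fibered_def)
 have iff: "f x &* h y = T <-> f x = T &* uinv (h y)" for x y T by (rule umult_eq_iff)
 let ?A = "%x. f (fst x) &* h (snd x)"
 have cont: "continuous_on (X \<times> Y) ?A"
  by (intro continuous_intros continuous_on_compose2[OF cf] continuous_on_compose2[OF h]) auto
 have open_im: "open (?A ` C)" if C: "openin (top_of_set (X \<times> Y)) C" for C
 proof (subst open_subopen, intro ballI)
  fix T assume "T \<in> ?A ` C"
  then obtain x y where xy: "(x, y) \<in> C" "T = f x &* h y" by auto
  define U where "U = {x. (x, y) \<in> C}"
  let ?B = "%T. T &* uinv (h y)"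
  have "openin (top_of_set X) U"
  proof -
   obtain W where W: "open W" "C = (X \<times> Y) \<inter> W" using C by (auto simp: openin_open)
   have "U = X \<inter> (%x. (x, y)) -` W" using xy W by (auto simp: U_def)
   moreover have "open ((%x. (x, y)) -` W)" using W by (intro open_vimage continuous_intros)
   ultimately show ?thesis by (simp add: openin_open_Int)
  qed
  then have "open (f ` U)" by (rule op)
  then have "open (?B -` (f ` U))" by (intro open_vimage continuous_intros)
  moreover have "T \<in> ?B -` (f ` U)"
   using xy by (auto simp: U_def umult_assoc)
  moreover have "?B -` (f ` U) \<subseteq> ?A ` C"
  proof
   fix S assume "S \<in> ?B -` (f ` U)"
   then obtain x' where "(x', y) \<in> C" "f x' = S &* uinv (h y)" by (auto simp: U_def)
   then show "S \<in> ?A ` C" using iff[of x' y S] by force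
  qed
  ultimately show "\<exists>V. open V \<and> T \<in> V \<and> V \<subseteq> ?A ` C" by blast
 qed
 have fibT: "connected {x \<in> X \<times> Y. f (fst x) &* h (snd x) = T}" for T
 proof -
  define Z where "Z = {x \<in> X \<times> Y. f (fst x) &* h (snd x) = T}"
  define B where "B = {y \<in> Y. T &* uinv (h y) \<in> I}"
  have ZB: "snd ` Z = B" unfolding Z_def B_def using im iff by (auto simp: image_iff) metis
  have "connected (Z \<inter> snd -` B)"
  proof (rule connected_open_monotone_preimage[OF _ ZB])
   show "continuous_on Z snd" by (intro continuous_intros)
   show "openin (top_of_set B) (snd ` U)" if U: "openin (top_of_set Z) U" for U
   proof (subst openin_subopen, intro ballI)
    fix y assume "y \<in> snd ` U"
    then obtain x where xy: "(x, y) \<in> U" by auto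
    obtain W where W: "open W" "U = Z \<inter> W" using U by (auto simp: openin_open)
    obtain W1 W2 where W12: "open W1" "open W2" "x \<in> W1" "y \<in> W2" "W1 \<times> W2 \<subseteq> W"
     using W xy by (metis IntD2 open_prod_elim mem_Sigma_iff)
    have o: "open (f ` (X \<inter> W1))" using W12 by (intro op openin_open_Int)
    have xyZ: "x \<in> X" "y \<in> Y" "f x = T &* uinv (h y)" using xy W iff by (auto simp: Z_def)
    let ?C = "%y. T &* uinv (h y)"
    have "continuous_on Y ?C" by (intro continuous_intros h)
    then have "openin (top_of_set Y) (Y \<inter> ?C -` (f ` (X \<inter> W1)))"
     using o by (rule continuous_openin_preimage_gen)
    then obtain V where V: "open V" "Y \<inter> ?C -` (f ` (X \<inter> W1)) = Y \<inter> V"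
     by (auto simp: openin_open)
    have "y \<in> B \<inter> (V \<inter> W2)"
    proof -
     have "T &* uinv (h y) \<in> f ` (X \<inter> W1)" using xyZ W12 by (metis IntI image_eqI)
     then have "y \<in> V" using V xyZ by blast
     moreover have "f x \<in> I" using xyZ(1) im by blast
     then have "y \<in> B" using xyZ(2) unfolding xyZ(3) B_def by blast
     ultimately show ?thesis using W12 by blast
    qed
    moreover have "B \<inter> (V \<inter> W2) \<subseteq> snd ` U"
    proof
     fix y' assume y': "y' \<in> B \<inter> (V \<inter> W2)"
     then have "y' \<in> Y" by (simp add: B_def)
     then have "T &* uinv (h y') \<in> f ` (X \<inter> W1)" using y' V by blast
     then obtain x' where x': "x' \<in> X" "x' \<in> W1" "f x' = T &* uinv (h y')" by force
     then have "(x', y') \<in> Z" using \<open>y' \<in> Y\<close> iff by (simp add: Z_def)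
     moreover have "(x', y') \<in> W" using x' y' W12 by blast
     ultimately show "y' \<in> snd ` U" unfolding W(2) by force
    qed
    moreover have "openin (top_of_set B) (B \<inter> (V \<inter> W2))"
     using V(1) W12(2) by (intro openin_open_Int open_Int)
    ultimately show "\<exists>V. openin (top_of_set B) V \<and> y \<in> V \<and> V \<subseteq> snd ` U" by blast
   qed
   fix y assume "y \<in> B"
   then have "y \<in> Y" by (simp add: B_def)
   then have "Z \<inter> snd -` {y} = (%x. (x, y)) ` {x \<in> X. f x = T &* uinv (h y)}"
    using iff by (auto simp: Z_def)
   then show "connected (Z \<inter> snd -` {y})"
    by (simp only:) (intro connected_continuous_image[OF _ fib] continuous_intros)
  qed (use Y in \<open>auto simp: B_def\<close>)
  moreover have "Z \<inter> snd -` B = Z" using ZB by auto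
  ultimately show ?thesis by (simp add: Z_def)
 qed
 have "?A ` (X \<times> Y) = J"
 proof (intro equalityI subsetI)
  fix T assume "T \<in> ?A ` (X \<times> Y)"
  then obtain x y where xy: "x \<in> X" "y \<in> Y" "T = f x &* h y" by auto
  then have "T &* uinv (h y) \<in> I" using im by (auto simp: umult_assoc)
  then show "T \<in> J" using xy J by blast
 next
  fix T assume "T \<in> J"
  then obtain y where y: "y \<in> Y" "T &* uinv (h y) \<in> I" using J by blast
  then obtain x where "x \<in> X" "f x = T &* uinv (h y)" using im by (metis imageE)
  then have "f x &* h y = T" using iff by blast
  then show "T \<in> ?A ` (X \<times> Y)"
   using \<open>x \<in> X\<close> y by (intro image_eqI[of _ _ "(x, y)"]) auto
 qed
 then show ?thesis unfolding fibered_def using cont open_im fibT by blast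
qed

lemma fibered_iso:
 assumes f: "fibered X f I" and c: "continuous_on X ph" "continuous_on Y z"
  and ph: "\<And>x. x \<in> X ==> ph x \<in> Y" "\<And>x. x \<in> X ==> z (ph x) = x" "\<And>x. x \<in> X ==> h (ph x) = f x"
  and z: "\<And>y. y \<in> Y ==> z y \<in> X" "\<And>y. y \<in> Y ==> ph (z y) = y"
 shows "fibered Y h I"
proof -
 have h: "h y = f (z y)" if "y \<in> Y" for y using ph(3) z that by metis
 have im: "h ` C = f ` (X \<inter> ph -` C)" if "C \<subseteq> Y" for C
  using that ph(3) z h by (force simp: image_iff)
 have "continuous_on Y (%y. f (z y))"
  using f z(1) unfolding fibered_def by (intro continuous_on_compose2[OF _ c(2)]) auto
 then have "continuous_on Y h" by (rule continuous_on_eq) (use h in auto)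
 moreover have "open (h ` C)" if C: "openin (top_of_set Y) C" for C
  using f continuous_openin_preimage[OF c(1) _ C] ph(1) im[OF openin_imp_subset[OF C]] by (auto simp: fibered_def)
 moreover have "connected {y \<in> Y. h y = T}" for T
 proof -
  have "{y \<in> Y. h y = T} = ph ` {x \<in> X. f x = T}" using ph z h by (force simp: image_iff)
  then show ?thesis using f continuous_on_subset[OF c(1)] connected_continuous_image unfolding fibered_def by (metis (mono_tags, lifting) mem_Collect_eq subsetI)
 qed
 moreover have "h ` Y = f ` X" using im[of Y] ph(1) by (metis Int_absorb2 image_subsetI subset_refl image_subset_iff_subset_vimage)
 ultimately show ?thesis using f unfolding fibered_def by blast
qed

lemma fibered_extend:
 assumes f: "fibered X f I" and X: "X \<subseteq> X'" "continuous_on X' f"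
  and cl: "\<And>x. x \<in> X' ==> x \<notin> X ==> x \<in> closure {y \<in> X. f y = f x}"
 shows "fibered X' f I"
proof -
 have op: "\<And>C. openin (top_of_set X) C ==> open (f ` C)"
  and fib: "\<And>T. connected {x \<in> X. f x = T}" and im: "f ` X = I"
  using f by (auto simp: fibered_def)
 have cl': "x \<in> closure {y \<in> X. f y = f x}" if "x \<in> X'" for x
  using cl[OF that] closure_subset[of "{y \<in> X. f y = f x}"] by auto
 have meet: "\<exists>y \<in> X \<inter> U. f y = f x" if "open U" "x \<in> X'" "x \<in> U" for U x
 proof -
  have "U \<inter> {y \<in> X. f y = f x} ~= {}" using cl'[OF that(2)] that(1,3) open_Int_closure_eq_empty by blast
  then show ?thesis by auto
 qed
 have "open (f ` C)" if C: "openin (top_of_set X') C" for C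
 proof -
  obtain U where U: "open U" "C = X' \<inter> U" using C by (auto simp: openin_open)
  have "f ` C = f ` (X \<inter> U)" using meet[OF U(1)] X(1) unfolding U(2) by (auto simp: image_iff) metis
  then show ?thesis using op[of "X \<inter> U"] U(1) by (simp add: openin_open_Int)
 qed
 moreover have "connected {x \<in> X'. f x = T}" for T
  by (rule connected_intermediate_closure[OF fib[of T]]) (use X(1) cl' in auto)
 moreover have "f ` X' = I" unfolding im[symmetric] using X(1) meet[of UNIV] by (auto simp: image_iff) metis
 ultimately show ?thesis unfolding fibered_def using X(2) by blast
qed

section \<open>Pairs with prescribed commutator\<close>

lemma fibered_npairs: "fibered npairs (%x. pcomm (fst x) (snd x)) (uband (-1) 1 - {uone})"
proof -
 have 1: "{x \<in> npairs. pcomm (fst x) (snd x) = T} = (if T = uone then {} else pfiber T)" for T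
  by (auto simp: npairs_def pfiber_def)
 let ?A = "%x. pcomm (fst x) (snd x)"
 have "continuous_on npairs ?A"
  by (intro continuous_intros) (auto simp: npairs_def)
 moreover have "?A ` npairs = uband (-1) 1 - {uone}"
 proof -
  have "T \<in> ?A ` npairs <-> {x \<in> npairs. pcomm (fst x) (snd x) = T} ~= {}" for T by blast
  then have "T \<in> ?A ` npairs <-> T \<in> uband (-1) 1 - {uone}" for T
   unfolding 1 using pfiber_connected(2)[of T] by (cases "T = uone") simp_all
  then show ?thesis by blast
 qed
 ultimately show ?thesis unfolding fibered_def 1 using open_pcomm_image pfiber_connected(1) by simp
qed

lemma npairs_near:
 assumes k: "Im (fst (umat k)) ~= 0 \<or> snd (umat k) ~= 0"
 shows "(pproj k, pproj l) \<in> closure npairs"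
proof -
 obtain X where X: "umat k #* X ~= X #* umat k"
 proof (cases "snd (umat k) = 0")
  case True
  then show ?thesis using k complex_eq_iff that by (force simp: cm_mult_def)
 next
  case False
  then have "umat k #* (\<i>, 0) ~= (\<i>, 0) #* umat k" by (auto simp: cm_mult_def complex_eq_iff)
  then show ?thesis by (rule that)
 qed
 show ?thesis
 proof (cases "pcomm (pproj k) (pproj l) = uone")
  case False
  then show ?thesis using closure_subset by (force simp: npairs_def)
 next
  case True
  have comm: "umat k #* umat l' = umat l' #* umat k" if "ucomm k l' = uone" for l'
  by (metis ucomm_def that umult_eq_iff umult_one umat_mult)
  have kl: "umat k #* umat l = umat l #* umat k" using comm True by simp
  define b where "b = (%s. umat l #* ((1, 0) + s *\<^sub>R X))"
  have "(b ---> umat l #* ((1, 0) + 0 *\<^sub>R X)) (at_right 0)" unfolding b_def by (intro tendsto_intros)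
  then have lb: "(b ---> umat l) (at_right 0)" by (simp add: zero_prod_def[symmetric])
  then have "((%s. cm_det (b s)) ---> cm_det (umat l)) (at_right 0)" by (intro tendsto_intros)
  then have d: "eventually (%s. 0 < cm_det (b s)) (at_right 0)" by (rule order_tendstoD) simp
  moreover have "eventually (%s. 0 < s) (at_right (0 :: real))" by (simp add: eventually_at_filter)
  ultimately have ev: "eventually (%s. (pproj k, pmat (b s)) \<in> npairs) (at_right 0)"
  proof eventually_elim
   case (elim s)
   obtain l' where l': "b s = sqrt (cm_det (b s)) *\<^sub>R umat l'" "pmat (b s) = pproj l'" using det_pos_scale[OF elim(1)] .
   have "ucomm k l' ~= uone"
   proof
    assume "ucomm k l' = uone"
    then have "umat k #* b s = b s #* umat k" by (subst (1 2) l'(1)) (simp add: comm)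
    then have "s *\<^sub>R (umat k #* umat l #* X) = s *\<^sub>R (umat l #* X #* umat k)"
     by (simp add: b_def cm_mult_add cm_mult_assoc[symmetric] kl)
    then have "umat l #* (umat k #* X) = umat l #* (X #* umat k)" using elim(2) by (simp add: kl cm_mult_assoc)
    then show False using X by (metis cm_adj_cancel(3) cm_det_umat)
   qed
   then show ?case unfolding l'(2) by (simp add: npairs_def)
  qed
  have "((%s. (pproj k, pmat (b s))) ---> (pproj k, pproj l)) (at_right 0)"
   using tendsto_pmat[OF lb] by (intro tendsto_intros) simp
  then show ?thesis using ev by (intro Lim_in_closed_set[OF closed_closure])
   (auto elim!: eventually_mono intro: subsetD[OF closure_subset])
 qed
qed

lemma npairs_dense: "ppts \<times> ppts \<subseteq> closure npairs"
proof
 fix x assume x: "x \<in> ppts \<times> ppts"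
 then obtain k l where kl: "x = (pproj k, pproj l)" by (metis SigmaE pproj_surj)
 show "x \<in> closure npairs"
 proof (cases "Im (fst (umat k)) ~= 0 \<or> snd (umat k) ~= 0")
  case True then show ?thesis using npairs_near kl by simp
 next
  case False
  then have s: "snd k = 0" "sin (fst k) = 0" by (simp_all add: umat_def)
  let ?A = "%h. (pproj (urot h &* k), pproj l)"
  have "(?A ---> (pproj (urot 0 &* k), pproj l)) (at_right 0)"
   unfolding pproj_def urot_mult_left fst_conv snd_conv by (intro tendsto_intros)
  then have lim: "(?A ---> x) (at_right 0)"
   by (simp add: kl urot_mult_left)
  have "eventually (%h. h \<in> {0<..<pi}) (at_right (0 :: real))" by (rule eventually_at_right_real) simp
  then have "eventually (%h. (pproj (urot h &* k), pproj l) \<in> closure npairs) (at_right 0)"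
  proof eventually_elim
   case (elim h)
   have "cos (fst k) ~= 0" using sin_cos_squared_add[of "fst k"] s(2) by auto
   moreover have "0 < sin h" using elim by (intro sin_gt_zero) auto
   ultimately have "sin (h + fst k) ~= 0" using s(2) by (simp add: sin_add)
   then show ?case by (intro npairs_near) (simp add: umat_def urot_mult_left s)
  qed
  then show ?thesis using lim by (intro Lim_in_closed_set[OF closed_closure]) auto
 qed
qed

lemma pairs_split:
 assumes ab: "a < b" and E: "finite E"
 defines "I \<equiv> uband a b - E"
 shows "connected {y \<in> ppts \<times> ppts. T &* uinv (pcomm (fst y) (snd y)) \<in> I}"
  "{y \<in> ppts \<times> ppts. T &* uinv (pcomm (fst y) (snd y)) \<in> I} ~= {} <-> T \<in> uband (a - 2) (b + 2)"
proof -
 define YT where "YT = {y \<in> ppts \<times> ppts. T &* uinv (pcomm (fst y) (snd y)) \<in> I}"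
 define F where "F = insert uone ((%e. uinv e &* T) ` E)"
 define K where "K = ubands T a b - F"
 have F: "finite F" using E by (simp add: F_def)
 have "open I" unfolding I_def using E by (intro open_Diff open_uband finite_imp_closed)
 have K: "k \<in> K <-> k \<in> uband (-1) 1 \<and> k ~= uone \<and> T &* uinv k \<in> I" for k
 proof -
  have e: "T &* uinv k = e <-> k = uinv e &* T" for e
  by (metis umult_eq_iff)
  have "T &* uinv k \<in> E <-> k \<in> (%e. uinv e &* T) ` E"
   unfolding image_iff e[symmetric] by simp
  then show ?thesis unfolding K_def F_def ubands_def I_def by blast
 qed
 define N where "N = {x \<in> npairs. pcomm (fst x) (snd x) \<in> K}"
 have "connected N" unfolding N_def
  using ubands_delete(1)[OF ab F, of T] K by (intro fibered_vimage_connected[OF fibered_npairs]) (auto simp: K_def)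
 moreover have sub: "N \<subseteq> YT"
  unfolding N_def by (auto simp: YT_def npairs_def K)
 moreover have cl: "YT \<subseteq> closure N"
 proof
  fix y assume y: "y \<in> YT"
  let ?A = "%y. T &* uinv (pcomm (fst y) (snd y))"
  have "continuous_on (ppts \<times> ppts) ?A"
   by (intro continuous_intros) auto
  then have "openin (top_of_set (ppts \<times> ppts)) (ppts \<times> ppts \<inter> ?A -` I)"
   using \<open>open I\<close> by (rule continuous_openin_preimage_gen)
  then obtain U where U: "open U" "ppts \<times> ppts \<inter> ?A -` I = ppts \<times> ppts \<inter> U"
   by (auto simp: openin_open)
  have "y \<in> U" "y \<in> closure npairs" using y U npairs_dense by (auto simp: YT_def)
  then have "y \<in> closure (U \<inter> npairs)" using open_Int_closure_subset[OF U(1)] by blast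
  moreover have "U \<inter> npairs \<subseteq> N"
  proof
   fix x assume x: "x \<in> U \<inter> npairs"
   then have p: "fst x \<in> ppts" "snd x \<in> ppts" "pcomm (fst x) (snd x) ~= uone" by (auto simp: npairs_def)
   then have "x \<in> ppts \<times> ppts \<inter> U" using x by (auto simp: mem_Times_iff)
   then have "T &* uinv (pcomm (fst x) (snd x)) \<in> I" unfolding U(2)[symmetric] by simp
   moreover have "pcomm (fst x) (snd x) \<in> uband (-1) 1"
    using pcomm_bounds[OF p(1,2)] by (simp add: uband_def ule_uz not_le)
   ultimately show "x \<in> N" using x p K by (auto simp: N_def)
  qed
  ultimately show "y \<in> closure N" using closure_mono by blast
 qed
 ultimately show "connected YT" by (rule connected_intermediate_closure)
 have "YT ~= {} <-> N ~= {}"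
  using sub cl by (cases "N = {}") auto
 also have "\<dots> <-> K ~= {}"
 proof -
  have "K \<subseteq> (%x. pcomm (fst x) (snd x)) ` npairs" using fibered_npairs K by (auto simp: fibered_def)
  then show ?thesis unfolding N_def by blast
 qed
 also have "\<dots> <-> T \<in> uband (a - 2) (b + 2)" unfolding K_def by (rule ubands_delete(2)[OF ab F])
 finally show "YT ~= {} <-> T \<in> uband (a - 2) (b + 2)" .
qed

section \<open>Products of parabolic elements\<close>

definition ppairs :: "(complex \<times> complex) set" where
 "ppairs = {x. fst x ~= 0 \<and> snd x ~= 0 \<and> sgn (fst x) ~= sgn (snd x)}"

definition pprod :: "real => real => complex \<times> complex => ucov" where
 "pprod s t x = upp s (fst x) &* upp t (snd x)"

definition axial :: "ucov => complex => real" where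
 "axial T v = Im (fst (umat T)) - Re (snd (umat T) * cnj v)"

lemma axial_udisp:
 assumes z: "cmod v = 1" obtains r where "0 < r" "axial T v = r * sin (udisp T v)"
proof -
 obtain h where h: "cis (2 * h) = \<i> * v" using axis_exists[OF z] .
 obtain r where r: "0 < r" "Im (fst (umat T) + snd (umat T) * cis (- (2 * h))) = r * sin (uact T h - h)"
  by (rule Im_umat_uact)
 have "axial T v = r * sin (udisp T v)"
  using r(2) unfolding axis_cnj[OF h] uact_axis[OF h] axial_def by (simp add: algebra_simps)
 then show ?thesis using that r(1) by blast
qed

lemma axial_pos:
 assumes "cmod v = 1" "0 < udisp T v" "udisp T v < pi" shows "0 < axial T v"
 using axial_udisp[OF assms(1), of T] sin_gt_zero[OF assms(2,3)] by (metis mult_pos_pos)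

lemma udisp_of_axial:
 assumes "cmod v = 1" "0 < axial T v" "- pi < udisp T v" "udisp T v < 2 * pi"
 shows "0 < udisp T v" "udisp T v < pi"
proof -
 have s: "0 < sin (udisp T v)" using axial_udisp[OF assms(1), of T] assms(2) by (metis zero_less_mult_pos)
 show "0 < udisp T v"
 proof (rule ccontr)
  assume "\<not> 0 < udisp T v"
  then have "0 <= sin (- udisp T v)" using assms by (intro sin_ge_zero) auto
  then show False using s by simp
 qed
 show "udisp T v < pi"
 by (smt (verit) assms sin_le_zero s)
qed

lemma udisp_bounds:
 assumes "cmod v = 1" shows "ulo T <= udisp T v" "udisp T v <= uhi T"
proof -
 obtain h where h: "cis (2 * h) = \<i> * v" using axis_exists[OF assms] .
 show "ulo T <= udisp T v" "udisp T v <= uhi T"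
  using uact_lo_hi[where k = T and x = h] unfolding uact_axis[OF h] by linarith+
qed

lemma udisp_mult_upar:
 assumes "cmod v = 1" shows "udisp (T &* upar v r) v = udisp T v"
by (smt (verit) uact_mult upar_fix axis_exists assms uact_axis)

lemma upar_bounds:
 assumes "cmod v = 1"
 shows "0 <= r ==> ulo (upar v r) = 0" "r <= 0 ==> uhi (upar v r) = 0" "- pi < ulo (upar v r)" "uhi (upar v r) < pi"
  "ulo (upar v r) <= 0" (is ?P) "0 <= uhi (upar v r)" (is ?Q)
proof -
 have b: "arctan r < pi / 2" "- (pi / 2) < arctan r"
  "0 <= r <-> 0 <= arctan r" "r <= 0 <-> arctan r <= 0" using arctan_ubound[of r] arctan_lbound[of r] by auto
 have u: "ulo (upar v r) = (if 0 <= r then 0 else 2 * arctan r)" "uhi (upar v r) = (if r <= 0 then 0 else 2 * arctan r)"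
  unfolding ulo_upar[OF assms] uhi_upar[OF assms] by (auto simp: abs_if arctan_minus)
 show "0 <= r ==> ulo (upar v r) = 0" "r <= 0 ==> uhi (upar v r) = 0" "- pi < ulo (upar v r)" "uhi (upar v r) < pi"
  ?P ?Q
  unfolding u b(3,4) using b(1,2) pi_gt_zero by (cases "0 <= arctan r"; cases "arctan r <= 0"; simp only: if_True if_False; linarith)+
qed

lemma udisp_upar_pos:
 assumes "cmod v = 1" "cmod h = 1" "v ~= h" "0 < r"
 shows "0 < udisp (upar h r) v" (is ?Q) "udisp (upar h r) v < pi" (is ?P)
proof -
 have "(cmod (h - v))\<^sup>2 = (cmod h)\<^sup>2 + (cmod v)\<^sup>2 - 2 * Re (h * cnj v)"
  unfolding cmod_power2 by (simp add: power2_eq_square algebra_simps)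
 moreover have "0 < (cmod (h - v))\<^sup>2" using assms by simp
 ultimately have "0 < r * (1 - Re (h * cnj v))" using assms by simp
 then have "0 < axial (upar h r) v" by (simp add: axial_def umat_upar assms algebra_simps)
 moreover have "- pi < udisp (upar h r) v" "udisp (upar h r) v < 2 * pi"
  using udisp_bounds[OF assms(1), of "upar h r"] upar_bounds[OF assms(2), of r] assms(4) by linarith+
 ultimately show ?Q ?P
  using udisp_of_axial[OF assms(1)] by blast+
qed

definition psol :: "ucov => complex => real" where
 "psol T v = (1 - Re (fst (umat T))) / axial T v"

definition psec :: "ucov => complex => complex \<times> complex" where
 "psec T v = (snd (umat (T &* upar v (- psol T v))), of_real \<bar>psol T v\<bar> * v)"

lemma trace_mult_upar:
 assumes "cmod v = 1"
 shows "Re (fst (umat (T &* upar v (- q)))) = Re (fst (umat T)) + q * axial T v"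
 by (simp add: umat_mult umat_upar assms cm_mult_def axial_def algebra_simps)

lemma umat_upp: "w ~= 0 ==> snd (umat (upp 1 w)) = w"
 using polar[of w] by (simp add: upp_def umat_upar cmod_sgn)

lemma psec_recover:
 assumes x: "x \<in> ppairs" and t: "t = 1 \<or> t = -1"
 defines "T \<equiv> pprod 1 t x" and "v \<equiv> sgn (snd x)"
 shows "0 < udisp T v" "udisp T v < pi" "0 < t * (1 - Re (fst (umat T)))" (is ?P) "psec T v = x"
proof -
 have z: "cmod v = 1" "cmod (sgn (fst x)) = 1" using x by (simp_all add: ppairs_def v_def cmod_sgn)
 have T: "T = upar (sgn (fst x)) (cmod (fst x)) &* upar v (t * cmod (snd x))" by (simp add: T_def pprod_def upp_def v_def)
 show d: "0 < udisp T v" "udisp T v < pi"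
  unfolding T udisp_mult_upar[OF z(1)] using x z by (auto intro!: udisp_upar_pos simp: ppairs_def v_def)
 have a: "0 < axial T v" using axial_pos[OF z(1) d] .
 have k: "T &* upar v (- (t * cmod (snd x))) = upp 1 (fst x)"
  unfolding T umult_assoc upar_add[OF z(1)] by (simp add: upp_def)
 have "Re (fst (umat T)) + t * cmod (snd x) * axial T v = 1"
  unfolding trace_mult_upar[OF z(1), symmetric] k by (simp add: upp_def umat_upar z)
 then have q: "1 - Re (fst (umat T)) = t * cmod (snd x) * axial T v" by simp
 then have p: "psol T v = t * cmod (snd x)" using a by (simp add: psol_def)
 show ?P using x t a q by (auto simp: ppairs_def)
 have "\<bar>psol T v\<bar> = cmod (snd x)" using t unfolding p by auto
 then show "psec T v = x"
  using x polar[of "snd x"] unfolding psec_def p k by (simp add: prod_eq_iff ppairs_def umat_upp v_def)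
qed

lemma psec_solution:
 assumes z: "cmod v = 1" and t: "t = 1 \<or> t = -1"
  and d: "0 < udisp T v" "udisp T v < pi" and q: "0 < t * (1 - Re (fst (umat T)))"
 shows "psec T v \<in> ppairs" "pprod 1 t (psec T v) = T" (is ?Q) "sgn (snd (psec T v)) = v" (is ?P)
proof -
 have a: "0 < axial T v" using axial_pos[OF z d] .
 have p: "0 < t * psol T v" using q a by (simp add: psol_def)
 then have p': "psol T v ~= 0" "t * \<bar>psol T v\<bar> = psol T v" using t by auto
 define k where "k = T &* upar v (- psol T v)"
 have tr: "Re (fst (umat k)) = 1" unfolding k_def trace_mult_upar[OF z] using a by (simp add: psol_def)
 obtain h where h: "cis (2 * h) = \<i> * v" using axis_exists[OF z] .
 have k_h: "uact k h = h + udisp T v"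
  unfolding uact_axis[OF h] k_def udisp_mult_upar[OF z] ..
 then obtain b r where e: "cmod b = 1" "0 < r" "k = upar b r" "of_real r * b = snd (umat k)"
  using parabolic_of_trace[OF tr, of h] d by auto
 have u: "fst (psec T v) = of_real r * b" unfolding psec_def k_def[symmetric] e(4) by simp
 have sn: "sgn (fst (psec T v)) = b" "cmod (fst (psec T v)) = r" unfolding u using sgn_polar[OF e(1,2)] by auto
 show sv: ?P unfolding psec_def using sgn_polar(1)[OF z, of "\<bar>psol T v\<bar>"] p' by simp
 have "b ~= v"
 proof
  assume "b = v"
  then have "uact k h = h" using e upar_fix[OF z h] by simp
  then show False using k_h d by simp
 qed
 moreover have "snd (psec T v) ~= 0" "fst (psec T v) ~= 0"
  using sv z sn e by auto
 ultimately show "psec T v \<in> ppairs" using sn sv by (simp add: ppairs_def)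
 have 1: "upp 1 (fst (psec T v)) = k" unfolding upp_def sn using e by simp
 have 2: "upp t (snd (psec T v)) = upar v (psol T v)" using assms sv p' by (simp add: psec_def norm_mult upp_def)
 show ?Q
  unfolding pprod_def 1 2 k_def umult_assoc upar_add[OF z] by simp
qed

lemma continuous_on_axial [continuous_intros]:
 "continuous_on S f ==> continuous_on S g ==> continuous_on S (%x. axial (f x) (g x))"
 unfolding axial_def by (intro continuous_intros)

lemma continuous_on_psec:
 assumes "continuous_on S f" "continuous_on S g" "\<And>x. x \<in> S ==> axial (f x) (g x) ~= 0"
 shows "continuous_on S (%x. psec (f x) (g x))"
 unfolding psec_def psol_def by (intro continuous_intros assms ballI)

lemma continuous_on_udisp:
 assumes "continuous_on S f" "cmod v = 1"
 shows "continuous_on S (%x. udisp (f x) v)"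
 unfolding udisp_def
 by (intro continuous_intros assms(1) ballI Re_pos_not_nonpos udisp_dir_pos assms(2))

lemma continuous_on_pprod: "continuous_on ppairs (pprod s t)"
 unfolding pprod_def by (intro continuous_intros) (auto simp: ppairs_def)

lemma upp_bounds:
 assumes "w ~= 0" shows "ulo (upp 1 w) = 0" "uhi (upp (-1) w) = 0" "- pi < ulo (upp s w)" "uhi (upp s w) < pi"
 using upar_bounds[OF cmod_sgn[OF assms]] by (simp_all add: upp_def)

lemma pprod_range:
 assumes x: "x \<in> ppairs" and t: "t = 1 \<or> t = -1"
 shows "- pi < ulo (pprod 1 t x)" "uhi (pprod 1 t x) < 2 * pi"
proof -
 have nz: "fst x ~= 0" "snd x ~= 0" using x by (auto simp: ppairs_def)
 have "y + - pi < uact (pprod 1 t x) y" for y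
  using uact_lo_hi(1)[where k = "upp t (snd x)" and x = y] upp_bounds(3)[OF nz(2), of t]
   uact_lo_hi(1)[where k = "upp 1 (fst x)" and x = "uact (upp t (snd x)) y"] upp_bounds(1)[OF nz(1)]
  unfolding pprod_def uact_mult by linarith
 then show "- pi < ulo (pprod 1 t x)" unfolding less_ulo_iff by blast
 obtain y where y: "uact (pprod 1 t x) y = y + uhi (pprod 1 t x)" by (rule uact_hi_attained)
 show "uhi (pprod 1 t x) < 2 * pi"
  using y uact_lo_hi(2)[where k = "upp t (snd x)" and x = y] upp_bounds(4)[OF nz(2), of t]
   uact_lo_hi(2)[where k = "upp 1 (fst x)" and x = "uact (upp t (snd x)) y"] upp_bounds(4)[OF nz(1), of 1]
  unfolding pprod_def uact_mult by linarith
qed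

lemma pprod_fiber:
 assumes x: "x \<in> ppairs" and t: "t = 1 \<or> t = -1"
 defines "T \<equiv> pprod 1 t x"
 shows "{y \<in> ppairs. pprod 1 t y = T} = psec T ` {v. cmod v = 1 \<and> 0 < axial T v}"
proof (intro equalityI subsetI)
 fix y assume "y \<in> {y \<in> ppairs. pprod 1 t y = T}"
 then have y: "y \<in> ppairs" "pprod 1 t y = T" by auto
 have z: "cmod (sgn (snd y)) = 1" using y by (simp add: ppairs_def cmod_sgn)
 note r = psec_recover[OF y(1) t, unfolded y(2)]
 show "y \<in> psec T ` {v. cmod v = 1 \<and> 0 < axial T v}"
  using r(4) z axial_pos[OF z r(1,2)] by (intro image_eqI[of _ _ "sgn (snd y)"]) auto
next
 fix y assume "y \<in> psec T ` {v. cmod v = 1 \<and> 0 < axial T v}"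
 then obtain v where z: "y = psec T v" "cmod v = 1" "0 < axial T v" by auto
 have b: "- pi < udisp T v" "udisp T v < 2 * pi"
  using udisp_bounds[OF z(2), of T] pprod_range[OF x t] unfolding T_def by linarith+
 show "y \<in> {y \<in> ppairs. pprod 1 t y = T}"
  using psec_solution[OF z(2) t udisp_of_axial[OF z(2,3) b]] psec_recover(3)[OF x t] z(1) by (simp add: T_def)
qed

definition pimg :: "real => real => ucov set" where
 "pimg s t = (if s = 1 \<and> t = 1 then upos 1 else if s = -1 \<and> t = -1 then uneg 1 else uband 0 0)"

lemma pprod_image:
 assumes t: "t = 1 \<or> t = -1" shows "pprod 1 t ` ppairs = pimg 1 t"
proof (intro equalityI subsetI)
 fix T assume "T \<in> pprod 1 t ` ppairs"
 then obtain x where x: "x \<in> ppairs" "T = pprod 1 t x" by blast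
 have z: "cmod (sgn (snd x)) = 1" "cmod (sgn (fst x)) = 1" and nz: "fst x ~= 0" "snd x ~= 0"
  using x by (simp_all add: ppairs_def cmod_sgn)
 note d = psec_recover(1,2)[OF x(1) t, folded x(2)]
 have uh: "0 < uhi T" "ulo T < pi" using udisp_bounds[OF z(1), of T] d by linarith+
 obtain ph where ph: "cis (2 * ph) = \<i> * sgn (fst x)" using axis_exists[OF z(2)] .
 have f: "uact (upp 1 (fst x)) ph = ph" unfolding upp_def by (rule upar_fix[OF z(2) ph])
 show "T \<in> pimg 1 t"
 proof (cases "t = 1")
  case True
  have "y + 0 < uact T y" for y
  proof -
   have 1: "y <= uact (upp 1 (snd x)) y" "uact (upp 1 (snd x)) y <= uact T y"
    using uact_lo_hi(1)[where k = "upp 1 (snd x)" and x = y] upp_bounds(1)[OF nz(2)]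
     uact_lo_hi(1)[where k = "upp 1 (fst x)" and x = "uact (upp 1 (snd x)) y"] upp_bounds(1)[OF nz(1)]
    unfolding x(2) pprod_def True uact_mult by linarith+
   have "uact T y ~= y"
   proof
    assume "uact T y = y"
    then have fx: "uact (upp 1 (snd x)) y = y" "uact (upp 1 (fst x)) y = y"
     using 1 unfolding x(2) pprod_def True uact_mult by auto
    let ?A = "- \<i> * cis (2 * y)"
    have c: "cis (2 * y) = \<i> * ?A" and n: "cmod ?A = 1" by (simp_all add: norm_mult)
    have "udisp (upp 1 (snd x)) ?A = 0" "udisp (upp 1 (fst x)) ?A = 0"
     using uact_axis[OF c] fx by (metis add_cancel_left_right)+
    then have "- \<i> * cis (2 * y) = sgn (snd x)" "- \<i> * cis (2 * y) = sgn (fst x)"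
     using udisp_upar_pos(1)[OF n z(1), of "cmod (snd x)"] udisp_upar_pos(1)[OF n z(2), of "cmod (fst x)"] nz
     unfolding upp_def by auto
    then show False using x(1) by (simp add: ppairs_def)
   qed
   then show ?thesis using 1 by simp
  qed
  then have "0 < ulo T" unfolding less_ulo_iff by blast
  then show ?thesis using uh True by (simp add: pimg_def upos_def ule_uz not_le)
 next
  case False
  then have t1: "t = -1" using t by simp
  define y where "y = uact (uinv (upp t (snd x))) ph"
  have Ty: "uact T y = ph" unfolding x(2) pprod_def uact_mult y_def by (simp add: f)
  have "0 < udisp (upp 1 (snd x)) (sgn (fst x))"
   unfolding upp_def using x(1) nz z by (intro udisp_upar_pos) (auto simp: ppairs_def)
  then have "ph < y" unfolding y_def uinv_upp[OF nz(2)] t1 using uact_axis[OF ph, of "upp 1 (snd x)"] by simp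
  then have "ulo T < 0" using uact_lo_hi(1)[where k = T and x = y] Ty by linarith
  then have "T \<in> uband 0 0" using uh by (simp add: uband_def ule_one not_le)
  then show ?thesis using False by (simp add: pimg_def)
 qed
next
 fix T assume T: "T \<in> pimg 1 t"
 obtain v where z: "cmod v = 1" "0 < udisp T v" "udisp T v < pi" "0 < t * (1 - Re (fst (umat T)))"
 proof (cases "t = 1")
  case True
  then have T': "0 < ulo T" "\<not> uz 1 <~ T" using T by (auto simp: pimg_def upos_def)
  then have "ulo T < pi" by (simp add: ule_uz not_le)
  obtain v where z: "cmod v = 1" "udisp T v < pi * of_int 1" using T'(2) exists_udisp_less_iff by blast
  have "0 < udisp T v" using udisp_bounds(1)[OF z(1), of T] T' by linarith
  moreover have "0 < 2 - 2 * Re (fst (umat T))" using pfiber_positive(3)[OF T'(1) \<open>ulo T < pi\<close>] .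
  ultimately show ?thesis using that z True by simp
 next
  case False
  then have T': "\<not> T <~ uone" "\<not> uone <~ T" using T by (auto simp: pimg_def uband_def)
  then have h: "ulo T < 0" "0 < uhi T" by (simp_all add: ule_one not_le)
  obtain v where z: "cmod v = 1" "0 < udisp T v" using T'(1) exists_udisp_greater_iff by blast
  have "udisp T v < pi" using udisp_bounds(2)[OF z(1), of T] ulo_le_uhi(2)[of T] h by linarith
  then show ?thesis using that z hyperbolic_trace[OF h] False t by simp
 qed
 from psec_solution[OF z(1) t z(2,3,4)] show "T \<in> pprod 1 t ` ppairs" by (metis image_eqI)
qed

lemma fibered_pprod_pos:
 assumes t: "t = 1 \<or> t = -1" shows "fibered ppairs (pprod 1 t) (pimg 1 t)"
proof -
 have "connected {x \<in> ppairs. pprod 1 t x = T}" for T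
 proof (cases "{x \<in> ppairs. pprod 1 t x = T} = {}")
  case True then show ?thesis by (simp only: connected_empty)
 next
  case False
  then obtain x where x: "x \<in> ppairs" "pprod 1 t x = T" by blast
  let ?B = "{v. cmod v = 1 \<and> 0 < axial T v}"
  have "?B = {v. cmod v = 1 \<and> - Im (fst (umat T)) < Re (v * - cnj (snd (umat T)))}"
   by (intro Collect_cong conj_cong HOL.refl) (simp add: axial_def algebra_simps)
  then have "connected ?B" by (simp only: connected_arc_halfplane)
  moreover have "continuous_on ?B (psec T)"
   by (rule continuous_on_psec) (auto intro: continuous_intros)
  ultimately show ?thesis using connected_continuous_image pprod_fiber[OF x(1) t] x(2) by metis
 qed
 moreover have "open (pprod 1 t ` C)" if C: "openin (top_of_set ppairs) C" for C
 proof (subst open_subopen, intro ballI)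
  fix T assume "T \<in> pprod 1 t ` C"
  then obtain x where x: "x \<in> C" "T = pprod 1 t x" by blast
  obtain U where U: "open U" "C = ppairs \<inter> U" using C by (auto simp: openin_open)
  have xp: "x \<in> ppairs" using x U by blast
  define v where "v = sgn (snd x)"
  have z: "cmod v = 1" using xp by (simp add: v_def ppairs_def cmod_sgn)
  note r = psec_recover[OF xp t, folded x(2) v_def]
  define V where "V = {T. 0 < udisp T v} \<inter> {T. udisp T v < pi} \<inter> {T. 0 < t * (1 - Re (fst (umat T)))}"
  have V: "open V" unfolding V_def
   by (intro open_Int open_Collect_less continuous_intros continuous_on_udisp z)
  let ?A = "%T. psec T v"
  have "continuous_on V ?A"
   using axial_pos[OF z] by (intro continuous_on_psec continuous_intros) (auto simp: V_def less_imp_neq[symmetric])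
  then have "open (V \<inter> ?A -` U)" using V U(1) by (rule continuous_open_preimage)
  moreover have "T \<in> V \<inter> ?A -` U" using r x U by (simp add: V_def)
  moreover have "V \<inter> ?A -` U \<subseteq> pprod 1 t ` C"
  proof
   fix S assume "S \<in> V \<inter> ?A -` U"
   then have "psec S v \<in> C" "pprod 1 t (psec S v) = S"
    using psec_solution[OF z t, of S] by (auto simp: V_def U)
   then show "S \<in> pprod 1 t ` C" by (metis image_eqI)
  qed
  ultimately show "\<exists>V. open V \<and> T \<in> V \<and> V \<subseteq> pprod 1 t ` C" by blast
 qed
 ultimately show ?thesis unfolding fibered_def using continuous_on_pprod pprod_image[OF t] by blast
qed

lemma pprod_vary_pos:
 assumes x: "x \<in> ppairs" and t: "t = 1 \<or> t = -1"
 shows "x \<in> closure {y \<in> ppairs. pprod 1 t y = pprod 1 t x \<and> sgn (snd y) ~= sgn (snd x)}"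
proof -
 define T where "T = pprod 1 t x"
 define v where "v = sgn (snd x)"
 have z: "cmod v = 1" using x by (simp add: v_def ppairs_def cmod_sgn)
 note r = psec_recover[OF x t, folded T_def v_def]
 define g where "g = (%e. v * cis e)"
 have g: "cmod (g e) = 1" for e by (simp add: g_def norm_mult z)
 let ?A = "{e. 0 < axial T (g e)}"
 have "continuous_on UNIV (%e. axial T (g e))" unfolding g_def by (intro continuous_intros)
 then have o: "open ?A" by (intro open_Collect_less continuous_on_const)
 let ?B = "%e. psec T (g e)"
 have "continuous_on ?A ?B"
  unfolding g_def by (intro continuous_on_psec continuous_intros) auto
 moreover have 0: "0 \<in> ?A" using axial_pos[OF z r(1,2)] by (simp add: g_def)
 ultimately have "isCont ?B 0" using o continuous_on_eq_continuous_at by blast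
 then have lim: "(?B ---> x) (at_right 0)" using tendsto_within_subset r by (force simp: isCont_def g_def)
 have "eventually (%e. e \<in> ?A) (at_right 0)"
  using o 0 by (metis (mono_tags, lifting) eventually_at_topological)
 moreover have "eventually (%e. e \<in> {0<..<pi}) (at_right (0 :: real))" by (rule eventually_at_right_real) simp
 ultimately have "eventually (%e. psec T (g e) \<in> {y \<in> ppairs. pprod 1 t y = T \<and> sgn (snd y) ~= v}) (at_right 0)"
 proof eventually_elim
  case (elim e)
  have b: "- pi < udisp T (g e)" "udisp T (g e) < 2 * pi"
   using udisp_bounds[OF g, of T e] pprod_range[OF x t] unfolding T_def by linarith+
  have "g e ~= v"
  proof
   assume "g e = v"
   then have "cis e = 1" using z by (auto simp: g_def)
   then have "sin e = 0" by (metis cis.sel(2) one_complex.sel(2))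
   moreover have "0 < sin e" using elim by (intro sin_gt_zero) auto
   ultimately show False by simp
  qed
  then show ?case using psec_solution[OF g t udisp_of_axial[OF g _ b] r(3)] elim by simp
 qed
 then show ?thesis unfolding T_def[symmetric] v_def[symmetric]
  by (intro Lim_in_closed_set[OF closed_closure _ _ lim]) (auto elim!: eventually_mono intro: subsetD[OF closure_subset])
qed

subsection \<open>Orientation reversal for pairs\<close>

definition pmir :: "complex \<times> complex => complex \<times> complex" where
 "pmir x = (- cnj (fst x), - cnj (snd x))"

lemma sgn_cnj_neg: "sgn (- cnj w) = - cnj (sgn w)" for w :: complex
 by (simp add: sgn_eq)

lemma pmir: "pmir (pmir x) = x" "x \<in> ppairs ==> pmir x \<in> ppairs" "x \<in> ppairs ==> umir (pprod s t x) = pprod (- s) (- t) (pmir x)"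
proof -
 show "pmir (pmir x) = x" by (simp add: pmir_def)
 have "sgn (fst x) = sgn (snd x)" if "sgn (- cnj (fst x)) = sgn (- cnj (snd x))"
  using that unfolding sgn_cnj_neg by (simp only: neg_equal_iff_equal complex_cnj_cancel_iff)
 then show "x \<in> ppairs ==> pmir x \<in> ppairs" by (auto simp: pmir_def ppairs_def)
 show "x \<in> ppairs ==> umir (pprod s t x) = pprod (- s) (- t) (pmir x)"
  by (simp add: pprod_def umir_mult umir_upp pmir_def ppairs_def)
qed

lemma fibered_umir:
 assumes "fibered X f I" shows "fibered X (%x. umir (f x)) (umir ` I)"
proof -
 have "open (umir ` V)" if "open V" for V
 proof -
  have "open (umir -` V)" using that by (intro open_vimage continuous_intros)
  moreover have "umir -` V = umir ` V" by (auto simp: image_iff) (metis umir_umir)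
  ultimately show ?thesis by simp
 qed
 moreover have "umir (f x) = T <-> f x = umir T" for x T by (metis umir_umir)
 moreover have "(%x. umir (f x)) ` C = umir ` (f ` C)" for C by (simp add: image_image)
 moreover have "continuous_on X (%x. umir (f x))" using assms unfolding fibered_def by (intro continuous_intros) simp
 ultimately show ?thesis using assms unfolding fibered_def by (simp del: split_paired_All)
qed

lemma fibered_pprod:
 assumes s: "s = 1 \<or> s = -1" and t: "t = 1 \<or> t = -1"
 shows "fibered ppairs (pprod s t) (pimg s t)"
proof (cases "s = 1")
 case True then show ?thesis using fibered_pprod_pos t by simp
next
 case False
 then have s1: "s = -1" using s by simp
 have t': "- t = 1 \<or> - t = -1" using t by auto
 have "fibered ppairs (pprod s t) (umir ` pimg 1 (- t))"
  using pmir s1 pmir(3)[of _ 1 "- t"] unfolding pmir_def[abs_def]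
  by (intro fibered_iso[OF fibered_umir[OF fibered_pprod_pos[OF t']], of pmir _ pmir]) (auto simp: pmir_def[abs_def] intro!: continuous_intros)
 moreover have "umir ` pimg 1 (- t) = pimg s t"
 proof -
  have i: "umir ` A = B" if "\<And>k. umir k \<in> A <-> k \<in> B" for A B
   using that by (auto simp: image_iff) (metis umir_umir)+
  show ?thesis using t s1 unfolding pimg_def by (auto intro!: i simp: umir_upos umir_uband)
 qed
 ultimately show ?thesis by simp
qed

lemma pprod_vary:
 assumes x: "x \<in> ppairs" and s: "s = 1 \<or> s = -1" and t: "t = 1 \<or> t = -1"
 shows "x \<in> closure {y \<in> ppairs. pprod s t y = pprod s t x \<and> sgn (fst y) ~= sgn (fst x)}"
proof -
 let ?A = "{y \<in> ppairs. pprod s t y = pprod s t x \<and> sgn (snd y) ~= sgn (snd x)}"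
 have "x \<in> closure ?A"
 proof (cases "s = 1")
  case True then show ?thesis using pprod_vary_pos[OF x t] by simp
 next
  case False
  then have s1: "s = -1" using s by simp
  have t': "- t = 1 \<or> - t = -1" using t by auto
  define A where "A = {y \<in> ppairs. pprod 1 (- t) y = pprod 1 (- t) (pmir x) \<and> sgn (snd y) ~= sgn (snd (pmir x))}"
  have "pmir x \<in> closure A" unfolding A_def by (rule pprod_vary_pos[OF pmir(2)[OF x] t'])
  moreover have "continuous_on (closure A) pmir" unfolding pmir_def by (intro continuous_intros)
  ultimately have "pmir (pmir x) \<in> closure (pmir ` A)"
   using image_closure_subset[of A pmir "closure (pmir ` A)"] by (simp add: closure_subset image_subset_iff)
  moreover have "pmir ` A \<subseteq> ?A"
  proof
   fix z assume "z \<in> pmir ` A"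
   then obtain y where y: "z = pmir y" "y \<in> ppairs" "pprod 1 (- t) y = pprod 1 (- t) (pmir x)" "sgn (snd y) ~= sgn (snd (pmir x))"
    by (auto simp: A_def)
   have "pprod s t z = pprod s t x"
    using pmir(3)[OF y(2), of 1 "- t"] pmir(3)[OF pmir(2)[OF x], of 1 "- t"] y s1 pmir(1) by simp
   moreover have "sgn (snd z) ~= sgn (snd x)"
    using y(4) unfolding y(1) pmir_def snd_conv sgn_cnj_neg by (metis complex_cnj_cnj complex_cnj_minus minus_minus)
   ultimately show "z \<in> ?A"
    using pmir(2)[OF y(2)] y(1) by blast
  qed
  ultimately have "pmir (pmir x) \<in> closure ?A"
   by (rule_tac subsetD[OF closure_mono])
  then show ?thesis unfolding pmir(1) .
 qed
 moreover have "sgn (fst y) ~= sgn (fst x)" if y: "y \<in> ppairs" "pprod s t y = pprod s t x" "sgn (snd y) ~= sgn (snd x)" for y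
 proof
  assume e: "sgn (fst y) = sgn (fst x)"
  have z: "cmod (sgn (fst x)) = 1" and nz: "snd x ~= 0" using x by (simp_all add: ppairs_def cmod_sgn)
  have "uinv (upp s (fst y)) &* upp s (fst x) = upp t (snd y) &* uinv (upp t (snd x))"
   using y(2) unfolding pprod_def by (metis umult_assoc umult_eq_iff(1) umult_eq_iff(2))
  then have "upar (sgn (fst x)) (s * cmod (fst x) - s * cmod (fst y)) = pprod t (- t) (snd y, snd x)"
   unfolding uinv_upp[OF nz] unfolding upp_def e uinv_upar[OF z] upar_add[OF z] pprod_def by (simp add: upp_def)
  moreover have "pprod t (- t) (snd y, snd x) \<in> pprod t (- t) ` ppairs" using x y by (simp add: ppairs_def)
  moreover have "pprod t (- t) ` ppairs = pimg t (- t)" by (smt (verit) fibered_def t fibered_pprod)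
  ultimately have "upar (sgn (fst x)) (s * cmod (fst x) - s * cmod (fst y)) \<in> uband 0 0" using t by (auto simp: pimg_def)
  then show False
   using upar_bounds(1,2)[OF z, of "s * cmod (fst x) - s * cmod (fst y)"] linear[of 0 "s * cmod (fst x) - s * cmod (fst y)"]
   unfolding uband_def by (auto simp: ule_one simp del: diff_ge_0_iff_ge diff_le_0_iff_le)
 qed
 ultimately show ?thesis
  by (rule_tac subsetD[OF closure_mono]) auto
qed

section \<open>Genus zero\<close>

primrec pword :: "(nat => int) => (nat => complex) => nat => ucov" where
 "pword s w 0 = uone"
| "pword s w (Suc k) = pword s w k &* upp (of_int (s k)) (w k)"

definition ptuples :: "nat => (nat => complex) set" where
 "ptuples k = {w. (\<forall>i<k. w i ~= 0) \<and> (\<forall>i\<ge>k. w i = 1)}"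

definition nonpar :: "nat => (nat => complex) set" where
 "nonpar k = {w \<in> ptuples k. \<exists>i<k. sgn (w i) ~= sgn (w 0)}"

definition uimg :: "nat => nat => ucov set" where
 "uimg P N = (if N = 0 then upos (int P - 1) else if P = 0 then uneg (int N - 1) else uband (1 - int N) (int P - 1))"

lemma p_plus_0 [simp]: "p_plus 0 s = 0" and p_minus_0 [simp]: "p_minus 0 s = 0"
 by (simp_all add: p_plus_def p_minus_def)

lemma p_plus_Suc: "p_plus (Suc k) s = p_plus k s + (if s k = 1 then 1 else 0)" (is ?Q)
 and p_minus_Suc: "p_minus (Suc k) s = p_minus k s + (if s k = -1 then 1 else 0)" (is ?P)
proof -
 have "{i. i < Suc k \<and> s i = c} = (if s k = c then insert k {i. i < k \<and> s i = c} else {i. i < k \<and> s i = c})" for c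
  by (auto simp: less_Suc_eq)
 then show ?Q
  ?P
  unfolding p_plus_def p_minus_def by simp_all
qed

lemma p_plus_minus: "(\<And>i. i < k ==> s i = 1 \<or> s i = -1) ==> p_plus k s + p_minus k s = k"
proof (induction k)
 case (Suc k)
 then have "p_plus k s + p_minus k s = k" by simp
 with Suc.prems[of k] show ?case by (auto simp: p_plus_Suc p_minus_Suc)
qed simp

lemma pword_cong: "(\<And>i. i < k ==> v i = w i) ==> pword s v k = pword s w k"
 by (induction k) auto

lemma continuous_on_pword:
 "(\<And>i. i < k ==> continuous_on S (%x. f x i)) ==> (\<And>i x. i < k ==> x \<in> S ==> f x i ~= 0) ==> continuous_on S (%x. pword s (f x) k)"
 by (induction k) (auto intro!: continuous_intros)

lemma uimg_split:
 assumes "2 <= P + N" "t = 1 \<or> t = -1"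
 shows "connected (usplit T (of_int t) (uimg P N))" (is ?Q)
  "usplit T (of_int t) (uimg P N) ~= {} <-> T \<in> uimg (P + (if t = 1 then 1 else 0)) (N + (if t = -1 then 1 else 0))" (is ?P)
proof -
 have "connected (usplit T (of_int t) (uimg P N)) \<and>
  (usplit T (of_int t) (uimg P N) ~= {} <-> T \<in> uimg (P + (if t = 1 then 1 else 0)) (N + (if t = -1 then 1 else 0)))"
 proof (cases "N = 0 \<or> P = 0")
  case False
  then have "1 - int N <= int P - 1" by simp
  from uband_split_pos[OF this, of T] uband_split_neg[OF this, of T] show ?thesis
   using False assms(2) by (auto simp: uimg_def)
 next
  case True
  then show ?thesis
  proof
   assume N: "N = 0"
   then have "1 <= int P - 1" using assms(1) by simp
   from upos_split_pos[OF this, of T] upos_split_neg[OF this, of T] show ?thesis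
    using N assms by (auto simp: uimg_def)
  next
   assume P: "P = 0"
   then have "1 <= int N - 1" using assms(1) by simp
   from uneg_split_pos[OF this, of T] uneg_split_neg[OF this, of T] show ?thesis
    using P assms by (auto simp: uimg_def)
  qed
 qed
 then show ?Q
  ?P
  by blast+
qed

lemma continuous_image_closure:
 assumes "continuous_on UNIV g" "x \<in> closure A" "g ` A \<subseteq> B" shows "g x \<in> closure B"
proof -
 have "g ` closure A \<subseteq> closure B"
  using assms closure_subset[of B] by (intro image_closure_subset) (auto intro: continuous_on_subset)
 then show ?thesis using assms(2) by blast
qed

lemma continuous_on_fun_upd [continuous_intros]:
 assumes "continuous_on S f" "continuous_on S g" shows "continuous_on S (%x. (f x)(k := g x))"
proof (rule continuous_on_coordinatewise_then_product)
 fix i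
 have "continuous_on S (%x. f x i)" using assms(1) by (rule continuous_on_product_then_coordinatewise)
 then show "continuous_on S (%x. ((f x)(k := g x)) i)" using assms(2) by (cases "i = k") auto
qed

lemma continuous_on_coordinate [continuous_intros]: "continuous_on S (%w. w i)"
 by (rule continuous_on_product_then_coordinatewise[OF continuous_on_id])

lemma fibered_pword_2:
 assumes s: "s 0 = 1 \<or> s 0 = -1" "s 1 = 1 \<or> s 1 = -1"
 shows "fibered (nonpar 2) (%w. pword s w 2) (uimg (p_plus 2 s) (p_minus 2 s))"
proof -
 have "pimg (of_int (s 0)) (of_int (s 1)) = uimg (p_plus 2 s) (p_minus 2 s)"
  using s by (auto simp: pimg_def uimg_def numeral_2_eq_2 p_plus_Suc p_minus_Suc)
 moreover have "fibered ppairs (pprod (of_int (s 0)) (of_int (s 1))) (pimg (of_int (s 0)) (of_int (s 1)))"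
  using s by (intro fibered_pprod) auto
 moreover have "fibered (nonpar 2) (%w. pword s w 2) J"
  if "fibered ppairs (pprod (of_int (s 0)) (of_int (s 1))) J" for J
 proof (rule fibered_iso[OF that])
  define h where "h = (%x :: complex \<times> complex. (%_ :: nat. 1 :: complex)(0 := fst x, 1 := snd x))"
  define z where "z = (%w :: nat => complex. (w 0, w 1))"
  show "continuous_on ppairs h" "continuous_on (nonpar 2) z"
   unfolding h_def z_def by (intro continuous_intros)+
  show "z (h x) = x" for x by (simp add: h_def z_def)
  show "pword s (h x) 2 = pprod (of_int (s 0)) (of_int (s 1)) x" for x
   by (simp add: h_def pprod_def numeral_2_eq_2)
  show "h x \<in> nonpar 2" if "x \<in> ppairs" for x
   using that by (auto simp: h_def nonpar_def ptuples_def ppairs_def less_2_cases_iff intro!: exI[of _ "1 :: nat"])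
  fix w assume w: "w \<in> nonpar 2"
  then obtain i where "i < 2" "sgn (w i) ~= sgn (w 0)" by (auto simp: nonpar_def)
  then have "sgn (w 1) ~= sgn (w 0)" by (cases i) auto
  then show "z w \<in> ppairs" using w by (auto simp: nonpar_def ptuples_def ppairs_def z_def)
  have "h (z w) i = w i" for i
   using w by (cases "2 <= i") (auto simp: h_def z_def nonpar_def ptuples_def not_le less_2_cases_iff)
  then show "h (z w) = w" by blast
 qed
 ultimately show ?thesis by simp
qed

lemma fibered_pword_Suc:
 assumes k: "2 <= k" and s: "s (k - 1) = 1 \<or> s (k - 1) = -1" "s k = 1 \<or> s k = -1" and PN: "2 <= P + N"
  and f: "fibered (nonpar k) (%w. pword s w k) (uimg P N)"
 shows "fibered (nonpar (Suc k)) (%w. pword s w (Suc k)) (uimg (P + (if s k = 1 then 1 else 0)) (N + (if s k = -1 then 1 else 0)))"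
proof -
 define J where "J = uimg (P + (if s k = 1 then 1 else 0)) (N + (if s k = -1 then 1 else 0))"
 define X' where "X' = {w \<in> ptuples (Suc k). \<exists>i<k. sgn (w i) ~= sgn (w 0)}"
 have u: "{y \<in> - {0}. T &* uinv (upp (of_int (s k)) y) \<in> uimg P N} = usplit T (of_int (s k)) (uimg P N)" for T
  by (auto simp: usplit_def)
 let ?B = "%w. pword s w (Suc k)"
 have "fibered (nonpar k \<times> - {0}) (%x. pword s (fst x) k &* upp (of_int (s k)) (snd x)) J"
  using uimg_split[OF PN s(2)] unfolding J_def
  by (intro fibered_fusion[OF f] continuous_on_upp continuous_on_id) (simp_all only: u, simp)
 then have 1: "fibered X' ?B J"
 proof (rule fibered_iso)
  show "continuous_on (nonpar k \<times> - {0}) (%x. (fst x)(k := snd x))" "continuous_on X' (%w. (w(k := 1), w k))"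
   by (intro continuous_intros)+
  fix x :: "(nat => complex) \<times> complex" assume x: "x \<in> nonpar k \<times> - {0}"
  then obtain i where i: "i < k" "sgn (fst x i) ~= sgn (fst x 0)" unfolding mem_Times_iff nonpar_def by blast
  then show "(fst x)(k := snd x) \<in> X'" using x by (auto simp: X'_def nonpar_def ptuples_def less_Suc_eq intro!: exI[of _ i])
  show "(((fst x)(k := snd x))(k := 1), ((fst x)(k := snd x)) k) = x"
   using x by (auto simp: nonpar_def ptuples_def)
  show "pword s ((fst x)(k := snd x)) (Suc k) = pword s (fst x) k &* upp (of_int (s k)) (snd x)"
   using pword_cong[of k "(fst x)(k := snd x)" "fst x" s] by simp
 next
  fix w assume "w \<in> X'"
  then show "(w(k := 1), w k) \<in> nonpar k \<times> - {0}" using k by (auto simp: X'_def nonpar_def ptuples_def)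
 qed simp
 obtain m where m: "k = Suc m" "1 <= m" using k by (cases k) auto
 have "fibered (nonpar (Suc k)) ?B J"
 proof (rule fibered_extend[OF 1])
  show "X' \<subseteq> nonpar (Suc k)" by (auto simp: X'_def nonpar_def intro: less_SucI)
  show "continuous_on (nonpar (Suc k)) ?B"
   by (intro continuous_on_pword continuous_on_coordinate) (simp add: nonpar_def ptuples_def)
  fix w assume w: "w \<in> nonpar (Suc k)" "w \<notin> X'"
  then have par: "sgn (w i) = sgn (w 0)" if "i < k" for i using that unfolding X'_def nonpar_def by blast
  obtain i where "i < Suc k" "sgn (w i) ~= sgn (w 0)" using w by (auto simp: nonpar_def)
  then have wk: "sgn (w k) ~= sgn (w 0)" using par by (metis less_SucE)
  define A where "A = {y \<in> ppairs. pprod (of_int (s m)) (of_int (s k)) y = pprod (of_int (s m)) (of_int (s k)) (w m, w k)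
   \<and> sgn (fst y) ~= sgn (fst (w m, w k))}"
  have "(w m, w k) \<in> ppairs" using w(1) wk par[of m] m by (auto simp: ppairs_def nonpar_def ptuples_def)
  then have x: "(w m, w k) \<in> closure A" unfolding A_def using s m by (intro pprod_vary) auto
  define g where "g = (%y. w(m := fst y, k := snd y))"
  let ?A = "{y \<in> X'. pword s y (Suc k) = pword s w (Suc k)}"
  have "continuous_on UNIV g" unfolding g_def by (intro continuous_intros)
  moreover note x
  moreover have "g ` A \<subseteq> ?A"
  proof
   fix z assume "z \<in> g ` A"
   then obtain y where y: "z = g y" "y \<in> A" by blast
   have "z \<in> ptuples (Suc k)" using y w(1) m by (auto simp: g_def A_def ppairs_def nonpar_def ptuples_def)
   moreover have "sgn (z m) ~= sgn (z 0)" using y par[of m] m by (auto simp: g_def A_def)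
   moreover have "pword s z (Suc k) = pword s w m &* pprod (of_int (s m)) (of_int (s k)) y"
    using pword_cong[of m z w s] y m by (simp add: g_def pprod_def umult_assoc)
   moreover have "pword s w (Suc k) = pword s w m &* pprod (of_int (s m)) (of_int (s k)) (w m, w k)"
    using m by (simp add: pprod_def umult_assoc)
   ultimately show "z \<in> ?A"
    using y(2) m unfolding X'_def A_def by auto
  qed
  ultimately have "g (w m, w k) \<in> closure ?A"
   by (rule continuous_image_closure)
  then show "w \<in> closure ?A" by (simp add: g_def)
 qed
 then show ?thesis unfolding J_def .
qed

lemma fibered_pword:
 assumes "2 <= k" "\<And>i. i < k ==> s i = 1 \<or> s i = -1"
 shows "fibered (nonpar k) (%w. pword s w k) (uimg (p_plus k s) (p_minus k s))"
 using assms
proof (induction k rule: dec_induct)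
 case base
 then show ?case by (intro fibered_pword_2) auto
next
 case (step k)
 then have "fibered (nonpar k) (%w. pword s w k) (uimg (p_plus k s) (p_minus k s))" by simp
 moreover have "2 <= p_plus k s + p_minus k s" using p_plus_minus[of k s] step by simp
 ultimately show ?case unfolding p_plus_Suc p_minus_Suc
  using step by (intro fibered_pword_Suc) auto
qed

lemma upar_eq_uz: "cmod v = 1 ==> upar v r = uz n <-> n = 0 \<and> r = 0"
 by (auto simp: upar_def uz_def urot_def)

definition par :: "(nat => int) => nat => (nat => complex) set" where
 "par s k = {w \<in> ptuples k. (\<forall>i<k. sgn (w i) = sgn (w 0)) \<and> (\<Sum>i<k. of_int (s i) * cmod (w i)) = 0}"

definition polar_tuple :: "nat => complex => (nat => real) => nat => complex" where
 "polar_tuple k v r = (%i. if i < k then of_real (r i) * v else 1)"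

lemma pword_parallel:
 assumes "cmod v = 1" "\<And>i. i < k ==> sgn (w i) = v"
 shows "pword s w k = upar v (\<Sum>i<k. of_int (s i) * cmod (w i))"
 using assms(2) by (induction k) (simp_all add: upp_def upar_add[OF assms(1)])

lemma pword_par:
 assumes "w \<in> ptuples k" "0 < k" "\<forall>i<k. sgn (w i) = sgn (w 0)"
 shows "pword s w k = uz n <-> n = 0 \<and> w \<in> par s k"
proof -
 have z: "cmod (sgn (w 0)) = 1" using assms(1,2) by (simp add: cmod_sgn ptuples_def)
 have "w \<in> par s k <-> (\<Sum>i<k. of_int (s i) * cmod (w i)) = 0" using assms(1,3) unfolding par_def by blast
 moreover have "pword s w k = upar (sgn (w 0)) (\<Sum>i<k. of_int (s i) * cmod (w i))"
  using assms(3) by (intro pword_parallel z) blast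
 ultimately show ?thesis by (simp only: upar_eq_uz[OF z])
qed

lemma pword_fiber:
 assumes "0 < k"
 shows "{w \<in> ptuples k. pword s w k = uz n} = {w \<in> nonpar k. pword s w k = uz n} \<union> (if n = 0 then par s k else {})"
proof -
 have "w \<in> nonpar k \<or> (\<forall>i<k. sgn (w i) = sgn (w 0))" if "w \<in> ptuples k" for w
  using that unfolding nonpar_def by blast
 then have "w \<in> {w \<in> ptuples k. pword s w k = uz n} <->
   w \<in> {w \<in> nonpar k. pword s w k = uz n} \<union> (if n = 0 then par s k else {})" for w
 proof (cases "w \<in> ptuples k \<and> (\<forall>i<k. sgn (w i) = sgn (w 0))")
  case True
  then have "w \<notin> nonpar k" unfolding nonpar_def by blast
  moreover have "w \<in> ptuples k" "pword s w k = uz n <-> n = 0 \<and> w \<in> par s k"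
   using pword_par[OF _ assms, of w s n] True by blast+
  ultimately show ?thesis by auto
 next
  case False
  then show ?thesis by (auto simp: par_def nonpar_def)
 qed
 then show ?thesis by blast
qed

lemma polar_tuple_par:
 assumes "cmod v = 1" "\<And>i. i < k ==> 0 < r i" "(\<Sum>i<k. of_int (s i) * r i) = 0" "0 < k"
 shows "polar_tuple k v r \<in> par s k"
using sgn_polar assms by (force simp: polar_tuple_def ptuples_def par_def)

lemma par_polar:
 assumes "w \<in> par s k" "0 < k"
 obtains v r where "cmod v = 1" "\<forall>i<k. 0 < r i" "(\<Sum>i<k. of_int (s i) * r i) = 0" "w = polar_tuple k v r"
proof (rule that)
 have w: "w \<in> ptuples k" "\<And>i. i < k ==> sgn (w i) = sgn (w 0)" and sum: "(\<Sum>i<k. of_int (s i) * cmod (w i)) = 0"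
  using assms(1) unfolding par_def by blast+
 have nz: "w i ~= 0" if "i < k" for i using w(1) that by (simp add: ptuples_def)
 show "cmod (sgn (w 0)) = 1" "\<forall>i<k. 0 < cmod (w i)" "(\<Sum>i<k. of_int (s i) * cmod (w i)) = 0"
  using nz assms(2) sum by (simp_all add: cmod_sgn)
 have "w i = of_real (cmod (w i)) * sgn (w 0)" if "i < k" for i
  using polar[OF nz[OF that]] unfolding w(2)[OF that] .
 then have "w i = polar_tuple k (sgn (w 0)) (%i. cmod (w i)) i" for i
  using w(1) unfolding polar_tuple_def by (cases "i < k") (simp_all add: ptuples_def)
 then show "w = polar_tuple k (sgn (w 0)) (%i. cmod (w i))" by blast
qed

lemma connected_par:
 assumes "0 < k" shows "connected (par s k)"
proof (cases "par s k = {}")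
 case False
 then obtain v where v: "v \<in> par s k" by blast
 obtain h q where q: "cmod h = 1" "\<forall>i<k. 0 < q i" "(\<Sum>i<k. of_int (s i) * q i) = 0" "v = polar_tuple k h q"
  using par_polar[OF v assms] .
 show ?thesis
 proof (rule connected_hub)
  fix w assume w: "w \<in> par s k"
  obtain z r where r: "cmod z = 1" "\<forall>i<k. 0 < r i" "(\<Sum>i<k. of_int (s i) * r i) = 0" "w = polar_tuple k z r"
   using par_polar[OF w assms] .
  define f where "f = (%x. polar_tuple k (snd x) (%i. (1 - fst x) * r i + fst x * q i))"
  let ?A = "{0..1} \<times> sphere 0 1"
  have "continuous_on ?A (%x. f x i)" for i
   unfolding f_def polar_tuple_def by (cases "i < k") (auto intro!: continuous_intros)
  then have "continuous_on ?A f" by (rule continuous_on_coordinatewise_then_product)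
  moreover have "connected ({0..1::real} \<times> sphere (0::complex) 1)"
   by (intro connected_Times connected_sphere) auto
  ultimately have "connected (f ` ?A)" by (rule connected_continuous_image)
  moreover have "f ` ?A \<subseteq> par s k"
  proof (rule image_subsetI)
   fix x :: "real \<times> complex" assume x: "x \<in> {0..1} \<times> sphere 0 1"
   have "(\<Sum>i<k. of_int (s i) * ((1 - fst x) * r i + fst x * q i))
    = (1 - fst x) * (\<Sum>i<k. of_int (s i) * r i) + fst x * (\<Sum>i<k. of_int (s i) * q i)"
    by (simp add: sum_distrib_left sum.distrib[symmetric] algebra_simps)
   moreover have "0 < (1 - fst x) * r i + fst x * q i" if "i < k" for i
    using x r(2)[rule_format, OF that] q(2)[rule_format, OF that] by (cases "fst x = 0") (auto simp: mem_Times_iff intro!: add_nonneg_pos)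
   ultimately show "f x \<in> par s k" unfolding f_def using x r(3) q(3) assms
    by (intro polar_tuple_par) (auto simp: mem_Times_iff)
  qed
  moreover have "v = f (1, h)" "w = f (0, z)" by (simp_all add: f_def q(4) r(4))
  moreover have "(1, h) \<in> {0..1::real} \<times> sphere 0 1" "(0, z) \<in> {0..1::real} \<times> sphere 0 1" using q r by simp_all
  ultimately show "\<exists>C. connected C \<and> C \<subseteq> par s k \<and> v \<in> C \<and> w \<in> C" by blast
 qed
qed simp

lemma sum_sign:
 fixes x y :: real
 assumes "\<And>i. i < k ==> s i = 1 \<or> s i = -1"
 shows "(\<Sum>i<k. of_int (s i) * (if s i = 1 then x else y)) = x * p_plus k s - y * p_minus k s"
 using assms
proof (induction k)
 case (Suc k)
 then have "(\<Sum>i<k. of_int (s i) * (if s i = 1 then x else y)) = x * p_plus k s - y * p_minus k s" by simp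
 with Suc.prems[of k] show ?case by (auto simp: p_plus_Suc p_minus_Suc algebra_simps)
qed simp

lemma par_nonempty:
 assumes s: "\<And>i. i < k ==> s i = 1 \<or> s i = -1" and k: "0 < k"
 shows "par s k ~= {} <-> 1 <= p_plus k s \<and> 1 <= p_minus k s"
proof
 assume "par s k ~= {}"
 then obtain w where w: "w \<in> par s k" by blast
 obtain v r where r: "cmod v = 1" "\<forall>i<k. 0 < r i" "(\<Sum>i<k. of_int (s i) * r i) = 0" "w = polar_tuple k v r"
  using par_polar[OF w k] .
 have ne: "{..<k} ~= {}" using k by auto
 have "\<exists>i<k. s i = 1"
 proof (rule ccontr)
  assume "\<not> (\<exists>i<k. s i = 1)"
  then have "s i = -1" if "i < k" for i using s that by blast
  then have "(\<Sum>i<k. of_int (s i) * r i) = - (\<Sum>i<k. r i)" by (simp add: sum_negf[symmetric])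
  moreover have "0 < (\<Sum>i<k. r i)" using r(2) ne by (intro sum_pos) auto
  ultimately show False using r by simp
 qed
 moreover have "\<exists>i<k. s i = -1"
 proof (rule ccontr)
  assume "\<not> (\<exists>i<k. s i = -1)"
  then have "s i = 1" if "i < k" for i using s that by blast
  then have "0 < (\<Sum>i<k. of_int (s i) * r i)" using r(2) ne by (intro sum_pos) auto
  then show False using r(3) by simp
 qed
 ultimately show "1 <= p_plus k s \<and> 1 <= p_minus k s"
  unfolding p_plus_def p_minus_def by (auto simp: Suc_le_eq card_gt_0_iff)
next
 assume PN: "1 <= p_plus k s \<and> 1 <= p_minus k s"
 define r where "r = (%i. if s i = 1 then real (p_minus k s) else real (p_plus k s))"
 have "polar_tuple k 1 r \<in> par s k" using sum_sign k s PN polar_tuple_par by (simp add: r_def)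
 then show "par s k ~= {}" by blast
qed

lemma sign_change:
 assumes s: "\<And>i. i < k ==> s i = 1 \<or> s i = (-1 :: int)" and PN: "1 <= p_plus k s" "1 <= p_minus k s"
 obtains i where "Suc i < k" "s (Suc i) = - s i"
proof -
 have "\<exists>i. Suc i < k \<and> s (Suc i) = - s i"
 proof (rule ccontr)
  assume *: "\<not> (\<exists>i. Suc i < k \<and> s (Suc i) = - s i)"
  have const: "i < k ==> s i = s 0" for i
  proof (induction i)
   case (Suc i)
   then show ?case using * s[of i] s[of "Suc i"] by force
  qed simp
  let ?A = "{i. i < k \<and> s i = (if s 0 = 1 then -1 else 1)}"
  have "?A = {}"
  proof (intro equals0I)
   fix i assume "i \<in> ?A"
   then show False using const[of i] by (simp split: if_splits)
  qed
  then have "card ?A = 0" by (simp only: card.empty)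
  then have "p_plus k s = 0 \<or> p_minus k s = 0" unfolding p_plus_def p_minus_def by (simp split: if_splits)
  then show False using PN by simp
 qed
 then show ?thesis using that by blast
qed

lemma pword_cong_from:
 assumes "pword s v m = pword s w m" "\<And>i. m <= i ==> v i = w i" "m <= k"
 shows "pword s v k = pword s w k"
 using assms(3) by (induction k rule: dec_induct) (simp_all add: assms)

lemma par_limit:
 assumes s: "\<And>i. i < k ==> s i = 1 \<or> s i = -1" and PN: "2 <= p_plus k s" "2 <= p_minus k s"
 shows "\<exists>w \<in> par s k. w \<in> closure {v \<in> nonpar k. pword s v k = uone}"
proof -
 have k4: "4 <= k" using p_plus_minus[of k s] s PN by simp
 obtain i where i: "Suc i < k" "s (Suc i) = - s i"
  using sign_change[of k s] s PN by (metis one_le_numeral order_trans)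
 define q where "q = (%j. if s j = 1 then real (p_minus k s) - 1 else real (p_plus k s) - 1)"
 define r where "r = (%j. if j = i \<or> j = Suc i then 1 else q j)"
 have "(\<Sum>j<k. of_int (s j) * r j) = (\<Sum>j<k. of_int (s j) * q j
  + (if i = j then of_int (s i) * (1 - q i) else 0) + (if Suc i = j then of_int (s (Suc i)) * (1 - q (Suc i)) else 0))"
  by (rule sum.cong) (auto simp: r_def algebra_simps)
 also have "\<dots> = (\<Sum>j<k. of_int (s j) * q j) + of_int (s i) * (1 - q i) + of_int (s (Suc i)) * (1 - q (Suc i))"
  using i by (simp add: sum.distrib)
 also have "\<dots> = 0"
  unfolding q_def using sum_sign[of k s "real (p_minus k s) - 1" "real (p_plus k s) - 1"] s[of i] i s
  by (auto simp: algebra_simps dest: Suc_lessD)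
 finally have r: "(\<Sum>j<k. of_int (s j) * r j) = 0" .
 define w where "w = polar_tuple k 1 r"
 have rp: "0 < r j" for j using PN by (auto simp: r_def q_def)
 then have w: "w \<in> par s k" unfolding w_def using r k4 by (intro polar_tuple_par) auto
 have wt: "w \<in> ptuples k" using w by (simp add: par_def)
 have wp: "\<forall>i<k. sgn (w i) = sgn (w 0)" using w unfolding par_def by blast
 have w1: "pword s w k = uone" using pword_par[OF wt _ wp, of s 0] w k4 by simp
 have ws: "sgn (w j) = 1" if "j < k" for j using that rp[of j] by (simp add: w_def polar_tuple_def sgn_of_real)
 have wi: "w i = w (Suc i)" "w i ~= 0" using i by (auto simp: w_def polar_tuple_def r_def)
 define g where "g = (%e. w(i := w i * cis e, Suc i := w i * cis e))"
 let ?A = "{v \<in> nonpar k. pword s v k = uone}"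
 have "continuous_on UNIV g" unfolding g_def by (intro continuous_intros)
 moreover have "(0 :: real) \<in> closure {0<..<pi}" by simp
 moreover have "g ` {0<..<pi} \<subseteq> ?A"
 proof (rule image_subsetI)
  fix e assume e: "e \<in> {0<..<pi}"
  have pair: "pword s v (Suc (Suc i)) = pword s v i" if "v i = v (Suc i)" "v i ~= 0" for v
   using that i(2) by (simp add: umult_assoc uinv_upp[symmetric])
  have "pword s (g e) (Suc (Suc i)) = pword s (g e) i" by (rule pair) (use wi in \<open>simp_all add: g_def\<close>)
  also have "\<dots> = pword s w i" by (rule pword_cong) (simp add: g_def)
  also have "\<dots> = pword s w (Suc (Suc i))" using pair[of w] wi by simp
  finally have "pword s (g e) k = pword s w k" by (rule pword_cong_from) (use i in \<open>auto simp: g_def\<close>)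
  moreover have "g e \<in> ptuples k" using wt i wi by (auto simp: g_def ptuples_def)
  moreover have "\<exists>j<k. sgn (g e j) ~= sgn (g e 0)"
  proof -
   have c: "cis e ~= 1" using e sin_gt_zero by (force simp: complex_eq_iff)
   have si: "sgn (g e i) = cis e" using ws[of i] i by (simp add: g_def sgn_mult sgn_eq[of "cis e"])
   show ?thesis
   proof (cases "i = 0")
    case True
    then have "sgn (g e 2) = 1" using ws[of 2] k4 by (simp add: g_def)
    then show ?thesis using si c True k4 by (intro exI[of _ 2]) auto
   next
    case False
    then show ?thesis using ws si c i by (auto simp: g_def)
   qed
  qed
  ultimately show "g e \<in> ?A" using w1 by (simp add: nonpar_def)
 qed
 ultimately have "g 0 \<in> closure ?A" by (rule continuous_image_closure)
 moreover have "g 0 = w" by (auto simp: g_def wi)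
 ultimately show ?thesis using w by auto
qed

lemma uz_in_uimg: "3 <= P + N ==> uz n \<in> uimg P N <->
  (2 - int N <= n \<and> n <= int P - 2 \<or> n = 1 \<and> N = 0 \<or> n = -1 \<and> P = 0)"
 by (auto simp: uimg_def uz_in_uband uz_in_upos uz_in_uneg)

lemma connected_genus_zero:
 assumes k: "3 <= k" and s: "\<And>i. i < k ==> s i = 1 \<or> s i = -1"
 shows "connected {w \<in> ptuples k. pword s w k = uz n}"
  "{w \<in> ptuples k. pword s w k = uz n} ~= {} <->
   (2 - int (p_minus k s) <= n \<and> n <= int (p_plus k s) - 2 \<or> n = 1 \<and> p_minus k s = 0 \<or> n = -1 \<and> p_plus k s = 0
   \<or> n = 0 \<and> (p_minus k s = 1 \<or> p_plus k s = 1))" (is ?P)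
proof -
 have k0: "0 < k" and k2: "2 <= k" using k by simp_all
 have sum: "p_plus k s + p_minus k s = k" using p_plus_minus s by blast
 have 3: "3 <= p_plus k s + p_minus k s" using k sum by simp
 define C where "C = {w \<in> nonpar k. pword s w k = uz n}"
 have fib: "fibered (nonpar k) (%w. pword s w k) (uimg (p_plus k s) (p_minus k s))"
  using fibered_pword[OF k2, of s] s by blast
 have C: "connected C" "C ~= {} <-> uz n \<in> uimg (p_plus k s) (p_minus k s)"
 proof -
  show "connected C" using fib unfolding C_def fibered_def by (elim conjE) (rule spec)
  have img: "uimg (p_plus k s) (p_minus k s) = (%w. pword s w k) ` nonpar k" using fib unfolding fibered_def by simp
  show "C ~= {} <-> uz n \<in> uimg (p_plus k s) (p_minus k s)" unfolding C_def img image_iff by (auto intro: HOL.sym)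
 qed
 let ?A = "{w \<in> ptuples k. pword s w k = uz n}"
 have eq: "?A = C \<union> (if n = 0 then par s k else {})"
  unfolding C_def by (rule pword_fiber[OF k0])
 show "connected ?A"
 proof (cases "n = 0")
  case False then show ?thesis unfolding eq using C(1) by simp
 next
  case True
  show ?thesis
  proof (cases "2 <= p_plus k s \<and> 2 <= p_minus k s")
   case True
   then obtain w where w: "w \<in> par s k" "w \<in> closure C"
    using par_limit[of k s] s unfolding C_def \<open>n = 0\<close> by auto
   have "connected (insert w C)"
    using w(2) closure_subset by (intro connected_intermediate_closure[OF C(1)]) auto
   then have "connected (insert w C \<union> par s k)"
    using w(1) by (intro connected_Un connected_par k0) auto
   moreover have "insert w C \<union> par s k = C \<union> par s k" using w(1) by blast
   ultimately show ?thesis unfolding eq using \<open>n = 0\<close> by simp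
  next
   case False
   then show ?thesis using C uz_in_uimg 3 eq connected_par k0 by force
  qed
 qed
 have "?A ~= {} <->
  uz n \<in> uimg (p_plus k s) (p_minus k s) \<or> n = 0 \<and> 1 <= p_plus k s \<and> 1 <= p_minus k s" using par_nonempty k0 s eq C by simp
 then show ?P
  unfolding uz_in_uimg[OF 3] using 3 by (auto simp: Suc_le_eq)
qed

section \<open>Positive genus\<close>

abbreviation trivial_handle :: "ppt \<times> ppt" where
 "trivial_handle \<equiv> (pproj uone, pproj uone)"

primrec hword :: "(nat => ppt \<times> ppt) => nat => ucov" where
 "hword x 0 = uone"
| "hword x (Suc j) = hword x j &* pcomm (fst (x j)) (snd (x j))"

definition htuples :: "nat => (nat => ppt \<times> ppt) set" where
 "htuples g = {x. (\<forall>j<g. x j \<in> ppts \<times> ppts) \<and> (\<forall>j\<ge>g. x j = trivial_handle)}"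

definition ncom :: "nat => (nat => ppt \<times> ppt) set" where
 "ncom g = {x \<in> htuples g. x 0 \<in> npairs}"

lemma hword_cong: "(\<And>j. j < k ==> x j = y j) ==> hword x k = hword y k"
 by (induction k) auto

lemma hword_Suc_left: "hword x (Suc k) = pcomm (fst (x 0)) (snd (x 0)) &* hword (%j. x (Suc j)) k"
 by (induction k) (simp_all add: umult_assoc)

lemma fibered_hword:
 "fibered (ncom (Suc m)) (%x. hword x (Suc m)) (uband (- 2 * int m - 1) (2 * int m + 1) - (if m = 0 then {uone} else {}))"
proof (induction m)
 case 0
 have "fibered (ncom 1) (%x. hword x 1) (uband (-1) 1 - {uone})"
 proof (rule fibered_iso[OF fibered_npairs])
  let ?A = "%_. trivial_handle"
  show "continuous_on npairs (%y. ?A(0 := y))" "continuous_on (ncom 1) (%x. x 0)"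
   by (intro continuous_intros)+
  fix x assume x: "x \<in> ncom 1"
  then have "(?A(0 := x 0)) j = x j" for j by (cases j) (auto simp: ncom_def htuples_def)
  then show "?A(0 := x 0) = x" by blast
 qed (auto simp: ncom_def htuples_def npairs_def)
 then show ?case by simp
next
 case (Suc m)
 define E :: "ucov set" where "E = (if m = 0 then {uone} else {})"
 define a b where "a = - 2 * int m - 1" and "b = 2 * int m + 1"
 note IH = Suc.IH[folded a_def b_def E_def]
 have ab: "a < b" "finite E" by (simp_all add: a_def b_def E_def)
 note split = pairs_split[OF ab]
 have "fibered (ncom (Suc m) \<times> (ppts \<times> ppts)) (%x. hword (fst x) (Suc m) &* pcomm (fst (snd x)) (snd (snd x))) (uband (a - 2) (b + 2))"
  by (intro fibered_fusion[OF IH] continuous_on_pcomm_aux split)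
 then have "fibered (ncom (Suc (Suc m))) (%x. hword x (Suc (Suc m))) (uband (a - 2) (b + 2))"
 proof (rule fibered_iso)
  show "continuous_on (ncom (Suc m) \<times> (ppts \<times> ppts)) (%x. (fst x)(Suc m := snd x))"
   "continuous_on (ncom (Suc (Suc m))) (%x. (x(Suc m := trivial_handle), x (Suc m)))" by (intro continuous_intros)+
  show "(((fst x)(Suc m := snd x))(Suc m := trivial_handle), ((fst x)(Suc m := snd x)) (Suc m)) = x"
   "(fst x)(Suc m := snd x) \<in> ncom (Suc (Suc m))" if "x \<in> ncom (Suc m) \<times> (ppts \<times> ppts)" for x
   using that by (auto simp: ncom_def htuples_def mem_Times_iff less_Suc_eq prod_eq_iff)
  show "hword ((fst x)(Suc m := snd x)) (Suc (Suc m)) = hword (fst x) (Suc m) &* pcomm (fst (snd x)) (snd (snd x))" for x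
   using hword_cong[of "Suc m" "(fst x)(Suc m := snd x)" "fst x"] by simp
 qed (auto simp: ncom_def htuples_def less_Suc_eq)
 moreover have "a - 2 = - 2 * int (Suc m) - 1" "b + 2 = 2 * int (Suc m) + 1" by (simp_all add: a_def b_def)
 ultimately show ?case by simp
qed

lemma upp_inj:
 assumes "t = 1 \<or> t = -1" "upp t v = upp t w" shows "v = w"
proof -
 have f: "fst (upp t w) = arctan (t * cmod w)" "snd (upp t w) = of_real t * w * cis (- arctan (t * cmod w))" for w
  using polar[of w] by (simp_all add: upp_def upar_def) (metis mult.assoc sgn_zero mult_zero_right)
 have "arctan (t * cmod v) = arctan (t * cmod w)" using assms(2) f(1) by metis
 moreover from this have "of_real t * v * cis (- arctan (t * cmod w)) = of_real t * w * cis (- arctan (t * cmod w))"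
  using assms(2) f(2) by metis
 ultimately show ?thesis using assms(1) by auto
qed

lemma uband_split_minus:
 assumes "a <= b" "t = 1 \<or> t = -1" "finite E"
 shows "connected (usplit T t (uband a b - E))" (is ?Q)
  "usplit T t (uband a b - E) ~= {} <-> T \<in> uband (a - (if t = -1 then 1 else 0)) (b + (if t = 1 then 1 else 0))" (is ?P)
proof -
 define F where "F = {w. w ~= 0 \<and> T &* uinv (upp t w) \<in> E}"
 have "inj_on (%w. T &* uinv (upp t w)) F"
 proof (rule inj_onI)
  fix v w assume "T &* uinv (upp t v) = T &* uinv (upp t w)"
  then have "uinv (uinv (upp t v)) = uinv (uinv (upp t w))" by (metis uinv_cancel)
  then show "v = w" using upp_inj[OF assms(2)] by simp
 qed
 moreover have "finite ((%w. T &* uinv (upp t w)) ` F)" using assms(3) by (rule finite_subset[rotated]) (auto simp: F_def)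
 ultimately have F: "finite F" by (rule finite_imageD[rotated])
 have eq: "usplit T t (uband a b - E) = usplit T t (uband a b) - F" by (auto simp: usplit_def F_def)
 have o: "open (usplit T t (uband a b))" by (rule open_usplit[OF open_uband])
 have c: "connected (usplit T t (uband a b))"
  and n: "usplit T t (uband a b) ~= {} <-> T \<in> uband (a - (if t = -1 then 1 else 0)) (b + (if t = 1 then 1 else 0))"
  using uband_split_pos[OF assms(1), of T] uband_split_neg[OF assms(1), of T] assms(2) by auto
 show ?Q unfolding eq by (rule connected_open_delete_finite[OF o c _ F]) simp
 have "usplit T t (uband a b) - F ~= {} <-> usplit T t (uband a b) ~= {}"
 proof (intro iffI notI)
  assume "usplit T t (uband a b) ~= {}" "usplit T t (uband a b) - F = {}"
  then show False by (metis finite_imp_not_open F Diff_eq_empty_iff finite_subset o)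
 qed auto
 then show ?P
  unfolding eq n .
qed

definition sword :: "nat => nat => (nat => int) => (nat => ppt \<times> ppt) \<times> (nat => complex) => ucov" where
 "sword g p s x = hword (fst x) g &* pword s (snd x) p"

lemma fibered_sword:
 assumes s: "\<And>i. i < k ==> s i = 1 \<or> s i = -1"
 shows "fibered (ncom (Suc m) \<times> ptuples k) (sword (Suc m) k s)
  (uband (- 2 * int m - 1 - int (p_minus k s)) (2 * int m + 1 + int (p_plus k s)) - (if m = 0 \<and> k = 0 then {uone} else {}))"
 using s
proof (induction k)
 case 0
 have pt: "ptuples 0 = {%_. 1}" by (auto simp: ptuples_def)
 from fibered_hword[of m] have "fibered (ncom (Suc m) \<times> ptuples 0) (sword (Suc m) 0 s)
  (uband (- 2 * int m - 1) (2 * int m + 1) - (if m = 0 then {uone} else {}))"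
  by (rule fibered_iso[of _ _ _ "%x. (x, %_. 1)" _ fst]) (auto simp: sword_def pt intro!: continuous_on_Pair continuous_on_id continuous_on_const continuous_on_fst)
 then show ?case by simp
next
 case (Suc k)
 define E :: "ucov set" where "E = (if m = 0 \<and> k = 0 then {uone} else {})"
 define a b where "a = - 2 * int m - 1 - int (p_minus k s)" and "b = 2 * int m + 1 + int (p_plus k s)"
 let ?A = "ncom (Suc m) \<times> ptuples k"
 have IH: "fibered ?A (sword (Suc m) k s) (uband a b - E)"
  unfolding a_def b_def E_def using Suc by simp
 define t :: real where "t = of_int (s k)"
 have sk: "s k = 1 \<or> s k = -1" using Suc.prems by simp
 have ab: "a <= b" "t = 1 \<or> t = -1" "finite E" using sk by (auto simp: a_def b_def E_def t_def)
 define J where "J = uband (a - (if t = -1 then 1 else 0)) (b + (if t = 1 then 1 else 0))"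
 have u: "{y \<in> - {0}. T &* uinv (upp t y) \<in> uband a b - E} = usplit T t (uband a b - E)" for T
  unfolding usplit_def by auto
 have "fibered (?A \<times> - {0}) (%x. sword (Suc m) k s (fst x) &* upp t (snd x)) J"
 proof (rule fibered_fusion[OF IH])
  show "continuous_on (- {0}) (upp t)" using continuous_on_upp[OF continuous_on_id, of "- {0}" t] by auto
  show "connected {y \<in> - {0}. T &* uinv (upp t y) \<in> uband a b - E}" for T
   unfolding u by (rule uband_split_minus[OF ab])
  show "{y \<in> - {0}. T &* uinv (upp t y) \<in> uband a b - E} ~= {} <-> T \<in> J" for T
   unfolding u J_def by (rule uband_split_minus[OF ab])
 qed
 then have "fibered (ncom (Suc m) \<times> ptuples (Suc k)) (sword (Suc m) (Suc k) s) J"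
 proof (rule fibered_iso)
  define h where "h = (%x :: ((nat => ppt \<times> ppt) \<times> (nat => complex)) \<times> complex. (fst (fst x), (snd (fst x))(k := snd x)))"
  define z where "z = (%x :: (nat => ppt \<times> ppt) \<times> (nat => complex). ((fst x, (snd x)(k := 1)), snd x k))"
  show "continuous_on (?A \<times> - {0}) h" unfolding h_def by (intro continuous_intros)
  show "continuous_on (ncom (Suc m) \<times> ptuples (Suc k)) z" unfolding z_def
   by (intro continuous_intros continuous_on_product_then_coordinatewise[OF continuous_on_snd[OF continuous_on_id]])
  show "z (h x) = x" if "x \<in> ?A \<times> - {0}" for x
  proof -
   have "snd (fst x) k = 1" using that by (simp add: mem_Times_iff ptuples_def)
   then show ?thesis by (simp add: h_def z_def prod_eq_iff fun_upd_idem)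
  qed
  show "sword (Suc m) (Suc k) s (h x) = sword (Suc m) k s (fst x) &* upp t (snd x)" for x
   using pword_cong[of k "(snd (fst x))(k := snd x)" "snd (fst x)" s]
   by (simp add: sword_def h_def umult_assoc t_def del: hword.simps)
  show "h x \<in> ncom (Suc m) \<times> ptuples (Suc k)" if "x \<in> ?A \<times> - {0}" for x
   using that by (auto simp: h_def ptuples_def less_Suc_eq)
  show "z x \<in> ?A \<times> - {0}" "h (z x) = x" if "x \<in> ncom (Suc m) \<times> ptuples (Suc k)" for x
   using that by (auto simp: h_def z_def ptuples_def less_Suc_eq)
 qed
 moreover have "J = uband (- 2 * int m - 1 - int (p_minus (Suc k) s)) (2 * int m + 1 + int (p_plus (Suc k) s))"
  using sk by (auto simp: J_def a_def b_def t_def p_plus_Suc p_minus_Suc)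
 ultimately show ?case by simp
qed

subsection \<open>Commuting handles\<close>

lemma pcomm_commuting:
 assumes "0 < cm_det A" "0 < cm_det B" "A #* B = B #* A" shows "pcomm (pmat A) (pmat B) = uone"
proof -
 obtain k where k: "A = sqrt (cm_det A) *\<^sub>R umat k" "pmat A = pproj k" using det_pos_scale[OF assms(1)] .
 obtain l where l: "B = sqrt (cm_det B) *\<^sub>R umat l" "pmat B = pproj l" using det_pos_scale[OF assms(2)] .
 define c d where "c = sqrt (cm_det A)" and "d = sqrt (cm_det B)"
 have cd: "c ~= 0" "d ~= 0" using assms by (simp_all add: c_def d_def)
 have "c *\<^sub>R umat k #* d *\<^sub>R umat l = d *\<^sub>R umat l #* c *\<^sub>R umat k"
  using assms(3) k(1) l(1) unfolding c_def d_def by metis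
 then have "umat (k &* l) = umat (l &* k)" using cd by (simp add: umat_mult mult.commute[of d])
 then obtain n where n: "k &* l = uz (2 * n) &* (l &* k)" unfolding umat_eq_iff by blast
 have "ucomm k l = uz (2 * n) &* uone" unfolding ucomm_def n by (simp add: umult_assoc)
 then have "ucomm k l = uone" by (rule ucomm_level[rotated 2]) (simp_all add: ulo_def uhi_def)
 then show ?thesis by (simp add: k(2) l(2))
qed

definition contract :: "real => ppt => ppt" where
 "contract t q = pmat ((of_real (1 - t), 0) + t *\<^sub>R umat (plift q))"

lemma contract_det:
 assumes t: "0 <= t" "t <= 1" and q: "q \<in> ppts" shows "0 < cm_det ((of_real (1 - t), 0) + t *\<^sub>R umat (plift q))"
proof -
 have "0 <= cos (Arg (fst q) / 2)"
  using Arg_bounded[of "fst q"] by (intro cos_ge_zero) auto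
 then have r: "0 <= Re (fst (umat (plift q)))" by (simp add: umat_def plift_def)
 have "cm_det ((of_real (1 - t), 0) + t *\<^sub>R umat (plift q)) = (1 - t)\<^sup>2 + 2 * t * ((1 - t) * Re (fst (umat (plift q)))) + t\<^sup>2"
  unfolding cm_det_add by (simp add: cm_ip_def cm_det_def[of "(_, 0)"] cmod_power2)
 moreover have "0 <= 2 * t * ((1 - t) * Re (fst (umat (plift q))))" using t r by simp
 moreover have "0 < (1 - t)\<^sup>2 + t\<^sup>2"
  using t by (cases "t = 0") (auto intro!: add_nonneg_pos)
 ultimately show ?thesis by linarith
qed

lemma contract:
 assumes q: "q \<in> ppts"
 shows "continuous_on {0..1} (%t. contract t q)" (is ?P) "contract 0 q = pproj uone" "contract 1 q = q"
  "0 <= t ==> t <= 1 ==> contract t q \<in> ppts"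
proof -
 let ?A = "%t. (of_real (1 - t), 0) + t *\<^sub>R umat (plift q)"
 have "continuous_on (?A ` {0..1}) pmat"
  using contract_det[OF _ _ q] by (intro continuous_on_subset[OF continuous_on_pmat]) auto
 moreover have "continuous_on {0..1} ?A" by (intro continuous_intros)
 ultimately show ?P
  unfolding contract_def using continuous_on_compose[of "{0..1}" "%t. (of_real (1 - t), 0) + t *\<^sub>R umat (plift q)" pmat]
  by (simp add: o_def)
 have "umat uone = (1, 0)" by (simp add: umat_def radius_def)
 then show "contract 0 q = pproj uone" using pmat_umat[of uone] by (simp add: contract_def)
 show "contract 1 q = q" using q by (simp add: contract_def flip: zero_prod_def)
 show "0 <= t ==> t <= 1 ==> contract t q \<in> ppts" unfolding contract_def by (intro pmat_in_ppts contract_det q)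
qed

lemma contract_commuting:
 assumes q: "q \<in> ppts" "r \<in> ppts" "pcomm q r = uone" and t: "0 <= t" "t <= 1"
 shows "pcomm (contract t q) (contract t r) = uone"
proof -
 have c: "umat (plift q) #* umat (plift r) = umat (plift r) #* umat (plift q)" by (metis pcomm_def ucomm_def q umult_assoc uinv_left umult_one umat_mult)
 show ?thesis unfolding contract_def
 proof (rule pcomm_commuting)
  define U V where "U = umat (plift q)" and "V = umat (plift r)"
  let ?A = "(of_real (1 - t), 0)"
  show "(?A + t *\<^sub>R umat (plift q)) #* (?A + t *\<^sub>R umat (plift r))
    = (?A + t *\<^sub>R umat (plift r)) #* (?A + t *\<^sub>R umat (plift q))"
   using c unfolding U_def[symmetric] V_def[symmetric]
   by (simp only: cm_mult_add cm_mult_scaleR cm_scalar) (simp add: algebra_simps)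
 qed (intro contract_det q t)+
qed

definition pborel :: "complex => real => ppt" where
 "pborel v r = pmat (of_real (r + 1), \<i> * v * of_real (r - 1))"

lemma pborel:
 assumes z: "cmod v = 1"
 shows "pborel v 1 = pproj uone" "continuous_on {0<..} (pborel v)" "0 < h ==> pborel v h \<in> ppts"
  "0 < h ==> pcomm (pborel v h) (pproj (upar v 1)) = upar v (h - 1)"
proof -
 have "(of_real (1 + 1), \<i> * v * of_real (1 - 1)) = 2 *\<^sub>R umat uone" by (simp add: scaleR_conv_of_real)
 then show "pborel v 1 = pproj uone" unfolding pborel_def by (simp only: pmat_scaleR[of 2] pmat_umat zero_neq_numeral[symmetric] not_False_eq_True)
 have "continuous_on ((%h. (of_real (h + 1), \<i> * v * of_real (h - 1))) ` {0<..}) pmat"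
  using upar_scale_intertwiner(1)[OF z] by (intro continuous_on_subset[OF continuous_on_pmat]) auto
 moreover have "continuous_on {0<..} (%h. (of_real (h + 1) :: complex, \<i> * v * of_real (h - 1)))" by (intro continuous_intros)
 ultimately show "continuous_on {0<..} (pborel v)"
  unfolding pborel_def[abs_def] using continuous_on_compose[of "{0<..}" "%h. (of_real (h + 1), \<i> * v * of_real (h - 1))" pmat]
  by (simp add: o_def)
 assume r: "0 < h"
 define B :: cmat where "B = (of_real (h + 1), \<i> * v * of_real (h - 1))"
 note I = upar_scale_intertwiner[OF z r, folded B_def]
 show "pborel v h \<in> ppts" unfolding pborel_def B_def[symmetric] by (rule pmat_in_ppts[OF I(1)])
 obtain k where k: "B = sqrt (cm_det B) *\<^sub>R umat k" "pmat B = pproj k" using det_pos_scale[OF I(1)] .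
 have "B #* umat (upar v 1) = umat (upar v h) #* B" using I(2)[of 1] unfolding umat_upar[OF z] by simp
 then have "sqrt (cm_det B) *\<^sub>R (umat k #* umat (upar v 1)) = sqrt (cm_det B) *\<^sub>R (umat (upar v h) #* umat k)"
  by (subst (asm) (1 2) k(1)) simp
 then have "umat (k &* upar v 1) = umat (upar v h &* k)" using I(1) by (simp add: umat_mult)
 then obtain n where n: "k &* upar v 1 = uz (2 * n) &* (upar v h &* k)" unfolding umat_eq_iff by blast
 have "ucomm k (upar v 1) = uz (2 * n) &* (upar v h &* uinv (upar v 1))" unfolding ucomm_def n by (simp add: umult_assoc)
 then show "pcomm (pborel v h) (pproj (upar v 1)) = upar v (h - 1)" using assms ucomm_level k by (simp add: uinv_upar upar_add upar_bounds pborel_def B_def)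
qed

lemma sword_split:
 "sword (Suc m) (Suc q) s (x(0 := h), w(q := c)) =
  pcomm (fst h) (snd h) &* (hword (%j. x (Suc j)) m &* pword s w q &* upp (of_int (s q)) c)"
proof -
 have "hword (%j. (x(0 := h)) (Suc j)) m = hword (%j. x (Suc j)) m" by simp
 moreover have "pword s (w(q := c)) q = pword s w q" by (rule pword_cong) simp
 ultimately show ?thesis unfolding sword_def by (simp add: hword_Suc_left umult_assoc del: hword.simps(2))
qed

lemma commuting_reach:
 assumes x: "x \<in> htuples (Suc m)" "x 0 \<notin> npairs" and w: "w \<in> ptuples (Suc q)" and t: "s q = 1 \<or> s q = -1"
  and e: "sword (Suc m) (Suc q) s (x, w) = uz n"
 defines "F \<equiv> {y \<in> htuples (Suc m) \<times> ptuples (Suc q). sword (Suc m) (Suc q) s y = uz n}"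
  and "C \<equiv> {y \<in> ncom (Suc m) \<times> ptuples (Suc q). sword (Suc m) (Suc q) s y = uz n}"
 shows "\<exists>D. connected D \<and> D \<subseteq> F \<and> (x, w) \<in> D \<and> D \<inter> closure C ~= {}"
proof -
 define Q where "Q = hword (%j. x (Suc j)) m &* pword s w q"
 have sw: "sword (Suc m) (Suc q) s (x(0 := h), w(q := c)) = pcomm (fst h) (snd h) &* (Q &* upp (of_int (s q)) c)" for h c
  unfolding Q_def by (rule sword_split)
 have x0: "fst (x 0) \<in> ppts" "snd (x 0) \<in> ppts" using x(1) by (auto simp: htuples_def mem_Times_iff)
 then have com: "pcomm (fst (x 0)) (snd (x 0)) = uone" using x(2) by (simp add: npairs_def)
 have Q: "Q &* upp (of_int (s q)) (w q) = uz n" using sw[of "x 0" "w q"] e com by simp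
 have wq: "w q ~= 0" using w by (simp add: ptuples_def)
 define v where "v = sgn (w q)"
 have z: "cmod v = 1" using wq by (simp add: v_def cmod_sgn)
 have htup: "x(0 := h) \<in> htuples (Suc m)" if "fst h \<in> ppts" "snd h \<in> ppts" for h
  using x(1) that by (auto simp: htuples_def mem_Times_iff)
 have inF: "(x(0 := h), w) \<in> F" if "fst h \<in> ppts" "snd h \<in> ppts" "pcomm (fst h) (snd h) = uone" for h
  using sw[of h "w q"] that htup Q w by (simp add: F_def)
 define f1 where "f1 = (%r. (x(0 := (contract r (fst (x 0)), contract r (snd (x 0)))), w))"
 define f2 where "f2 = (%r. (x(0 := (pproj uone, pproj (upar v r))), w))"
 have "continuous_on {0..1} f1" unfolding f1_def by (intro continuous_intros contract x0)
 then have c1: "connected (f1 ` {0..1})" by (rule connected_continuous_image) simp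
 have "continuous_on {0..1} f2" unfolding f2_def upar_def by (intro continuous_intros)
 then have c2: "connected (f2 ` {0..1})" by (rule connected_continuous_image) simp
 define D where "D = f1 ` {0..1} \<union> f2 ` {0..1}"
 have "f1 0 = f2 0" using contract(2) x0 by (simp add: f1_def f2_def)
 moreover have "f1 0 \<in> f1 ` {0..1}" "f2 0 \<in> f2 ` {0..1}" "f1 1 \<in> f1 ` {0..1}" "f2 1 \<in> f2 ` {0..1}" by simp_all
 ultimately have D: "f1 ` {0..1} \<inter> f2 ` {0..1} ~= {}" "f1 1 \<in> D" "f2 1 \<in> D"
  unfolding D_def by (metis IntI empty_iff, blast+)
 then have cD: "connected D" unfolding D_def by (intro connected_Un c1 c2)
 have "f1 1 = (x, w)" using contract(3) x0 by (simp add: f1_def)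
 moreover have "D \<subseteq> F"
 proof -
  have "f1 r \<in> F" if "r \<in> {0..1}" for r
   unfolding f1_def using that x0 com by (intro inF) (auto intro: contract contract_commuting)
  moreover have "f2 r \<in> F" for r
   unfolding f2_def by (intro inF) (simp_all add: ucomm_def)
  ultimately show ?thesis unfolding D_def by blast
 qed
 moreover have "f2 1 \<in> closure C"
 proof -
  define t where "t = real_of_int (s q)"
  have tt: "t = 1 \<or> t = -1" using assms(4) by (auto simp: t_def)
  define d where "d = min (1 / 2) (cmod (w q) / 2)"
  have d: "0 < d" "d <= 1 / 2" "d < cmod (w q)" using wq by (auto simp: d_def min_def)
  define h where "h = (%e. (pborel v (1 + t * e), pproj (upar v 1)))"
  define k where "k = (%e. (x(0 := h e), w(q := of_real (cmod (w q) - e) * v)))"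
  have rho: "0 < 1 + t * e" if "e \<in> {0..d}" for e using that tt d by auto
  have "continuous_on {0..d} (%e. pborel v (1 + t * e))"
   by (rule continuous_on_compose2[OF pborel(2)[OF z]]) (use rho in \<open>auto intro!: continuous_intros\<close>)
  then have "continuous_on {0..d} k" unfolding k_def h_def by (intro continuous_intros)
  moreover have "k ` {0<..<d} \<subseteq> C"
  proof (rule image_subsetI)
   fix e assume e: "e \<in> {0<..<d}"
   have h: "fst (h e) \<in> ppts" "snd (h e) \<in> ppts" "pcomm (fst (h e)) (snd (h e)) = upar v (t * e)"
    using pborel(3,4)[OF z, of "1 + t * e"] rho[of e] e by (simp_all add: h_def)
   have 1: "x(0 := h e) \<in> ncom (Suc m)" using e tt h htup by (auto simp: npairs_def upar_def ncom_def)
   have re: "0 < cmod (w q) - e" using e d by auto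
   then have 2: "w(q := of_real (cmod (w q) - e) * v) \<in> ptuples (Suc q)" using z w by (auto simp: ptuples_def)
   have u: "upp t (w q) = upar v (t * cmod (w q))" "upp t (of_real (cmod (w q) - e) * v) = upar v (t * (cmod (w q) - e))"
    using upp_polar[OF z re] by (simp_all add: upp_def v_def)
   have Q': "Q = uz n &* upar v (- (t * cmod (w q)))"
    using Q unfolding t_def[symmetric] u(1) umult_eq_iff(1) uinv_upar[OF z] .
   have "upar v (t * e) &* (Q &* upp t (of_real (cmod (w q) - e) * v))
     = uz n &* (upar v (t * e) &* upar v (- (t * cmod (w q))) &* upar v (t * (cmod (w q) - e)))" by (smt (verit) uz_central Q' u umult_assoc)
   also have "\<dots> = uz n" unfolding upar_add[OF z] by (simp add: algebra_simps)
   finally have "sword (Suc m) (Suc q) s (k e) = uz n" unfolding k_def sw h(3) t_def[symmetric] .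
   then show "k e \<in> C" using 1 2 by (simp add: C_def k_def)
  qed
  moreover have "closure {0<..<d} = {0..d}" using d by simp
  ultimately have "k ` {0..d} \<subseteq> closure C"
   using image_closure_subset[of "{0<..<d}" k "closure C"] closure_subset[of C] by simp
  moreover have "k 0 = f2 1"
   using polar[OF wq] by (simp add: k_def h_def f2_def pborel(1)[OF z] v_def[symmetric] fun_upd_idem)
  moreover have "k 0 \<in> k ` {0..d}" using d by simp
  ultimately show ?thesis by (metis subsetD)
 qed
 ultimately show ?thesis using D cD by auto
qed

lemma connected_closure_reach:
 assumes C: "connected C" "C \<subseteq> F"
  and reach: "\<And>y. y \<in> F ==> y \<notin> C ==> \<exists>D. connected D \<and> D \<subseteq> F \<and> y \<in> D \<and> D \<inter> closure C ~= {}"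
 shows "connected F" "C = {} <-> F = {}" (is ?P)
proof -
 show e: ?P
 using reach C by force
 show "connected F"
 proof (cases "F = {}")
  case False
  then obtain c where c: "c \<in> C" using e by blast
  show ?thesis
  proof (rule connected_hub)
   fix y assume y: "y \<in> F"
   show "\<exists>K. connected K \<and> K \<subseteq> F \<and> c \<in> K \<and> y \<in> K"
   proof (cases "y \<in> C")
    case True then show ?thesis using C c by blast
   next
    case False
    then obtain D d where D: "connected D" "D \<subseteq> F" "y \<in> D" "d \<in> D" "d \<in> closure C" using reach[OF y] by blast
    have "connected (insert d C)"
     using D(5) closure_subset by (intro connected_intermediate_closure[OF C(1)]) auto
    then have "connected (insert d C \<union> D)" using D by (intro connected_Un) auto
    then show ?thesis using D C c by (intro exI[of _ "insert d C \<union> D"]) auto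
   qed
  qed
 qed simp
qed

lemma connected_positive_genus:
 assumes s: "\<And>i. i < Suc q ==> s i = 1 \<or> s i = -1"
 shows "connected {y \<in> htuples (Suc m) \<times> ptuples (Suc q). sword (Suc m) (Suc q) s y = uz n}" (is ?Q)
  "{y \<in> htuples (Suc m) \<times> ptuples (Suc q). sword (Suc m) (Suc q) s y = uz n} ~= {} <->
   - 2 * int m - int (p_minus (Suc q) s) <= n \<and> n <= 2 * int m + int (p_plus (Suc q) s)" (is ?P)
proof -
 define F where "F = {y \<in> htuples (Suc m) \<times> ptuples (Suc q). sword (Suc m) (Suc q) s y = uz n}"
 define C where "C = {y \<in> ncom (Suc m) \<times> ptuples (Suc q). sword (Suc m) (Suc q) s y = uz n}"
 define I where "I = uband (- 2 * int m - 1 - int (p_minus (Suc q) s)) (2 * int m + 1 + int (p_plus (Suc q) s))"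
 have fib: "fibered (ncom (Suc m) \<times> ptuples (Suc q)) (sword (Suc m) (Suc q) s) I"
  using fibered_sword[of "Suc q" s m] s by (simp add: I_def)
 have C: "connected C" using fib unfolding C_def fibered_def by (elim conjE) (rule spec)
 have img: "I = sword (Suc m) (Suc q) s ` (ncom (Suc m) \<times> ptuples (Suc q))" using fib unfolding fibered_def by simp
 have ne: "C ~= {} <-> uz n \<in> I" unfolding C_def img image_iff by (auto intro: HOL.sym)
 have sub: "C \<subseteq> F" by (auto simp: C_def F_def ncom_def)
 have reach: "\<exists>D. connected D \<and> D \<subseteq> F \<and> y \<in> D \<and> D \<inter> closure C ~= {}" if y: "y \<in> F" "y \<notin> C" for y
 proof -
  have y': "fst y \<in> htuples (Suc m)" "snd y \<in> ptuples (Suc q)" "sword (Suc m) (Suc q) s (fst y, snd y) = uz n" "fst y 0 \<notin> npairs"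
   using y by (auto simp: F_def C_def ncom_def mem_Times_iff)
  have "s q = 1 \<or> s q = -1" using s by simp
  from commuting_reach[where s = s, OF y'(1,4,2) this y'(3)] show ?thesis unfolding F_def C_def by simp
 qed
 note R = connected_closure_reach[OF C sub reach]
 show ?Q
  using R(1) unfolding F_def .
 show ?P
  using R(2) ne unfolding F_def[symmetric] by (auto simp: I_def uz_in_uband)
qed

section \<open>The matrix model\<close>

definition mcm :: "real^2^2 => cmat" where
 "mcm A = (Complex ((A$1$1 + A$2$2) / 2) ((A$1$2 - A$2$1) / 2), Complex ((A$1$1 - A$2$2) / 2) (- (A$1$2 + A$2$1) / 2))"

definition cmm :: "cmat => real^2^2" where
 "cmm z = mat2 (Re (fst z) + Re (snd z)) (Im (fst z) - Im (snd z)) (- Im (fst z) - Im (snd z)) (Re (fst z) - Re (snd z))"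

lemma mat2_nth [simp]: "mat2 a b c d $ 1 $ 1 = a" "mat2 a b c d $ 1 $ 2 = b" "mat2 a b c d $ 2 $ 1 = c" "mat2 a b c d $ 2 $ 2 = d"
 by (simp_all add: mat2_def)

lemma mat2_eq_iff: "A = (B :: real^2^2) <-> A$1$1 = B$1$1 \<and> A$1$2 = B$1$2 \<and> A$2$1 = B$2$1 \<and> A$2$2 = B$2$2"
 by (simp add: vec_eq_iff forall_2)

lemma mat_mult_nth: "(A ** (B :: real^2^2)) $ i $ j = A$i$1 * B$1$j + A$i$2 * B$2$j"
 by (simp add: matrix_matrix_mult_def sum_2)

lemma mat_one_nth [simp]: "(mat 1 :: real^2^2) $ 1 $ 1 = 1" "(mat 1 :: real^2^2) $ 1 $ 2 = 0" "(mat 1 :: real^2^2) $ 2 $ 1 = 0" "(mat 1 :: real^2^2) $ 2 $ 2 = 1"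
 by (simp_all add: mat_def)

lemma mcm_cmm [simp]: "mcm (cmm z) = z"
 by (simp add: mcm_def cmm_def prod_eq_iff complex_eq_iff)

lemma cmm_mcm [simp]: "cmm (mcm A) = A"
 by (simp add: mcm_def cmm_def mat2_eq_iff field_simps)

lemma mcm_mult: "mcm (A ** B) = mcm A #* mcm B"
 by (simp add: mcm_def cm_mult_def mat_mult_nth prod_eq_iff complex_eq_iff field_simps)

lemma cmm_mult: "cmm (y #* z) = cmm y ** cmm z"
 by (metis mcm_mult mcm_cmm cmm_mcm)

lemma mcm_linear: "mcm (A + B) = mcm A + mcm B" "mcm (c *\<^sub>R A) = c *\<^sub>R mcm A" "mcm (- A) = - mcm A"
 by (simp_all add: mcm_def prod_eq_iff complex_eq_iff field_simps)

lemma cmm_minus: "cmm (- z) = - cmm z"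
 by (metis mcm_linear(3) mcm_cmm cmm_mcm)

lemma mcm_one [simp]: "mcm (mat 1) = (1, 0)"
 by (simp add: mcm_def complex_eq_iff)

lemma cmm_one [simp]: "cmm (1, 0) = mat 1"
 by (metis mcm_one cmm_mcm)

lemma det_mcm: "det A = cm_det (mcm A)"
 unfolding cm_det_def cmod_power2 by (simp add: mcm_def det_2 power2_eq_square field_simps)

lemma det_cmm [simp]: "det (cmm z) = cm_det z"
 by (simp add: det_mcm)

lemma trace_mcm: "trace A = 2 * Re (fst (mcm A))"
 by (simp add: mcm_def trace_def sum_2)

lemma continuous_on_mcm [continuous_intros]: "continuous_on S f ==> continuous_on S (%x. mcm (f x))"
proof -
 assume f: "continuous_on S f"
 have "continuous_on S (%x. f x $ i $ j)" for i j using f by (intro continuous_intros)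
 note c = this
 show ?thesis unfolding mcm_def Complex_eq by (intro continuous_intros c) auto
qed

lemma continuous_on_cmm [continuous_intros]: "continuous_on S f ==> continuous_on S (%x. cmm (f x))"
proof -
 have if_const: "continuous_on S (%x. if P then g x else h x)"
  if "continuous_on S g" "continuous_on S h" for P and g h :: "'a => real"
  using that by (cases P) auto
 assume f: "continuous_on S f"
 have "cmm z = (\<chi> i j. if i = 1 then (if j = 1 then Re (fst z) + Re (snd z) else Im (fst z) - Im (snd z))
   else (if j = 1 then - Im (fst z) - Im (snd z) else Re (fst z) - Re (snd z)))" for z
  by (simp add: cmm_def mat2_eq_iff)
 moreover have "continuous_on S (%x. \<chi> i j. if i = 1 then (if j = 1 then Re (fst (f x)) + Re (snd (f x)) else Im (fst (f x)) - Im (snd (f x)))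
   else (if j = 1 then - Im (fst (f x)) - Im (snd (f x)) else Re (fst (f x)) - Re (snd (f x))) :: real^2^2)"
 proof (intro continuous_on_vec_lambda)
  fix i j :: 2
  show "continuous_on S (%x. if i = 1 then (if j = 1 then Re (fst (f x)) + Re (snd (f x)) else Im (fst (f x)) - Im (snd (f x)))
   else (if j = 1 then - Im (fst (f x)) - Im (snd (f x)) else Re (fst (f x)) - Re (snd (f x))))"
   by (intro if_const continuous_intros f)
 qed
 ultimately show ?thesis by simp
qed

lemma SL2R_simps [simp]: "carrier SL2R = {A. det A = 1}" "x \<otimes>\<^bsub>SL2R\<^esub> y = x ** y" "\<one>\<^bsub>SL2R\<^esub> = mat 1"
 by (simp_all add: SL2R_def)

lemma uminus_mult: "- A ** B = - (A ** (B :: real^2^2))" "(A :: real^2^2) ** - B = - (A ** B)"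
 by (simp_all add: mat2_eq_iff mat_mult_nth)

lemma psl_eq: "psl A = {A, - A}"
 by (auto simp: psl_def r_coset_def uminus_mult)

lemma psl_minus [simp]: "psl (- A) = psl A"
 by (auto simp: psl_eq)

lemma carrier_PSL2R: "carrier PSL2R = psl ` {A. det A = 1}"
 by (auto simp: PSL2R_def FactGroup_def RCOSETS_def psl_def)

lemma one_PSL2R: "\<one>\<^bsub>PSL2R\<^esub> = psl (mat 1)"
 by (simp add: PSL2R_def FactGroup_def psl_eq)

lemma mult_PSL2R: "psl A \<otimes>\<^bsub>PSL2R\<^esub> psl B = psl (A ** B)"
 by (auto simp: PSL2R_def FactGroup_def set_mult_def psl_eq uminus_mult)

definition upsl :: "ucov => (real^2^2) set" where
 "upsl k = psl (cmm (umat k))"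

definition pcoord :: "(real^2^2) set => ppt" where
 "pcoord X = pmat (mcm (SOME A. A \<in> X))"

lemma pcoord_psl: "pcoord (psl A) = pmat (mcm A)"
proof -
 have "(SOME B. B \<in> psl A) \<in> psl A" by (rule someI[of _ A]) (simp add: psl_eq)
 then have "mcm (SOME B. B \<in> psl A) = 1 *\<^sub>R mcm A \<or> mcm (SOME B. B \<in> psl A) = (-1) *\<^sub>R mcm A" using mcm_linear by (auto simp: psl_eq)
 then show ?thesis unfolding pcoord_def using pmat_scaleR[of 1 "mcm A"] pmat_scaleR[of "-1" "mcm A"] by auto
qed

lemma pcoord_upsl [simp]: "pcoord (upsl k) = pproj k"
 by (simp add: upsl_def pcoord_psl)

lemma upsl_in [simp]: "upsl k \<in> carrier PSL2R"
 by (simp add: upsl_def carrier_PSL2R)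

lemma upsl_surj: assumes "X \<in> carrier PSL2R" obtains k where "X = upsl k"
proof -
 obtain A where A: "det A = 1" "X = psl A" using assms by (auto simp: carrier_PSL2R)
 then obtain k where "umat k = mcm A" using umat_surj[of "mcm A"] by (auto simp: det_mcm)
 then have "X = upsl k" using A by (simp add: upsl_def)
 then show ?thesis by (rule that)
qed

lemma umat_uz_mult: "umat (uz n &* k) = (if even n then umat k else - umat k)"
proof -
 have "umat (uz n) = (of_real (cos (pi * of_int n)), 0)"
  by (simp add: umat_def uz_def urot_def complex_eq_iff)
 moreover have "cos (pi * of_int n) = (if even n then 1 else -1)" by (rule cos_npi_int)
 ultimately show ?thesis by (simp add: umat_mult cm_scalar)
qed

lemma upsl_eq_iff: "upsl k = upsl l <-> pproj k = pproj l"
proof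
 show "upsl k = upsl l ==> pproj k = pproj l" by (metis pcoord_upsl)
 assume "pproj k = pproj l"
 then obtain n where "k = uz n &* l" unfolding pproj_eq_iff by blast
 then show "upsl k = upsl l" by (simp add: upsl_def umat_uz_mult cmm_minus)
qed

lemma upsl_eq_uz: "upsl k = upsl l <-> (\<exists>n. k = uz n &* l)"
 by (simp add: upsl_eq_iff pproj_eq_iff)

lemma upsl_mult: "upsl k \<otimes>\<^bsub>PSL2R\<^esub> upsl l = upsl (k &* l)"
 by (simp add: upsl_def mult_PSL2R umat_mult cmm_mult)

lemma upsl_one: "\<one>\<^bsub>PSL2R\<^esub> = upsl uone"
 by (simp add: upsl_def one_PSL2R umat_def)

lemma group_PSL2R: "group PSL2R"
proof (rule groupI)
 show "\<one>\<^bsub>PSL2R\<^esub> \<in> carrier PSL2R" by (simp add: upsl_one)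
 fix X Y Z assume "X \<in> carrier PSL2R" "Y \<in> carrier PSL2R" "Z \<in> carrier PSL2R"
 moreover obtain k where k: "X = upsl k" using upsl_surj calculation(1) .
 moreover obtain l where l: "Y = upsl l" using upsl_surj calculation(2) .
 moreover obtain m where m: "Z = upsl m" using upsl_surj calculation(3) .
 ultimately show "X \<otimes>\<^bsub>PSL2R\<^esub> Y \<in> carrier PSL2R"
  "X \<otimes>\<^bsub>PSL2R\<^esub> Y \<otimes>\<^bsub>PSL2R\<^esub> Z = X \<otimes>\<^bsub>PSL2R\<^esub> (Y \<otimes>\<^bsub>PSL2R\<^esub> Z)"
  by (simp_all add: upsl_mult umult_assoc)
next
 fix X assume "X \<in> carrier PSL2R"
 then obtain k where k: "X = upsl k" by (rule upsl_surj)
 show "\<one>\<^bsub>PSL2R\<^esub> \<otimes>\<^bsub>PSL2R\<^esub> X = X" by (simp add: upsl_one k upsl_mult)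
 have "upsl (uinv k) \<otimes>\<^bsub>PSL2R\<^esub> X = \<one>\<^bsub>PSL2R\<^esub>" by (simp add: k upsl_mult upsl_one)
 then show "\<exists>Y\<in>carrier PSL2R. Y \<otimes>\<^bsub>PSL2R\<^esub> X = \<one>\<^bsub>PSL2R\<^esub>" by (intro bexI[of _ "upsl (uinv k)"]) simp_all
qed

lemma upsl_inv: "inv\<^bsub>PSL2R\<^esub> (upsl k) = upsl (uinv k)"
 by (rule group.inv_equality[OF group_PSL2R]) (simp_all add: upsl_mult upsl_one)

lemma upsl_eq_one: "upsl k = \<one>\<^bsub>PSL2R\<^esub> <-> (\<exists>n. k = uz n)"
 unfolding upsl_one upsl_eq_uz by simp

lemma openin_PSL2R_top: "openin PSL2R_top U <-> U \<subseteq> carrier PSL2R \<and>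
  openin (top_of_set (carrier SL2R)) {A \<in> carrier SL2R. psl A \<in> U}"
proof -
 let ?A = "top_of_set (carrier SL2R)"
 have "istopology (%U. U \<subseteq> carrier PSL2R \<and> openin ?A {A \<in> carrier SL2R. psl A \<in> U})"
  unfolding istopology_def
 proof (rule conjI; intro allI impI conjI)
  fix S T :: "(real^2^2) set set"
  assume S: "S \<subseteq> carrier PSL2R \<and> openin ?A {A \<in> carrier SL2R. psl A \<in> S}"
   and T: "T \<subseteq> carrier PSL2R \<and> openin ?A {A \<in> carrier SL2R. psl A \<in> T}"
  show "S \<inter> T \<subseteq> carrier PSL2R" using S by blast
  let ?C = "{A \<in> carrier SL2R. psl A \<in> S \<inter> T}"
  have "?C = {A \<in> carrier SL2R. psl A \<in> S} \<inter> {A \<in> carrier SL2R. psl A \<in> T}" by blast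
  then show "openin ?A ?C" using S T by (simp only: openin_Int)
 next
  fix K :: "(real^2^2) set set set"
  assume K: "\<forall>S\<in>K. S \<subseteq> carrier PSL2R \<and> openin ?A {A \<in> carrier SL2R. psl A \<in> S}"
  show "\<Union> K \<subseteq> carrier PSL2R" using K by blast
  let ?B = "(%S. {A \<in> carrier SL2R. psl A \<in> S}) ` K"
  let ?D = "{A \<in> carrier SL2R. psl A \<in> \<Union> K}"
  have "?D = \<Union> ?B" by blast
  moreover have "openin ?A (\<Union> ?B)" using K by (intro openin_Union) blast
  ultimately show "openin ?A ?D" by (simp only:)
 qed
 then show ?thesis unfolding PSL2R_top_def by (simp only: topology_inverse')
qed

lemma topspace_PSL2R_top [simp]: "topspace PSL2R_top = carrier PSL2R"
proof
 show "topspace PSL2R_top \<subseteq> carrier PSL2R" using openin_PSL2R_top by (metis openin_topspace)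
 have "{A \<in> carrier SL2R. psl A \<in> carrier PSL2R} = carrier SL2R" by (auto simp: carrier_PSL2R)
 then have "openin PSL2R_top (carrier PSL2R)" unfolding openin_PSL2R_top by simp
 then show "carrier PSL2R \<subseteq> topspace PSL2R_top" by (rule openin_subset)
qed

lemma continuous_map_psl: "continuous_map (top_of_set {A. det A = 1}) PSL2R_top psl"
 unfolding continuous_map_def by (auto simp: carrier_PSL2R openin_PSL2R_top)

lemma continuous_map_upsl: "continuous_map euclidean PSL2R_top upsl"
proof -
 have "continuous_on UNIV (%k. cmm (umat k))" by (intro continuous_intros)
 then have "continuous_map euclidean (top_of_set {A. det A = 1}) (%k. cmm (umat k))"
  by (simp add: continuous_map_in_subtopology)
 from continuous_map_compose[OF this continuous_map_psl] show ?thesis by (simp add: o_def upsl_def[abs_def])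
qed

lemma open_upsl_vimage: "openin PSL2R_top U ==> open {k. upsl k \<in> U}"
 using openin_continuous_map_preimage[OF continuous_map_upsl, of U] by simp

lemma continuous_map_pcoord: "continuous_map PSL2R_top (top_of_set ppts) pcoord"
 unfolding continuous_map_def
proof (intro conjI allI impI)
 show "pcoord \<in> topspace PSL2R_top \<rightarrow> topspace (top_of_set ppts)"
  by (auto elim: upsl_surj)
 fix U :: "ppt set" assume U: "openin (top_of_set ppts) U"
 let ?A = "%A. pmat (mcm A)"
 have c: "continuous_on {A. det A = 1} ?A"
  by (rule continuous_on_compose2[OF continuous_on_pmat]) (auto intro!: continuous_intros simp: det_mcm)
 have "?A \<in> {A. det A = 1} \<rightarrow> ppts" by (auto intro!: pmat_in_ppts simp: det_mcm)
 then have "openin (top_of_set {A. det A = 1}) ({A. det A = 1} \<inter> ?A -` U)"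
  using c U by (intro continuous_openin_preimage[of _ _ ppts]) auto
 moreover have "{A. det A = 1} \<inter> ?A -` U = {A \<in> carrier SL2R. psl A \<in> {X \<in> carrier PSL2R. pcoord X \<in> U}}"
  by (auto simp: pcoord_psl carrier_PSL2R)
 ultimately show "openin PSL2R_top {X \<in> topspace PSL2R_top. pcoord X \<in> U}"
  unfolding openin_PSL2R_top by simp
qed

subsection \<open>Parabolic elements and their signs\<close>

lemma trace_psl: "B \<in> psl A ==> \<bar>trace B\<bar> = 2 * \<bar>Re (fst (mcm A))\<bar>"
 by (auto simp: psl_eq trace_mcm mcm_linear)

lemma plift_upar: assumes "cmod v = 1" shows "plift (pproj (upar v r)) = upar v r"
proof -
 have "Arg (cis (2 * arctan r)) = 2 * arctan r"
  using arctan_ubound[of r] arctan_lbound[of r] by (intro Arg_cis) auto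
 then show ?thesis by (simp add: plift_def pproj_def upar_def)
qed

lemma parabolic_upsl: "parabolic (upsl k) <-> \<bar>Re (fst (umat k))\<bar> = 1 \<and> upsl k ~= \<one>\<^bsub>PSL2R\<^esub>"
proof -
 have "(\<forall>B\<in>upsl k. \<bar>trace B\<bar> = 2) <-> \<bar>Re (fst (umat k))\<bar> = 1"
  using trace_psl[of _ "cmm (umat k)"] psl_eq[of "cmm (umat k)"] unfolding upsl_def by auto
 then show ?thesis by (auto simp: parabolic_def)
qed

lemma parabolic_iff: "parabolic X <-> (\<exists>v r. cmod v = 1 \<and> r ~= 0 \<and> X = upsl (upar v r))"
proof
 assume X: "parabolic X"
 then obtain k_0 where k0: "X = upsl k_0" using upsl_surj by (auto simp: parabolic_def)
 define k where "k = plift (pproj k_0)"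
 have Xk: "X = upsl k" unfolding k0 upsl_eq_iff k_def by simp
 have fk: "\<bar>fst k\<bar> <= pi / 2" using Arg_bounded[of "fst (pproj k_0)"] by (auto simp: k_def plift_def abs_le_iff)
 have "0 <= Re (fst (umat k))" using fk cos_ge_zero by (simp add: umat_def)
 moreover have tr: "\<bar>Re (fst (umat k))\<bar> = 1" "X ~= \<one>\<^bsub>PSL2R\<^esub>" using X unfolding Xk parabolic_upsl by simp_all
 ultimately have re: "Re (fst (umat k)) = 1" by simp
 then have "cos (fst k) ~= 0" by (auto simp: umat_def)
 then have t: "\<bar>fst k\<bar> < pi / 2" by (smt (verit) cos_minus cos_pi_half fk)
 define y where "y = Im (fst (umat k))"
 have "y ~= 0"
 proof
  assume "y = 0"
  then have "sin (fst k) = 0" by (simp add: y_def umat_def)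
  then have f0: "fst k = 0" using t sin_gt_zero[of "\<bar>fst k\<bar>"] by (cases "fst k = 0") (auto simp: abs_if split: if_splits)
  then have "radius (snd k) = 1" using re by (simp add: umat_def)
  then have "snd k = 0" using radius_power2[of "snd k"] by simp
  then have "k = uone" using f0 by (simp add: prod_eq_iff)
  then show False using tr(2) Xk by (simp add: upsl_one)
 qed
 from upar_of_trace[OF re t y_def this] show "\<exists>v r. cmod v = 1 \<and> r ~= 0 \<and> X = upsl (upar v r)"
  using Xk \<open>y ~= 0\<close> by metis
next
 assume "\<exists>v r. cmod v = 1 \<and> r ~= 0 \<and> X = upsl (upar v r)"
 then obtain v r where r: "cmod v = 1" "r ~= 0" "X = upsl (upar v r)" by blast
 then show "parabolic X" by (simp add: parabolic_upsl umat_upar upsl_eq_one upar_eq_uz)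
qed

lemma conjugate_upsl: "conjugate_in PSL2R (upsl k) (upsl m) <-> (\<exists>l n. k = uz n &* (l &* m &* uinv l))"
proof
 assume "conjugate_in PSL2R (upsl k) (upsl m)"
 then obtain h where h: "h \<in> carrier PSL2R" "upsl k = h \<otimes>\<^bsub>PSL2R\<^esub> upsl m \<otimes>\<^bsub>PSL2R\<^esub> inv\<^bsub>PSL2R\<^esub> h" by (auto simp: conjugate_in_def)
 obtain l where "h = upsl l" using upsl_surj[OF h(1)] .
 then show "\<exists>l n. k = uz n &* (l &* m &* uinv l)" by (metis upsl_inv upsl_mult h upsl_eq_uz)
next
 assume "\<exists>l n. k = uz n &* (l &* m &* uinv l)"
 then obtain l n where "k = uz n &* (l &* m &* uinv l)" by blast
 then have "upsl k = upsl l \<otimes>\<^bsub>PSL2R\<^esub> upsl m \<otimes>\<^bsub>PSL2R\<^esub> inv\<^bsub>PSL2R\<^esub> (upsl l)" using upsl_eq_uz by (simp add: upsl_inv upsl_mult)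
 then show "conjugate_in PSL2R (upsl k) (upsl m)" unfolding conjugate_in_def by (intro bexI[of _ "upsl l"]) simp_all
qed

lemma upar_conjugate:
 assumes z: "cmod v = 1" "cmod h = 1" and r: "0 < p * r"
 shows "\<exists>l n. upar v r = uz n &* (l &* upar h p &* uinv l)"
proof -
 define u where "u = r / p"
 have rho: "0 < u" "u * p = r" using r by (auto simp: u_def zero_less_mult_iff divide_pos_pos divide_neg_neg)
 define S where "S = (of_real (u + 1) :: complex, \<i> * h * of_real (u - 1))"
 note S = upar_scale_intertwiner[OF z(2) rho(1), folded S_def]
 define c where "c = csqrt (v / h)"
 have c1: "cmod c = 1" by (simp add: c_def norm_csqrt norm_divide z)
 then have cc: "c * cnj c = 1" using complex_norm_square[of c] by simp
 have eta: "h ~= 0" using z by auto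
 have "c * c * h = v" using eta by (simp add: c_def flip: power2_eq_square)
 then have R: "(c, 0) #* (Complex 1 r, of_real r * h) = (Complex 1 r, of_real r * v) #* (c, 0)" using cc by (auto simp: cm_mult_def)
 define B where "B = (c, 0) #* S"
 have "B #* umat (upar h p) = (c, 0) #* (S #* umat (upar h p))" unfolding B_def by (simp add: cm_mult_assoc)
 also have "S #* umat (upar h p) = (Complex 1 r, of_real r * h) #* S" using S(2)[of p] unfolding umat_upar[OF z(2)] rho .
 also have "(c, 0) #* \<dots> = umat (upar v r) #* B" unfolding umat_upar[OF z(1)] B_def by (metis R cm_mult_assoc)
 finally have B: "B #* umat (upar h p) = umat (upar v r) #* B" .
 have "cm_det (c, 0) = 1" using c1 by (simp add: cm_det_def)
 then have "0 < cm_det B" using S(1) by (simp add: B_def)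
 then obtain l where l: "B = sqrt (cm_det B) *\<^sub>R umat l" "pmat B = pproj l" by (rule det_pos_scale)
 have "sqrt (cm_det B) *\<^sub>R (umat l #* umat (upar h p)) = sqrt (cm_det B) *\<^sub>R (umat (upar v r) #* umat l)"
  using B by (subst (asm) (1 2) l(1)) simp
 then have "umat (l &* upar h p) = umat (upar v r &* l)" using \<open>0 < cm_det B\<close> by (simp add: umat_mult)
 then have "umat (upar v r &* l) = umat (l &* upar h p)" ..
 then obtain n where "upar v r &* l = uz (2 * n) &* (l &* upar h p)" unfolding umat_eq_iff by blast
 then show ?thesis by (metis umult_assoc umult_eq_iff)
qed

lemma upar_not_conjugate:
 assumes z: "cmod v = 1" "cmod h = 1" and r: "0 < p" "r < 0"
 shows "upar v r ~= uz n &* (l &* upar h p &* uinv l)"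
proof
 assume e: "upar v r = uz n &* (l &* upar h p &* uinv l)"
 define K where "K = l &* upar h p &* uinv l"
 have "Re (fst (A #* B)) = Re (fst (B #* A))" for A B by (simp add: cm_mult_def algebra_simps)
 then have "Re (fst (umat K)) = Re (fst (umat (uinv l &* (l &* upar h p))))" unfolding K_def umat_mult by metis
 then have "Re (fst (umat K)) = 1" by (simp add: umat_upar z flip: umult_assoc)
 moreover have "Re (fst (umat (uz n &* K))) = 1" using umat_upar[OF z(1), of r] unfolding e K_def[symmetric] by simp
 ultimately have ev: "even n" by (auto simp: umat_uz_mult split: if_splits)
 have "uhi (upar v r) = uhi K + pi * of_int n" unfolding e K_def[symmetric] by (simp add: uhi_def uz_mult_left)
 then have hi: "uhi K = - pi * of_int n" using upar_bounds(2)[OF z(1), of r] r by simp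
 have "\<not> upar h p <~ uz 0" "upar h p <~ uz 1"
  using r upar_bounds(4)[OF z(2), of p] unfolding ule_uz uhi_upar[OF z(2)] by (simp_all add: not_le)
 then have "\<not> K <~ uz 0" "K <~ uz 1" unfolding K_def uz_ule_conj by simp_all
 then have "0 < uhi K" "uhi K <= pi" unfolding ule_uz by (simp_all add: not_le)
 then have "pi * of_int n < pi * 0" "pi * (-1) <= pi * of_int n" unfolding hi by simp_all
 then have "real_of_int n < 0" "-1 <= real_of_int n" by (simp_all only: mult_less_cancel_left_pos mult_le_cancel_left_pos pi_gt_zero)
 then show False using ev by auto
qed

lemma parabolic_models:
 "psl (mat2 1 1 0 1) = upsl (upar (- \<i>) (1 / 2))" "psl (mat2 1 (-1) 0 1) = upsl (upar (- \<i>) (- 1 / 2))"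
proof -
 have "cmm (umat (upar (- \<i>) (1 / 2))) = mat2 1 1 0 1" "cmm (umat (upar (- \<i>) (- 1 / 2))) = mat2 1 (-1) 0 1"
  by (simp_all add: umat_upar cmm_def)
 then show "psl (mat2 1 1 0 1) = upsl (upar (- \<i>) (1 / 2))" "psl (mat2 1 (-1) 0 1) = upsl (upar (- \<i>) (- 1 / 2))"
  by (simp_all only: upsl_def)
qed

lemma parabolic_sign:
 assumes z: "cmod v = 1" and r: "r ~= 0"
 shows "positive_parabolic (upsl (upar v r)) <-> 0 < r" "negative_parabolic (upsl (upar v r)) <-> r < 0"
proof -
 have p: "parabolic (upsl (upar v r))" using assms parabolic_iff by blast
 have i: "cmod (- \<i>) = 1" by simp
 have "\<not> (\<exists>l n. upar v r = uz n &* (l &* upar (- \<i>) (1 / 2) &* uinv l))" if "r < 0"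
  using upar_not_conjugate[OF z i _ that, of "1 / 2"] by auto
 moreover have "\<not> (\<exists>l n. upar v r = uz n &* (l &* upar (- \<i>) (- 1 / 2) &* uinv l))" if "0 < r"
 proof clarify
  fix l n assume "upar v r = uz n &* (l &* upar (- \<i>) (- 1 / 2) &* uinv l)"
  then have "upar v (- r) = uinv (l &* upar (- \<i>) (- 1 / 2) &* uinv l) &* uinv (uz n)"
   using uinv_upar[OF z, of r] by (metis uinv_mult)
  also have "\<dots> = uz (- n) &* (l &* upar (- \<i>) (1 / 2) &* uinv l)"
   by (simp add: uinv_mult uinv_uz uz_central uinv_upar umult_assoc)
  finally show False using upar_not_conjugate[OF z i, of "1 / 2" "- r"] that by simp
 qed
 moreover have "\<exists>l n. upar v r = uz n &* (l &* upar (- \<i>) (1 / 2) &* uinv l)" if "0 < r"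
  using upar_conjugate[OF z i, of "1 / 2" r] that by simp
 moreover have "\<exists>l n. upar v r = uz n &* (l &* upar (- \<i>) (- 1 / 2) &* uinv l)" if "r < 0"
  using upar_conjugate[OF z i, of "- 1 / 2" r] that by simp
 ultimately show "positive_parabolic (upsl (upar v r)) <-> 0 < r" "negative_parabolic (upsl (upar v r)) <-> r < 0"
  unfolding positive_parabolic_def negative_parabolic_def parabolic_models conjugate_upsl using p r by (meson linorder_neqE_linordered_idom)+
qed

section \<open>The universal covering group\<close>

lemma pcoord_in: "X \<in> carrier PSL2R ==> pcoord X \<in> ppts"
 by (auto elim: upsl_surj)

lemma upsl_pcoord: "X \<in> carrier PSL2R ==> pproj k = pcoord X ==> X = upsl k"
 by (metis upsl_surj pcoord_upsl upsl_eq_iff)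

lemma psl_lift_exists:
 fixes f :: "'a::real_normed_vector => (real^2^2) set"
 assumes S: "convex S" and f: "continuous_map (top_of_set S) PSL2R_top f"
 obtains z where "continuous_on S z" "\<forall>x\<in>S. f x = upsl (z x)"
proof -
 have "continuous_map (top_of_set S) (top_of_set ppts) (%x. pcoord (f x))"
  using continuous_map_compose[OF f continuous_map_pcoord] by (simp add: o_def)
 then have c: "continuous_on S (%x. pcoord (f x))" and p: "\<And>x. x \<in> S ==> pcoord (f x) \<in> ppts"
  by (auto simp: continuous_map_in_subtopology)
 have fc: "f x \<in> carrier PSL2R" if "x \<in> S" for x using f that by (auto simp: continuous_map_def)
 have "continuous_on S (%x. fst (pcoord (f x)))" using c by (rule continuous_on_fst)
 moreover have "contractible S" using S by (rule convex_imp_contractible)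
 moreover have n: "cmod (fst (pcoord (f x))) = 1" if "x \<in> S" for x using p[OF that] by (simp add: ppts_def)
 then have "fst (pcoord (f x)) ~= 0" if "x \<in> S" for x using that by force
 ultimately obtain g where g: "continuous_on S g" "\<And>x. x \<in> S ==> fst (pcoord (f x)) = exp (g x)"
  using continuous_logarithm_on_contractible by blast
 show ?thesis
 proof (rule that)
  show "continuous_on S (%x. (Im (g x) / 2, snd (pcoord (f x))))" using g(1) c by (intro continuous_intros) auto
  show "\<forall>x\<in>S. f x = upsl (Im (g x) / 2, snd (pcoord (f x)))"
  proof
  fix x assume x: "x \<in> S"
  have "exp (Re (g x)) = 1" using n[OF x] unfolding g(2)[OF x] by simp
  then show "f x = upsl (Im (g x) / 2, snd (pcoord (f x)))" using x upsl_pcoord fc by (simp add: exp_eq_polar pproj_def prod_eq_iff g)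
  qed
 qed
qed

lemma psl_lift_unique:
 assumes S: "connected S" and l: "continuous_on S z" "continuous_on S h"
  and e: "\<And>x. x \<in> S ==> upsl (z x) = upsl (h x)"
 shows "\<exists>n. \<forall>x\<in>S. z x = uz n &* h x"
proof -
 define d where "d = (%x. (fst (z x) - fst (h x)) / pi)"
 have ex: "\<exists>n. z x = uz n &* h x \<and> d x = of_int n" if "x \<in> S" for x
 proof -
  obtain n where "z x = uz n &* h x" using e[OF \<open>x \<in> S\<close>] unfolding upsl_eq_uz by blast
  then show ?thesis by (intro exI[of _ n]) (simp add: d_def uz_mult_left)
 qed
 have "continuous_on S d" unfolding d_def using l by (intro continuous_intros) auto
 moreover have "\<exists>e>0. \<forall>y. y \<in> S \<and> d y ~= d x --> e <= norm (d y - d x)" if x: "x \<in> S" for x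
 proof (intro exI[of _ 1] conjI allI impI)
  fix y assume y: "y \<in> S \<and> d y ~= d x"
  obtain m n where "d x = of_int m" "d y = of_int n" using ex x y by metis
  moreover from this y have "1 <= \<bar>real_of_int (n - m)\<bar>" by auto
  ultimately show "1 <= norm (d y - d x)" by simp
 qed simp
 ultimately have "d constant_on S" by (rule continuous_discrete_range_constant[OF S])
 then obtain c where c: "\<And>x. x \<in> S ==> d x = c" by (auto simp: constant_on_def)
 show ?thesis
 proof (cases "S = {}")
  case False
  then obtain x0 n where n: "d x0 = of_int n" "x0 \<in> S" using ex by blast
  have "z x = uz n &* h x" if x: "x \<in> S" for x
  using ex x c n by simp
  then show ?thesis by blast
 qed simp
qed

definition ulift :: "(real => (real^2^2) set) => (real => ucov) => bool" where
 "ulift c z <-> continuous_on {0..1} z \<and> z 0 = uone \<and> (\<forall>t\<in>{0..1}. c t = upsl (z t))"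

definition uend :: "(real => (real^2^2) set) => ucov" where
 "uend c = (THE k. \<exists>z. ulift c z \<and> z 1 = k)"

lemma continuous_map_upsl_compose: "continuous_on S z ==> continuous_map (top_of_set S) PSL2R_top (%x. upsl (z x))"
 using continuous_map_compose[OF _ continuous_map_upsl, of "top_of_set S" z] by (simp add: o_def)

lemma psl_paths_ulift: "c \<in> psl_paths <-> (\<exists>z. ulift c z)"
proof
 assume g: "c \<in> psl_paths"
 then have "continuous_map (top_of_set {0..1}) PSL2R_top c" "c 0 = \<one>\<^bsub>PSL2R\<^esub>" by (simp_all add: psl_paths_def pathin_def)
 moreover obtain z where l: "continuous_on {0..1} z" "\<forall>t\<in>{0..1}. c t = upsl (z t)"
  using psl_lift_exists[OF convex_real_interval(5) calculation(1)] .
 ultimately have "upsl (z 0) = \<one>\<^bsub>PSL2R\<^esub>" using l(2) by simp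
 then obtain n where n: "z 0 = uz n" unfolding upsl_eq_one by blast
 have "ulift c (%t. uz (- n) &* z t)"
  unfolding ulift_def
 proof (intro conjI ballI)
  show "continuous_on {0..1} (%t. uz (- n) &* z t)" using l(1) by (intro continuous_intros)
  show "uz (- n) &* z 0 = uone" by (simp add: n uz_add)
  fix t :: real assume "t \<in> {0..1}"
  then show "c t = upsl (uz (- n) &* z t)" unfolding bspec[OF l(2) \<open>t \<in> {0..1}\<close>] upsl_eq_uz
   by (intro exI[of _ n]) (simp add: uz_add flip: umult_assoc)
 qed
 then show "\<exists>z. ulift c z" by blast
next
 assume "\<exists>z. ulift c z"
 then obtain z where l: "continuous_on {0..1} z" "z 0 = uone" "\<And>t. t \<in> {0..1} ==> c t = upsl (z t)" by (auto simp: ulift_def)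
 have "continuous_map (top_of_set {0..1}) PSL2R_top c"
  by (rule continuous_map_eq[OF continuous_map_upsl_compose[OF l(1)]]) (simp add: l(3))
 moreover have "c 0 = \<one>\<^bsub>PSL2R\<^esub>" using l(3)[of 0] by (simp add: l(2) upsl_one)
 ultimately show "c \<in> psl_paths" by (simp add: psl_paths_def pathin_def)
qed

lemma uend_eq: assumes "ulift c z" shows "uend c = z 1"
 unfolding uend_def
proof (rule the_equality)
 show "\<exists>z'. ulift c z' \<and> z' 1 = z 1" using assms by blast
 fix k assume "\<exists>h. ulift c h \<and> h 1 = k"
 then obtain h where m: "ulift c h" "h 1 = k" by blast
 have "\<exists>n. \<forall>t\<in>{0..1}. h t = uz n &* z t"
  using assms m(1) by (intro psl_lift_unique) (auto simp: ulift_def)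
 then obtain n where n: "\<And>t. t \<in> {0..1} ==> h t = uz n &* z t" by blast
 have "uone = uz n" using n[of 0] assms m(1) by (simp add: ulift_def)
 then show "k = z 1" using n umult_one m by simp
qed

lemma psl_path_rel_iff: "(c, d) \<in> psl_path_rel <-> c \<in> psl_paths \<and> d \<in> psl_paths \<and> uend c = uend d"
proof (cases "c \<in> psl_paths \<and> d \<in> psl_paths")
 case True
 then obtain z u where lm: "ulift c z" "ulift d u" unfolding psl_paths_ulift by blast
 note e = uend_eq[OF lm(1)] uend_eq[OF lm(2)]
 have l: "continuous_on {0..1} z" "z 0 = uone" "\<And>t. t \<in> {0..1} ==> c t = upsl (z t)"
  and m: "continuous_on {0..1} u" "u 0 = uone" "\<And>t. t \<in> {0..1} ==> d t = upsl (u t)"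
  using lm by (auto simp: ulift_def)
 let ?A = "{0..1} \<times> {0..1}"
 have pt: "prod_topology (top_of_set {0..1::real}) (top_of_set {0..1::real}) = top_of_set ?A"
  by (rule prod_topology_subtopology_eu)
 have "homotopic_with (%b. b 0 = c 0 \<and> b 1 = c 1) (top_of_set {0..1}) PSL2R_top c d <->
  (\<exists>h. continuous_map (top_of_set ({0..1::real} \<times> {0..1})) PSL2R_top h \<and> (\<forall>x\<in>{0..1}. h (0, x) = c x) \<and>
    (\<forall>x\<in>{0..1}. h (1, x) = d x) \<and> (\<forall>t\<in>{0..1}. h (t, 0) = c 0 \<and> h (t, 1) = c 1))"
  by (subst homotopic_with) (simp_all add: pt)
 also have "\<dots> <-> z 1 = u 1"
 proof
  assume "\<exists>h. continuous_map (top_of_set ({0..1::real} \<times> {0..1})) PSL2R_top h \<and> (\<forall>x\<in>{0..1}. h (0, x) = c x) \<and>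
    (\<forall>x\<in>{0..1}. h (1, x) = d x) \<and> (\<forall>t\<in>{0..1}. h (t, 0) = c 0 \<and> h (t, 1) = c 1)"
  then obtain h where hh: "continuous_map (top_of_set ({0..1::real} \<times> {0..1::real})) PSL2R_top h \<and> (\<forall>x\<in>{0..1}. h (0, x) = c x) \<and>
    (\<forall>x\<in>{0..1}. h (1, x) = d x) \<and> (\<forall>t\<in>{0..1}. h (t, 0) = c 0 \<and> h (t, 1) = c 1)" by (rule exE)
  then have h1: "continuous_map (top_of_set ?A) PSL2R_top h" by (rule conjunct1)
  have h2: "h (0, x) = c x" "h (1, x) = d x" "h (x, 0) = c 0" "h (x, 1) = c 1" if "x \<in> {0..1}" for x
   using hh that by simp_all
  have "convex ({0..1::real} \<times> {0..1::real})" by (intro convex_Times) simp_all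
  then obtain H where H: "continuous_on ?A H" and H': "\<forall>x\<in>{0..1} \<times> {0..1}. h x = upsl (H x)"
   using psl_lift_exists[OF _ h1] by blast
  have H2: "h (t, x) = upsl (H (t, x))" if "t \<in> {0..1}" "x \<in> {0..1}" for t x using H' that by blast
  have c1: "continuous_on {0..1} (%x. H (t, x))" "continuous_on {0..1} (%x. H (x, t))" if "t \<in> {0..1}" for t
   using that by (auto intro!: continuous_on_compose2[OF H] continuous_intros)
  have cst: "continuous_on {0..1} (%t :: real. k)" for k :: ucov by (rule continuous_on_const)
  have "\<exists>n. \<forall>t\<in>{0..1}. H (0, t) = uz n &* z t"
   using h2(1) l(3) by (intro psl_lift_unique c1 l(1)) (simp_all flip: H2)
  then obtain n where n: "\<And>t. t \<in> {0..1} ==> H (0, t) = uz n &* z t" by blast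
  have "\<exists>n. \<forall>t\<in>{0..1}. H (1, t) = uz n &* u t"
   using h2(2) m(3) by (intro psl_lift_unique c1 m(1)) (simp_all flip: H2)
  then obtain n' where n': "\<And>t. t \<in> {0..1} ==> H (1, t) = uz n' &* u t" by blast
  have "\<exists>j. \<forall>t\<in>{0..1}. H (t, 0) = uz j &* H (0, 0)"
   using h2(3,4) by (intro psl_lift_unique c1 cst) (simp_all flip: H2)
  then obtain j where j: "\<And>t. t \<in> {0..1} ==> H (t, 0) = uz j &* H (0, 0)" by blast
  have "\<exists>j. \<forall>t\<in>{0..1}. H (t, 1) = uz j &* H (0, 1)"
   using h2(3,4) by (intro psl_lift_unique c1 cst) (simp_all flip: H2)
  then obtain j' where j': "\<And>t. t \<in> {0..1} ==> H (t, 1) = uz j' &* H (0, 1)" by blast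
  have "uz n = uz n'" using j n n' l m by force
  moreover have "H (1, 1) = H (0, 1)" using j'[of 0] j'[of 1] by simp
  then have "uz n &* z 1 = uz n' &* u 1" using n[of 1] n'[of 1] by simp
  ultimately show "z 1 = u 1" by (metis uinv_cancel)
 next
  assume e1: "z 1 = u 1"
  define h where "h = (%x. upsl ((1 - fst x) *\<^sub>R z (snd x) + fst x *\<^sub>R u (snd x)))"
  have "continuous_on ?A (%x :: real \<times> real. (1 - fst x) *\<^sub>R z (snd x) + fst x *\<^sub>R u (snd x))"
   by (intro continuous_intros continuous_on_compose2[OF l(1)] continuous_on_compose2[OF m(1)]) auto
  then have "continuous_map (top_of_set ?A) PSL2R_top h"
   unfolding h_def by (rule continuous_map_upsl_compose)
  moreover have "h (0, x) = c x" "h (1, x) = d x" if "x \<in> {0..1}" for x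
   using l(3) m(3) that by (simp_all add: h_def)
  moreover have "h (t, 0) = c 0 \<and> h (t, 1) = c 1" for t
   using l(3) by (simp add: h_def l(2) m(2) e1[symmetric] flip: scaleR_left_distrib zero_prod_def)
  ultimately show "\<exists>h. continuous_map (top_of_set ({0..1::real} \<times> {0..1})) PSL2R_top h \<and> (\<forall>x\<in>{0..1}. h (0, x) = c x) \<and>
    (\<forall>x\<in>{0..1}. h (1, x) = d x) \<and> (\<forall>t\<in>{0..1}. h (t, 0) = c 0 \<and> h (t, 1) = c 1)" by blast
 qed
 finally show ?thesis using True e by (simp add: psl_path_rel_def)
next
 case False
 then show ?thesis by (auto simp: psl_path_rel_def)
qed

definition pclass :: "ucov => (real => (real^2^2) set) set" where
 "pclass k = {c \<in> psl_paths. uend c = k}"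

lemma psl_path_rel_class: "c \<in> psl_paths ==> psl_path_rel `` {c} = pclass (uend c)"
 by (auto simp: pclass_def psl_path_rel_iff)

lemma pclass_ulift: "ulift c z ==> psl_path_rel `` {c} = pclass (z 1)"
 using psl_path_rel_class[of c] psl_paths_ulift uend_eq by metis

lemma ulift_line: "ulift (%t. upsl (t *\<^sub>R k)) (%t. t *\<^sub>R k)"
 unfolding ulift_def by (auto intro!: continuous_intros simp flip: zero_prod_def)

lemma pclass_nonempty: "\<exists>c. c \<in> pclass k"
proof
 have "uend (%t. upsl (t *\<^sub>R k)) = k" using uend_eq[OF ulift_line, of k] by simp
 then show "(%t. upsl (t *\<^sub>R k)) \<in> pclass k" using ulift_line psl_paths_ulift unfolding pclass_def by blast
qed

lemma pclass_eq_iff: "pclass k = pclass l <-> k = l"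
 using pclass_nonempty[of k] by (auto simp: pclass_def)

lemma carrier_SL2R_univ: "carrier SL2R_univ = range pclass"
proof -
 have "psl_paths // psl_path_rel = range pclass"
 proof (intro equalityI subsetI)
  fix L assume "L \<in> psl_paths // psl_path_rel"
  then show "L \<in> range pclass" by (auto simp: quotient_def psl_path_rel_class)
 next
  fix L assume "L \<in> range pclass"
  then obtain k where k: "L = pclass k" by blast
  obtain c where "c \<in> pclass k" using pclass_nonempty by blast
  then have "c \<in> psl_paths" "L = psl_path_rel `` {c}" using k psl_path_rel_class by (auto simp: pclass_def)
  then show "L \<in> psl_paths // psl_path_rel" by (simp add: quotientI)
 qed
 then show ?thesis by (simp add: SL2R_univ_def)
qed

lemma pclass_in [simp]: "pclass k \<in> carrier SL2R_univ"
 by (simp add: carrier_SL2R_univ)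

lemma pclass_mult: "pclass k \<otimes>\<^bsub>SL2R_univ\<^esub> pclass l = pclass (k &* l)"
proof -
 have "psl_path_rel `` {%t. c t \<otimes>\<^bsub>PSL2R\<^esub> d t} = pclass (k &* l)" if g: "c \<in> pclass k" "d \<in> pclass l" for c d
 proof -
  obtain z m where lm: "ulift c z" "ulift d m" using g unfolding pclass_def psl_paths_ulift by blast
  have "ulift (%t. c t \<otimes>\<^bsub>PSL2R\<^esub> d t) (%t. z t &* m t)"
   using lm by (auto simp: ulift_def upsl_mult intro!: continuous_intros)
  from pclass_ulift[OF this] show ?thesis using g lm uend_eq by (auto simp: pclass_def)
 qed
 moreover have "\<exists>c. c \<in> pclass k" "\<exists>c. c \<in> pclass l" by (rule pclass_nonempty)+
 ultimately show ?thesis unfolding SL2R_univ_def by auto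
qed

lemma pclass_one: "\<one>\<^bsub>SL2R_univ\<^esub> = pclass uone"
proof -
 have "ulift (%t. \<one>\<^bsub>PSL2R\<^esub>) (%t. uone)" by (simp add: ulift_def upsl_one)
 from pclass_ulift[OF this] show ?thesis by (simp add: SL2R_univ_def)
qed

lemma pclass_proj: "univ_proj (pclass k) = upsl k"
proof -
 have e: "c 1 = upsl k" if g: "c \<in> pclass k" for c
 proof -
  obtain z where "ulift c z" using g unfolding pclass_def psl_paths_ulift by blast
  then show ?thesis using g uend_eq[of c z] by (auto simp: pclass_def ulift_def)
 qed
 have "(%c. c 1) ` pclass k = (%c. upsl k) ` pclass k" by (rule image_cong[OF HOL.refl e])
 also have "\<dots> = {upsl k}"
 using pclass_nonempty by (simp add: ex_in_conv image_constant_conv)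
 finally have "(%c. c 1) ` pclass k = {upsl k}" .
 then show ?thesis by (simp add: univ_proj_def)
qed

lemma lifts_upsl: "lifts (upsl k) = {pclass l | l. upsl l = upsl k}"
proof (intro equalityI subsetI)
 fix L assume "L \<in> lifts (upsl k)"
 then have L: "L \<in> range pclass" "univ_proj L = upsl k" unfolding lifts_def carrier_SL2R_univ by simp_all
 from L(1) obtain l where l: "L = pclass l" by (rule rangeE)
 then have "upsl l = upsl k" using L(2) by (simp only: pclass_proj)
 with l show "L \<in> {pclass l | l. upsl l = upsl k}" by (intro CollectI exI conjI)
next
 fix L assume "L \<in> {pclass l | l. upsl l = upsl k}"
 then obtain l where "L = pclass l" "upsl l = upsl k" by (elim CollectE exE conjE)
 then show "L \<in> lifts (upsl k)" by (simp add: lifts_def pclass_proj)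
qed

lemma group_SL2R_univ: "group SL2R_univ"
proof (rule groupI)
 fix X assume "X \<in> carrier SL2R_univ"
 then obtain k where k: "X = pclass k" by (auto simp: carrier_SL2R_univ)
 have "pclass (uinv k) \<otimes>\<^bsub>SL2R_univ\<^esub> X = \<one>\<^bsub>SL2R_univ\<^esub>" by (simp add: k pclass_mult pclass_one)
 then show "\<exists>Y\<in>carrier SL2R_univ. Y \<otimes>\<^bsub>SL2R_univ\<^esub> X = \<one>\<^bsub>SL2R_univ\<^esub>" by (intro bexI[of _ "pclass (uinv k)"]) simp_all
qed (auto simp: carrier_SL2R_univ pclass_mult pclass_one umult_assoc)

lemma pclass_inv: "inv\<^bsub>SL2R_univ\<^esub> (pclass k) = pclass (uinv k)"
 by (rule group.inv_equality[OF group_SL2R_univ]) (simp_all add: pclass_mult pclass_one)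

lemma pclass_commutator: "group_commutator SL2R_univ (pclass k) (pclass l) = pclass (ucomm k l)"
 by (simp add: group_commutator_def pclass_mult pclass_inv ucomm_def)

lemma pclass_uz_pow: "pclass (uz 1) [^]\<^bsub>SL2R_univ\<^esub> (n :: int) = pclass (uz n)"
proof -
 have nat: "pclass (uz 1) [^]\<^bsub>SL2R_univ\<^esub> (m :: nat) = pclass (uz (int m))" for m
 proof (induction m)
  case (Suc m)
  then show ?case by (simp add: pclass_mult uz_add add.commute)
 qed (simp add: pclass_one)
 show ?thesis by (simp add: int_pow_def2 nat pclass_inv uinv_uz)
qed

subsection \<open>The exponential map\<close>

lemma trace_free_square:
 assumes "trace X = 0" shows "X ** X = (- det X) *\<^sub>R (mat 1 :: real^2^2)"
proof -
 have "X$2$2 = - X$1$1" using assms by (simp add: trace_def sum_2)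
 then show ?thesis by (simp add: mat2_eq_iff mat_mult_nth det_2 algebra_simps)
qed

lemma mat_mult_linear:
 fixes A B C :: "real^2^2"
 shows "A ** (B + C) = A ** B + A ** C" "A ** (c *\<^sub>R B) = c *\<^sub>R (A ** B)" "A ** mat 1 = A"
 by (simp_all add: mat2_eq_iff mat_mult_nth algebra_simps)

lemma mat_power_form:
 fixes w :: complex and X :: "real^2^2"
 assumes tr: "trace X = 0" and w: "w ~= 0" "w\<^sup>2 = of_real (- det X)"
 shows "((**) X ^^ n) (mat 1) = Re ((w ^ n + (- w) ^ n) / 2) *\<^sub>R mat 1 + Re ((w ^ n - (- w) ^ n) / (2 * w)) *\<^sub>R X"
proof (induction n)
 case (Suc n)
 define c d where "c = (w ^ n + (- w) ^ n) / 2" and "d = (w ^ n - (- w) ^ n) / (2 * w)"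
 have "(w ^ Suc n + (- w) ^ Suc n) / 2 = w\<^sup>2 * d" using w(1) by (simp add: d_def field_simps power2_eq_square)
 then have 1: "Re ((w ^ Suc n + (- w) ^ Suc n) / 2) = - det X * Re d" unfolding w(2) by simp
 have "(w ^ Suc n - (- w) ^ Suc n) / (2 * w) = c" using w(1) by (simp add: c_def field_simps)
 then have 2: "Re ((w ^ Suc n - (- w) ^ Suc n) / (2 * w)) = Re c" by simp
 have "((**) X ^^ Suc n) (mat 1) = X ** (Re c *\<^sub>R mat 1 + Re d *\<^sub>R X)" using Suc.IH by (simp add: c_def d_def)
 also have "\<dots> = (- det X * Re d) *\<^sub>R mat 1 + Re c *\<^sub>R X"
  by (simp only: mat_mult_linear trace_free_square[OF tr]) (simp add: algebra_simps)
 finally show ?case unfolding 1 2 .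
qed simp

lemma mat_exp_form:
 fixes w :: complex
 assumes tr: "trace X = 0" and w: "w ~= 0" "w\<^sup>2 = of_real (- det X)"
 shows "mat_exp X = Re ((exp w + exp (- w)) / 2) *\<^sub>R mat 1 + Re ((exp w - exp (- w)) / (2 * w)) *\<^sub>R X"
proof -
 have s: "(%n. w ^ n / fact n) sums exp w" "(%n. (- w) ^ n / fact n) sums exp (- w)"
  using exp_converges[of w] exp_converges[of "- w"] by (simp_all add: scaleR_conv_of_real field_simps)
 have re: "Re (x / fact n) = (1 / fact n) * Re x" for x n
  by (metis Re_divide_of_real of_real_fact times_divide_eq_left mult_1)
 let ?B = "(exp w + exp (- w)) / 2"
 have "(%n. (w ^ n / fact n + (- w) ^ n / fact n) / 2) sums ?B"
  by (intro sums_divide sums_add s)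
 then have "(%n. Re ((w ^ n + (- w) ^ n) / 2 / fact n)) sums Re ?B"
  by (intro sums_Re) (simp add: add_divide_distrib mult.commute)
 then have 1: "(%n. (1 / fact n) * Re ((w ^ n + (- w) ^ n) / 2)) sums Re ?B" unfolding re .
 let ?A = "(exp w - exp (- w)) / (2 * w)"
 have "(%n. (w ^ n / fact n - (- w) ^ n / fact n) / (2 * w)) sums ?A"
  by (intro sums_divide sums_diff s)
 then have "(%n. Re ((w ^ n - (- w) ^ n) / (2 * w) / fact n)) sums Re ?A"
  by (intro sums_Re) (simp add: diff_divide_distrib mult.commute)
 then have 2: "(%n. (1 / fact n) * Re ((w ^ n - (- w) ^ n) / (2 * w))) sums Re ?A" unfolding re .
 have "(%n. (1 / fact n) *\<^sub>R (((**) X ^^ n) (mat 1))) =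
  (%n. ((1 / fact n) * Re ((w ^ n + (- w) ^ n) / 2)) *\<^sub>R mat 1 + ((1 / fact n) * Re ((w ^ n - (- w) ^ n) / (2 * w))) *\<^sub>R X)"
  unfolding mat_power_form[OF tr w] by (simp add: scaleR_add_right)
 moreover have "\<dots> sums (Re ?B *\<^sub>R mat 1 + Re ?A *\<^sub>R X)"
  by (intro sums_add sums_scaleR_left 1 2)
 ultimately show ?thesis unfolding mat_exp_def by (simp add: sums_iff)
qed

lemma mat_exp_hyperbolic:
 assumes "trace X = 0" "det X = - r\<^sup>2" "r ~= 0" shows "mat_exp X = cosh r *\<^sub>R mat 1 + (sinh r / r) *\<^sub>R X"
proof -
 have "(of_real r :: complex)\<^sup>2 = of_real (- det X)" using assms by simp
 then have "mat_exp X = Re ((exp (of_real r) + exp (- of_real r)) / 2) *\<^sub>R mat 1 + Re ((exp (of_real r) - exp (- of_real r)) / (2 * of_real r)) *\<^sub>R X"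
  using assms by (intro mat_exp_form) auto
 moreover have "(exp (of_real r) + exp (- of_real r)) / 2 = (of_real (cosh r) :: complex)"
  "(exp (of_real r) - exp (- of_real r)) / (2 * of_real r) = (of_real (sinh r / r) :: complex)"
  by (simp_all add: cosh_def sinh_def scaleR_conv_of_real exp_of_real[symmetric] field_simps)
 ultimately show ?thesis by (simp only: Re_complex_of_real)
qed

lemma mat_exp_elliptic:
 assumes "trace X = 0" "det X = r\<^sup>2" "r ~= 0" shows "mat_exp X = cos r *\<^sub>R mat 1 + (sin r / r) *\<^sub>R X"
proof -
 define w where "w = \<i> * of_real r"
 have "mat_exp X = Re ((exp w + exp (- w)) / 2) *\<^sub>R mat 1 + Re ((exp w - exp (- w)) / (2 * w)) *\<^sub>R X" using assms mat_exp_form by (simp add: w_def power_mult_distrib)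
 moreover have e: "exp w = cis r" "exp (- w) = cis (- r)" by (simp_all add: w_def cis_conv_exp)
 have "(exp w + exp (- w)) / 2 = of_real (cos r)" unfolding e by (simp add: complex_eq_iff)
 moreover have "exp w - exp (- w) = 2 * w * of_real (sin r / r)" unfolding e using assms(3) by (simp add: complex_eq_iff w_def)
 then have "(exp w - exp (- w)) / (2 * w) = of_real (sin r / r)" using assms(3) by (simp add: w_def)
 ultimately show ?thesis by (simp only: Re_complex_of_real)
qed

lemma mat_exp_nilpotent:
 assumes "trace X = 0" "det X = 0" shows "mat_exp X = mat 1 + X"
proof -
 have "X ** X = 0" using trace_free_square[OF assms(1)] assms(2) by simp
 moreover have "X ** 0 = 0" by (simp add: mat2_eq_iff mat_mult_nth)
 ultimately have z: "((**) X ^^ (n + 2)) (mat 1) = 0" for n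
  by (induction n) (simp_all add: mat_mult_linear(3) numeral_2_eq_2)
 have "(%n. (1 / fact n) *\<^sub>R (((**) X ^^ n) (mat 1))) sums (\<Sum>n\<in>{..<2}. (1 / fact n) *\<^sub>R (((**) X ^^ n) (mat 1)))"
 proof (rule sums_finite)
  fix n :: nat assume "n \<notin> {..<2}"
  then obtain m where "n = m + 2" by (metis add.commute lessThan_iff less_eqE not_less)
  then show "(1 / fact n) *\<^sub>R (((**) X ^^ n) (mat 1)) = 0" using z by simp
 qed simp
 then show ?thesis unfolding mat_exp_def by (simp add: sums_iff numeral_2_eq_2 mat_mult_linear(3))
qed

lemma det_scale_2: "det (c *\<^sub>R X :: real^2^2) = c\<^sup>2 * det X"
 by (simp add: det_2 power2_eq_square algebra_simps)

lemma trace_scale: "trace (c *\<^sub>R X :: real^2^2) = c * trace X"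
 by (simp add: trace_def sum_distrib_left)

lemma det_trace_free: "trace X = 0 ==> det (a *\<^sub>R mat 1 + b *\<^sub>R X :: real^2^2) = a\<^sup>2 + b\<^sup>2 * det X"
proof -
 assume "trace X = 0"
 then have "X$2$2 = - X$1$1" by (simp add: trace_def sum_2)
 then show ?thesis by (simp add: det_2 power2_eq_square algebra_simps)
qed

lemma mat_exp_path:
 assumes tr: "trace X = 0"
 shows "(%t. psl (mat_exp (t *\<^sub>R X))) \<in> psl_paths"
proof -
 obtain M where M: "continuous_on UNIV M" "\<And>t. mat_exp (t *\<^sub>R X) = M t" "\<And>t. det (M t) = 1"
 proof -
  have trt: "trace (t *\<^sub>R X) = 0" for t using tr by (simp add: trace_scale)
  have d0: "mat_exp 0 = mat 1" using mat_exp_nilpotent[of 0] by (simp add: trace_def det_2)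
  consider "det X = 0" | r where "r > 0" "det X = r\<^sup>2" | r where "r > 0" "det X = - r\<^sup>2"
   by (metis (no_types) linorder_neqE_linordered_idom neg_0_less_iff_less real_sqrt_gt_zero real_sqrt_pow2 less_imp_le minus_minus)
  then show ?thesis
  proof cases
   case 1
   show ?thesis
   proof (rule that)
    show "continuous_on UNIV (%t. mat 1 + t *\<^sub>R X)" by (intro continuous_intros)
    show "mat_exp (t *\<^sub>R X) = mat 1 + t *\<^sub>R X" for t using trt by (intro mat_exp_nilpotent) (simp_all add: det_scale_2 1)
    show "det (mat 1 + t *\<^sub>R X) = 1" for t using det_trace_free[OF tr, of 1 t] 1 by simp
   qed
  next
   case 2
   show ?thesis
   proof (rule that)
    show "continuous_on UNIV (%t. cos (t * r) *\<^sub>R mat 1 + (sin (t * r) / r) *\<^sub>R X)" using 2 by (intro continuous_intros) auto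
    show "mat_exp (t *\<^sub>R X) = cos (t * r) *\<^sub>R mat 1 + (sin (t * r) / r) *\<^sub>R X" for t
    proof (cases "t = 0")
     case False
     then have "mat_exp (t *\<^sub>R X) = cos (t * r) *\<^sub>R mat 1 + (sin (t * r) / (t * r)) *\<^sub>R (t *\<^sub>R X)"
      using trt 2 by (intro mat_exp_elliptic) (simp_all add: det_scale_2 power_mult_distrib)
     then show ?thesis using False by simp
    qed (simp add: d0)
    show "det (cos (t * r) *\<^sub>R mat 1 + (sin (t * r) / r) *\<^sub>R X) = 1" for t
     unfolding det_trace_free[OF tr] using 2 by (simp add: power_divide)
   qed
  next
   case 3
   show ?thesis
   proof (rule that)
    show "continuous_on UNIV (%t. cosh (t * r) *\<^sub>R mat 1 + (sinh (t * r) / r) *\<^sub>R X)" using 3 by (intro continuous_intros) auto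
    show "mat_exp (t *\<^sub>R X) = cosh (t * r) *\<^sub>R mat 1 + (sinh (t * r) / r) *\<^sub>R X" for t
    proof (cases "t = 0")
     case False
     then have "mat_exp (t *\<^sub>R X) = cosh (t * r) *\<^sub>R mat 1 + (sinh (t * r) / (t * r)) *\<^sub>R (t *\<^sub>R X)"
      using trt 3 by (intro mat_exp_hyperbolic) (simp_all add: det_scale_2 power_mult_distrib)
     then show ?thesis using False by simp
    qed (simp add: d0)
    show "det (cosh (t * r) *\<^sub>R mat 1 + (sinh (t * r) / r) *\<^sub>R X) = 1" for t
     unfolding det_trace_free[OF tr] using 3 by (simp add: power_divide cosh_square_eq)
   qed
  qed
 qed
 have "continuous_map (top_of_set {0..1}) (top_of_set {A. det A = 1}) M"
  using M(1,3) by (auto simp: continuous_map_in_subtopology intro: continuous_on_subset)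
 then have "continuous_map (top_of_set {0..1}) PSL2R_top (psl \<circ> M)" using continuous_map_psl by (rule continuous_map_compose)
 moreover have "M 0 = mat 1" using M(2)[of 0] mat_exp_nilpotent[of 0] by (simp add: trace_def det_2)
 ultimately show ?thesis by (simp add: psl_paths_def pathin_def M(2) o_def one_PSL2R)
qed

lemma univ_exp_proj:
 assumes tr: "trace X = 0" obtains k where "univ_exp X = pclass k" "upsl k = psl (mat_exp X)"
proof -
 have g: "(%t. psl (mat_exp (t *\<^sub>R X))) \<in> psl_paths" by (rule mat_exp_path[OF tr])
 then obtain z where k: "ulift (%t. psl (mat_exp (t *\<^sub>R X))) z" unfolding psl_paths_ulift by blast
 then have "upsl (z 1) = psl (mat_exp X)" by (force simp: ulift_def)
 moreover have "univ_exp X = pclass (z 1)" unfolding univ_exp_def by (rule pclass_ulift[OF k])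
 ultimately show ?thesis using that by blast
qed

lemma univ_exp_nilpotent:
 assumes z: "cmod v = 1" and X: "mcm X = (\<i> * of_real r, of_real r * v)"
 shows "trace X = 0" "univ_exp X = pclass (upar v r)" (is ?P)
proof -
 show tr: "trace X = 0" by (simp add: trace_mcm X)
 have d: "det X = 0" by (simp add: det_mcm X cm_det_def norm_mult z)
 have "mat_exp (t *\<^sub>R X) = cmm (umat (upar v (t * r)))" for t
 proof -
  have "mat_exp (t *\<^sub>R X) = mat 1 + t *\<^sub>R X" using tr d by (intro mat_exp_nilpotent) (simp_all add: trace_scale det_scale_2)
  moreover have "mcm (mat 1 + t *\<^sub>R X) = umat (upar v (t * r))"
   unfolding mcm_linear X umat_upar[OF z] by (simp add: complex_eq_iff)
  ultimately show ?thesis by (metis cmm_mcm)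
 qed
 then have "ulift (%t. psl (mat_exp (t *\<^sub>R X))) (%t. upar v (t * r))"
  unfolding ulift_def upsl_def upar_def by (auto intro!: continuous_intros)
 from pclass_ulift[OF this] show ?P by (simp add: univ_exp_def)
qed

lemma nilpotent_coordinates:
 assumes "trace X = 0" "det X = 0" "X ~= 0"
 obtains v r where "cmod v = 1" "mcm X = (\<i> * of_real r, of_real r * v)"
proof -
 define r where "r = Im (fst (mcm X))"
 have f: "fst (mcm X) = \<i> * of_real r" using assms(1) by (simp add: trace_mcm complex_eq_iff r_def)
 have n: "cmod (snd (mcm X)) = \<bar>r\<bar>"
  using assms(2) unfolding det_mcm cm_det_def f by (simp add: norm_mult) (metis norm_ge_zero power2_abs power2_eq_iff_nonneg abs_ge_zero)
 have "r ~= 0"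
 proof
  assume "r = 0"
  then have "mcm X = 0" using f n by (simp add: prod_eq_iff)
  then have "X = cmm 0" by (metis cmm_mcm)
  then show False using assms(3) by (simp add: cmm_def mat2_eq_iff)
 qed
 then show ?thesis using f n by (intro that[of "snd (mcm X) / of_real r" r]) (simp_all add: norm_divide prod_eq_iff)
qed

lemma parabolic_lift_upsl:
 assumes z: "cmod v = 1" and r: "r ~= 0"
 shows "parabolic_lift (upsl (upar v r)) = pclass (upar v r)"
 unfolding parabolic_lift_def
proof (rule the_equality)
 have "mcm (cmm (\<i> * of_real r, of_real r * v)) = (\<i> * of_real r, of_real r * v)" by simp
 note X = univ_exp_nilpotent[OF z this]
 have "pclass (upar v r) \<in> univ_exp ` sl2R" unfolding X(2)[symmetric] by (rule imageI) (simp add: sl2R_def X(1))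
 moreover have "pclass (upar v r) \<in> lifts (upsl (upar v r))" unfolding lifts_upsl by blast
 ultimately show "pclass (upar v r) \<in> lifts (upsl (upar v r)) \<and> pclass (upar v r) \<in> univ_exp ` sl2R" by blast
next
 fix L assume L: "L \<in> lifts (upsl (upar v r)) \<and> L \<in> univ_exp ` sl2R"
 then obtain X where X: "L = univ_exp X" "trace X = 0" by (auto simp: sl2R_def)
 obtain k where k: "univ_exp X = pclass k" "upsl k = psl (mat_exp X)" using univ_exp_proj[OF X(2)] .
 have e: "psl (mat_exp X) = upsl (upar v r)" using L X k pclass_proj by (simp add: lifts_def)
 have par: "parabolic (psl (mat_exp X))" unfolding e parabolic_iff using z r by blast
 have tr: "\<bar>trace (mat_exp X)\<bar> = 2" using par by (simp add: psl_eq parabolic_def)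
 have ne: "mat_exp X ~= mat 1" "mat_exp X ~= - mat 1" using par by (auto simp: parabolic_def one_PSL2R)
 have trf: "trace (a *\<^sub>R mat 1 + b *\<^sub>R X) = 2 * a" for a b using X(2) by (simp add: trace_def sum_2 flip: distrib_left)
 have "\<not> det X < 0"
 proof
  assume "det X < 0"
  then have s: "0 < sqrt (- det X)" "det X = - (sqrt (- det X))\<^sup>2" by simp_all
  have "(sinh (sqrt (- det X)))\<^sup>2 = 0" by (smt (verit) power2_eq_1_iff s mat_exp_hyperbolic X tr trf cosh_square_eq)
  then show False using s(1) by simp
 qed
 moreover have "\<not> det X > 0"
 proof
  assume "det X > 0"
  then have s: "0 < sqrt (det X)" "det X = (sqrt (det X))\<^sup>2" by simp_all
  have m: "mat_exp X = cos (sqrt (det X)) *\<^sub>R mat 1 + (sin (sqrt (det X)) / sqrt (det X)) *\<^sub>R X"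
   using s by (intro mat_exp_elliptic X(2)) simp_all
  then have c: "\<bar>cos (sqrt (det X))\<bar> = 1" using tr trf by simp
  then have "(sin (sqrt (det X)))\<^sup>2 = 0" using sin_squared_eq[of "sqrt (det X)"] by (metis diff_self one_power2 power2_abs)
  then have "mat_exp X = cos (sqrt (det X)) *\<^sub>R mat 1" using m by simp
  then show False using c ne by (auto simp: abs_if split: if_splits)
 qed
 ultimately have d: "det X = 0" by simp
 have "X ~= 0" using ne(1) mat_exp_nilpotent[OF X(2) d] by auto
 then obtain x q where q: "cmod x = 1" "mcm X = (\<i> * of_real q, of_real q * x)" by (rule nilpotent_coordinates[OF X(2) d])
 then have L': "L = pclass (upar x q)" using X(1) univ_exp_nilpotent by simp
 then have "upsl (upar x q) = upsl (upar v r)" using L pclass_proj by (simp add: lifts_def)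
 then show "L = pclass (upar v r)" by (metis upsl_eq_iff plift_upar q assms L')
qed

lemma univ_z_eq: "univ_z = pclass (uz 1)"
proof -
 define X where "X = mat2 0 pi (- pi) 0"
 have X: "trace X = 0" "det X = pi\<^sup>2" by (simp_all add: X_def trace_def sum_2 det_2 power2_eq_square)
 have "mat_exp (t *\<^sub>R X) = cmm (umat (urot (t * pi)))" for t
 proof (cases "t = 0")
  case True
  then show ?thesis using mat_exp_nilpotent[of 0] by (simp add: trace_def det_2 umat_urot)
 next
  case False
  then have "mat_exp (t *\<^sub>R X) = cos (t * pi) *\<^sub>R mat 1 + (sin (t * pi) / (t * pi)) *\<^sub>R (t *\<^sub>R X)"
   by (intro mat_exp_elliptic) (simp_all add: trace_scale det_scale_2 X power_mult_distrib)
  also have "\<dots> = cmm (umat (urot (t * pi)))"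
   using False by (simp add: umat_urot cmm_def X_def mat2_eq_iff)
  finally show ?thesis .
 qed
 then have "ulift (%t. psl (mat_exp (t *\<^sub>R X))) (%t. urot (t * pi))"
  unfolding ulift_def upsl_def by (auto intro!: continuous_intros simp: urot_def)
 from pclass_ulift[OF this] show ?thesis by (simp add: univ_z_def univ_exp_def X_def uz_def)
qed

section \<open>Representations of surface groups\<close>

lemma words_append [simp]: "u @ v \<in> words S <-> u \<in> words S \<and> v \<in> words S"
 by (auto simp: words_def)

lemma words_Nil [simp]: "[] \<in> words S" and words_Cons [simp]: "l # u \<in> words S <-> fst l \<in> S \<and> u \<in> words S"
 by (cases l; auto simp: words_def)+

lemma presentation_rel_words: "(u, v) \<in> presentation_rel S R ==> u \<in> words S \<and> v \<in> words S"
 by (induction rule: presentation_rel.induct) auto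

lemma presentation_rel_append:
 assumes "(u, v) \<in> presentation_rel S R" "w \<in> words S"
 shows "(u @ w, v @ w) \<in> presentation_rel S R" (is ?P) "(w @ u, w @ v) \<in> presentation_rel S R" (is ?Q)
proof -
 show ?P using assms
 proof (induction rule: presentation_rel.induct)
  case (cancel u v x b)
  then show ?case using presentation_rel.cancel[where u = u and v = "v @ w" and x = x and b = b and S = S and R = R] by simp
 next
  case (relator u v r)
  then show ?case using presentation_rel.relator[where u = u and v = "v @ w" and r = r and S = S and R = R] by simp
 qed (auto intro: presentation_rel.refl presentation_rel.sym presentation_rel.trans)
 show ?Q using assms
 proof (induction rule: presentation_rel.induct)
  case (cancel u v x b)
  then show ?case using presentation_rel.cancel[where u = "w @ u" and v = v and x = x and b = b and S = S and R = R] by simp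
 next
  case (relator u v r)
  then show ?case using presentation_rel.relator[where u = "w @ u" and v = v and r = r and S = S and R = R] by simp
 qed (auto intro: presentation_rel.refl presentation_rel.sym presentation_rel.trans)
qed

abbreviation wclass :: "'a set => 'a word set => 'a word => 'a word set" where
 "wclass S R u \<equiv> presentation_rel S R `` {u}"

lemma wclass_eqI: "(u, v) \<in> presentation_rel S R ==> wclass S R u = wclass S R v"
 by (auto intro: presentation_rel.sym presentation_rel.trans)

lemma carrier_presented: "carrier (presented_group S R) = wclass S R ` words S"
 by (auto simp: presented_group_def quotient_def)

lemma mult_presented:
 assumes "u \<in> words S" "v \<in> words S"
 shows "wclass S R u \<otimes>\<^bsub>presented_group S R\<^esub> wclass S R v = wclass S R (u @ v)"
proof -
 have "wclass S R (u' @ v') = wclass S R (u @ v)" if "u' \<in> wclass S R u" "v' \<in> wclass S R v" for u' v'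
 proof -
  have r: "(u, u') \<in> presentation_rel S R" "(v, v') \<in> presentation_rel S R" using that by auto
  then show ?thesis by (metis presentation_rel_append presentation_rel_words wclass_eqI)
 qed
 moreover have "u \<in> wclass S R u" "v \<in> wclass S R v" using assms by (auto intro: presentation_rel.refl)
 ultimately have "(\<Union>u'\<in>wclass S R u. \<Union>v'\<in>wclass S R v. wclass S R (u' @ v')) = wclass S R (u @ v)" by blast
 then show ?thesis by (simp add: presented_group_def)
qed

fun uev :: "('a => ucov) => 'a word => ucov" where
 "uev z [] = uone"
| "uev z ((x, b) # u) = (if b then z x else uinv (z x)) &* uev z u"

lemma uev_append: "uev z (u @ v) = uev z u &* uev z v"
 by (induction u) (auto simp: umult_assoc)

lemma uev_rel:
 assumes "(u, v) \<in> presentation_rel S R" "\<And>r. r \<in> R ==> \<exists>n. uev z r = uz n"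
 shows "upsl (uev z u) = upsl (uev z v)"
 using assms(1)
proof (induction rule: presentation_rel.induct)
 case (cancel u v x b)
 then show ?case by (cases b) (simp_all add: uev_append umult_assoc)
next
 case (relator u v r)
 then obtain n where "uev z r = uz n" using assms(2) by blast
 then have "uev z (u @ r @ v) = uz n &* uev z (u @ v)" by (simp add: uev_append) (metis umult_assoc uz_central)
 then show ?case unfolding upsl_eq_uz by blast
qed simp_all

definition urep :: "'a set => 'a word set => ('a => ucov) => 'a word set => (real^2^2) set" where
 "urep S R z = (\<lambda>X\<in>carrier (presented_group S R). upsl (uev z (SOME u. u \<in> X)))"

lemma urep_class:
 assumes "u \<in> words S" "\<And>r. r \<in> R ==> \<exists>n. uev z r = uz n"
 shows "urep S R z (wclass S R u) = upsl (uev z u)"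
proof -
 have "u \<in> wclass S R u" using assms(1) by (auto intro: presentation_rel.refl)
 then have "(SOME v. v \<in> wclass S R u) \<in> wclass S R u" by (rule someI)
 then have "(u, SOME v. v \<in> wclass S R u) \<in> presentation_rel S R" by simp
 from uev_rel[OF this assms(2)] show ?thesis using assms(1) by (simp add: urep_def carrier_presented)
qed

lemma urep_hom:
 assumes "\<And>r. r \<in> R ==> \<exists>n. uev z r = uz n"
 shows "urep S R z \<in> hom (presented_group S R) PSL2R \<inter> extensional (carrier (presented_group S R))"
proof -
 have "urep S R z (X \<otimes>\<^bsub>presented_group S R\<^esub> Y) = urep S R z X \<otimes>\<^bsub>PSL2R\<^esub> urep S R z Y"
  if XY: "X \<in> carrier (presented_group S R)" "Y \<in> carrier (presented_group S R)" for X Y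
 proof -
  obtain u v where "X = wclass S R u" "u \<in> words S" "Y = wclass S R v" "v \<in> words S"
   using XY unfolding carrier_presented by blast
  then show ?thesis using assms by (simp add: mult_presented urep_class uev_append upsl_mult)
 qed
 moreover have "urep S R z X \<in> carrier PSL2R" if "X \<in> carrier (presented_group S R)" for X
  using that by (simp add: urep_def)
 ultimately show ?thesis by (auto simp: hom_def urep_def)
qed

lemma hom_word:
 assumes h: "h \<in> hom (presented_group S R) PSL2R" and z: "\<And>x. x \<in> S ==> h (presented_gen S R x) = upsl (z x)"
  and u: "u \<in> words S"
 shows "h (wclass S R u) = upsl (uev z u)"
proof -
 have car: "h (wclass S R u) \<in> carrier PSL2R" if "u \<in> words S" for u
  using h that by (auto simp: hom_def carrier_presented)
 have mul: "h (wclass S R (u @ v)) = h (wclass S R u) \<otimes>\<^bsub>PSL2R\<^esub> h (wclass S R v)" if "u \<in> words S" "v \<in> words S" for u v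
  using hom_mult[OF h, of "wclass S R u" "wclass S R v"] mult_presented[OF that, of R] that by (simp add: carrier_presented)
 obtain k where k: "h (wclass S R []) = upsl k" using car[of "[]"] upsl_surj by (metis words_Nil)
 have "upsl k = upsl (k &* k)" using mul[of "[]" "[]"] by (simp add: k upsl_mult)
 then obtain n where "k = uz n &* (k &* k)" unfolding upsl_eq_uz by blast
 then have one: "h (wclass S R []) = upsl uone" by (metis umult_eq_iff uinv_uz k upsl_eq_one upsl_one)
 have pos: "h (wclass S R [(x, True)]) = upsl (z x)" if "x \<in> S" for x
  using z[OF that] by (simp add: presented_gen_def)
 have neg: "h (wclass S R [(x, False)]) = upsl (uinv (z x))" if x: "x \<in> S" for x
 proof -
  obtain m where m: "h (wclass S R [(x, False)]) = upsl m" using car[of "[(x, False)]"] upsl_surj x by (metis words_Nil words_Cons fst_conv)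
  have "wclass S R ([(x, True)] @ [(x, False)]) = wclass S R []"
   using presentation_rel.cancel[where u = "[]" and v = "[]" and x = x and b = True and S = S and R = R] x by (intro wclass_eqI) simp
  then have "upsl uone = upsl (z x &* m)" using mul[of "[(x, True)]" "[(x, False)]"] x by (simp add: one pos m upsl_mult)
  then have "upsl (uinv (z x)) \<otimes>\<^bsub>PSL2R\<^esub> upsl uone = upsl (uinv (z x)) \<otimes>\<^bsub>PSL2R\<^esub> upsl (z x &* m)" by simp
  then show ?thesis unfolding m upsl_mult by simp
 qed
 show ?thesis using u
 proof (induction u)
  case Nil
  then show ?case using one by simp
 next
  case (Cons l u)
  obtain x b where l: "l = (x, b)" by (cases l)
  have "h (wclass S R (l # u)) = h (wclass S R [l]) \<otimes>\<^bsub>PSL2R\<^esub> h (wclass S R u)"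
   using mul[of "[l]" u] Cons.prems by simp
  then show ?case using Cons l pos[of x] neg[of x] by (cases b) (simp_all add: upsl_mult)
 qed
qed

lemma hom_relator:
 assumes h: "h \<in> hom (presented_group S R) PSL2R" and z: "\<And>x. x \<in> S ==> h (presented_gen S R x) = upsl (z x)"
  and r: "r \<in> R" "r \<in> words S"
 shows "\<exists>n. uev z r = uz n"
proof -
 have "wclass S R r = wclass S R []"
  using presentation_rel.relator[where u = "[]" and v = "[]" and r = r and S = S and R = R] r by (intro wclass_eqI) simp
 then have "upsl (uev z r) = upsl uone"
  using hom_word[OF h z r(2)] hom_word[OF h z words_Nil] by simp
 then show ?thesis unfolding upsl_eq_uz by simp
qed

primrec ucprod :: "(nat => ucov) => nat => ucov" where
 "ucprod c 0 = uone"
| "ucprod c (Suc k) = ucprod c k &* c k"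

lemma ucprod_cong: "(\<And>i. i < k ==> c i = d i) ==> ucprod c k = ucprod d k"
 by (induction k) auto

lemma pword_ucprod: "pword s w k = ucprod (%i. upp (of_int (s i)) (w i)) k"
 by (induction k) auto

lemma uev_surface_relator:
 "uev z (surface_relator g p) = hword (%j. (pproj (z (Gen_a j)), pproj (z (Gen_b j)))) g &* ucprod (%i. z (Gen_c i)) p"
proof -
 have "uev z (concat (map (%j. [(Gen_a j, True), (Gen_b j, True), (Gen_a j, False), (Gen_b j, False)]) [0..<g]))
  = hword (%j. (pproj (z (Gen_a j)), pproj (z (Gen_b j)))) g"
  by (induction g) (simp_all add: uev_append ucomm_def umult_assoc)
 moreover have "uev z (map (%i. (Gen_c i, True)) [0..<p]) = ucprod (%i. z (Gen_c i)) p"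
  by (induction p) (simp_all add: uev_append)
 ultimately show ?thesis by (simp add: surface_relator_def uev_append)
qed

lemma surface_relator_words: "surface_relator g p \<in> words (surface_gens g p)"
 by (auto simp: surface_relator_def words_def surface_gens_def)

lemma surface_elt_in: "x \<in> surface_gens g p ==> surface_elt g p x \<in> carrier (surface_group g p)"
 unfolding surface_elt_def surface_group_def presented_gen_def carrier_presented by (rule imageI) simp

definition rep_lift :: "nat => nat => (surface_gen word set => (real^2^2) set) => surface_gen => ucov" where
 "rep_lift g p h x = plift (pcoord (h (surface_elt g p x)))"

definition rep_handles :: "nat => nat => (surface_gen word set => (real^2^2) set) => nat => ppt \<times> ppt" where
 "rep_handles g p h j = (if j < g then (pcoord (h (surface_elt g p (Gen_a j))), pcoord (h (surface_elt g p (Gen_b j)))) else trivial_handle)"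

definition rep_product :: "nat => nat => (surface_gen word set => (real^2^2) set) => ucov" where
 "rep_product g p h = hword (rep_handles g p h) g &* ucprod (%i. rep_lift g p h (Gen_c i)) p"

lemma rep_in: "h \<in> representations g p ==> x \<in> surface_gens g p ==> h (surface_elt g p x) \<in> carrier PSL2R"
 using surface_elt_in by (auto simp: representations_def hom_def)

lemma rep_lift_upsl:
 assumes "h \<in> representations g p" "x \<in> surface_gens g p"
 shows "h (surface_elt g p x) = upsl (rep_lift g p h x)" (is ?Q) "pproj (rep_lift g p h x) = pcoord (h (surface_elt g p x))" (is ?P)
proof -
 note c = rep_in[OF assms]
 show p: ?P
  unfolding rep_lift_def by (rule pproj_plift[OF pcoord_in[OF c]])
 show ?Q by (rule upsl_pcoord[OF c p])
qed

lemma rep_product_central: "h \<in> representations g p ==> \<exists>n. rep_product g p h = uz n"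
proof -
 assume r: "h \<in> representations g p"
 then have h: "h \<in> hom (presented_group (surface_gens g p) {surface_relator g p}) PSL2R"
  by (simp add: representations_def surface_group_def)
 have "\<exists>n. uev (rep_lift g p h) (surface_relator g p) = uz n"
  using rep_lift_upsl(1)[OF r] by (intro hom_relator[OF h]) (auto simp: surface_elt_def surface_relator_words)
 moreover have "hword (%j. (pproj (rep_lift g p h (Gen_a j)), pproj (rep_lift g p h (Gen_b j)))) g = hword (rep_handles g p h) g"
  using rep_lift_upsl(2)[OF r] by (intro hword_cong) (auto simp: rep_handles_def surface_gens_def)
 ultimately show "\<exists>n. rep_product g p h = uz n" by (simp add: uev_surface_relator rep_product_def)
qed

lemma rep_handles_in: "h \<in> representations g p ==> rep_handles g p h \<in> htuples g"
 using pcoord_in[OF rep_in] by (auto simp: rep_handles_def htuples_def surface_gens_def)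

lemma parabolic_rep:
 assumes "h \<in> type_preserving g p" "i < p"
 obtains v r where "cmod v = 1" "r ~= 0" "h (surface_elt g p (Gen_c i)) = upsl (upar v r)"
  "rep_lift g p h (Gen_c i) = upar v r"
using assms parabolic_iff by (auto simp: type_preserving_def rep_lift_def plift_upar)

lemma list_product_append:
 "list_product SL2R_univ (map (%i. pclass (f i)) [0..<k] @ map (%i. pclass (h i)) [0..<l]) = pclass (ucprod f k &* ucprod h l)"
proof -
 have "list_product SL2R_univ (map (%x. pclass (f x)) xs @ ys) = pclass (foldr (&*) (map f xs) n)"
  if "list_product SL2R_univ ys = pclass n" for f xs ys n
  using that by (induction xs) (simp_all add: list_product_def pclass_mult)
 note 1 = this
 have 2: "ucprod f k &* n = foldr (&*) (map f [0..<k]) n" for f k n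
 proof (induction k arbitrary: n)
  case (Suc k)
  have "ucprod f (Suc k) &* n = ucprod f k &* (f k &* n)" by (simp add: umult_assoc)
  also have "\<dots> = foldr (&*) (map f [0..<k]) (f k &* n)" by (rule Suc.IH)
  finally show ?case by simp
 qed simp
 have "list_product SL2R_univ [] = pclass uone" by (simp add: list_product_def pclass_one)
 from 1[OF this, of h "[0..<l]"] have "list_product SL2R_univ (map (%i. pclass (h i)) [0..<l]) = pclass (ucprod h l)"
  unfolding 2[symmetric] by simp
 from 1[OF this, of f "[0..<k]"] show ?thesis unfolding 2[symmetric] .
qed

lemma hword_ucprod: "hword x k = ucprod (%j. pcomm (fst (x j)) (snd (x j))) k"
 by (induction k) auto

lemma rel_euler_iff:
 assumes h: "h \<in> type_preserving g p"
 shows "rel_euler g p h = n <-> rep_product g p h = uz n"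
proof -
 have r: "h \<in> representations g p" using h by (simp add: type_preserving_def)
 define L where "L = (%al be. list_product SL2R_univ
    (map (%j. group_commutator SL2R_univ (al j) (be j)) [0..<g]
    @ map (%i. parabolic_lift (h (surface_elt g p (Gen_c i)))) [0..<p]))"
 have L: "L al be = pclass (rep_product g p h)"
  if a: "\<forall>j<g. al j \<in> lifts (h (surface_elt g p (Gen_a j)))" and b: "\<forall>j<g. be j \<in> lifts (h (surface_elt g p (Gen_b j)))" for al be
 proof -
  have "group_commutator SL2R_univ (al j) (be j) = pclass (pcomm (fst (rep_handles g p h j)) (snd (rep_handles g p h j)))" if j: "j < g" for j
  proof -
   have e: "h (surface_elt g p (Gen_a j)) = upsl (rep_lift g p h (Gen_a j))" "h (surface_elt g p (Gen_b j)) = upsl (rep_lift g p h (Gen_b j))"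
    using j by (auto intro!: rep_lift_upsl r simp: surface_gens_def)
   have "al j \<in> lifts (h (surface_elt g p (Gen_a j)))" "be j \<in> lifts (h (surface_elt g p (Gen_b j)))" using a b j by simp_all
   then have "\<exists>k. al j = pclass k \<and> upsl k = h (surface_elt g p (Gen_a j))" "\<exists>k. be j = pclass k \<and> upsl k = h (surface_elt g p (Gen_b j))"
    unfolding e lifts_upsl by simp_all
   then obtain k l where kl: "al j = pclass k" "upsl k = h (surface_elt g p (Gen_a j))" "be j = pclass l" "upsl l = h (surface_elt g p (Gen_b j))"
    by (elim exE conjE)
   then have "rep_handles g p h j = (pproj k, pproj l)" using j by (metis rep_handles_def pcoord_upsl)
   then show ?thesis using kl by (simp add: pclass_commutator)
  qed
  then have "map (%j. group_commutator SL2R_univ (al j) (be j)) [0..<g]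
   = map (%j. pclass (pcomm (fst (rep_handles g p h j)) (snd (rep_handles g p h j)))) [0..<g]" by simp
  moreover have "parabolic_lift (h (surface_elt g p (Gen_c i))) = pclass (rep_lift g p h (Gen_c i))" if i: "i < p" for i
  by (metis parabolic_lift_upsl assms parabolic_rep i)
  then have "map (%i. parabolic_lift (h (surface_elt g p (Gen_c i)))) [0..<p] = map (%i. pclass (rep_lift g p h (Gen_c i))) [0..<p]" by simp
  ultimately show ?thesis unfolding L_def rep_product_def hword_ucprod by (simp only: list_product_append)
 qed
 have ex: "\<forall>j<g. pclass (rep_lift g p h (Gen_a j)) \<in> lifts (h (surface_elt g p (Gen_a j)))"
  "\<forall>j<g. pclass (rep_lift g p h (Gen_b j)) \<in> lifts (h (surface_elt g p (Gen_b j)))"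
  using rep_lift_upsl(1)[OF r] by (auto simp: lifts_def pclass_proj surface_gens_def)
 have iff: "(\<forall>al be. (\<forall>j<g. al j \<in> lifts (h (surface_elt g p (Gen_a j)))) -->
   (\<forall>j<g. be j \<in> lifts (h (surface_elt g p (Gen_b j)))) --> L al be = univ_z [^]\<^bsub>SL2R_univ\<^esub> m)
   <-> rep_product g p h = uz m" for m
  unfolding univ_z_eq pclass_uz_pow pclass_eq_iff[symmetric]
 proof
  assume *: "\<forall>al be. (\<forall>j<g. al j \<in> lifts (h (surface_elt g p (Gen_a j)))) -->
   (\<forall>j<g. be j \<in> lifts (h (surface_elt g p (Gen_b j)))) --> L al be = pclass (uz m)"
  show "pclass (rep_product g p h) = pclass (uz m)"
   using *[rule_format, of "%j. pclass (rep_lift g p h (Gen_a j))" "%j. pclass (rep_lift g p h (Gen_b j))"] ex L[OF ex] by simp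
 next
  assume "pclass (rep_product g p h) = pclass (uz m)"
  then show "\<forall>al be. (\<forall>j<g. al j \<in> lifts (h (surface_elt g p (Gen_a j)))) -->
   (\<forall>j<g. be j \<in> lifts (h (surface_elt g p (Gen_b j)))) --> L al be = pclass (uz m)" using L by simp
 qed
 obtain m where m: "rep_product g p h = uz m" using rep_product_central[OF r] by blast
 have "rel_euler g p h = (THE m. rep_product g p h = uz m)"
  unfolding rel_euler_def iff[unfolded L_def] ..
 also have "\<dots> = m" using m by (intro the_equality) auto
 finally show ?thesis using m by auto
qed

definition tuple_lift :: "(nat => int) => (nat => ppt \<times> ppt) \<times> (nat => complex) => surface_gen => ucov" where
 "tuple_lift s y x = (case x of Gen_a j => plift (fst (fst y j)) | Gen_b j => plift (snd (fst y j)) | Gen_c i => upp (of_int (s i)) (snd y i))"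

definition tuple_rep :: "nat => nat => (nat => int) => (nat => ppt \<times> ppt) \<times> (nat => complex) => surface_gen word set => (real^2^2) set" where
 "tuple_rep g p s y = urep (surface_gens g p) {surface_relator g p} (tuple_lift s y)"

definition stratum_tuples :: "nat => nat => int => (nat => int) => ((nat => ppt \<times> ppt) \<times> (nat => complex)) set" where
 "stratum_tuples g p n s = {y \<in> htuples g \<times> ptuples p. sword g p s y = uz n}"

lemma tuple_lift_relator:
 assumes "fst y \<in> htuples g" shows "uev (tuple_lift s y) (surface_relator g p) = sword g p s y"
proof -
 have "hword (%j. (pproj (tuple_lift s y (Gen_a j)), pproj (tuple_lift s y (Gen_b j)))) g = hword (fst y) g"
  using assms by (intro hword_cong) (auto simp: tuple_lift_def htuples_def mem_Times_iff)
 then show ?thesis by (simp add: uev_surface_relator sword_def pword_ucprod tuple_lift_def)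
qed

lemma tuple_rep_class:
 assumes "y \<in> stratum_tuples g p n s" "u \<in> words (surface_gens g p)"
 shows "tuple_rep g p s y (wclass (surface_gens g p) {surface_relator g p} u) = upsl (uev (tuple_lift s y) u)"
 unfolding tuple_rep_def using assms by (intro urep_class) (auto simp: tuple_lift_relator stratum_tuples_def)

lemma tuple_rep_elt:
 assumes "y \<in> stratum_tuples g p n s" "x \<in> surface_gens g p"
 shows "tuple_rep g p s y (surface_elt g p x) = upsl (tuple_lift s y x)"
 using tuple_rep_class[OF assms(1), of "[(x, True)]"] assms(2) by (simp add: surface_elt_def presented_gen_def)

lemma sign_vector_cases: "s \<in> sign_vectors p ==> i < p ==> s i = 1 \<or> s i = -1"
 by (auto simp: sign_vectors_def PiE_iff)

lemma tuple_rep_in_stratum: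
 assumes y: "y \<in> stratum_tuples g p n s" and s: "s \<in> sign_vectors p"
 shows "tuple_rep g p s y \<in> rep_stratum g p (n, s)"
proof -
 have y': "fst y \<in> htuples g" "snd y \<in> ptuples p" "sword g p s y = uz n" using y by (auto simp: stratum_tuples_def)
 have "uev (tuple_lift s y) (surface_relator g p) = uz n" using tuple_lift_relator[OF y'(1)] y'(3) by simp
 then have rep: "tuple_rep g p s y \<in> representations g p"
  unfolding representations_def tuple_rep_def surface_group_def by (intro urep_hom) auto
 have c: "tuple_rep g p s y (surface_elt g p (Gen_c i)) = upsl (upar (sgn (snd y i)) (of_int (s i) * cmod (snd y i)))"
  "cmod (sgn (snd y i)) = 1" "of_int (s i) * cmod (snd y i) ~= 0" if i: "i < p" for i
  using tuple_rep_elt[OF y, of "Gen_c i"] i y'(2) sign_vector_cases[OF s i]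
  by (auto simp: surface_gens_def tuple_lift_def upp_def ptuples_def cmod_sgn)
 have tp: "tuple_rep g p s y \<in> type_preserving g p"
  unfolding type_preserving_def parabolic_iff using rep c by blast
 let ?A = "tuple_rep g p s y"
 have "rep_handles g p ?A j = fst y j" for j
  using tuple_rep_elt[OF y, of "Gen_a j"] tuple_rep_elt[OF y, of "Gen_b j"] y'(1)
  by (cases "j < g") (auto simp: rep_handles_def tuple_lift_def surface_gens_def htuples_def mem_Times_iff prod_eq_iff)
 then have "hword (rep_handles g p ?A) g = hword (fst y) g" by (intro hword_cong)
 moreover have "ucprod (%i. rep_lift g p ?A (Gen_c i)) p = pword s (snd y) p"
  unfolding pword_ucprod using c by (intro ucprod_cong) (simp add: rep_lift_def plift_upar upp_def)
 ultimately have "rel_euler g p ?A = n" using y' rel_euler_iff tp by (simp add: rep_product_def sword_def)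
 moreover have "rep_sign g p ?A = s"
 proof
  fix i
  show "rep_sign g p ?A i = s i"
  proof (cases "i < p")
   case True
   have "cmod (snd y i) > 0" using c(3)[OF True] by auto
   then show ?thesis using sign_vector_cases[OF s True] True c[OF True] parabolic_sign[OF c(2,3)[OF True]]
    by (auto simp: rep_sign_def)
  next
   case False
   then show ?thesis using s by (simp add: rep_sign_def sign_vectors_def PiE_iff extensional_def)
  qed
 qed
 ultimately show ?thesis using tp by (simp add: rep_stratum_def)
qed

lemma rep_stratum_image:
 assumes s: "s \<in> sign_vectors p"
 shows "rep_stratum g p (n, s) = tuple_rep g p s ` stratum_tuples g p n s"
proof (intro equalityI subsetI)
 fix h assume "h \<in> rep_stratum g p (n, s)"
 then have tp: "h \<in> type_preserving g p" and e: "rel_euler g p h = n" "rep_sign g p h = s" by (auto simp: rep_stratum_def)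
 have r: "h \<in> representations g p" using tp by (simp add: type_preserving_def)
 have ex: "\<exists>w. w ~= 0 \<and> rep_lift g p h (Gen_c i) = upp (of_int (s i)) w" if i: "i < p" for i
 proof -
  obtain v q where q: "cmod v = 1" "q ~= 0" "h (surface_elt g p (Gen_c i)) = upsl (upar v q)"
   "rep_lift g p h (Gen_c i) = upar v q" using parabolic_rep[OF tp i] .
  have "upp (of_int (s i)) (of_real \<bar>q\<bar> * v) = upar v q" using i q parabolic_sign e upp_polar by (auto simp: rep_sign_def)
  moreover have "of_real \<bar>q\<bar> * v ~= 0" using q by auto
  ultimately show ?thesis using q(4) by metis
 qed
 define w where "w = (%i. if i < p then SOME w. w ~= 0 \<and> rep_lift g p h (Gen_c i) = upp (of_int (s i)) w else 1)"
 have w: "w i ~= 0 \<and> rep_lift g p h (Gen_c i) = upp (of_int (s i)) (w i)" if "i < p" for i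
  using someI_ex[OF ex[OF that]] that by (simp add: w_def)
 define y where "y = (rep_handles g p h, w)"
 have l: "tuple_lift s y x = rep_lift g p h x" if "x \<in> surface_gens g p" for x
  using that w by (auto simp: surface_gens_def tuple_lift_def y_def rep_handles_def rep_lift_def)
 have "rep_product g p h = sword g p s y"
  unfolding rep_product_def sword_def y_def pword_ucprod using w by (simp cong: ucprod_cong)
 then have "sword g p s y = uz n" using rel_euler_iff[OF tp, of n] e(1) by simp
 moreover have "w \<in> ptuples p" using w by (auto simp: ptuples_def w_def)
 ultimately have y: "y \<in> stratum_tuples g p n s" using rep_handles_in[OF r] by (simp add: stratum_tuples_def y_def)
 have "h X = tuple_rep g p s y X" if X: "X \<in> carrier (surface_group g p)" for X
 proof -
  obtain u where u: "u \<in> words (surface_gens g p)" "X = wclass (surface_gens g p) {surface_relator g p} u"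
   using X unfolding surface_group_def carrier_presented by blast
  have "h X = upsl (uev (tuple_lift s y) u)" unfolding u(2)
   using r rep_lift_upsl(1)[OF r] l by (intro hom_word u(1)) (auto simp: representations_def surface_group_def surface_elt_def)
  then show ?thesis using tuple_rep_class[OF y u(1)] u(2) by simp
 qed
 moreover have "h \<in> extensional (carrier (surface_group g p))" "tuple_rep g p s y \<in> extensional (carrier (surface_group g p))"
  using r by (auto simp: representations_def tuple_rep_def urep_def surface_group_def)
 ultimately show "h \<in> tuple_rep g p s ` stratum_tuples g p n s" by (metis extensionalityI y image_eqI)
next
 fix h assume "h \<in> tuple_rep g p s ` stratum_tuples g p n s"
 then show "h \<in> rep_stratum g p (n, s)" using tuple_rep_in_stratum[OF _ s] by blast
qed

section \<open>Connected components of the representation space\<close>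

definition local_lift :: "'a::t2_space set => 'a => ('a => ucov) => bool" where
 "local_lift Y y f <-> (\<exists>h. continuous (at y within Y) h \<and> (\<forall>z\<in>Y. upsl (h z) = upsl (f z)))"

lemma local_liftI: "continuous (at y within Y) f ==> local_lift Y y f"
 unfolding local_lift_def by blast

lemma local_lift_compose:
 assumes "local_lift Y y f" "local_lift Y y h"
  and c: "continuous_on UNIV (%z. F (fst z) (snd z))" and F: "\<And>k l. upsl (F k l) = G (upsl k) (upsl l)"
 shows "local_lift Y y (%z. F (f z) (h z))"
proof -
 obtain v u where s: "continuous (at y within Y) v" "\<forall>z\<in>Y. upsl (v z) = upsl (f z)"
  "continuous (at y within Y) u" "\<forall>z\<in>Y. upsl (u z) = upsl (h z)" using assms(1,2) unfolding local_lift_def by blast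
 have "isCont (%z. F (fst z) (snd z)) (v y, u y)"
  using c unfolding continuous_on_eq_continuous_at[OF open_UNIV] by blast
 then have "continuous (at y within Y) (%z. F (v z) (u z))"
  using continuous_within_compose3[where f = "%z. (v z, u z)" and g = "%z. F (fst z) (snd z)"] s by (simp add: continuous_Pair)
 then show ?thesis using s(2,4) F unfolding local_lift_def by (intro exI[of _ "%z. F (v z) (u z)"]) simp
qed

lemma local_lift_plift:
 assumes q: "continuous_on Y q" "\<And>z. z \<in> Y ==> q z \<in> ppts" and y: "y \<in> Y"
 shows "local_lift Y y (%z. plift (q z))"
proof -
 obtain h where h: "\<And>r. r \<in> ppts ==> pproj (h r) = r" "continuous (at (q y)) h"
  using pproj_local_section[OF q(2)[OF y]] by metis
 have "continuous (at y within Y) (%z. h (q z))"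
  by (rule continuous_within_compose3[where f = q and g = h]) (use h(2) q(1) y in \<open>simp_all add: continuous_on_eq_continuous_within\<close>)
 then show ?thesis unfolding local_lift_def upsl_eq_iff using h(1) q(2) by (intro exI[of _ "%z. h (q z)"]) simp
qed

lemma local_lift_tuple:
 assumes y: "y \<in> stratum_tuples g p n s" and x: "x \<in> surface_gens g p"
 shows "local_lift (stratum_tuples g p n s) y (%y. tuple_lift s y x)"
proof -
 have c: "continuous_on Y (%y. fst y j)" "continuous_on Y (%y. snd y j)" for Y :: "((nat => ppt \<times> ppt) \<times> (nat => complex)) set" and j
  by (rule continuous_on_product_then_coordinatewise[OF continuous_on_fst[OF continuous_on_id]],
    rule continuous_on_product_then_coordinatewise[OF continuous_on_snd[OF continuous_on_id]])
 have h: "fst (fst z j) \<in> ppts \<and> snd (fst z j) \<in> ppts" if "z \<in> stratum_tuples g p n s" "j < g" for z j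
  using that by (force simp: stratum_tuples_def htuples_def mem_Times_iff)
 show ?thesis
 proof (cases x)
  case (Gen_c i)
  then have "continuous_on (stratum_tuples g p n s) (%y. upp (of_int (s i)) (snd y i))"
   using x by (intro continuous_on_upp c) (auto simp: ptuples_def surface_gens_def stratum_tuples_def)
  then show ?thesis using y by (intro local_liftI) (simp add: tuple_lift_def Gen_c continuous_on_eq_continuous_within)
 qed (use x h in \<open>auto simp: tuple_lift_def surface_gens_def intro!: local_lift_plift[OF _ _ y] continuous_on_fst[OF c(1)] continuous_on_snd[OF c(1)]\<close>)
qed

lemma local_lift_word:
 assumes y: "y \<in> stratum_tuples g p n s" and u: "u \<in> words (surface_gens g p)"
 shows "local_lift (stratum_tuples g p n s) y (%y. uev (tuple_lift s y) u)"
 using u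
proof (induction u)
 case (Cons l u)
 obtain x b where l: "l = (x, b)" by (cases l)
 let ?L = "local_lift (stratum_tuples g p n s) y"
 have x: "?L (%y. tuple_lift s y x)" using local_lift_tuple[OF y] Cons.prems l by simp
 have "?L (%y. uinv (tuple_lift s y x))"
  by (rule local_lift_compose[OF x x, of "%k l. uinv k" "%X Y. inv\<^bsub>PSL2R\<^esub> X"]) (intro continuous_intros, simp add: upsl_inv)
 then have "?L (%y. (if b then tuple_lift s y x else uinv (tuple_lift s y x)) &* uev (tuple_lift s y) u)"
  using x Cons by (intro local_lift_compose[of _ _ _ _ "(&*)" "%X Y. X \<otimes>\<^bsub>PSL2R\<^esub> Y"])
   (cases b; auto intro!: continuous_intros simp: upsl_mult)+
 then show ?case by (simp add: l)
qed (simp add: local_liftI)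

lemma topspace_compact_open: "f \<in> topspace (compact_open_topology X Y) <-> continuous_map X Y f \<and> f \<in> extensional (topspace X)"
by (auto simp: compact_open_topology_def)

lemma representation_continuous:
 assumes "h \<in> representations g p"
 shows "h \<in> topspace (compact_open_topology (discrete_topology (carrier (surface_group g p))) PSL2R_top)"
 using assms by (auto simp: topspace_compact_open representations_def hom_def)

lemma topspace_type_preserving [simp]: "topspace (type_preserving_space g p) = type_preserving g p"
 using representation_continuous by (auto simp: type_preserving_space_def representation_space_def type_preserving_def)

lemma continuous_map_eval:
 assumes e: "e \<in> carrier (surface_group g p)"
 shows "continuous_map (type_preserving_space g p) PSL2R_top (%h. h e)"
 unfolding continuous_map_def
proof (intro conjI allI impI)
 let ?A = "type_preserving_space g p"
 show "(%h. h e) \<in> topspace ?A \<rightarrow> topspace PSL2R_top"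
  using e by (auto simp: type_preserving_def representations_def hom_def)
 fix V assume V: "openin PSL2R_top V"
 define X where "X = discrete_topology (carrier (surface_group g p))"
 define B where "B = {f. continuous_map X PSL2R_top f \<and> f \<in> extensional (topspace X) \<and> f ` {e} \<subseteq> V}"
 have "compactin X {e}" using e by (simp add: X_def compactin_discrete_topology)
 then have "openin (compact_open_topology X PSL2R_top) B"
  unfolding compact_open_topology_def B_def using V by (intro topology_generated_by_Basis) blast
 then have "openin ?A (type_preserving g p \<inter> (representations g p \<inter> B))"
  unfolding type_preserving_space_def representation_space_def X_def by (intro openin_subtopology_Int2)
 moreover have "type_preserving g p \<inter> (representations g p \<inter> B) = {h \<in> topspace ?A. h e \<in> V}"
  using representation_continuous by (auto simp: B_def X_def type_preserving_def topspace_compact_open simp del: topspace_discrete_topology)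
 ultimately show "openin ?A {h \<in> topspace ?A. h e \<in> V}" by simp
qed

lemma continuous_map_tuple_rep:
 assumes s: "s \<in> sign_vectors p"
 shows "continuous_map (top_of_set (stratum_tuples g p n s)) (type_preserving_space g p) (tuple_rep g p s)"
proof -
 define Y where "Y = stratum_tuples g p n s"
 define X where "X = discrete_topology (carrier (surface_group g p))"
 have tp: "tuple_rep g p s y \<in> type_preserving g p" if "y \<in> Y" for y
  using tuple_rep_in_stratum[OF _ s, of y g n] that by (auto simp: Y_def rep_stratum_def)
 then have rep: "tuple_rep g p s y \<in> representations g p" if "y \<in> Y" for y using that by (auto simp: type_preserving_def)
 have single: "openin (top_of_set Y) {y \<in> Y. tuple_rep g p s y e \<in> V}"
  if e: "e \<in> carrier (surface_group g p)" and V: "openin PSL2R_top V" for e V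
 proof (subst openin_subopen, intro ballI)
  fix y_0 assume y0: "y_0 \<in> {y \<in> Y. tuple_rep g p s y e \<in> V}"
  obtain u where u: "u \<in> words (surface_gens g p)" "e = wclass (surface_gens g p) {surface_relator g p} u"
   using e unfolding surface_group_def carrier_presented by blast
  obtain h where h: "continuous (at y_0 within Y) h" "\<forall>y\<in>Y. upsl (h y) = upsl (uev (tuple_lift s y) u)"
   using local_lift_word[OF _ u(1), of y_0 n s] y0 unfolding Y_def local_lift_def by blast
  have ev: "tuple_rep g p s y e = upsl (h y)" if "y \<in> Y" for y
   using tuple_rep_class[OF _ u(1), of y n s] h(2) that u(2) by (simp add: Y_def)
  have "open {k. upsl k \<in> V}" "h y_0 \<in> {k. upsl k \<in> V}" using open_upsl_vimage[OF V] y0 ev[of y_0] by (simp_all only: mem_Collect_eq)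
  then obtain A where A: "open A" "y_0 \<in> A" "\<forall>y\<in>Y. y \<in> A --> h y \<in> {k. upsl k \<in> V}"
   using h(1) unfolding continuous_within_topological by meson
  then show "\<exists>T. openin (top_of_set Y) T \<and> y_0 \<in> T \<and> T \<subseteq> {y \<in> Y. tuple_rep g p s y e \<in> V}"
   using y0 ev by (intro exI[of _ "Y \<inter> A"]) (auto intro: openin_open_Int)
 qed
 have "continuous_map (top_of_set Y) (compact_open_topology X PSL2R_top) (tuple_rep g p s)"
  unfolding compact_open_topology_def
 proof (rule continuous_on_generated_topo)
  fix W assume "W \<in> {{f. continuous_map X PSL2R_top f \<and> f \<in> extensional (topspace X) \<and> f ` K \<subseteq> V} | K V.
   compactin X K \<and> openin PSL2R_top V}"
  then obtain K V where K: "compactin X K" "openin PSL2R_top V"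
   and W: "W = {f. continuous_map X PSL2R_top f \<and> f \<in> extensional (topspace X) \<and> f ` K \<subseteq> V}" by blast
  have K': "finite K" "K \<subseteq> carrier (surface_group g p)" using K(1) by (simp_all add: X_def compactin_discrete_topology)
  have "tuple_rep g p s -` W \<inter> topspace (top_of_set Y) = {y \<in> Y. \<forall>e\<in>K. tuple_rep g p s y e \<in> V}"
   using representation_continuous[OF rep] unfolding W X_def[symmetric] topspace_compact_open by auto
  moreover have "openin (top_of_set Y) {y \<in> Y. \<forall>e\<in>K. tuple_rep g p s y e \<in> V}"
   using K'
  proof (induction K rule: finite_induct)
   case (insert e K)
   have "{y \<in> Y. \<forall>e\<in>insert e K. tuple_rep g p s y e \<in> V} = {y \<in> Y. tuple_rep g p s y e \<in> V} \<inter> {y \<in> Y. \<forall>e\<in>K. tuple_rep g p s y e \<in> V}" by blast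
   then show ?case using insert single[OF _ K(2), of e] by (simp add: openin_Int)
  qed simp
  ultimately show "openin (top_of_set Y) (tuple_rep g p s -` W \<inter> topspace (top_of_set Y))" by simp
 next
  have "tuple_rep g p s ` topspace (top_of_set Y) \<subseteq> topspace (compact_open_topology X PSL2R_top)"
   using representation_continuous[OF rep] unfolding X_def by auto
  then show "tuple_rep g p s ` topspace (top_of_set Y) \<subseteq> \<Union> {{f. continuous_map X PSL2R_top f \<and> f \<in> extensional (topspace X) \<and> f ` K \<subseteq> V} | K V.
   compactin X K \<and> openin PSL2R_top V}" unfolding compact_open_topology_def topology_generated_by_topspace .
 qed
 then show ?thesis unfolding type_preserving_space_def representation_space_def continuous_map_in_subtopology
  using tp rep unfolding X_def Y_def by auto
qed

lemma connected_stratum: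
 assumes "s \<in> sign_vectors p" "connected (stratum_tuples g p n s)"
 shows "connectedin (type_preserving_space g p) (rep_stratum g p (n, s))"
 unfolding rep_stratum_image[OF assms(1)]
 by (rule connectedin_continuous_map_image[OF continuous_map_tuple_rep[OF assms(1), of g n]])
   (simp add: connectedin_subtopology assms(2))

lemma continuous_map_umult:
 assumes "continuous_map X euclidean f" "continuous_map X euclidean h"
 shows "continuous_map X euclidean (%x. f x &* h x)"
proof -
 have "continuous_map X (prod_topology euclidean euclidean) (%x. (f x, h x))" using assms by (rule continuous_map_pairedI)
 moreover have "continuous_map (prod_topology euclidean euclidean) euclidean (%z. fst z &* snd z)"
  unfolding euclidean_product_topology[symmetric] by (simp, intro continuous_intros)
 ultimately have "continuous_map X euclidean ((%z. fst z &* snd z) \<circ> (%x. (f x, h x)))" by (rule continuous_map_compose)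
 then show ?thesis by (simp add: o_def)
qed

lemma continuous_map_coordinate:
 assumes x: "x \<in> surface_gens g p"
 shows "continuous_map (type_preserving_space g p) (top_of_set ppts) (%h. pcoord (h (surface_elt g p x)))"
 using continuous_map_compose[OF continuous_map_eval[OF surface_elt_in[OF x]] continuous_map_pcoord] by (simp add: o_def)

lemma continuous_map_puncture:
 assumes i: "i < p"
 shows "continuous_map (type_preserving_space g p) euclidean (%h. rep_lift g p h (Gen_c i))"
proof -
 define D where "D = {q :: ppt. fst q \<notin> \<real>\<^sub>\<le>\<^sub>0}"
 let ?A = "%h. pcoord (h (surface_elt g p (Gen_c i)))"
 let ?B = "type_preserving_space g p"
 have "Gen_c i \<in> surface_gens g p" using i by (simp add: surface_gens_def)
 from continuous_map_coordinate[OF this] have "continuous_map ?B euclidean ?A"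
  by (rule continuous_map_into_fulltopology)
 moreover have "pcoord (h (surface_elt g p (Gen_c i))) \<in> D" if t: "h \<in> type_preserving g p" for h
 using parabolic_rep t i by (force simp: complex_nonpos_Reals_iff sin_double cos_double D_def pproj_def upar_def)
 ultimately have "continuous_map ?B (top_of_set D) ?A"
  by (auto simp: continuous_map_in_subtopology)
 moreover have "continuous_on D plift" unfolding plift_def D_def by (intro continuous_intros) auto
 then have "continuous_map (top_of_set D) euclidean plift" by simp
 ultimately have "continuous_map ?B euclidean (plift \<circ> ?A)"
  by (rule continuous_map_compose)
 then show ?thesis by (simp add: o_def rep_lift_def)
qed

lemma continuous_map_rep_product: "continuous_map (type_preserving_space g p) euclidean (rep_product g p)"
proof -
 let ?B = "type_preserving_space g p"
 have "continuous_map ?B euclidean (%h. hword (rep_handles g p h) k)" if "k <= g" for k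
  using that
 proof (induction k)
  case (Suc k)
  have k: "Gen_a k \<in> surface_gens g p" "Gen_b k \<in> surface_gens g p" using Suc.prems by (auto simp: surface_gens_def)
  let ?A = "%h. (pcoord (h (surface_elt g p (Gen_a k))), pcoord (h (surface_elt g p (Gen_b k))))"
  let ?C = "prod_topology (top_of_set ppts) (top_of_set ppts)"
  have "continuous_map ?B ?C
   ?A"
   by (intro continuous_map_pairedI continuous_map_coordinate k)
  moreover have "continuous_map ?C euclidean (%x. pcomm (fst x) (snd x))"
   unfolding prod_topology_subtopology_eu using continuous_on_pcomm_aux by simp
  ultimately have "continuous_map ?B euclidean ((%x. pcomm (fst x) (snd x)) \<circ>
   ?A)"
   by (rule continuous_map_compose)
  then have "continuous_map ?B euclidean (%h. pcomm (fst (rep_handles g p h k)) (snd (rep_handles g p h k)))"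
   using Suc.prems by (simp add: rep_handles_def o_def)
  then show ?case using Suc by (simp add: continuous_map_umult)
 qed simp
 moreover have "continuous_map ?B euclidean (%h. ucprod (%i. rep_lift g p h (Gen_c i)) k)" if "k <= p" for k
  using that by (induction k) (simp_all add: continuous_map_umult continuous_map_puncture)
 ultimately show ?thesis unfolding rep_product_def[abs_def] by (intro continuous_map_umult) simp_all
qed

lemma rep_sign_iff:
 assumes h: "h \<in> type_preserving g p" and s: "s \<in> sign_vectors p"
 shows "rep_sign g p h = s <-> (\<forall>i<p. 0 < of_int (s i) * fst (rep_lift g p h (Gen_c i)))" (is ?P) "rep_sign g p h \<in> sign_vectors p" (is ?Q)
proof -
 have sg: "rep_sign g p h i = (if 0 < fst (rep_lift g p h (Gen_c i)) then 1 else -1)" "fst (rep_lift g p h (Gen_c i)) ~= 0" if i: "i < p" for i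
 proof -
  obtain v r where r: "cmod v = 1" "r ~= 0" "h (surface_elt g p (Gen_c i)) = upsl (upar v r)"
   "rep_lift g p h (Gen_c i) = upar v r" using parabolic_rep[OF h i] .
  then show "rep_sign g p h i = (if 0 < fst (rep_lift g p h (Gen_c i)) then 1 else -1)" "fst (rep_lift g p h (Gen_c i)) ~= 0"
   using i parabolic_sign[OF r(1,2)] by (simp_all add: rep_sign_def upar_def)
 qed
 show r: ?Q
  unfolding sign_vectors_def
 using sg by (simp add: rep_sign_def)
 have eq: "rep_sign g p h i = s i <-> 0 < of_int (s i) * fst (rep_lift g p h (Gen_c i))" if i: "i < p" for i
  using sign_vector_cases[OF s i] sg(2)[OF i] unfolding sg(1)[OF i] by (elim disjE) (simp_all split: if_split, linarith?)
 show ?P using PiE_ext r s eq by (force simp: sign_vectors_def)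
qed

lemma open_stratum:
 assumes s: "s \<in> sign_vectors p"
 shows "openin (type_preserving_space g p) (rep_stratum g p (n, s))"
proof -
 define A where "A = {k :: ucov. \<bar>fst k - pi * of_int n\<bar> < pi / 2}"
 define B where "B = (%i. {k :: ucov. 0 < of_int (s i) * fst k})"
 let ?A = "{h \<in> type_preserving g p. rep_product g p h \<in> A}"
 let ?C = "type_preserving_space g p"
 have "open A" "open (B i)" for i unfolding A_def B_def by (intro open_Collect_less continuous_intros)+
 then have o: "openin ?C ?A"
  "\<And>i. i < p ==> openin ?C {h \<in> type_preserving g p. rep_lift g p h (Gen_c i) \<in> B i}"
  using openin_continuous_map_preimage[OF continuous_map_rep_product, of A g p]
   openin_continuous_map_preimage[OF continuous_map_puncture] by simp_all
 let ?B = "{h \<in> type_preserving g p. \<forall>i<p. rep_lift g p h (Gen_c i) \<in> B i}"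
 have "openin ?C {h \<in> type_preserving g p. \<forall>i<k. rep_lift g p h (Gen_c i) \<in> B i}" if "k <= p" for k
  using that
 proof (induction k)
  case (Suc k)
  have "{h \<in> type_preserving g p. \<forall>i<Suc k. rep_lift g p h (Gen_c i) \<in> B i} =
   {h \<in> type_preserving g p. \<forall>i<k. rep_lift g p h (Gen_c i) \<in> B i} \<inter> {h \<in> type_preserving g p. rep_lift g p h (Gen_c k) \<in> B k}"
   by (auto simp: less_Suc_eq)
  then show ?case using Suc o(2)[of k] by (simp add: openin_Int)
 next
  case 0
  show ?case using openin_topspace[of "type_preserving_space g p"] by simp
 qed
 from openin_Int[OF o(1) this[OF order_refl]]
 have "openin ?C (?A \<inter> ?B)" .
 moreover have "rep_product g p h \<in> A <-> rel_euler g p h = n" if h: "h \<in> type_preserving g p" for h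
 proof -
  have "h \<in> representations g p" using h by (simp add: type_preserving_def)
  then obtain m where m: "rep_product g p h = uz m" using rep_product_central by blast
  have "fst (uz m) - pi * of_int n = pi * of_int (m - n)" by (simp add: uz_def urot_def algebra_simps)
  then have "uz m \<in> A <-> pi * \<bar>of_int (m - n)\<bar> < pi * (1 / 2)" by (simp add: A_def abs_mult)
  also have "\<dots> <-> m = n" unfolding mult_less_cancel_left_pos[OF pi_gt_zero] by linarith
  finally show ?thesis using m rel_euler_iff[OF h, of n] by simp
 qed
 then have "?A \<inter> ?B = rep_stratum g p (n, s)"
  using rep_sign_iff(1)[OF _ s] by (auto simp: rep_stratum_def B_def)
 ultimately show ?thesis by simp
qed

lemma clopen_partition_components:
 assumes cover: "topspace X = (\<Union>i\<in>I. f i)"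
  and f: "\<And>i. i \<in> I ==> openin X (f i)" "\<And>i. i \<in> I ==> connectedin X (f i)" "\<And>i. i \<in> I ==> f i ~= {}"
  and disj: "\<And>i j. i \<in> I ==> j \<in> I ==> f i \<inter> f j ~= {} ==> i = j"
 shows "bij_betw f I (connected_components_of X)"
proof -
 have comp: "connected_component_of_set X x = f i" if i: "i \<in> I" and x: "x \<in> f i" for i x
 proof
  have "topspace X - f i = (\<Union>j\<in>I - {i}. f j)" unfolding cover using disj i by fastforce
  then have "closedin X (f i)" using assms i by (auto simp: closedin_def)
  then have "connected_component_of_set X x \<subseteq> f i \<or> disjnt (connected_component_of_set X x) (f i)"
   using f(1)[OF i] by (intro connectedin_clopen_cases) (simp_all add: connectedin_connected_component_of)
  moreover have "x \<in> connected_component_of_set X x"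
   using x i cover by (auto simp: connected_component_of_refl)
  ultimately show "connected_component_of_set X x \<subseteq> f i" using x by (auto simp: disjnt_def)
  show "f i \<subseteq> connected_component_of_set X x" using f(2)[OF i] x by (rule connected_component_of_maximal)
 qed
 have "connected_components_of X = f ` I"
 proof (intro equalityI subsetI)
  fix C assume "C \<in> connected_components_of X"
  then obtain x where "x \<in> topspace X" "C = connected_component_of_set X x" by (auto simp: connected_components_of_def)
  then show "C \<in> f ` I" using comp cover by auto
 next
  fix C assume "C \<in> f ` I"
  then obtain i x where i: "i \<in> I" "C = f i" "x \<in> f i" using f(3) by blast
  then have "x \<in> topspace X" "C = connected_component_of_set X x" using cover comp by auto
  then show "C \<in> connected_components_of X" unfolding connected_components_of_def by blast
 qed
 moreover have "inj_on f I" using disj f(3) by (intro inj_onI) (metis inf.idem)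
 ultimately show ?thesis by (simp add: bij_betw_def)
qed

lemma rep_stratum_components:
 assumes conn: "\<And>n s. s \<in> sign_vectors p ==> connected (stratum_tuples g p n s)"
  and I: "I = {(n, s). s \<in> sign_vectors p \<and> stratum_tuples g p n s ~= {}}"
 shows "bij_betw (rep_stratum g p) I (connected_components_of (type_preserving_space g p))"
proof (rule clopen_partition_components)
 let ?A = "type_preserving_space g p"
 show "topspace ?A = (\<Union>i\<in>I. rep_stratum g p i)"
 proof (intro equalityI subsetI)
  fix h assume "h \<in> topspace ?A"
  then have h: "h \<in> type_preserving g p" by simp
  have "(\<lambda>i\<in>{..<p}. 1) \<in> sign_vectors p" by (simp add: sign_vectors_def)
  then have s: "rep_sign g p h \<in> sign_vectors p" using rep_sign_iff(2)[OF h] by blast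
  have st: "h \<in> rep_stratum g p (rel_euler g p h, rep_sign g p h)" using h by (simp add: rep_stratum_def)
  then have "stratum_tuples g p (rel_euler g p h) (rep_sign g p h) ~= {}" unfolding rep_stratum_image[OF s] by blast
  then show "h \<in> (\<Union>i\<in>I. rep_stratum g p i)" using s st unfolding I by blast
 qed (auto simp: rep_stratum_def)
 fix i assume "i \<in> I"
 then obtain n s where i: "i = (n, s)" "s \<in> sign_vectors p" "stratum_tuples g p n s ~= {}" unfolding I by blast
 show "openin ?A (rep_stratum g p i)" unfolding i(1) by (rule open_stratum[OF i(2)])
 show "connectedin ?A (rep_stratum g p i)" unfolding i(1) by (rule connected_stratum[OF i(2) conn[OF i(2)]])
 show "rep_stratum g p i ~= {}" unfolding i(1) rep_stratum_image[OF i(2)] using i(3) by simp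
next
 fix i j assume "rep_stratum g p i \<inter> rep_stratum g p j ~= {}"
 then show "i = j" by (auto simp: rep_stratum_def split: prod.splits)
qed

lemma sign_vector_sum: "s \<in> sign_vectors p ==> int (p_plus p s) + int (p_minus p s) = int p"
 using p_plus_minus[of p s] sign_vector_cases[of s p] by (metis of_nat_add)

lemma positive_genus_strata:
 assumes s: "s \<in> sign_vectors p" and g: "1 <= g" and p: "1 <= p"
 shows "connected (stratum_tuples g p n s)"
  "stratum_tuples g p n s ~= {} <-> euler_char g p + int (p_plus p s) <= n \<and> n <= - euler_char g p - int (p_minus p s)"
proof -
 obtain m q where mq: "g = Suc m" "p = Suc q" using g p by (metis Suc_le_D One_nat_def)
 have s': "s i = 1 \<or> s i = -1" if "i < Suc q" for i using sign_vector_cases[OF s] that mq by simp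
 show "connected (stratum_tuples g p n s)"
  unfolding stratum_tuples_def mq by (rule connected_positive_genus(1)) (rule s')
 have "stratum_tuples g p n s ~= {} <-> - 2 * int m - int (p_minus p s) <= n \<and> n <= 2 * int m + int (p_plus p s)"
  unfolding stratum_tuples_def mq by (rule connected_positive_genus(2)) (rule s')
 then show "stratum_tuples g p n s ~= {} <-> euler_char g p + int (p_plus p s) <= n \<and> n <= - euler_char g p - int (p_minus p s)"
  using sign_vector_sum[OF s] mq by (auto simp: euler_char_def)
qed

lemma genus_zero_strata:
 assumes s: "s \<in> sign_vectors p" and p: "3 <= p"
 shows "connected (stratum_tuples 0 p n s)"
  "stratum_tuples 0 p n s ~= {} <-> (euler_char 0 p + int (p_plus p s) <= n \<and> n <= - euler_char 0 p - int (p_minus p s)) \<or>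
    (n = 0 \<and> (p_minus p s = 1 \<or> p_plus p s = 1)) \<or> (n = 1 \<and> p_minus p s = 0 \<or> n = -1 \<and> p_plus p s = 0)"
proof -
 have eq: "stratum_tuples 0 p n s = {%_. trivial_handle} \<times> {w \<in> ptuples p. pword s w p = uz n}"
  unfolding stratum_tuples_def htuples_def sword_def by auto
 note c = connected_genus_zero[OF p sign_vector_cases[OF s], where n = n]
 show "connected (stratum_tuples 0 p n s)"
  unfolding eq by (intro connected_Times connected_sing) (rule c(1))
 have "stratum_tuples 0 p n s ~= {} <-> {w \<in> ptuples p. pword s w p = uz n} ~= {}" unfolding eq by blast
 also note c(2)
 finally show "stratum_tuples 0 p n s ~= {} <-> (euler_char 0 p + int (p_plus p s) <= n \<and> n <= - euler_char 0 p - int (p_minus p s)) \<or>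
    (n = 0 \<and> (p_minus p s = 1 \<or> p_plus p s = 1)) \<or> (n = 1 \<and> p_minus p s = 0 \<or> n = -1 \<and> p_plus p s = 0)"
  using sign_vector_sum[OF s] unfolding euler_char_def by linarith
qed

subsection \<open>Counting\<close>

lemma finite_sign_vectors: "finite (sign_vectors p)"
 unfolding sign_vectors_def by (intro finite_PiE) auto

lemma card_sign_vectors: "card {s \<in> sign_vectors p. p_plus p s = k} = p choose k"
proof -
 have "bij_betw (%s. {i. i < p \<and> s i = 1}) {s \<in> sign_vectors p. p_plus p s = k} {A. A \<subseteq> {..<p} \<and> card A = k}"
 proof (rule bij_betw_byWitness[where f' = "%A. \<lambda>i\<in>{..<p}. if i \<in> A then 1 else -1"])
  show "\<forall>s\<in>{s \<in> sign_vectors p. p_plus p s = k}. (\<lambda>i\<in>{..<p}. if i \<in> {i. i < p \<and> s i = 1} then 1 else -1) = s"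
  proof (intro ballI ext)
   fix s i assume "s \<in> {s \<in> sign_vectors p. p_plus p s = k}"
   then have s: "s \<in> sign_vectors p" by simp
   then have "s i = undefined" if "\<not> i < p" using that by (simp add: sign_vectors_def PiE_iff extensional_def)
   then show "(\<lambda>i\<in>{..<p}. if i \<in> {i. i < p \<and> s i = 1} then 1 else -1) i = s i"
    using sign_vector_cases[OF s, of i] by (cases "i < p") auto
  qed
  show "\<forall>A\<in>{A. A \<subseteq> {..<p} \<and> card A = k}. {i. i < p \<and> (\<lambda>i\<in>{..<p}. if i \<in> A then 1 else -1 :: int) i = 1} = A" by auto
  show "(%s. {i. i < p \<and> s i = 1}) ` {s \<in> sign_vectors p. p_plus p s = k} \<subseteq> {A. A \<subseteq> {..<p} \<and> card A = k}"
   by (auto simp: p_plus_def)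
  show "(%A. \<lambda>i\<in>{..<p}. if i \<in> A then 1 else -1) ` {A. A \<subseteq> {..<p} \<and> card A = k} \<subseteq> {s \<in> sign_vectors p. p_plus p s = k}"
  proof (rule image_subsetI)
   fix A assume A: "A \<in> {A. A \<subseteq> {..<p} \<and> card A = k}"
   then have "{i. i < p \<and> (\<lambda>i\<in>{..<p}. if i \<in> A then 1 else -1 :: int) i = 1} = A" by auto
   then show "(\<lambda>i\<in>{..<p}. if i \<in> A then 1 else -1) \<in> {s \<in> sign_vectors p. p_plus p s = k}"
    using A by (auto simp: p_plus_def sign_vectors_def)
  qed
 qed
 then show ?thesis using bij_betw_same_card by (force simp: n_subsets)
qed

definition hyperbolic_range :: "int => nat => (int \<times> (nat => int)) set" where
 "hyperbolic_range c p = {(n, s). s \<in> sign_vectors p \<and> c + int (p_plus p s) <= n \<and> n <= - c - int (p_minus p s)}"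

lemma card_hyperbolic_range:
 "finite (hyperbolic_range c p)"
 "card (hyperbolic_range c p) = (\<Sum>n = c..-c. \<Sum>k = max (n + int p + c) 0..min (n - c) (int p). p choose nat k)"
proof -
 define B where "B = (%n. {s \<in> sign_vectors p. int (p_plus p s) \<in> {max (n + int p + c) 0..min (n - c) (int p)}})"
 have eq: "hyperbolic_range c p = (SIGMA n : {c..-c}. B n)"
 using sign_vector_sum by (force simp: B_def hyperbolic_range_def)
 have B: "finite (B n)" for n unfolding B_def using finite_sign_vectors by simp
 show "finite (hyperbolic_range c p)" unfolding eq using B by (intro finite_SigmaI) auto
 have "card (B n) = (\<Sum>k = max (n + int p + c) 0..min (n - c) (int p). p choose nat k)" for n
 proof -
  have "B n = (\<Union>k\<in>{max (n + int p + c) 0..min (n - c) (int p)}. {s \<in> sign_vectors p. int (p_plus p s) = k})"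
   unfolding B_def by blast
  then have "card (B n) = (\<Sum>k = max (n + int p + c) 0..min (n - c) (int p). card {s \<in> sign_vectors p. int (p_plus p s) = k})"
   using finite_sign_vectors by (simp only:) (intro card_UN_disjoint, auto)
  also have "\<dots> = (\<Sum>k = max (n + int p + c) 0..min (n - c) (int p). p choose nat k)"
  proof (rule sum.cong)
   fix k assume "k \<in> {max (n + int p + c) 0..min (n - c) (int p)}"
   then have "{s \<in> sign_vectors p. int (p_plus p s) = k} = {s \<in> sign_vectors p. p_plus p s = nat k}" by auto
   then show "card {s \<in> sign_vectors p. int (p_plus p s) = k} = p choose nat k" by (simp add: card_sign_vectors)
  qed simp
  finally show ?thesis .
 qed
 then show "card (hyperbolic_range c p) = (\<Sum>n = c..-c. \<Sum>k = max (n + int p + c) 0..min (n - c) (int p). p choose nat k)"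
  unfolding eq by (subst card_SigmaI) (auto simp: B)
qed

definition exceptional :: "nat => (int \<times> (nat => int)) set" where
 "exceptional p = {(n, s). s \<in> sign_vectors p \<and> ((n = 0 \<and> (p_minus p s = 1 \<or> p_plus p s = 1)) \<or>
  (n = 1 \<and> p_minus p s = 0 \<or> n = -1 \<and> p_plus p s = 0))}"

lemma card_exceptional:
 assumes p: "3 <= p"
 shows "finite (exceptional p)" "card (exceptional p) = 2 * p + 2" "hyperbolic_range (2 - int p) p \<inter> exceptional p = {}"
proof -
 define V where "V = (%k. {s \<in> sign_vectors p. p_plus p s = k})"
 have fV: "finite (V k)" for k unfolding V_def using finite_sign_vectors by simp
 have m: "p_minus p s = p - p_plus p s" "p_plus p s <= p" if "s \<in> sign_vectors p" for s using sign_vector_sum[OF that] by simp_all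
 have eq: "exceptional p = ({0} \<times> V 1 \<union> {0} \<times> V (p - 1)) \<union> ({1} \<times> V p \<union> {-1} \<times> V 0)"
 proof -
  have "p_minus p s = 1 <-> p_plus p s = p - 1" "p_minus p s = 0 <-> p_plus p s = p" if "s \<in> sign_vectors p" for s
   using m[OF that] p by auto
  then have "(n, s) \<in> exceptional p <-> (n, s) \<in> ({0} \<times> V 1 \<union> {0} \<times> V (p - 1)) \<union> ({1} \<times> V p \<union> {-1} \<times> V 0)" for n s
   unfolding exceptional_def V_def by blast
  then show ?thesis by auto
 qed
 have c: "card ({0 :: int} \<times> V 1) = p" "card ({0 :: int} \<times> V (p - 1)) = p" "card ({1 :: int} \<times> V p) = 1" "card ({-1 :: int} \<times> V 0) = 1"
  using p binomial_symmetric[of 1 p] unfolding V_def card_cartesian_product by (simp_all add: card_sign_vectors)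
 show "finite (exceptional p)" unfolding eq using fV by simp
 have d: "({0 :: int} \<times> V 1) \<inter> ({0} \<times> V (p - 1)) = {}" "({1 :: int} \<times> V p) \<inter> ({-1} \<times> V 0) = {}"
  "({0 :: int} \<times> V 1 \<union> {0} \<times> V (p - 1)) \<inter> ({1} \<times> V p \<union> {-1} \<times> V 0) = {}"
  using p by (auto simp: V_def)
 have "card (exceptional p) = card ({0 :: int} \<times> V 1) + card ({0 :: int} \<times> V (p - 1)) + (card ({1 :: int} \<times> V p) + card ({-1 :: int} \<times> V 0))"
  using fV by (simp only: eq card_Un_disjoint[OF _ _ d(3)] card_Un_disjoint[OF _ _ d(1)] card_Un_disjoint[OF _ _ d(2)]
   finite_Un finite_cartesian_product finite.intros simp_thms)
 then show "card (exceptional p) = 2 * p + 2" unfolding c by simp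
 show "hyperbolic_range (2 - int p) p \<inter> exceptional p = {}"
  using sign_vector_sum p unfolding hyperbolic_range_def exceptional_def by fastforce
qed

lemma components_count: "bij_betw f I C ==> finite I ==> card I = m ==> finite C \<and> card C = m \<and> bij_betw f I C"
 by (metis bij_betw_finite bij_betw_same_card)

theorem corollary1p5:
  fixes g p :: nat and chi :: int
  assumes "p \<ge> 1" and "g = 0 \<Longrightarrow> p \<ge> 3"
  defines "chi \<equiv> euler_char g p"
  shows
    "(g \<ge> 1 \<longrightarrow>
        finite (connected_components_of (type_preserving_space g p)) \<and>
        card (connected_components_of (type_preserving_space g p)) =
          (\<Sum>n = chi..-chi. \<Sum>k = max (n + int p + chi) 0..min (n - chi) (int p). p choose nat k) \<and>
        bij_betw (rep_stratum g p)
          {(n, s). s \<in> sign_vectors p \<and>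
             chi + int (p_plus p s) \<le> n \<and> n \<le> - chi - int (p_minus p s)}
          (connected_components_of (type_preserving_space g p))) \<and>
     (g = 0 \<longrightarrow>
        finite (connected_components_of (type_preserving_space g p)) \<and>
        card (connected_components_of (type_preserving_space g p)) =
          (\<Sum>n = chi..-chi. \<Sum>k = max (n + int p + chi) 0..min (n - chi) (int p). p choose nat k)
            + 2 * p + 2 \<and>
        bij_betw (rep_stratum g p)
          {(n, s). s \<in> sign_vectors p \<and>
             ((chi + int (p_plus p s) \<le> n \<and> n \<le> - chi - int (p_minus p s)) \<or>
              (n = 0 \<and> (p_minus p s = 1 \<or> p_plus p s = 1)) \<or>
              (n = 1 \<and> p_minus p s = 0 \<or> n = -1 \<and> p_plus p s = 0))}
          (connected_components_of (type_preserving_space g p)))"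
proof (intro conjI[of "_ --> _"] impI, goal_cases)
 case 1
 have "(s \<in> sign_vectors p \<and> stratum_tuples g p n s ~= {}) = ((n, s) \<in> hyperbolic_range chi p)" for n s
  using positive_genus_strata(2)[OF _ 1 assms(1), of s n] unfolding hyperbolic_range_def chi_def by blast
 then have "hyperbolic_range chi p = {(n, s). s \<in> sign_vectors p \<and> stratum_tuples g p n s ~= {}}" by auto
 from rep_stratum_components[OF positive_genus_strata(1)[OF _ 1 assms(1)] this]
 show ?case using card_hyperbolic_range[of chi p] unfolding hyperbolic_range_def[symmetric] by (intro components_count)
next
 case 2
 let "_ \<and> _ \<and> bij_betw _ ?I _" = ?case
 have p: "3 <= p" using 2 by (rule assms(2))
 have chi: "chi = 2 - int p" using 2 by (simp add: chi_def euler_char_def)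
 have I: "?I = hyperbolic_range chi p \<union> exceptional p" unfolding hyperbolic_range_def exceptional_def by auto
 have "(s \<in> sign_vectors p \<and> stratum_tuples g p n s ~= {}) = ((n, s) \<in> ?I)" for n s
  using genus_zero_strata(2)[OF _ p, of s n] unfolding chi_def 2 by simp blast
 then have "?I = {(n, s). s \<in> sign_vectors p \<and> stratum_tuples g p n s ~= {}}" by auto
 from rep_stratum_components[OF genus_zero_strata(1)[OF _ p, folded 2] this]
 show ?case unfolding I using card_hyperbolic_range[of chi p] card_exceptional[OF p]
  by (intro components_count) (simp_all add: card_Un_disjoint chi)
qed

end
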